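(* Let $\{\mu_n\}_{n=1}^\infty$ be a sequence of Borel probability measures on $\mathbb{R}^2$ and let $\{k_n\}_{n=1}^\infty$ be a sequence of positive integers with $\lim_{n\to\infty}k_n=\infty$. For $j=1,2$, assume that the free convolution powers $\nu_{jn}=[\mu_n^{(j)}]^{\boxplus k_n}$ converge weakly, as $n\to\infty$, to $\nu_\boxplus^{\gamma_j,\sigma_j}$, the $\boxplus$-infinitely divisible law on $\mathbb{R}$ with L\'evy parameters $(\gamma_j,\sigma_j)$. Then the following statements are equivalent: (1) The pointwise limit $R(z,w)=\lim_{n\to\infty}k_nR_{\mu_n}(z,w)$ exists for $(z,w)$ in a product domain $\Omega$ where all $R_{\mu_n}$ are defined. (2) The pointwise limit $$D(z,w)=\lim_{n\to\infty}k_n\int_{\mathbb{R}^2}\frac{zwst}{(1-zs)(1-wt)}\,d\mu_n(s,t)$$ exists for any $(z,w)\in(\mathbb{C}\setminus\mathbb{R})^2$. (3) The finite signed measures $$d\rho_n(s,t)=k_n\,\frac{st}{\sqrt{1+s^2}\sqrt{1+t^2}}\,d\mu_n(s,t)$$ converge weakly to a finite signed measure $\rho$ on $\mathbb{R}^2$. Moreover, if (1), (2) and (3) hold, then the limit function $D$ has a unique integral representation $$D(z,w)=\int_{\mathbb{R}^2}\frac{zw\sqrt{1+s^2}\sqrt{1+t^2}}{(1-zs)(1-wt)}\,d\rho(s,t),$$ and $$R(z,w)=zR_{\nu_\boxplus^{\gamma_1,\sigma_1}}(z)+wR_{\nu_\boxplus^{\gamma_2,\sigma_2}}(w)+D(z,w).$$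 In particular, the limit $R(z,w)$ extends analytically to $(\mathbb{C}\setminus\mathbb{R})^2$.
   Context: For a Borel probability measure $\mu$ on $\mathbb{R}^2$, its marginals are $\mu^{(j)}=\mu\circ\pi_j^{-1}$, $j=1,2$, where $\pi_1(s,t)=s$, $\pi_2(s,t)=t$, and its Cauchy transform is $G_\mu(z,w)=\int_{\mathbb{R}^2}\frac{1}{(z-s)(w-t)}\,d\mu(s,t)$ for $z,w\in\mathbb{C}\setminus\mathbb{R}$. For a probability measure $m$ on $\mathbb{R}$, $G_m(z)=\int_{\mathbb{R}}\frac{1}{z-x}\,dm(x)$, $z\notin\mathbb{R}$. For $\alpha,\beta>0$ the Stolz angle is $\Delta=\Delta_{\alpha,\beta}=\{x+iy\in\mathbb{C}: y<0,\ |x|<-\alpha y,\ y>-\beta\}$, $\overline{\Delta}=\{\bar z:z\in\Delta\}$ is its reflection, and the associated product domain is $\Omega=(\Delta\cup\overline\Delta)\times(\Delta\cup\overline\Delta)$. The one-dimensional $R$-transform $R_m$ of a probability measure $m$ on $\mathbb{R}$ is the holomorphic function on $\Delta\cup\overline\Delta$ (for a sufficiently small Stolz angle $\Delta$) with $1/z+R_m(z)\notin\mathbb{R}$, $G_m(1/z+R_m(z))=z$, and $zR_m(z)\to0$ as $z\to0$ in $\Delta\cup\overline\Delta$. The bi-free partial $R$-transform (or $R$-transform) of a probability measure $\mu$ on $\mathbb{R}^2$ is $$R_\mu(z,w)=zR_{\mu^{(1)}}(z)+wR_{\mu^{(2)}}(w)+\left[1-\frac{1}{h_\mu(z,w)}\right],\quad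 h_\mu(z,w)=\frac{G_\mu\left(1/z+R_{\mu^{(1)}}(z),\,1/w+R_{\mu^{(2)}}(w)\right)}{zw},$$ which is defined and holomorphic on a product domain $\Omega$ (with $\Delta$ small enough) on which $R_{\mu^{(1)}},R_{\mu^{(2)}}$ are defined and $h_\mu$ has no zeros. $\boxplus$ denotes free additive convolution of probability measures on $\mathbb{R}$ and $m^{\boxplus k}$ the $k$-fold free convolution of $m$ with itself. For $\gamma\in\mathbb{R}$ and $\sigma$ a finite positive Borel measure on $\mathbb{R}$ (L\'evy parameters), $\nu_\boxplus^{\gamma,\sigma}$ is the unique $\boxplus$-infinitely divisible law on $\mathbb{R}$ whose $R$-transform is $R_{\nu_\boxplus^{\gamma,\sigma}}(z)=\gamma+\int_{\mathbb{R}}\frac{z+x}{1-zx}\,d\sigma(x)$, $z\notin\mathbb{R}$. Weak convergence of finite (signed) Borel measures is convergence against bounded continuous functions. *)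

theory Defs
  imports "HOL-Probability.Probability" "HOL-Complex_Analysis.Complex_Analysis"
begin

definition borel_prob :: "'a::topological_space measure \<Rightarrow> bool" where
  "borel_prob m \<longleftrightarrow> prob_space m \<and> sets m = sets borel"

definition finite_borel :: "'a::topological_space measure \<Rightarrow> bool" where
  "finite_borel m \<longleftrightarrow> finite_measure m \<and> sets m = sets borel"

definition marginal1 :: "(real \<times> real) measure \<Rightarrow> real measure" where
  "marginal1 \<mu> = distr \<mu> borel fst"

definition marginal2 :: "(real \<times> real) measure \<Rightarrow> real measure" where
  "marginal2 \<mu> = distr \<mu> borel snd"

definition weakly_converges :: "(nat \<Rightarrow> 'a::topological_space measure) \<Rightarrow> 'a measure \<Rightarrow> bool" where
  "weakly_converges M m \<longleftrightarrow>
     (\<forall>f::'a \<Rightarrow> real. continuous_on UNIV f \<longrightarrow> bounded (range f) \<longrightarrow>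
        (\<lambda>n. \<integral>x. f x \<partial>M n) \<longlonglongrightarrow> (\<integral>x. f x \<partial>m))"

text \<open>A finite signed Borel measure is a countably additive real-valued set function on the
  Borel sets.  Its values on other sets are irrelevant, so two of them are identified when they
  agree on \<open>sets borel\<close>.\<close>

definition finite_signed_measure :: "('a::topological_space set \<Rightarrow> real) \<Rightarrow> bool" where
  "finite_signed_measure \<rho> \<longleftrightarrow> \<rho> {} = 0 \<and>
     (\<forall>A::nat \<Rightarrow> 'a set. range A \<subseteq> sets borel \<longrightarrow> disjoint_family A \<longrightarrow>
        (\<lambda>i. \<rho> (A i)) sums \<rho> (\<Union>i. A i))"

text \<open>The positive part of the Jordan decomposition, as the upper variation.  The set
  \<open>B = {}\<close> takes part in the supremum, so the truncation of negative values by \<open>ennreal\<close> is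
  harmless.  The negative part is the upper variation of \<open>-\<rho>\<close>.\<close>

definition upper_variation :: "('a::topological_space set \<Rightarrow> real) \<Rightarrow> 'a measure" where
  "upper_variation \<rho> =
     measure_of UNIV (sets borel) (\<lambda>A. SUP B\<in>{B \<in> sets borel. B \<subseteq> A}. ennreal (\<rho> B))"

definition signed_integral ::
  "('a::topological_space set \<Rightarrow> real) \<Rightarrow> ('a \<Rightarrow> 'b::{banach, second_countable_topology}) \<Rightarrow> 'b" where
  "signed_integral \<rho> f =
     (\<integral>x. f x \<partial>upper_variation \<rho>) - (\<integral>x. f x \<partial>upper_variation (\<lambda>A. - \<rho> A))"

definition weak_conv_signed ::
  "(nat \<Rightarrow> 'a::topological_space set \<Rightarrow> real) \<Rightarrow> ('a set \<Rightarrow> real) \<Rightarrow> bool" where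
  "weak_conv_signed \<rho>s \<rho> \<longleftrightarrow>
     (\<forall>f::'a \<Rightarrow> real. continuous_on UNIV f \<longrightarrow> bounded (range f) \<longrightarrow>
        (\<lambda>n. signed_integral (\<rho>s n) f) \<longlonglongrightarrow> signed_integral \<rho> f)"

definition signed_density :: "'a measure \<Rightarrow> ('a \<Rightarrow> real) \<Rightarrow> 'a set \<Rightarrow> real" where
  "signed_density m g A = (LINT x:A|m. g x)"

definition cauchy_transform :: "real measure \<Rightarrow> complex \<Rightarrow> complex" where
  "cauchy_transform m z = (\<integral>x. 1 / (z - complex_of_real x) \<partial>m)"

definition cauchy_transform2 :: "(real \<times> real) measure \<Rightarrow> complex \<Rightarrow> complex \<Rightarrow> complex" where
  "cauchy_transform2 \<mu> z w =
     (\<integral>(s, t). 1 / ((z - complex_of_real s) * (w - complex_of_real t)) \<partial>\<mu>)"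

definition stolz_angle :: "real \<Rightarrow> real \<Rightarrow> complex set" where
  "stolz_angle \<alpha> \<beta> = {z. Im z < 0 \<and> \<bar>Re z\<bar> < - \<alpha> * Im z \<and> Im z > - \<beta>}"

definition stolz_domain :: "real \<Rightarrow> real \<Rightarrow> complex set" where
  "stolz_domain \<alpha> \<beta> = stolz_angle \<alpha> \<beta> \<union> cnj ` stolz_angle \<alpha> \<beta>"

definition product_domain :: "real \<Rightarrow> real \<Rightarrow> (complex \<times> complex) set" where
  "product_domain \<alpha> \<beta> = stolz_domain \<alpha> \<beta> \<times> stolz_domain \<alpha> \<beta>"

definition is_R_transform ::
  "real \<Rightarrow> real \<Rightarrow> real measure \<Rightarrow> (complex \<Rightarrow> complex) \<Rightarrow> bool" where
  "is_R_transform \<alpha> \<beta> m R \<longleftrightarrow>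
     R holomorphic_on stolz_domain \<alpha> \<beta> \<and>
     (\<forall>z\<in>stolz_domain \<alpha> \<beta>. 1 / z + R z \<notin> \<real> \<and> cauchy_transform m (1 / z + R z) = z) \<and>
     ((\<lambda>z. z * R z) \<longlongrightarrow> 0) (at 0 within stolz_domain \<alpha> \<beta>)"

text \<open>On \<open>stolz_domain \<alpha> \<beta>\<close> the conditions above determine the values of the R-transform, and
  these do not depend on \<open>\<alpha>\<close> and \<open>\<beta>\<close>.  The choice is thus immaterial whenever an R-transform
  exists on the given domain; outside the domain the values are arbitrary.\<close>

definition R_transform :: "real \<Rightarrow> real \<Rightarrow> real measure \<Rightarrow> complex \<Rightarrow> complex" where
  "R_transform \<alpha> \<beta> m = (SOME R. is_R_transform \<alpha> \<beta> m R)"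

definition bifree_h ::
  "real \<Rightarrow> real \<Rightarrow> (real \<times> real) measure \<Rightarrow> complex \<Rightarrow> complex \<Rightarrow> complex" where
  "bifree_h \<alpha> \<beta> \<mu> z w =
     cauchy_transform2 \<mu> (1 / z + R_transform \<alpha> \<beta> (marginal1 \<mu>) z)
                         (1 / w + R_transform \<alpha> \<beta> (marginal2 \<mu>) w) / (z * w)"

definition bifree_R ::
  "real \<Rightarrow> real \<Rightarrow> (real \<times> real) measure \<Rightarrow> complex \<Rightarrow> complex \<Rightarrow> complex" where
  "bifree_R \<alpha> \<beta> \<mu> z w =
     z * R_transform \<alpha> \<beta> (marginal1 \<mu>) z + w * R_transform \<alpha> \<beta> (marginal2 \<mu>) w +
     (1 - 1 / bifree_h \<alpha> \<beta> \<mu> z w)"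

definition bifree_R_defined :: "real \<Rightarrow> real \<Rightarrow> (real \<times> real) measure \<Rightarrow> bool" where
  "bifree_R_defined \<alpha> \<beta> \<mu> \<longleftrightarrow>
     (\<exists>R. is_R_transform \<alpha> \<beta> (marginal1 \<mu>) R) \<and>
     (\<exists>R. is_R_transform \<alpha> \<beta> (marginal2 \<mu>) R) \<and>
     (\<forall>(z, w)\<in>product_domain \<alpha> \<beta>. bifree_h \<alpha> \<beta> \<mu> z w \<noteq> 0)"

text \<open>Free additive convolution is introduced analytically, through the linearizing property of
  the R-transform near 0; \<open>free_conv m1 m2 m\<close> says that \<open>m\<close> is the free convolution of \<open>m1\<close> and
  \<open>m2\<close>.  The Cauchy transform determines a probability measure, so there is at most one such
  \<open>m\<close>.\<close>

definition free_conv :: "real measure \<Rightarrow> real measure \<Rightarrow> real measure \<Rightarrow> bool" where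
  "free_conv m1 m2 m \<longleftrightarrow> borel_prob m1 \<and> borel_prob m2 \<and> borel_prob m \<and>
     (\<exists>\<alpha>>0. \<exists>\<beta>>0. \<exists>R1 R2. is_R_transform \<alpha> \<beta> m1 R1 \<and> is_R_transform \<alpha> \<beta> m2 R2 \<and>
        is_R_transform \<alpha> \<beta> m (\<lambda>z. R1 z + R2 z))"

inductive free_conv_power :: "real measure \<Rightarrow> nat \<Rightarrow> real measure \<Rightarrow> bool" for m where
  power_one: "free_conv_power m 1 m"
| power_Suc: "free_conv_power m k \<nu> \<Longrightarrow> free_conv \<nu> m \<nu>' \<Longrightarrow> free_conv_power m (Suc k) \<nu>'"

definition freely_infinitely_divisible :: "real measure \<Rightarrow> bool" where
  "freely_infinitely_divisible \<nu> \<longleftrightarrow> borel_prob \<nu> \<and>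
     (\<forall>k\<ge>1. \<exists>m. borel_prob m \<and> free_conv_power m k \<nu>)"

definition free_levy_R :: "real \<Rightarrow> real measure \<Rightarrow> complex \<Rightarrow> complex" where
  "free_levy_R \<gamma> \<sigma> z =
     complex_of_real \<gamma> + (\<integral>x. (z + complex_of_real x) / (1 - z * complex_of_real x) \<partial>\<sigma>)"

definition free_levy_law :: "real \<Rightarrow> real measure \<Rightarrow> real measure \<Rightarrow> bool" where
  "free_levy_law \<gamma> \<sigma> \<nu> \<longleftrightarrow> freely_infinitely_divisible \<nu> \<and>
     (\<exists>\<alpha>>0. \<exists>\<beta>>0. is_R_transform \<alpha> \<beta> \<nu> (free_levy_R \<gamma> \<sigma>))"

definition nonreal_pairs :: "(complex \<times> complex) set" where
  "nonreal_pairs = (- \<real>) \<times> (- \<real>)"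

text \<open>Holomorphy of a function of two variables on an open set, as complex Frechet
  differentiability.\<close>

definition holomorphic2_on :: "(complex \<Rightarrow> complex \<Rightarrow> complex) \<Rightarrow> (complex \<times> complex) set \<Rightarrow> bool" where
  "holomorphic2_on f S \<longleftrightarrow>
     (\<forall>p\<in>S. \<exists>a b. ((\<lambda>(z, w). f z w) has_derivative (\<lambda>(u, v). a * u + b * v)) (at p))"

definition R_limit ::
  "(nat \<Rightarrow> (real \<times> real) measure) \<Rightarrow> (nat \<Rightarrow> nat) \<Rightarrow> real \<Rightarrow> real \<Rightarrow>
   (complex \<Rightarrow> complex \<Rightarrow> complex) \<Rightarrow> bool" where
  "R_limit \<mu> k \<alpha> \<beta> R \<longleftrightarrow>
     (\<forall>n. bifree_R_defined \<alpha> \<beta> (\<mu> n)) \<and>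
     (\<forall>(z, w)\<in>product_domain \<alpha> \<beta>. (\<lambda>n. of_nat (k n) * bifree_R \<alpha> \<beta> (\<mu> n) z w) \<longlonglongrightarrow> R z w)"

definition D_limit ::
  "(nat \<Rightarrow> (real \<times> real) measure) \<Rightarrow> (nat \<Rightarrow> nat) \<Rightarrow> (complex \<Rightarrow> complex \<Rightarrow> complex) \<Rightarrow> bool" where
  "D_limit \<mu> k D \<longleftrightarrow>
     (\<forall>(z, w)\<in>nonreal_pairs.
        (\<lambda>n. of_nat (k n) *
             (\<integral>(s, t). z * w * complex_of_real s * complex_of_real t /
                ((1 - z * complex_of_real s) * (1 - w * complex_of_real t)) \<partial>\<mu> n)) \<longlonglongrightarrow> D z w)"

definition rho_limit ::
  "(nat \<Rightarrow> (real \<times> real) measure) \<Rightarrow> (nat \<Rightarrow> nat) \<Rightarrow> ((real \<times> real) set \<Rightarrow> real) \<Rightarrow> bool" where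
  "rho_limit \<mu> k \<rho> \<longleftrightarrow> finite_signed_measure \<rho> \<and>
     weak_conv_signed
       (\<lambda>n. signed_density (\<mu> n)
          (\<lambda>(s, t). real (k n) * (s * t / (sqrt (1 + s\<^sup>2) * sqrt (1 + t\<^sup>2))))) \<rho>"

definition D_representation ::
  "(complex \<Rightarrow> complex \<Rightarrow> complex) \<Rightarrow> ((real \<times> real) set \<Rightarrow> real) \<Rightarrow> bool" where
  "D_representation D \<rho> \<longleftrightarrow>
     (\<forall>(z, w)\<in>nonreal_pairs. D z w =
        signed_integral \<rho> (\<lambda>(s, t).
          z * w * complex_of_real (sqrt (1 + s\<^sup>2)) * complex_of_real (sqrt (1 + t\<^sup>2)) /
            ((1 - z * complex_of_real s) * (1 - w * complex_of_real t))))"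

end

theory Submission
  imports Defs
begin

text \<open>
  Put \<open>Z = 1 / (1 / z + R z)\<close>.  The functional equation of the R-transform becomes
  \<open>Z (1 + \<psi> Z) = z\<close> with \<open>\<psi> Z = \<integral> Z s / (1 - Z s)\<close>, and \<open>z R z = \<psi> Z\<close>.  On narrow cones the map
  \<open>Z \<mapsto> Z (1 + \<psi> Z)\<close> is a small perturbation of the identity, uniformly over tight families; so
  the laws \<open>\<nu>\<^sub>n\<close> have R-transforms on a common domain, and \<open>1 / k\<^sub>n\<close> times these are the R-transforms of
  the marginals by analytic continuation.  The imaginary part of \<open>\<psi> Z / Z\<close> then bounds
  \<open>k\<^sub>n \<integral> s\<^sup>2 / (1 + s\<^sup>2)\<close>, uniformly and with small tails.  Hence the signed measures \<open>\<rho>\<^sub>n\<close> have bounded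
  variation and are tight.

  With \<open>a = 1 + z R\<^sub>1 z\<close>, \<open>b = 1 + w R\<^sub>2 w\<close> and \<open>d = \<integral> Z s W t / ((1 - Z s) (1 - W t))\<close> one finds
  \<open>1 - 1 / h = (d - (a - 1) (b - 1)) / (a + b - 1 + d)\<close>, so that \<open>k\<^sub>n (1 - 1 / h)\<close> is asymptotically the
  integral defining \<open>D\<close>; Vitali's theorem carries convergence from a product domain to all pairs of
  nonreal numbers.  The integral is \<open>\<rho>\<^sub>n\<close> applied to a bounded continuous kernel; every subsequence of
  \<open>\<rho>\<^sub>n\<close> has a weak limit point, and Stieltjes inversion in each variable shows that the kernel integrals
  determine the limit.
\<close>

subsection \<open>Finite signed measures\<close>

text \<open>The hypotheses control only the marginals. The joint law enters through products of a
  function of s and a function of t; Young's inequality reduces these to the marginals, and a free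
  weight in it makes the tails small. Estimates on \<open>psi\<close> hold in cones: for |Re z| <
  |Im z| one has |z| <= 3/2 |Im z|, a relative error of 1/10 keeps |Z| <= 3 |Im Z|, and there |1 - Z
  s| >= 1/3 for every real s. The threshold 1/50 for \<open>spread\<close> makes the Lipschitz
  constant 24/50 of Z \<mapsto> Z psi(Z) less than 1/2. What survives is that Z never becomes real,
  so a Cayley transform puts all inverse functions into the unit disc. The \<rho>_n are signed and
  have no fixed mass. They are written as differences of positive measures whose densities against
  \<mu>_n are at least 1, hence can be normalised, and compactness is applied twice. Compactness in
  the plane is reduced to the line by a Borel right inverse of a plane-filling curve.\<close>

lemma finite_signed_measure_Un:
  assumes "finite_signed_measure \<rho>" "A \<in> sets borel" "B \<in> sets borel" "A \<inter> B = {}"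
  shows "\<rho> (A \<union> B) = \<rho> A + \<rho> B"
proof -
  have "range (binaryset A B) \<subseteq> sets borel"
    using assms by (simp add: range_binaryset_eq)
  moreover have "disjoint_family (binaryset A B)"
    using assms(4) by (auto simp: disjoint_family_on_def binaryset_def)
  ultimately have "(\<lambda>i. \<rho> (binaryset A B i)) sums \<rho> (A \<union> B)"
    using assms(1) unfolding finite_signed_measure_def by (metis UN_binaryset_eq)
  moreover have "(\<lambda>i. \<rho> (binaryset A B i)) sums (\<rho> A + \<rho> B)"
    using assms(1) by (intro binaryset_sums) (auto simp: finite_signed_measure_def)
  ultimately show ?thesis
    by (rule sums_unique2)
qed

lemma finite_signed_measure_Diff:
  assumes "finite_signed_measure \<rho>" "A \<in> sets borel" "B \<in> sets borel" "B \<subseteq> A"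
  shows "\<rho> (A - B) = \<rho> A - \<rho> B"
  using finite_signed_measure_Un[OF assms(1), of B "A - B"] assms
  by (simp add: Un_absorb1)

lemma finite_signed_measure_uminus:
  assumes "finite_signed_measure \<rho>" shows "finite_signed_measure (\<lambda>A. - \<rho> A)"
  using assms by (auto simp: finite_signed_measure_def intro: sums_minus)

text \<open>If \<rho> is unbounded on the subsets of E, then it is unbounded on one half of every
  splitting of E. Keeping that half and discarding the other, with |\<rho>| > 1 on the discarded
  piece, produces disjoint sets whose \<rho>-values would have to be summable.\<close>

lemma finite_signed_measure_bounded:
  fixes \<rho> :: "'a::topological_space set \<Rightarrow> real"
  assumes fsm: "finite_signed_measure \<rho>"
  shows "\<exists>M. \<forall>B\<in>sets borel. \<bar>\<rho> B\<bar> \<le> M"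
proof (rule ccontr)
  assume neg: "\<not> ?thesis"
  define big where "big E \<longleftrightarrow> E \<in> sets borel \<and> (\<forall>M. \<exists>B\<in>sets borel. B \<subseteq> E \<and> \<bar>\<rho> B\<bar> > M)" for E :: "'a set"
  have big_Un: "big B \<or> big (E - B)" if bE: "big E" "B \<in> sets borel" "B \<subseteq> E" for E B
  proof (rule ccontr)
    assume "\<not> (big B \<or> big (E - B))"
    then have nb: "\<not> big B" "\<not> big (E - B)" by auto
    have "E - B \<in> sets borel" using that by (auto simp: big_def)
    obtain M1 where M1: "\<And>C. C \<in> sets borel \<Longrightarrow> C \<subseteq> B \<Longrightarrow> \<bar>\<rho> C\<bar> \<le> M1"
      using nb(1) \<open>B \<in> sets borel\<close> unfolding big_def by (auto simp: not_less)
    obtain M2 where M2: "\<And>C. C \<in> sets borel \<Longrightarrow> C \<subseteq> E - B \<Longrightarrow> \<bar>\<rho> C\<bar> \<le> M2"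
      using nb(2) \<open>E - B \<in> sets borel\<close> unfolding big_def by (auto simp: not_less)
    obtain C where C: "C \<in> sets borel" "C \<subseteq> E" "\<bar>\<rho> C\<bar> > M1 + M2"
      using bE(1) unfolding big_def by blast
    have "\<rho> (C \<inter> B \<union> (C - B)) = \<rho> (C \<inter> B) + \<rho> (C - B)"
      using C that by (intro finite_signed_measure_Un[OF fsm]) auto
    moreover have "C \<inter> B \<union> (C - B) = C" by blast
    moreover have "\<bar>\<rho> (C \<inter> B)\<bar> \<le> M1" "\<bar>\<rho> (C - B)\<bar> \<le> M2"
      using C that by (auto intro!: M1 M2 simp: big_def)
    ultimately show False
      using C(3) by simp
  qed
  have step: "\<exists>F. big F \<and> F \<subseteq> E \<and> \<bar>\<rho> (E - F)\<bar> > 1" if E: "big E" for E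
  proof -
    \<comment> \<open>The margin 1 + |\<rho> E| gives |\<rho>| > 1 on B and on E - B alike, so
      either of them may be discarded.\<close>
    obtain B where B: "B \<in> sets borel" "B \<subseteq> E" "\<bar>\<rho> B\<bar> > 1 + \<bar>\<rho> E\<bar>"
      using E unfolding big_def by blast
    have EB: "E \<in> sets borel" using E by (simp add: big_def)
    have d: "\<rho> (E - B) = \<rho> E - \<rho> B"
      using finite_signed_measure_Diff[OF fsm EB B(1,2)] .
    have eq: "E - (E - B) = B" using B by blast
    from big_Un[OF E B(1,2)] show ?thesis
    proof
      assume "big B"
      moreover have "\<bar>\<rho> (E - B)\<bar> > 1" using B d by simp
      ultimately show ?thesis using B by blast
    next
      assume "big (E - B)"
      moreover have "\<bar>\<rho> (E - (E - B))\<bar> > 1" unfolding eq using B by simp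
      ultimately show ?thesis by blast
    qed
  qed
  have "big UNIV"
    using neg by (fastforce simp: big_def not_le)
  then have "\<exists>E. \<forall>n. big (E n) \<and> (E (Suc n) \<subseteq> E n \<and> \<bar>\<rho> (E n - E (Suc n))\<bar> > 1)"
    by (intro dependent_nat_choice) (use step in auto)
  then obtain E where E: "\<And>n. big (E n)" "\<And>n. E (Suc n) \<subseteq> E n"
    "\<And>n::nat. \<bar>\<rho> (E n - E (Suc n))\<bar> > 1"
    by blast
  have "disjoint_family (\<lambda>n. E n - E (Suc n))"
    using disjoint_family_Suc[of "\<lambda>n. - E n"] E(2) by (auto simp: Diff_eq Int_commute)
  moreover have "range (\<lambda>n. E n - E (Suc n)) \<subseteq> sets borel"
    using E(1) by (auto simp: big_def)
  ultimately have "summable (\<lambda>n. \<rho> (E n - E (Suc n)))"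
    using fsm unfolding finite_signed_measure_def by (meson sums_summable)
  then have "(\<lambda>n. \<rho> (E n - E (Suc n))) \<longlonglongrightarrow> 0"
    by (rule summable_LIMSEQ_zero)
  then have "eventually (\<lambda>n. \<bar>\<rho> (E n - E (Suc n))\<bar> < 1) sequentially"
    by (auto dest!: order_tendstoD(2)[OF tendsto_rabs, of _ _ _ 1])
  then show False
    using E(3) by (auto dest: eventually_happens' [OF sequentially_bot] less_asym)
qed

section \<open>Jordan decomposition through the upper variation\<close>

lemma sets_upper_variation [simp, measurable_cong]: "sets (upper_variation \<rho>) = sets borel"
  using sets.sigma_sets_eq[of borel] by (simp add: upper_variation_def sets_measure_of)

lemma space_upper_variation [simp]: "space (upper_variation \<rho>) = UNIV"
  by (simp add: upper_variation_def space_measure_of)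

text \<open>\<open>measure_of\<close> returns the given set function only once it is shown to be a
  measure. Superadditivity comes from taking unions of competitors, the reverse inequality from
  cutting a competitor B along the sets \<open>A i\<close>.\<close>

lemma emeasure_upper_variation:
  fixes \<rho> :: "'a::topological_space set \<Rightarrow> real"
  assumes fsm: "finite_signed_measure \<rho>" and A: "A \<in> sets borel"
  shows "emeasure (upper_variation \<rho>) A = (SUP B\<in>{B \<in> sets borel. B \<subseteq> A}. ennreal (\<rho> B))"
    (is "_ = ?V A")
proof -
  have mono: "?V A \<le> ?V B" if "A \<subseteq> B" for A B
    using that by (intro SUP_subset_mono) auto
  have up: "ennreal (\<rho> B) \<le> ?V A" if "B \<in> sets borel" "B \<subseteq> A" for A B
    using that by (intro SUP_upper) auto
  have superadd: "?V A + ?V B \<le> ?V (A \<union> B)" if "A \<inter> B = {}" for A B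
  proof -
    have "ennreal (\<rho> C) + ennreal (\<rho> D) \<le> ?V (A \<union> B)" 
      if C: "C \<in> sets borel" "C \<subseteq> A" and D: "D \<in> sets borel" "D \<subseteq> B" for C D
    proof (cases "\<rho> C \<ge> 0 \<and> \<rho> D \<ge> 0")
      case True
      then have "ennreal (\<rho> C) + ennreal (\<rho> D) = ennreal (\<rho> C + \<rho> D)"
        by simp
      also have "\<rho> C + \<rho> D = \<rho> (C \<union> D)"
        using C D \<open>A \<inter> B = {}\<close> by (subst finite_signed_measure_Un[OF fsm]) auto
      also have "ennreal (\<rho> (C \<union> D)) \<le> ?V (A \<union> B)"
        using C D by (intro up) auto
      finally show ?thesis .
    next
      case False
      \<comment> \<open>A negative value is sent to 0 by \<open>ennreal\<close>, and then the other
        set alone is a competitor inside A \<union> B.\<close>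
      then have "ennreal (\<rho> C) = 0 \<or> ennreal (\<rho> D) = 0"
        by (auto simp: not_le ennreal_neg)
      moreover have "ennreal (\<rho> C) \<le> ?V (A \<union> B)" "ennreal (\<rho> D) \<le> ?V (A \<union> B)"
        using C D by (auto intro: up)
      ultimately show ?thesis by auto
    qed
    then have "ennreal (\<rho> C) + ?V B \<le> ?V (A \<union> B)" if "C \<in> sets borel" "C \<subseteq> A" for C
      using that by (subst ennreal_SUP_add_right) (auto intro!: SUP_least)
    then show ?thesis
      by (subst ennreal_SUP_add_left[symmetric]) (auto intro!: SUP_least)
  qed
  have ca: "countably_additive (sets borel) ?V"
    unfolding countably_additive_def
  proof (intro allI impI antisym)
    fix A :: "nat \<Rightarrow> 'a set"
    assume A: "range A \<subseteq> sets borel" "disjoint_family A" "\<Union> (range A) \<in> sets borel"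
    show "?V (\<Union> (range A)) \<le> (\<Sum>i. ?V (A i))"
    proof (intro SUP_least)
      fix B assume "B \<in> {B \<in> sets borel. B \<subseteq> \<Union> (range A)}"
      then have B: "B \<in> sets borel" "B \<subseteq> \<Union> (range A)" by auto
      have BA: "B \<inter> A i \<in> sets borel" for i using A(1) B(1) by auto
      have "(\<lambda>i. \<rho> (B \<inter> A i)) sums \<rho> (\<Union>i. B \<inter> A i)"
      proof -
        have "disjoint_family (\<lambda>i. B \<inter> A i)" "range (\<lambda>i. B \<inter> A i) \<subseteq> sets borel"
          using A BA by (auto simp: disjoint_family_on_def)
        then show ?thesis using fsm unfolding finite_signed_measure_def by blast
      qed
      also have "(\<Union>i. B \<inter> A i) = B" using B by auto
      finally have sm: "(\<lambda>i. \<rho> (B \<inter> A i)) sums \<rho> B" .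
      \<comment> \<open>The pieces \<rho> (B \<inter> A i) may be negative, so the partial sums are
        compared with their positive parts before the bound by \<open>?V\<close> is applied.\<close>
      show "ennreal (\<rho> B) \<le> (\<Sum>i. ?V (A i))"
      proof (rule LIMSEQ_le_const2)
        show "(\<lambda>n. ennreal (\<Sum>i<n. \<rho> (B \<inter> A i))) \<longlonglongrightarrow> ennreal (\<rho> B)"
          using sm by (auto simp: sums_def intro!: tendsto_ennrealI)
        have "ennreal (\<Sum>i<n. \<rho> (B \<inter> A i)) \<le> (\<Sum>i. ?V (A i))" for n
        proof -
          have "ennreal (\<Sum>i<n. \<rho> (B \<inter> A i)) \<le> ennreal (\<Sum>i<n. max 0 (\<rho> (B \<inter> A i)))"
            by (intro ennreal_leI sum_mono) auto
          also have "\<dots> = (\<Sum>i<n. ennreal (max 0 (\<rho> (B \<inter> A i))))"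
            by (rule sum_ennreal[symmetric]) simp
          also have "\<dots> \<le> (\<Sum>i<n. ?V (A i))"
            using BA by (intro sum_mono) (auto simp: ennreal_max_0 intro!: up)
          also have "\<dots> \<le> (\<Sum>i. ?V (A i))"
            by (rule sum_le_suminf) auto
          finally show ?thesis .
        qed
        then show "\<exists>N. \<forall>n\<ge>N. ennreal (\<Sum>i<n. \<rho> (B \<inter> A i)) \<le> (\<Sum>i. ?V (A i))"
          by blast
      qed
    qed
    have fin: "(\<Sum>i<n. ?V (A i)) \<le> ?V (\<Union>i<n. A i)" for n
    proof (induction n)
      case (Suc n)
      have "A i \<inter> A n = {}" if "i < n" for i
        using A(2) that by (auto simp: disjoint_family_on_def)
      then have "(\<Union>i<n. A i) \<inter> A n = {}" by blast
      from superadd[OF this] have "?V (\<Union>i<n. A i) + ?V (A n) \<le> ?V (\<Union>i<Suc n. A i)"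
        by (simp only: lessThan_Suc UN_insert Un_commute)
      then show ?case
        using Suc by (auto intro: order_trans add_right_mono)
    qed auto
    show "(\<Sum>i. ?V (A i)) \<le> ?V (\<Union> (range A))"
      by (rule suminf_le_const, simp) (rule order_trans[OF fin mono], auto)
  qed
  have pos: "positive (sets borel) ?V"
    using fsm by (auto simp: positive_def finite_signed_measure_def Collect_conv_if bot_ennreal
        cong: conj_cong intro!: antisym SUP_least)
  show ?thesis
    by (rule emeasure_measure_of[OF upper_variation_def]) (use A pos ca in auto)
qed


lemma finite_measure_upper_variation:
  assumes fsm: "finite_signed_measure \<rho>"
  shows "finite_measure (upper_variation \<rho>)"
proof
  obtain M where "\<And>B. B \<in> sets borel \<Longrightarrow> \<bar>\<rho> B\<bar> \<le> M"
    using finite_signed_measure_bounded[OF fsm] by auto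
  then have "emeasure (upper_variation \<rho>) UNIV \<le> ennreal M"
    by (subst emeasure_upper_variation[OF fsm]) (fastforce intro!: SUP_least ennreal_leI)+
  then show "emeasure (upper_variation \<rho>) (space (upper_variation \<rho>)) \<noteq> \<infinity>"
    by (simp add: neq_top_trans[OF ennreal_neq_top])
qed

lemma le_measure_upper_variation:
  assumes "finite_signed_measure \<rho>" "A \<in> sets borel" "B \<in> sets borel" "B \<subseteq> A"
  shows "\<rho> B \<le> measure (upper_variation \<rho>) A"
proof -
  interpret finite_measure "upper_variation \<rho>"
    by (rule finite_measure_upper_variation) fact
  have "ennreal (\<rho> B) \<le> emeasure (upper_variation \<rho>) A"
    using assms by (subst emeasure_upper_variation) (auto intro: SUP_upper)
  then show ?thesis
    by (simp add: emeasure_eq_measure)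
qed

lemma measure_upper_variation_le:
  assumes "finite_signed_measure \<rho>" "A \<in> sets borel" "c \<ge> 0"
    and "\<And>B. B \<in> sets borel \<Longrightarrow> B \<subseteq> A \<Longrightarrow> \<rho> B \<le> c"
  shows "measure (upper_variation \<rho>) A \<le> c"
proof -
  interpret finite_measure "upper_variation \<rho>"
    by (rule finite_measure_upper_variation) fact
  have "emeasure (upper_variation \<rho>) A \<le> ennreal c"
    using assms by (subst emeasure_upper_variation) (auto intro!: SUP_least ennreal_leI)
  then show ?thesis
    using assms(3) by (simp add: emeasure_eq_measure)
qed

text \<open>For B inside A one has \<rho> B = \<rho> A - \<rho> (A - B), which is at most \<rho> A
  plus the upper variation of -\<rho> on A. The supremum over B gives one inequality, and exchanging
  \<rho> and -\<rho> gives the other.\<close>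

lemma jordan_decomposition:
  assumes fsm: "finite_signed_measure \<rho>" and A: "A \<in> sets borel"
  shows "\<rho> A = measure (upper_variation \<rho>) A - measure (upper_variation (\<lambda>A. - \<rho> A)) A"
proof -
  note fsm' = finite_signed_measure_uminus[OF fsm]
  have "measure (upper_variation \<rho>) A \<le> \<rho> A + measure (upper_variation (\<lambda>A. - \<rho> A)) A"
  proof (rule measure_upper_variation_le[OF fsm A])
    show "0 \<le> \<rho> A + measure (upper_variation (\<lambda>A. - \<rho> A)) A"
      using le_measure_upper_variation[OF fsm' A A] by simp
    show "\<rho> B \<le> \<rho> A + measure (upper_variation (\<lambda>A. - \<rho> A)) A" if "B \<in> sets borel" "B \<subseteq> A" for B
      using le_measure_upper_variation[OF fsm' A, of "A - B"] that A
        finite_signed_measure_Diff[OF fsm A that] by auto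
  qed
  moreover have "measure (upper_variation (\<lambda>A. - \<rho> A)) A \<le> measure (upper_variation \<rho>) A - \<rho> A"
  proof (rule measure_upper_variation_le[OF fsm' A])
    show "0 \<le> measure (upper_variation \<rho>) A - \<rho> A"
      using le_measure_upper_variation[OF fsm A A] by simp
    show "- \<rho> B \<le> measure (upper_variation \<rho>) A - \<rho> A" if "B \<in> sets borel" "B \<subseteq> A" for B
      using le_measure_upper_variation[OF fsm A, of "A - B"] that A
        finite_signed_measure_Diff[OF fsm A that] by auto
  qed
  ultimately show ?thesis by simp
qed

section \<open>Integrals against differences of finite measures\<close>

lemma finite_signed_measure_diff:
  fixes p q :: "'a::topological_space measure"
  assumes "finite_borel p" "finite_borel q"
  shows "finite_signed_measure (\<lambda>A. measure p A - measure q A)"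
proof -
  interpret p: finite_measure p using assms by (simp add: finite_borel_def)
  interpret q: finite_measure q using assms by (simp add: finite_borel_def)
  show ?thesis
    using assms p.finite_measure_UNION q.finite_measure_UNION
    by (auto simp: finite_signed_measure_def finite_borel_def intro!: sums_diff)
qed

text \<open>The identity p - q = p' - q' is written without subtraction, so that it makes sense in
  \<open>ennreal\<close> and passes through sums and monotone limits in the induction on f.\<close>

lemma nn_integral_add_measures_eq:
  assumes sets: "sets q = sets p" "sets p' = sets p" "sets q' = sets p"
    and eq: "\<And>A. A \<in> sets p \<Longrightarrow> emeasure p A + emeasure q' A = emeasure p' A + emeasure q A"
    and f: "f \<in> borel_measurable p"
  shows "nn_integral p f + nn_integral q' f = nn_integral p' f + nn_integral q f"
  using f
proof (induction f rule: borel_measurable_induct)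
  case (cong f g)
  have "space q = space p" "space p' = space p" "space q' = space p"
    using sets by (auto dest: sets_eq_imp_space_eq)
  with cong(3) have "nn_integral p f = nn_integral p g" "nn_integral q f = nn_integral q g"
    "nn_integral p' f = nn_integral p' g" "nn_integral q' f = nn_integral q' g"
    by (auto intro!: nn_integral_cong)
  with cong(4) show ?case by simp
next
  case (set A)
  then show ?case using sets eq by simp
next
  case (mult u c)
  then have "u \<in> borel_measurable q" "u \<in> borel_measurable p'" "u \<in> borel_measurable q'"
    using sets by (auto cong: measurable_cong_sets)
  with mult show ?case
    by (simp add: nn_integral_cmult flip: distrib_left)
next
  case (add u v)
  have "u \<in> borel_measurable q" "u \<in> borel_measurable p'" "u \<in> borel_measurable q'"
    "v \<in> borel_measurable q" "v \<in> borel_measurable p'" "v \<in> borel_measurable q'"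
    using add.hyps(1,3) sets by (auto cong: measurable_cong_sets)
  then have "(\<integral>\<^sup>+x. v x + u x \<partial>N) = nn_integral N v + nn_integral N u" if "N \<in> {p, q, p', q'}" for N
    using that add.hyps(1,3) by (auto intro: nn_integral_add)
  note nn = this
  have "(\<integral>\<^sup>+x. v x + u x \<partial>p) + (\<integral>\<^sup>+x. v x + u x \<partial>q') =
      (nn_integral p u + nn_integral q' u) + (nn_integral p v + nn_integral q' v)"
    by (simp add: nn; simp add: ac_simps)
  also have "\<dots> = (nn_integral p' u + nn_integral q u) + (nn_integral p' v + nn_integral q v)"
    using add.IH by simp
  also have "\<dots> = (\<integral>\<^sup>+x. v x + u x \<partial>p') + (\<integral>\<^sup>+x. v x + u x \<partial>q)"
    by (simp add: nn; simp add: ac_simps)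
  finally show ?case .
next
  case (seq U)
  have m: "U i \<in> borel_measurable q" "U i \<in> borel_measurable p'" "U i \<in> borel_measurable q'" for i
    using seq.hyps(1) sets by (auto cong: measurable_cong_sets)
  have inc: "incseq (\<lambda>i. nn_integral N (U i))" for N :: "'a measure"
    using seq.hyps(3) by (auto simp: incseq_def le_fun_def intro!: nn_integral_mono)
  have "nn_integral N (SUP i. U i) = (SUP i. nn_integral N (U i))" if "N \<in> {p, q, p', q'}" for N
  proof -
    have "(SUP i. U i) = (\<lambda>x. SUP i. U i x)" by (auto simp: fun_eq_iff image_comp)
    then show ?thesis
      using that m seq.hyps(1,3) by (auto intro!: nn_integral_monotone_convergence_SUP)
  qed
  then show ?case
    using seq.IH inc by (simp add: ennreal_SUP_add[symmetric] del: Sup_apply SUP_apply)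
qed

text \<open>Adding B makes f nonnegative. The constants this introduces cancel, because the
  hypothesis applied to the whole space relates the total masses.\<close>

lemma integral_add_measures_eq:
  fixes f :: "'a \<Rightarrow> real"
  assumes fin: "finite_measure p" "finite_measure q" "finite_measure p'" "finite_measure q'"
    and sets: "sets q = sets p" "sets p' = sets p" "sets q' = sets p"
    and eq: "\<And>A. A \<in> sets p \<Longrightarrow> measure p A + measure q' A = measure p' A + measure q A"
    and f: "f \<in> borel_measurable p" and B: "\<And>x. \<bar>f x\<bar> \<le> B"
  shows "(\<integral>x. f x \<partial>p) + (\<integral>x. f x \<partial>q') = (\<integral>x. f x \<partial>p') + (\<integral>x. f x \<partial>q)"
proof -
  have fm: "f \<in> borel_measurable q" "f \<in> borel_measurable p'" "f \<in> borel_measurable q'"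
    using f sets by (auto cong: measurable_cong_sets)
  have sp: "space q = space p" "space p' = space p" "space q' = space p"
    using sets by (auto dest: sets_eq_imp_space_eq)
  have pos: "0 \<le> f x + B" for x using B[of x] by auto
  have *: "(\<integral>\<^sup>+x. ennreal (f x + B) \<partial>N) = ennreal ((\<integral>x. f x \<partial>N) + B * measure N (space N))
     \<and> 0 \<le> (\<integral>x. f x \<partial>N) + B * measure N (space N)"
    if "finite_measure N" "f \<in> borel_measurable N" for N
  proof -
    interpret finite_measure N by fact
    have i: "integrable N f"
      using that B by (intro integrable_const_bound[of _ B]) auto
    have "(\<integral>x. f x + B \<partial>N) = (\<integral>x. f x \<partial>N) + B * measure N (space N)"
      using i by (simp add: mult.commute)
    moreover have "(\<integral>\<^sup>+x. ennreal (f x + B) \<partial>N) = ennreal (\<integral>x. f x + B \<partial>N)"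
      using i pos by (intro nn_integral_eq_integral) auto
    moreover have "0 \<le> (\<integral>x. f x + B \<partial>N)"
      using pos by (intro integral_nonneg_AE) auto
    ultimately show ?thesis by simp
  qed
  have "(\<integral>\<^sup>+x. ennreal (f x + B) \<partial>p) + (\<integral>\<^sup>+x. ennreal (f x + B) \<partial>q') =
    (\<integral>\<^sup>+x. ennreal (f x + B) \<partial>p') + (\<integral>\<^sup>+x. ennreal (f x + B) \<partial>q)"
  proof (rule nn_integral_add_measures_eq[OF sets])
    fix A assume "A \<in> sets p"
    from eq[OF this] show "emeasure p A + emeasure q' A = emeasure p' A + emeasure q A"
      using fin by (simp add: finite_measure.emeasure_eq_measure flip: ennreal_plus)
  qed (use f in auto)
  then have "((\<integral>x. f x \<partial>p) + B * measure p (space p)) + ((\<integral>x. f x \<partial>q') + B * measure q' (space q')) =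
    ((\<integral>x. f x \<partial>p') + B * measure p' (space p')) + ((\<integral>x. f x \<partial>q) + B * measure q (space q))"
    using *[OF fin(1) f] *[OF fin(2) fm(1)] *[OF fin(3) fm(2)] *[OF fin(4) fm(3)]
    by (simp flip: ennreal_plus)
  moreover have "B * measure p (space p) + B * measure q' (space q') =
      B * measure p' (space p') + B * measure q (space q)"
    using eq[of "space p"] sp by (simp flip: distrib_left)
  ultimately show ?thesis by linarith
qed

lemma integral_add_measures_eq_complex:
  fixes f :: "'a \<Rightarrow> complex"
  assumes fin: "finite_measure p" "finite_measure q" "finite_measure p'" "finite_measure q'"
    and sets: "sets q = sets p" "sets p' = sets p" "sets q' = sets p"
    and eq: "\<And>A. A \<in> sets p \<Longrightarrow> measure p A + measure q' A = measure p' A + measure q A"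
    and f: "f \<in> borel_measurable p" and B: "\<And>x. norm (f x) \<le> B"
  shows "(\<integral>x. f x \<partial>p) + (\<integral>x. f x \<partial>q') = (\<integral>x. f x \<partial>p') + (\<integral>x. f x \<partial>q)"
proof -
  have fm: "f \<in> borel_measurable q" "f \<in> borel_measurable p'" "f \<in> borel_measurable q'"
    using f sets by (auto cong: measurable_cong_sets)
  have i: "integrable p f" "integrable q f" "integrable p' f" "integrable q' f"
    using f fm fin B by (auto intro!: finite_measure.integrable_const_bound[of _ _ B])
  have bRe: "\<bar>Re (f x)\<bar> \<le> B" and bIm: "\<bar>Im (f x)\<bar> \<le> B" for x
    using abs_Re_le_cmod[of "f x"] abs_Im_le_cmod[of "f x"] B[of x] by linarith+
  have "(\<integral>x. Re (f x) \<partial>p) + (\<integral>x. Re (f x) \<partial>q') = (\<integral>x. Re (f x) \<partial>p') + (\<integral>x. Re (f x) \<partial>q)"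
    using f bRe by (intro integral_add_measures_eq[OF fin sets eq]) auto
  moreover have "(\<integral>x. Im (f x) \<partial>p) + (\<integral>x. Im (f x) \<partial>q') = (\<integral>x. Im (f x) \<partial>p') + (\<integral>x. Im (f x) \<partial>q)"
    using f bIm by (intro integral_add_measures_eq[OF fin sets eq]) auto
  ultimately show ?thesis
    using i by (simp add: complex_eq_iff)
qed

text \<open>If p - q = \<rho>, then the positive part of \<rho> plus q equals p plus the negative
  part, and \<open>integral_add_measures_eq\<close> compares the integrals. From here on a signed
  integral can be computed from any splitting of \<rho>, not just from the Jordan parts in its
  definition.\<close>

lemma signed_integral_diff:
  fixes f :: "'a::topological_space \<Rightarrow> real"
  assumes fin: "finite_borel p" "finite_borel q"
    and \<rho>: "\<And>A. A \<in> sets borel \<Longrightarrow> \<rho> A = measure p A - measure q A"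
    and fsm: "finite_signed_measure \<rho>"
    and f: "f \<in> borel_measurable borel" and B: "\<And>x. \<bar>f x\<bar> \<le> B"
  shows "signed_integral \<rho> f = (\<integral>x. f x \<partial>p) - (\<integral>x. f x \<partial>q)"
proof -
  note fsm' = finite_signed_measure_uminus[OF fsm]
  have "(\<integral>x. f x \<partial>upper_variation \<rho>) + (\<integral>x. f x \<partial>q) =
      (\<integral>x. f x \<partial>p) + (\<integral>x. f x \<partial>upper_variation (\<lambda>A. - \<rho> A))"
  proof (rule integral_add_measures_eq)
    fix A assume "A \<in> sets (upper_variation \<rho>)"
    then show "measure (upper_variation \<rho>) A + measure q A =
        measure p A + measure (upper_variation (\<lambda>A. - \<rho> A)) A"
      using jordan_decomposition[OF fsm, of A] \<rho>[of A] by simp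
  qed (use fin f B finite_measure_upper_variation fsm fsm' in \<open>auto simp: finite_borel_def cong: measurable_cong_sets\<close>)
  then show ?thesis by (simp add: signed_integral_def)
qed

text \<open>The sum of two measures is realised as the upper variation of the sum of the set
  functions; this function is nonnegative, so its negative part vanishes.\<close>

lemma finite_borel_sum:
  fixes p q :: "'a::topological_space measure"
  assumes "finite_borel p" "finite_borel q"
  obtains m where "finite_borel m" "\<And>A. A \<in> sets borel \<Longrightarrow> measure m A = measure p A + measure q A"
proof
  interpret p: finite_measure p using assms by (simp add: finite_borel_def)
  interpret q: finite_measure q using assms by (simp add: finite_borel_def)
  define \<rho> where "\<rho> A = measure p A + measure q A" for A
  have fsm: "finite_signed_measure \<rho>"
    using assms p.finite_measure_UNION q.finite_measure_UNION
    by (auto simp: finite_signed_measure_def finite_borel_def \<rho>_def intro!: sums_add)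
  show "finite_borel (upper_variation \<rho>)"
    using finite_measure_upper_variation[OF fsm] by (simp add: finite_borel_def)
  fix A :: "'a set" assume A: "A \<in> sets borel"
  have "measure (upper_variation (\<lambda>A. - \<rho> A)) A \<le> 0"
  proof (rule measure_upper_variation_le[OF finite_signed_measure_uminus[OF fsm] A])
    have "0 \<le> \<rho> B" for B unfolding \<rho>_def by (intro add_nonneg_nonneg measure_nonneg)
    then show "- \<rho> B \<le> 0" for B by simp
  qed simp
  then show "measure (upper_variation \<rho>) A = measure p A + measure q A"
    using jordan_decomposition[OF fsm A] by (simp add: \<rho>_def antisym)
qed

lemma integral_finite_borel_sum:
  fixes p q m :: "'a::topological_space measure" and f :: "'a \<Rightarrow> complex"
  assumes fin: "finite_borel p" "finite_borel q" "finite_borel m"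
    and m: "\<And>A. A \<in> sets borel \<Longrightarrow> measure m A = measure p A + measure q A"
    and f: "f \<in> borel_measurable borel" "\<And>x. norm (f x) \<le> B"
  shows "(\<integral>x. f x \<partial>m) = (\<integral>x. f x \<partial>p) + (\<integral>x. f x \<partial>q)"
proof -
  \<comment> \<open>The zero measure fills the fourth place: p + q = m + 0.\<close>
  have "(\<integral>x. f x \<partial>p) + (\<integral>x. f x \<partial>q) = (\<integral>x. f x \<partial>m) + (\<integral>x. f x \<partial>null_measure borel)"
  proof (rule integral_add_measures_eq_complex)
    show "finite_measure (null_measure (borel :: 'a measure))"
      by (rule finite_measureI) simp
  qed (use fin f in \<open>auto simp: finite_borel_def m cong: measurable_cong_sets\<close>)
  moreover have "(\<integral>x. f x \<partial>null_measure borel) = 0"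
    by (rule integral_eq_zero_AE) (simp add: AE_I[of _ _ UNIV])
  ultimately show ?thesis by simp
qed

subsection \<open>A space-filling curve and compactness of tight sequences in the plane\<close>

text \<open>The 2-periodic zigzag that equals |t| on [-1, 1].\<close>

definition triangle_wave :: "real \<Rightarrow> real" where
  "triangle_wave t = arccos (cos (pi * t)) / pi"

text \<open>Schoenberg's function: the curve below reads off the ternary digits of its argument.\<close>

definition schoenberg :: "real \<Rightarrow> real" where
  "schoenberg t = max 0 (min 1 (3 * triangle_wave t - 1))"

definition schoenberg_curve :: "nat \<Rightarrow> real \<Rightarrow> real" where
  "schoenberg_curve i t = (\<Sum>k. schoenberg (3 ^ (2 * k + i) * t) / 2 ^ Suc k)"

lemma triangle_wave_id: "0 \<le> t \<Longrightarrow> t \<le> 1 \<Longrightarrow> triangle_wave t = t"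
  by (simp add: triangle_wave_def arccos_cos)

lemma triangle_wave_periodic: "triangle_wave (2 * real n + t) = triangle_wave t"
proof -
  have "cos (pi * (2 * real n + t)) = cos (2 * real n * pi + pi * t)"
    by (simp add: algebra_simps)
  also have "\<dots> = cos (pi * t)"
    by (simp add: cos_add)
  finally show ?thesis
    by (simp add: triangle_wave_def)
qed

lemma continuous_on_triangle_wave: "continuous_on A triangle_wave"
  unfolding triangle_wave_def by (intro continuous_intros) auto

lemma schoenberg_periodic: "schoenberg (2 * real n + t) = schoenberg t"
  by (simp add: schoenberg_def triangle_wave_periodic)

lemma continuous_on_schoenberg: "continuous_on A schoenberg"
  unfolding schoenberg_def by (intro continuous_intros continuous_on_triangle_wave)

lemma schoenberg_bounds: "0 \<le> schoenberg t" "schoenberg t \<le> 1"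
  by (auto simp: schoenberg_def)

lemma schoenberg_curve_periodic: "schoenberg_curve i (2 * real n + t) = schoenberg_curve i t"
proof -
  have "schoenberg (3 ^ m * (2 * real n + t)) = schoenberg (3 ^ m * t)" for m
    using schoenberg_periodic[of "3 ^ m * n" "3 ^ m * t"] by (simp add: algebra_simps)
  then show ?thesis by (simp add: schoenberg_curve_def)
qed

lemma continuous_on_schoenberg_curve: "continuous_on UNIV (schoenberg_curve i)"
proof -
  have "uniform_limit UNIV (\<lambda>n t. \<Sum>k<n. schoenberg (3 ^ (2 * k + i) * t) / 2 ^ Suc k)
     (\<lambda>t. \<Sum>k. schoenberg (3 ^ (2 * k + i) * t) / 2 ^ Suc k) sequentially"
  proof (rule Weierstrass_m_test)
    show "summable (\<lambda>k. (1 / 2) ^ Suc k :: real)"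
      using power_half_series by (rule sums_summable)
    show "norm (schoenberg (3 ^ (2 * k + i) * t) / 2 ^ Suc k) \<le> (1 / 2) ^ Suc k" for k t
      using schoenberg_bounds[of "3 ^ (2 * k + i) * t"] by (simp add: power_divide divide_right_mono)
  qed
  then have "continuous_on UNIV (\<lambda>t. \<Sum>k. schoenberg (3 ^ (2 * k + i) * t) / 2 ^ Suc k)"
    by (rule uniform_limit_theorem[rotated])
      (auto intro!: always_eventually continuous_intros continuous_on_compose2[OF continuous_on_schoenberg[of UNIV]])
  then show ?thesis
    by (simp add: schoenberg_curve_def[abs_def])
qed

text \<open>Greedy digits: X doubles and drops its digit, stays in [0, 1], and X n / 2^n is the
  error after n digits. The point 1 is fixed with digit 1, so the closed right end is
  included.\<close>

lemma binary_expansion: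
  fixes x :: real
  assumes "0 \<le> x" "x \<le> 1"
  obtains a :: "nat \<Rightarrow> nat" where "\<And>k. a k \<le> 1" "(\<lambda>k. real (a k) / 2 ^ Suc k) sums x"
proof -
  define X where "X = rec_nat x (\<lambda>_ y. 2 * y - (if y \<ge> 1 / 2 then 1 else 0))"
  define a where "a k = (if X k \<ge> 1 / 2 then 1 else 0 :: nat)" for k
  have X0: "X 0 = x" and XS: "X (Suc k) = 2 * X k - real (a k)" for k
    by (simp_all add: X_def a_def)
  have bd: "0 \<le> X k \<and> X k \<le> 1" for k
    by (induction k) (use assms X0 XS in \<open>auto simp: a_def\<close>)
  have part: "(\<Sum>k<n. real (a k) / 2 ^ Suc k) = x - X n / 2 ^ n" for n
    by (induction n) (auto simp: X0 XS field_simps)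
  have "(\<lambda>n. X n / 2 ^ n) \<longlonglongrightarrow> 0"
  proof (rule tendsto_sandwich[where f = "\<lambda>_. 0" and h = "\<lambda>n. 1 / 2 ^ n"])
    show "(\<lambda>n. 1 / 2 ^ n :: real) \<longlonglongrightarrow> 0"
      using LIMSEQ_realpow_zero[of "1/2::real"] by (simp add: power_divide)
  qed (use bd in \<open>auto intro!: always_eventually divide_right_mono\<close>)
  then have "(\<lambda>n. x - X n / 2 ^ n) \<longlonglongrightarrow> x - 0"
    by (intro tendsto_intros)
  then have "(\<lambda>k. real (a k) / 2 ^ Suc k) sums x"
    unfolding sums_def part by simp
  then show thesis
    by (intro that[of a]) (auto simp: a_def)
qed

text \<open>t is the point of the Cantor set with ternary digits 2 c_j. Multiplication by 3^k
  produces an even integer plus the point of the shifted sequence, and \<open>schoenberg\<close> has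
  period 2. A point of the Cantor set lies in [0, 1/3] or in [2/3, 1] according to its first digit,
  and there \<open>schoenberg\<close> is constantly 0 or 1.\<close>

lemma schoenberg_digits:
  fixes c :: "nat \<Rightarrow> nat"
  assumes c: "\<And>k. c k \<le> 1"
  defines "t \<equiv> (\<Sum>j. 2 * real (c j) / 3 ^ Suc j)"
  shows "0 \<le> t" "t \<le> 1" "schoenberg (3 ^ k * t) = real (c k)"
proof -
  define T where "T c = (\<Sum>j. 2 * real (c j) / 3 ^ Suc j)" for c :: "nat \<Rightarrow> nat"
  have geo: "(\<lambda>j. 2 / 3 ^ Suc j :: real) sums 1"
    using sums_mult[OF geometric_sums[of "1/3::real"], of "2/3"] by (simp add: power_divide)
  have sm: "summable (\<lambda>j. 2 * real (c j) / 3 ^ Suc j)" if "\<And>k. c k \<le> 1" for c :: "nat \<Rightarrow> nat"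
  proof (rule summable_comparison_test[OF _ sums_summable[OF geo]])
    show "\<exists>N. \<forall>n\<ge>N. norm (2 * real (c n) / 3 ^ Suc n) \<le> 2 / 3 ^ Suc n"
      using that by (auto intro!: divide_right_mono simp: abs_mult)
  qed
  have T01: "0 \<le> T c \<and> T c \<le> 1" if "\<And>k. c k \<le> 1" for c :: "nat \<Rightarrow> nat"
  proof
    show "0 \<le> T c" unfolding T_def by (intro suminf_nonneg sm that) auto
    have "T c \<le> (\<Sum>j. 2 / 3 ^ Suc j)" unfolding T_def
      using that by (intro suminf_le sm that sums_summable[OF geo] divide_right_mono) auto
    then show "T c \<le> 1" using sums_unique[OF geo] by simp
  qed
  have T_shift: "3 * T c = 2 * real (c 0) + T (\<lambda>k. c (Suc k))" if "\<And>k. c k \<le> 1" for c :: "nat \<Rightarrow> nat"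
  proof -
    have s': "summable (\<lambda>j. 2 * real (c (Suc j)) / 3 ^ Suc j)"
      using sm[of "\<lambda>k. c (Suc k)"] that by simp
    have "T c = (\<Sum>j. 2 * real (c (Suc j)) / 3 ^ Suc (Suc j)) + 2 * real (c 0) / 3"
      unfolding T_def using suminf_split_head[OF sm[of c]] that by simp
    moreover have "(\<Sum>j. 2 * real (c (Suc j)) / 3 ^ Suc (Suc j)) = T (\<lambda>k. c (Suc k)) / 3"
      using suminf_divide[OF s', of 3] by (simp add: T_def field_simps)
    ultimately show ?thesis by simp
  qed
  have "schoenberg (3 ^ k * T c) = real (c k)" if "\<And>k. c k \<le> 1" for c :: "nat \<Rightarrow> nat"
    using that
  proof (induction k arbitrary: c)
    case 0
    have T: "T c = (2 * real (c 0) + T (\<lambda>k. c (Suc k))) / 3" "0 \<le> T c" "T c \<le> 1"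
      "0 \<le> T (\<lambda>k. c (Suc k))" "T (\<lambda>k. c (Suc k)) \<le> 1"
      using T_shift[of c, OF 0] T01[of c, OF 0] T01[of "\<lambda>k. c (Suc k)"] 0 by auto
    have "c 0 = 0 \<or> c 0 = 1" using 0[of 0] by linarith
    then show ?case
      using T by (auto simp: schoenberg_def triangle_wave_id max_def min_def)
  next
    case (Suc k)
    have "3 ^ Suc k * T c = 3 ^ k * (3 * T c)" by simp
    also have "\<dots> = 2 * real (3 ^ k * c 0) + 3 ^ k * T (\<lambda>k. c (Suc k))"
      unfolding T_shift[of c, OF Suc.prems] by (simp add: algebra_simps)
    finally have "3 ^ Suc k * T c = 2 * real (3 ^ k * c 0) + 3 ^ k * T (\<lambda>k. c (Suc k))" .
    then have "schoenberg (3 ^ Suc k * T c) = schoenberg (3 ^ k * T (\<lambda>k. c (Suc k)))"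
      by (simp only: schoenberg_periodic)
    then show ?case using Suc.IH[of "\<lambda>k. c (Suc k)"] Suc.prems by simp
  qed
  then show "0 \<le> t" "t \<le> 1" "schoenberg (3 ^ k * t) = real (c k)"
    using T01[OF c] c by (simp_all add: t_def T_def)
qed

text \<open>The binary digits of x and y are interleaved: coordinate i of the curve reads the digits
  at the positions 2 k + i.\<close>

lemma schoenberg_curve_surj:
  assumes "0 \<le> x" "x \<le> 1" "0 \<le> y" "y \<le> 1"
  obtains t where "0 \<le> t" "t \<le> 1" "schoenberg_curve 0 t = x" "schoenberg_curve 1 t = y"
proof -
  obtain a where a: "\<And>k. a k \<le> 1" "(\<lambda>k. real (a k) / 2 ^ Suc k) sums x"
    using binary_expansion[OF assms(1,2)] by blast
  obtain b where b: "\<And>k. b k \<le> 1" "(\<lambda>k. real (b k) / 2 ^ Suc k) sums y"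
    using binary_expansion[OF assms(3,4)] by blast
  define c where "c k = (if even k then a (k div 2) else b (k div 2))" for k
  have c1: "c k \<le> 1" for k using a b by (simp add: c_def)
  note t = schoenberg_digits[of c, OF c1]
  have "c (2 * k) = a k" "c (Suc (2 * k)) = b k" for k
    by (simp_all add: c_def)
  then show thesis
    using t(1,2) sums_unique[OF a(2)] sums_unique[OF b(2)]
    by (intro that[OF t(1,2)]; unfold schoenberg_curve_def t(3)) simp_all
qed

lemma plane_filling_curve:
  obtains \<psi> :: "real \<Rightarrow> real \<times> real" where "continuous_on UNIV \<psi>"
    "\<And>n::nat. {- real n..real n} \<times> {- real n..real n} \<subseteq> \<psi> ` {0..2 * real n + 1}"
proof
  \<comment> \<open>The scale u is constantly n on [2 n, 2 n + 1], where the curve therefore fills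
    the square of half-width n; on the intervals in between it grows linearly from n to n +
    1.\<close>
  define u where "u t = (t - triangle_wave t) / 2" for t
  define \<psi> where "\<psi> t = (u t * (2 * schoenberg_curve 0 t - 1), u t * (2 * schoenberg_curve 1 t - 1))" for t
  show "continuous_on UNIV \<psi>"
    unfolding \<psi>_def u_def
    by (intro continuous_intros continuous_on_triangle_wave continuous_on_schoenberg_curve) auto
  fix n :: nat
  show "{- real n..real n} \<times> {- real n..real n} \<subseteq> \<psi> ` {0..2 * real n + 1}"
  proof
    fix p assume "p \<in> {- real n..real n} \<times> {- real n..real n}"
    then obtain x y where p: "p = (x, y)" "- real n \<le> x" "x \<le> real n" "- real n \<le> y" "y \<le> real n"
      by auto
    have **: "0 \<le> (x / real n + 1) / 2 \<and> (x / real n + 1) / 2 \<le> 1 \<and> real n * (2 * ((x / real n + 1) / 2) - 1) = x"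
      if "- real n \<le> x" "x \<le> real n" for x
      using that by (cases "n = 0") (auto simp: field_simps)
    obtain t where t: "0 \<le> t" "t \<le> 1" "schoenberg_curve 0 t = (x / real n + 1) / 2"
        "schoenberg_curve 1 t = (y / real n + 1) / 2"
      using **[OF p(2,3)] **[OF p(4,5)] by (metis schoenberg_curve_surj)
    have "u (2 * real n + t) = real n"
      using t by (simp add: u_def triangle_wave_periodic triangle_wave_id)
    then have "\<psi> (2 * real n + t) = p"
      unfolding \<psi>_def schoenberg_curve_periodic t(3,4) using **[OF p(2,3)] **[OF p(4,5)] p(1) by simp
    then show "p \<in> \<psi> ` {0..2 * real n + 1}"
      using t by (intro image_eqI[of _ _ "2 * real n + t"]) auto
  qed
qed

text \<open>\<tau> p is the smallest nonnegative parameter at which the curve reaches p. Its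
  sublevel sets are the images of the intervals [0, c], which are compact; this makes \<tau>
  Borel.\<close>

lemma borel_section:
  fixes \<psi> :: "real \<Rightarrow> real \<times> real"
  assumes cont: "continuous_on UNIV \<psi>" and surj: "\<And>p. \<exists>t\<ge>0. \<psi> t = p"
  obtains \<tau> where "\<tau> \<in> borel_measurable borel" "\<And>p. \<psi> (\<tau> p) = p" "\<And>p. 0 \<le> \<tau> p"
    "\<And>t. 0 \<le> t \<Longrightarrow> \<tau> (\<psi> t) \<le> t"
proof
  define S where "S p = {t. 0 \<le> t \<and> \<psi> t = p}" for p
  define \<tau> where "\<tau> p = Inf (S p)" for p
  have bdd: "bdd_below (S p)" for p by (auto simp: S_def bdd_below_def)
  have "closed ({0..} \<inter> \<psi> -` {p})" for p
    by (intro closed_Int closed_atLeast closed_vimage cont) auto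
  then have "closed (S p)" for p
    by (simp add: S_def Int_def vimage_def)
  then have \<tau>: "\<tau> p \<in> S p" for p
    unfolding \<tau>_def using surj[of p] by (intro closed_contains_Inf bdd) (auto simp: S_def)
  then show 1: "\<psi> (\<tau> p) = p" "0 \<le> \<tau> p" for p by (auto simp: S_def)
  show 2: "\<tau> (\<psi> t) \<le> t" if "0 \<le> t" for t
    unfolding \<tau>_def using that by (intro cInf_lower bdd) (auto simp: S_def)
  have "{p. \<tau> p \<le> c} = \<psi> ` {0..c}" for c
    using 1 by (auto intro: order_trans[OF 2] simp: image_iff) (metis atLeastAtMost_iff)
  moreover have "compact (\<psi> ` {0..c})" for c
    by (intro compact_continuous_image continuous_on_subset[OF cont]) auto
  ultimately show "\<tau> \<in> borel_measurable borel"
    by (simp add: borel_measurable_iff_le borel_closed compact_imp_closed)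
qed

text \<open>\<tau> transports the laws to the line, where tightness yields a convergent subsequence,
  and \<psi> brings the limit back. Because \<psi> \<circ> \<tau> is the identity, a bounded
  continuous f on the plane is tested on the line by f \<circ> \<psi>, which is again bounded and
  continuous.\<close>

lemma tight_plane_subsequence:
  fixes N :: "nat \<Rightarrow> (real \<times> real) measure"
  assumes N: "\<And>n. borel_prob (N n)"
    and tight: "\<And>e. e > 0 \<Longrightarrow> \<exists>T. \<forall>n. measure (N n) (- ({-T..T} \<times> {-T..T})) \<le> e"
  obtains r M where "strict_mono (r :: nat \<Rightarrow> nat)" "borel_prob M" "weakly_converges (N \<circ> r) M"
proof -
  have prob: "prob_space (N n)" and sets [measurable_cong]: "sets (N n) = sets borel" for n
    using N by (auto simp: borel_prob_def)
  have space [simp]: "space (N n) = UNIV" for n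
    using sets_eq_imp_space_eq[OF sets] by simp
  obtain \<psi> :: "real \<Rightarrow> real \<times> real" where \<psi>: "continuous_on UNIV \<psi>"
    "\<And>n::nat. {- real n..real n} \<times> {- real n..real n} \<subseteq> \<psi> ` {0..2 * real n + 1}"
    using plane_filling_curve by blast
  have "\<exists>t\<ge>0. \<psi> t = p" for p
  proof -
    obtain n :: nat where "max \<bar>fst p\<bar> \<bar>snd p\<bar> \<le> real n"
      using real_arch_simple by blast
    then have "p \<in> {- real n..real n} \<times> {- real n..real n}" by (cases p) auto
    then show ?thesis using \<psi>(2)[of n] by force
  qed
  then obtain \<tau> where \<tau> [measurable]: "\<tau> \<in> borel_measurable borel"
    and \<tau>': "\<And>p. \<psi> (\<tau> p) = p" "\<And>p. 0 \<le> \<tau> p" "\<And>t. 0 \<le> t \<Longrightarrow> \<tau> (\<psi> t) \<le> t"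
    using borel_section[OF \<psi>(1)] by metis
  have \<psi>m [measurable]: "\<psi> \<in> borel_measurable borel"
    using \<psi>(1) by (rule borel_measurable_continuous_onI)
  define L where "L n = distr (N n) borel \<tau>" for n
  have Ld: "real_distribution (L n)" for n
    unfolding L_def by (intro prob_space.real_distribution_distr prob) simp
  have "tight L"
    unfolding tight_def
  proof (intro conjI allI impI Ld)
    fix e :: real assume "e > 0"
    then obtain T where T: "\<And>n. measure (N n) (- ({-T..T} \<times> {-T..T})) \<le> e / 2"
      using tight[of "e / 2"] by auto
    obtain m :: nat where m: "T \<le> real m" using real_arch_simple by blast
    \<comment> \<open>The left end is -1 because the interval is open on the left and \<tau> takes
      the value 0; the right end is the parameter by which the curve has filled the square of
      half-width m.\<close>
    have "measure (L n) {-1<..2 * real m + 1} > 1 - e" for n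
    proof -
      interpret prob_space "N n" by (rule prob)
      have "{-T..T} \<times> {-T..T} \<subseteq> \<tau> -` {-1<..2 * real m + 1}"
      proof
        fix p assume "p \<in> {-T..T} \<times> {-T..T}"
        then have "p \<in> {- real m..real m} \<times> {- real m..real m}" using m by auto
        then have "p \<in> \<psi> ` {0..2 * real m + 1}"
          using \<psi>(2)[of m] by (rule subsetD[rotated])
        then obtain t where "0 \<le> t" "t \<le> 2 * real m + 1" "p = \<psi> t"
          by auto
        then show "p \<in> \<tau> -` {-1<..2 * real m + 1}"
          using \<tau>'(2)[of p] \<tau>'(3)[of t] by auto
      qed
      then have "prob ({-T..T} \<times> {-T..T}) \<le> prob (\<tau> -` {-1<..2 * real m + 1})"
        by (intro finite_measure_mono) (auto simp: sets measurable_sets_borel[OF \<tau>])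
      moreover have "prob ({-T..T} \<times> {-T..T}) = 1 - prob (- ({-T..T} \<times> {-T..T}))"
        using prob_compl[of "{-T..T} \<times> {-T..T}"] by (simp add: sets Compl_eq_Diff_UNIV closed_Times borel_closed)
      ultimately show ?thesis
        using T[of n] \<open>e > 0\<close> by (simp add: L_def measure_distr)
    qed
    then show "\<exists>a b. a < b \<and> (\<forall>n. 1 - e < measure (L n) {a<..b})"
      by (intro exI[of _ "-1"] exI[of _ "2 * real m + 1"]) auto
  qed
  then obtain r M where r: "strict_mono (r :: nat \<Rightarrow> nat)" "real_distribution M" "weak_conv_m (L \<circ> r) M"
    using tight_imp_convergent_subsubsequence[of L id] by (auto simp: strict_mono_id)
  interpret M: real_distribution M by fact
  have [measurable_cong]: "sets M = sets borel" by (rule M.events_eq_borel)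
  have "borel_prob (distr M borel \<psi>)"
    unfolding borel_prob_def by (auto intro!: M.prob_space_distr)
  moreover have "weakly_converges (N \<circ> r) (distr M borel \<psi>)"
    unfolding weakly_converges_def
  proof (intro allI impI)
    fix f :: "real \<times> real \<Rightarrow> real"
    assume f: "continuous_on UNIV f" "bounded (range f)"
    then obtain B where B: "\<And>p. norm (f p) \<le> B" by (auto simp: bounded_iff)
    have [measurable]: "f \<in> borel_measurable borel"
      using f(1) by (rule borel_measurable_continuous_onI)
    have ic: "isCont (\<lambda>t. f (\<psi> t)) x" for x
      using continuous_on_compose2[OF f(1) \<psi>(1)] by (auto simp: continuous_on_eq_continuous_at)
    have "(\<lambda>n. \<integral>t. f (\<psi> t) \<partial>(L \<circ> r) n) \<longlonglongrightarrow> (\<integral>t. f (\<psi> t) \<partial>M)"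
      by (rule weak_conv_imp_integral_bdd_continuous_conv[OF _ r(2,3), where B = B]) (use B Ld ic in auto)
    moreover have "(\<integral>t. f (\<psi> t) \<partial>L n) = (\<integral>p. f p \<partial>N n)" for n
      unfolding L_def by (subst integral_distr) (auto simp: \<tau>')
    moreover have "(\<integral>t. f (\<psi> t) \<partial>M) = (\<integral>p. f p \<partial>distr M borel \<psi>)"
      by (subst integral_distr) auto
    ultimately show "(\<lambda>n. \<integral>x. f x \<partial>(N \<circ> r) n) \<longlonglongrightarrow> (\<integral>x. f x \<partial>distr M borel \<psi>)"
      by simp
  qed
  ultimately show thesis
    using r(1) by (intro that)
qed

subsection \<open>The integral kernel and uniqueness of the representing measure\<close>

text \<open>What is left of z s / (1 - z s) when the factor s / sqrt (1 + s^2) is moved into the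
  signed measure. For nonreal z it is bounded and continuous in s, hence admissible in weak
  convergence.\<close>

definition kern :: "complex \<Rightarrow> real \<Rightarrow> complex" where
  "kern z s = z * complex_of_real (sqrt (1 + s\<^sup>2)) / (1 - z * complex_of_real s)"

text \<open>Bounds (1 + |s|) / |1 - z s| uniformly in s. It is kept explicit because its continuity
  off the real axis supplies bounds on compact sets and limits along convergent arguments.\<close>

definition kern_const :: "complex \<Rightarrow> real" where
  "kern_const z = 1 + (1 + norm z) / \<bar>Im z\<bar>"

lemma sqrt_one_plus_sq_le: "sqrt (1 + s\<^sup>2) \<le> 1 + \<bar>s\<bar>"
  by (rule real_le_lsqrt) (auto simp: power2_eq_square algebra_simps abs_mult_self_eq)

lemma kern_const_ge_1: "1 \<le> kern_const z"
  by (simp add: kern_const_def)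

text \<open>|Im (1 - z s)| = |Im z| |s| bounds s, and then 1 <= |1 - z s| + |z| |s| bounds
  1.\<close>

lemma one_plus_abs_le:
  assumes "Im z \<noteq> 0"
  shows "1 + \<bar>s\<bar> \<le> kern_const z * norm (1 - z * complex_of_real s)"
proof -
  let ?u = "1 - z * complex_of_real s"
  have "\<bar>Im z\<bar> * \<bar>s\<bar> \<le> norm ?u"
    using abs_Im_le_cmod[of ?u] by (simp add: abs_mult)
  then have s: "\<bar>s\<bar> \<le> norm ?u / \<bar>Im z\<bar>"
    using assms by (simp add: field_simps)
  have "1 \<le> norm ?u + norm z * \<bar>s\<bar>"
    using norm_triangle_ineq[of ?u "z * complex_of_real s"] by (simp add: norm_mult)
  also have "\<dots> \<le> norm ?u + norm z * (norm ?u / \<bar>Im z\<bar>)"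
    using s by (intro add_left_mono mult_left_mono) auto
  finally show ?thesis
    using s by (simp add: kern_const_def algebra_simps add_divide_distrib)
qed

lemma one_minus_nonzero:
  assumes "Im z \<noteq> 0" shows "1 - z * complex_of_real s \<noteq> 0"
proof
  assume "1 - z * complex_of_real s = 0"
  with one_plus_abs_le[OF assms, of s] show False by simp
qed

lemma norm_kern_le:
  assumes "Im z \<noteq> 0"
  shows "norm (kern z s) \<le> norm z * kern_const z"
proof -
  have "sqrt (1 + s\<^sup>2) \<le> kern_const z * norm (1 - z * complex_of_real s)"
    using sqrt_one_plus_sq_le[of s] one_plus_abs_le[OF assms, of s] by linarith
  then have "sqrt (1 + s\<^sup>2) / norm (1 - z * complex_of_real s) \<le> kern_const z"
    using one_minus_nonzero[OF assms, of s] by (simp add: divide_le_eq)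
  from mult_left_mono[OF this, of "norm z"] show ?thesis
    by (simp add: kern_def norm_mult norm_divide)
qed

lemma measurable_kern [measurable]: "kern z \<in> borel_measurable borel"
  unfolding kern_def by measurable

text \<open>With z = 1 / \<zeta> the kernel is sqrt (1 + s^2) / (\<zeta> - s), so its jump across
  the real axis is a multiple of the Poisson kernel at height y. This is the source of Stieltjes
  inversion.\<close>

lemma kern_difference:
  fixes x y s :: real
  assumes "y > 0"
  defines "\<zeta> \<equiv> Complex x y"
  shows "kern (1 / \<zeta>) s - kern (1 / cnj \<zeta>) s =
    - 2 * \<i> * complex_of_real (sqrt (1 + s\<^sup>2) * y / ((x - s)\<^sup>2 + y\<^sup>2))"
proof -
  have nz: "\<zeta> \<noteq> 0" "cnj \<zeta> \<noteq> 0" "\<zeta> - complex_of_real s \<noteq> 0" "cnj \<zeta> - complex_of_real s \<noteq> 0"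
    using assms by (auto simp: complex_eq_iff)
  have k: "kern (1 / w) s = complex_of_real (sqrt (1 + s\<^sup>2)) / (w - complex_of_real s)" if "w \<noteq> 0" for w
    using that by (simp add: kern_def field_simps)
  have "1 / (\<zeta> - complex_of_real s) - 1 / (cnj \<zeta> - complex_of_real s) =
      (cnj \<zeta> - \<zeta>) / ((\<zeta> - complex_of_real s) * (cnj \<zeta> - complex_of_real s))"
    using nz by (simp add: field_simps)
  also have "cnj \<zeta> - \<zeta> = - 2 * \<i> * complex_of_real y"
    by (simp add: \<zeta>_def complex_eq_iff)
  also have "(\<zeta> - complex_of_real s) * (cnj \<zeta> - complex_of_real s) = complex_of_real ((x - s)\<^sup>2 + y\<^sup>2)"
    by (simp add: \<zeta>_def complex_eq_iff power2_eq_square algebra_simps)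
  finally have "complex_of_real (sqrt (1 + s\<^sup>2)) * (1 / (\<zeta> - complex_of_real s) - 1 / (cnj \<zeta> - complex_of_real s)) =
     complex_of_real (sqrt (1 + s\<^sup>2)) * (- 2 * \<i> * complex_of_real y / complex_of_real ((x - s)\<^sup>2 + y\<^sup>2))"
    by simp
  then show ?thesis
    by (simp add: k nz right_diff_distrib)
qed

section \<open>Stieltjes inversion for the weighted kernel\<close>

definition poisson_primitive :: "real \<Rightarrow> real \<Rightarrow> real \<Rightarrow> real \<Rightarrow> real" where
  "poisson_primitive a b y s = sqrt (1 + s\<^sup>2) * (arctan ((b - s) / y) - arctan ((a - s) / y))"

lemma integral_poisson_kernel:
  assumes "a \<le> b" "y > 0"
  shows "(\<integral>x. (sqrt (1 + s\<^sup>2) * y / ((x - s)\<^sup>2 + y\<^sup>2)) * indicator {a..b} x \<partial>lborel) = poisson_primitive a b y s"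
proof -
  have pos: "(x - s)\<^sup>2 + y\<^sup>2 > 0" for x
    using assms(2) by (simp add: add_nonneg_pos)
  have "(\<integral>x. (sqrt (1 + s\<^sup>2) * y / ((x - s)\<^sup>2 + y\<^sup>2)) * indicator {a..b} x \<partial>lborel) =
      sqrt (1 + s\<^sup>2) * arctan ((b - s) / y) - sqrt (1 + s\<^sup>2) * arctan ((a - s) / y)"
  proof (rule integral_FTC_Icc_real[OF assms(1)])
    fix x
    have "((\<lambda>x. sqrt (1 + s\<^sup>2) * arctan ((x - s) / y)) has_real_derivative
        sqrt (1 + s\<^sup>2) * (inverse (1 + ((x - s) / y)\<^sup>2) * (1 / y))) (at x)"
      by (auto intro!: derivative_eq_intros simp: assms(2)[THEN less_imp_neq, symmetric])
    also have "sqrt (1 + s\<^sup>2) * (inverse (1 + ((x - s) / y)\<^sup>2) * (1 / y)) =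
        sqrt (1 + s\<^sup>2) * y / ((x - s)\<^sup>2 + y\<^sup>2)"
    proof -
      have "1 + ((x - s) / y)\<^sup>2 = ((x - s)\<^sup>2 + y\<^sup>2) / y\<^sup>2"
        using assms(2) by (simp add: field_simps)
      then show ?thesis
        using assms(2) pos[of x] by (simp add: power2_eq_square)
    qed
    finally show "((\<lambda>x. sqrt (1 + s\<^sup>2) * arctan ((x - s) / y)) has_real_derivative
        sqrt (1 + s\<^sup>2) * y / ((x - s)\<^sup>2 + y\<^sup>2)) (at x)" .
    show "isCont (\<lambda>x. sqrt (1 + s\<^sup>2) * y / ((x - s)\<^sup>2 + y\<^sup>2)) x"
      using pos[of x] by (intro continuous_intros) auto
  qed
  then show ?thesis by (simp add: poisson_primitive_def algebra_simps)
qed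

text \<open>Meant for a fixed height y, where it gives the integrability that Fubini's theorem asks
  for on a bounded range of x. The part of sqrt (1 + s^2) that grows with s is absorbed through 2 |x
  - s| y <= (x - s)^2 + y^2.\<close>

lemma poisson_kernel_bound:
  assumes "y > 0" "\<bar>x\<bar> \<le> R"
  shows "sqrt (1 + s\<^sup>2) * y / ((x - s)\<^sup>2 + y\<^sup>2) \<le> (1 + R + y) / y"
proof -
  let ?d = "(x - s)\<^sup>2 + y\<^sup>2"
  have d: "?d > 0" using assms(1) by (simp add: add_nonneg_pos)
  have am: "2 * (\<bar>x - s\<bar> * y) \<le> ?d"
    using zero_le_power2[of "\<bar>x - s\<bar> - y"] by (simp add: power2_diff)
  have y2: "y * y \<le> ?d" by (simp add: power2_eq_square)
  have "sqrt (1 + s\<^sup>2) \<le> 1 + R + \<bar>x - s\<bar>"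
    using sqrt_one_plus_sq_le[of s] assms(2) by linarith
  then have "sqrt (1 + s\<^sup>2) * (y * y) \<le> (1 + R + \<bar>x - s\<bar>) * (y * y)"
    using assms by (intro mult_right_mono) auto
  also have "\<dots> = (1 + R) * (y * y) + (\<bar>x - s\<bar> * y) * y" by (simp add: algebra_simps)
  also have "\<dots> \<le> (1 + R) * ?d + ?d * y"
  proof (intro add_mono mult_left_mono mult_right_mono y2)
    have "0 \<le> \<bar>x - s\<bar> * y" using assms by simp
    then show "\<bar>x - s\<bar> * y \<le> ?d" using am by linarith
  qed (use assms in auto)
  finally show ?thesis
    using d assms(1) by (simp add: field_simps)
qed

text \<open>Uniform in s and in 0 < y <= 1, as dominated convergence for y tending to 0 requires.
  For |s| <= R = 1 + |a| + |b| the arctan difference is below 4. For larger |s| the mean value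
  theorem gives decay of order 1 / (c - s)^2 with |c - s| >= 1, which beats the weight sqrt (1 +
  s^2).\<close>

lemma poisson_primitive_bound:
  assumes "a \<le> b" "0 < y" "y \<le> 1"
  shows "\<bar>poisson_primitive a b y s\<bar> \<le> (2 + \<bar>a\<bar> + \<bar>b\<bar>) ^ 2 * 8"
proof -
  define R where "R = 1 + \<bar>a\<bar> + \<bar>b\<bar>"
  have R: "1 \<le> R" by (simp add: R_def)
  have nonneg: "0 \<le> arctan ((b - s) / y) - arctan ((a - s) / y)"
    using assms by (simp add: divide_right_mono arctan_le_iff)
  have "sqrt (1 + s\<^sup>2) * (arctan ((b - s) / y) - arctan ((a - s) / y)) \<le> (1 + R) ^ 2 * 8"
  proof (cases "\<bar>s\<bar> \<le> R")
    case True
    have "arctan ((b - s) / y) - arctan ((a - s) / y) \<le> 4"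
      using arctan_ubound[of "(b - s) / y"] arctan_lbound[of "(a - s) / y"] pi_less_4 by linarith
    then have "sqrt (1 + s\<^sup>2) * (arctan ((b - s) / y) - arctan ((a - s) / y)) \<le> (1 + R) * 4"
      using sqrt_one_plus_sq_le[of s] True R nonneg by (intro mult_mono) auto
    also have "\<dots> \<le> (1 + R) ^ 2 * 8" using R by (simp add: power2_eq_square algebra_simps)
    finally show ?thesis .
  next
    case False
    show ?thesis
    proof (cases "a = b")
      case True
      then show ?thesis by simp
    next
      case ne: False
      have "\<exists>c. a < c \<and> c < b \<and> arctan ((b - s) / y) - arctan ((a - s) / y) = (b - a) * (inverse (1 + ((c - s) / y)\<^sup>2) * (1 / y))"
        using ne assms by (intro MVT2) (auto intro!: derivative_eq_intros)
      then obtain c where c: "a < c" "c < b"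
        "arctan ((b - s) / y) - arctan ((a - s) / y) = (b - a) * (inverse (1 + ((c - s) / y)\<^sup>2) * (1 / y))"
        by blast
      have cs: "1 \<le> \<bar>c - s\<bar>" "1 + \<bar>s\<bar> \<le> \<bar>c - s\<bar> * (1 + R)"
      proof -
        have "\<bar>c\<bar> \<le> R - 1" using c by (auto simp: R_def)
        then show 1: "1 \<le> \<bar>c - s\<bar>" using False by linarith
        have "1 + \<bar>s\<bar> \<le> \<bar>c - s\<bar> + R" using \<open>\<bar>c\<bar> \<le> R - 1\<close> by linarith
        also have "R \<le> \<bar>c - s\<bar> * R" using 1 R by simp
        finally show "1 + \<bar>s\<bar> \<le> \<bar>c - s\<bar> * (1 + R)" by (simp add: algebra_simps)
      qed
      have "inverse (1 + ((c - s) / y)\<^sup>2) * (1 / y) = y / (y\<^sup>2 + (c - s)\<^sup>2)"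
        using assms(2) by (simp add: field_simps power2_eq_square)
      also have "\<dots> \<le> 1 / (c - s)\<^sup>2"
        using assms cs(1) by (intro frac_le) (auto simp: zero_less_power2)
      finally have le: "inverse (1 + ((c - s) / y)\<^sup>2) * (1 / y) \<le> 1 / (c - s)\<^sup>2" .
      have "sqrt (1 + s\<^sup>2) \<le> \<bar>c - s\<bar> * (1 + R)"
        using sqrt_one_plus_sq_le[of s] cs by linarith
      also have "\<dots> \<le> (c - s)\<^sup>2 * (1 + R)"
        using cs(1) R mult_right_mono[of 1 "\<bar>c - s\<bar>" "\<bar>c - s\<bar>"]
        by (intro mult_right_mono) (auto simp: power2_eq_square)
      finally have sq: "sqrt (1 + s\<^sup>2) \<le> (c - s)\<^sup>2 * (1 + R)" .
      have "sqrt (1 + s\<^sup>2) * ((b - a) * (inverse (1 + ((c - s) / y)\<^sup>2) * (1 / y))) \<le>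
          ((c - s)\<^sup>2 * (1 + R)) * ((b - a) * (1 / (c - s)\<^sup>2))"
        using assms le sq R by (intro mult_mono) (auto simp: divide_nonneg_pos)
      also have "\<dots> = (1 + R) * (b - a)"
        using cs(1) by auto
      also have "\<dots> \<le> (1 + R) * (1 + R)"
        using R by (intro mult_left_mono) (auto simp: R_def)
      also have "\<dots> \<le> (1 + R) ^ 2 * 8" using R by (simp add: power2_eq_square)
      finally show ?thesis using c(3) by simp
    qed
  qed
  then show ?thesis
    using nonneg by (simp add: poisson_primitive_def abs_mult R_def add.assoc)
qed

text \<open>An endpoint of the interval keeps half of its weight in the limit, through sgn 0 =
  0.\<close>

lemma poisson_primitive_limit:
  "(\<lambda>n. poisson_primitive a b (1 / real (Suc n)) s) \<longlonglongrightarrow>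
     sqrt (1 + s\<^sup>2) * (pi / 2 * (sgn (b - s) - sgn (a - s)))"
proof -
  have "(\<lambda>n. arctan (c * real (Suc n))) \<longlonglongrightarrow> pi / 2 * sgn c" for c :: real
  proof -
    consider "c = 0" | "c > 0" | "c < 0" by linarith
    then show ?thesis
    proof cases
      case 2
      have "filterlim (\<lambda>n. c * real (Suc n)) at_top sequentially"
        using 2 by (rule filterlim_tendsto_pos_mult_at_top[OF tendsto_const _
              filterlim_compose[OF filterlim_real_sequentially filterlim_Suc]])
      from filterlim_compose[OF tendsto_arctan_at_top this] 2 show ?thesis by simp
    next
      case 3
      have "filterlim (\<lambda>n. c * real (Suc n)) at_bot sequentially"
        using 3 by (rule filterlim_tendsto_neg_mult_at_bot[OF tendsto_const _
              filterlim_compose[OF filterlim_real_sequentially filterlim_Suc]])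
      from filterlim_compose[OF tendsto_arctan_at_bot this] 3 show ?thesis by simp
    qed simp
  qed
  note lim = this
  have "(\<lambda>n. sqrt (1 + s\<^sup>2) * (arctan ((b - s) * real (Suc n)) - arctan ((a - s) * real (Suc n)))) \<longlonglongrightarrow>
     sqrt (1 + s\<^sup>2) * (pi / 2 * sgn (b - s) - pi / 2 * sgn (a - s))"
    by (intro tendsto_intros lim)
  then show ?thesis
    by (simp add: poisson_primitive_def right_diff_distrib)
qed

text \<open>The hypothesis at 1 / \<zeta> and at its conjugate gives equal Poisson averages for
  every x. Fubini's theorem exchanges the integration over x in [a, b] with the measure and turns
  these averages into \<open>poisson_primitive\<close>.\<close>

lemma poisson_integrals_eq:
  fixes p q :: "'a measure" and S :: "'a \<Rightarrow> real" and g :: "'a \<Rightarrow> complex"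
  assumes p: "finite_measure p" and q: "finite_measure q" and sets: "sets q = sets p"
    and S: "S \<in> borel_measurable p" and g: "g \<in> borel_measurable p" "\<And>x. norm (g x) \<le> B"
    and eq: "\<And>z. Im z \<noteq> 0 \<Longrightarrow> (\<integral>x. g x * kern z (S x) \<partial>p) = (\<integral>x. g x * kern z (S x) \<partial>q)"
    and ab: "a \<le> b" and y: "0 < y"
  shows "(\<integral>x. g x * complex_of_real (poisson_primitive a b y (S x)) \<partial>p) =
     (\<integral>x. g x * complex_of_real (poisson_primitive a b y (S x)) \<partial>q)"
proof -
  define P where "P x s = sqrt (1 + s\<^sup>2) * y / ((x - s)\<^sup>2 + y\<^sup>2)" for x s
  have [measurable]: "(\<lambda>(x, s). P x s) \<in> borel_measurable (borel \<Otimes>\<^sub>M borel)"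
    unfolding P_def by measurable
  have P0: "0 \<le> P x s" for x s using y by (simp add: P_def)
  have PB: "norm (complex_of_real (P x s)) \<le> (1 + R + y) / y" if "\<bar>x\<bar> \<le> R" for x s R
    unfolding norm_of_real using poisson_kernel_bound[OF y that, of s] P0[of x s] by (simp add: P_def)
  have B0: "0 \<le> B" using g(2) norm_ge_zero order_trans by blast
  have pw: "(\<integral>\<omega>. g \<omega> * complex_of_real (P x (S \<omega>)) \<partial>p) = (\<integral>\<omega>. g \<omega> * complex_of_real (P x (S \<omega>)) \<partial>q)" for x
  proof -
    define z where "z = 1 / Complex x y"
    define z' where "z' = 1 / cnj (Complex x y)"
    have im: "Im z \<noteq> 0" "Im z' \<noteq> 0"
      using y by (auto simp: z_def z'_def Im_divide power2_eq_square sum_squares_eq_zero_iff)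
    have "(\<integral>\<omega>. g \<omega> * complex_of_real (P x (S \<omega>)) \<partial>N) =
        ((\<integral>\<omega>. g \<omega> * kern z (S \<omega>) \<partial>N) - (\<integral>\<omega>. g \<omega> * kern z' (S \<omega>) \<partial>N)) / (- 2 * \<i>)"
      if N: "finite_measure N" "sets N = sets p" for N
    proof -
      have [measurable]: "S \<in> borel_measurable N" "g \<in> borel_measurable N"
        using S g(1) N(2) by (auto cong: measurable_cong_sets)
      have i: "integrable N (\<lambda>\<omega>. g \<omega> * kern w (S \<omega>))" if "Im w \<noteq> 0" for w
      proof (rule finite_measure.integrable_const_bound[OF N(1), of _ "B * (norm w * kern_const w)"])
        show "AE \<omega> in N. norm (g \<omega> * kern w (S \<omega>)) \<le> B * (norm w * kern_const w)"
          using g(2) norm_kern_le[OF that] B0 by (auto simp: norm_mult intro!: mult_mono)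
      qed measurable
      have "g \<omega> * complex_of_real (P x (S \<omega>)) = (g \<omega> * kern z (S \<omega>) - g \<omega> * kern z' (S \<omega>)) / (- 2 * \<i>)" for \<omega>
      proof -
        have "kern z (S \<omega>) - kern z' (S \<omega>) = - 2 * \<i> * complex_of_real (P x (S \<omega>))"
          using kern_difference[OF y, of x "S \<omega>"] unfolding z_def z'_def P_def .
        then show ?thesis
          unfolding right_diff_distrib[symmetric] by (simp add: mult.left_commute[of "g \<omega>" \<i>])
      qed
      note pt = this
      show ?thesis
        unfolding pt integral_divide_zero
        by (subst Bochner_Integration.integral_diff[OF i[OF im(1)] i[OF im(2)]]) (rule refl)
    qed
    note red = this
    show ?thesis
      unfolding red[OF p refl] red[OF q sets] eq[OF im(1)] eq[OF im(2)] ..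
  qed
  have fub: "(\<integral>\<omega>. g \<omega> * complex_of_real (poisson_primitive a b y (S \<omega>)) \<partial>N) =
      (\<integral>x. indicator {a..b} x *\<^sub>R (\<integral>\<omega>. g \<omega> * complex_of_real (P x (S \<omega>)) \<partial>N) \<partial>lborel)"
    if N: "finite_measure N" "sets N = sets p" for N
  proof -
    have [measurable]: "S \<in> borel_measurable N" "g \<in> borel_measurable N"
      using S g(1) N(2) by (auto cong: measurable_cong_sets)
    interpret N: finite_measure N by fact
    interpret pair_sigma_finite N lborel ..
    define F where "F \<omega> x = indicator {a..b} x *\<^sub>R (g \<omega> * complex_of_real (P x (S \<omega>)))" for \<omega> x
    have "integrable (N \<Otimes>\<^sub>M lborel) (case_prod F)"
    proof (rule integrableI_bounded_set)
      show "space N \<times> {a..b} \<in> sets (N \<Otimes>\<^sub>M lborel)" by simp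
      show "case_prod F \<in> borel_measurable (N \<Otimes>\<^sub>M lborel)"
        unfolding F_def by measurable
      have "emeasure (N \<Otimes>\<^sub>M lborel) (space N \<times> {a..b}) = emeasure N (space N) * emeasure lborel {a..b}"
        by (rule lborel.emeasure_pair_measure_Times) auto
      also have "\<dots> < \<infinity>"
        using ab N.emeasure_real[of "space N"] by (auto simp flip: ennreal_mult' simp: ennreal_mult_less_top)
      finally show "emeasure (N \<Otimes>\<^sub>M lborel) (space N \<times> {a..b}) < \<infinity>" .
      show "AE x in N \<Otimes>\<^sub>M lborel. x \<in> space N \<times> {a..b} \<longrightarrow>
          norm (case_prod F x) \<le> B * ((1 + (\<bar>a\<bar> + \<bar>b\<bar>) + y) / y)"
      proof (intro AE_I2 impI)
        fix x assume "x \<in> space N \<times> {a..b}"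
        then obtain \<omega> t where x: "x = (\<omega>, t)" "\<bar>t\<bar> \<le> \<bar>a\<bar> + \<bar>b\<bar>" "t \<in> {a..b}" by (cases x) auto
        have "norm (F \<omega> t) = norm (g \<omega>) * norm (complex_of_real (P t (S \<omega>)))"
          using x(3) by (simp add: F_def norm_mult)
        also have "\<dots> \<le> B * ((1 + (\<bar>a\<bar> + \<bar>b\<bar>) + y) / y)"
          by (intro mult_mono g(2) PB x(2) B0) auto
        finally show "norm (case_prod F x) \<le> B * ((1 + (\<bar>a\<bar> + \<bar>b\<bar>) + y) / y)"
          by (simp add: x(1))
      qed
      show "AE x in N \<Otimes>\<^sub>M lborel. x \<notin> space N \<times> {a..b} \<longrightarrow> case_prod F x = 0"
        by (intro AE_I2) (auto simp: F_def space_pair_measure indicator_def)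
    qed
    note fubini = Fubini_integral[OF this]
    have inner: "(\<integral>x. F \<omega> x \<partial>lborel) = g \<omega> * complex_of_real (poisson_primitive a b y (S \<omega>))" for \<omega>
    proof -
      have "(\<integral>x. F \<omega> x \<partial>lborel) = (\<integral>x. g \<omega> * complex_of_real (P x (S \<omega>) * indicator {a..b} x) \<partial>lborel)"
        unfolding F_def by (intro Bochner_Integration.integral_cong) (auto split: split_indicator)
      also have "\<dots> = g \<omega> * complex_of_real (\<integral>x. P x (S \<omega>) * indicator {a..b} x \<partial>lborel)"
        by (simp add: integral_mult_right_zero del: of_real_mult)
      finally show ?thesis
        unfolding P_def integral_poisson_kernel[OF ab y] .
    qed
    show ?thesis
      using fubini unfolding inner by (simp add: F_def)
  qed
  show ?thesis
    using fub[OF p refl] fub[OF q sets] pw by simp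
qed

text \<open>The bounded factor g carries the other coordinate, so that one-dimensional inversion can
  be used twice. Letting y tend to 0 yields intervals with half weight at the endpoints; exhausting
  (a, b) by [a + e n, b - e n] removes the endpoints.\<close>

lemma interval_integrals_eq:
  fixes p q :: "'a measure" and S :: "'a \<Rightarrow> real" and g :: "'a \<Rightarrow> complex"
  assumes p: "finite_measure p" and q: "finite_measure q" and sets: "sets q = sets p"
    and S: "S \<in> borel_measurable p" and g: "g \<in> borel_measurable p" "\<And>x. norm (g x) \<le> B"
    and eq: "\<And>z. Im z \<noteq> 0 \<Longrightarrow> (\<integral>x. g x * kern z (S x) \<partial>p) = (\<integral>x. g x * kern z (S x) \<partial>q)"
    and ab: "a < b"
  shows "(\<integral>x. g x * complex_of_real (sqrt (1 + (S x)\<^sup>2) * indicator {a<..<b} (S x)) \<partial>p) =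
     (\<integral>x. g x * complex_of_real (sqrt (1 + (S x)\<^sup>2) * indicator {a<..<b} (S x)) \<partial>q)"
proof -
  define w where "w c d s = sqrt (1 + s\<^sup>2) * (pi / 2 * (sgn (d - s) - sgn (c - s)))" for c d s :: real
  have [measurable]: "w c d \<in> borel_measurable borel" for c d
    unfolding w_def sgn_if by measurable
  have [measurable]: "poisson_primitive c d y \<in> borel_measurable borel" for c d y
    unfolding poisson_primitive_def by measurable
  have B0: "0 \<le> B" using g(2) norm_ge_zero order_trans by blast
  have step1: "(\<lambda>n. \<integral>x. g x * complex_of_real (poisson_primitive c d (1 / real (Suc n)) (S x)) \<partial>N)
      \<longlonglongrightarrow> (\<integral>x. g x * complex_of_real (w c d (S x)) \<partial>N)"
    if N: "finite_measure N" "sets N = sets p" and cd: "c \<le> d" for N c d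
  proof (rule integral_dominated_convergence)
    have [measurable]: "S \<in> borel_measurable N" "g \<in> borel_measurable N"
      using S g(1) N(2) by (auto cong: measurable_cong_sets)
    interpret finite_measure N by fact
    show "(\<lambda>x. g x * complex_of_real (w c d (S x))) \<in> borel_measurable N" by measurable
    show "(\<lambda>x. g x * complex_of_real (poisson_primitive c d (1 / real (Suc n)) (S x))) \<in> borel_measurable N" for n
      by measurable
    show "integrable N (\<lambda>x. B * ((2 + \<bar>c\<bar> + \<bar>d\<bar>) ^ 2 * 8))" by simp
    show "AE x in N. (\<lambda>n. g x * complex_of_real (poisson_primitive c d (1 / real (Suc n)) (S x)))
        \<longlonglongrightarrow> g x * complex_of_real (w c d (S x))"
      unfolding w_def by (intro AE_I2 tendsto_intros poisson_primitive_limit)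
    show "AE x in N. norm (g x * complex_of_real (poisson_primitive c d (1 / real (Suc n)) (S x))) \<le>
        B * ((2 + \<bar>c\<bar> + \<bar>d\<bar>) ^ 2 * 8)" for n
    proof (intro AE_I2)
      fix x
      show "norm (g x * complex_of_real (poisson_primitive c d (1 / real (Suc n)) (S x))) \<le>
        B * ((2 + \<bar>c\<bar> + \<bar>d\<bar>) ^ 2 * 8)"
        unfolding norm_mult norm_of_real real_norm_def
        by (intro mult_mono g(2) poisson_primitive_bound cd B0) auto
    qed
  qed
  have w_eq: "(\<integral>x. g x * complex_of_real (w c d (S x)) \<partial>p) = (\<integral>x. g x * complex_of_real (w c d (S x)) \<partial>q)"
    if "c \<le> d" for c d
  proof (rule LIMSEQ_unique[OF step1[OF p refl that]])
    have "(\<integral>x. g x * complex_of_real (poisson_primitive c d (1 / real (Suc n)) (S x)) \<partial>p) =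
      (\<integral>x. g x * complex_of_real (poisson_primitive c d (1 / real (Suc n)) (S x)) \<partial>q)" for n
      by (rule poisson_integrals_eq[OF p q sets S g eq that]) auto
    then show "(\<lambda>n. \<integral>x. g x * complex_of_real (poisson_primitive c d (1 / real (Suc n)) (S x)) \<partial>p)
      \<longlonglongrightarrow> (\<integral>x. g x * complex_of_real (w c d (S x)) \<partial>q)"
      using step1[OF q sets that] by (simp only:)
  qed
  \<comment> \<open>The factor 2 keeps a + e n <= b - e n from n = 0 on.\<close>
  define e where "e n = (b - a) / (2 * real (Suc n))" for n
  have e0: "e n > 0" "a + e n \<le> b - e n" "e n \<le> b - a" for n
  proof -
    have "e n \<le> (b - a) / 2"
      unfolding e_def using ab by (intro divide_left_mono) auto
    then have h: "2 * e n \<le> b - a" by simp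
    show 1: "e n > 0" using ab by (simp add: e_def)
    show "a + e n \<le> b - e n" using h by linarith
    show "e n \<le> b - a" using h 1 by linarith
  qed
  have e_lim: "e \<longlonglongrightarrow> 0"
    unfolding e_def by real_asymp
  have w_lim: "(\<lambda>n. w (a + e n) (b - e n) s) \<longlonglongrightarrow> pi * (sqrt (1 + s\<^sup>2) * indicator {a<..<b} s)" for s
  proof -
    have "eventually (\<lambda>n. sgn (b - e n - s) = (if s < b then 1 else -1)) sequentially"
    proof (cases "s < b")
      case True
      then have "eventually (\<lambda>n. e n < b - s) sequentially"
        using e_lim by (intro order_tendstoD) auto
      then show ?thesis by eventually_elim (use True in auto)
    next
      case False
      then show ?thesis using e0(1) by (intro always_eventually) (auto simp: sgn_if, smt (verit) e0(1))
    qed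
    moreover have "eventually (\<lambda>n. sgn (a + e n - s) = (if a < s then -1 else 1)) sequentially"
    proof (cases "a < s")
      case True
      then have "eventually (\<lambda>n. e n < s - a) sequentially"
        using e_lim by (intro order_tendstoD) auto
      then show ?thesis by eventually_elim (use True in auto)
    next
      case False
      then show ?thesis using e0(1) by (intro always_eventually) (auto simp: sgn_if, smt (verit) e0(1))
    qed
    ultimately have "eventually (\<lambda>n. w (a + e n) (b - e n) s = pi * (sqrt (1 + s\<^sup>2) * indicator {a<..<b} s)) sequentially"
      by eventually_elim (use ab in \<open>auto simp: w_def split: split_indicator\<close>)
    then show ?thesis by (rule tendsto_eventually)
  qed
  \<comment> \<open>Outside [a + e n, b - e n] the two signs cancel, so the unbounded weight sqrt (1
    + s^2) counts only on a bounded set.\<close>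
  have w_bd: "\<bar>w (a + e n) (b - e n) s\<bar> \<le> pi * (1 + (\<bar>a\<bar> + \<bar>b\<bar>))" for n s
  proof (cases "a + e n \<le> s \<and> s \<le> b - e n")
    case True
    have "\<bar>sgn (b - e n - s) - sgn (a + e n - s)\<bar> \<le> 2"
      by (auto simp: sgn_if)
    then have "\<bar>w (a + e n) (b - e n) s\<bar> \<le> sqrt (1 + s\<^sup>2) * (pi / 2 * 2)"
      unfolding w_def abs_mult by (intro mult_mono) auto
    also have "sqrt (1 + s\<^sup>2) \<le> 1 + (\<bar>a\<bar> + \<bar>b\<bar>)"
      using sqrt_one_plus_sq_le[of s] True e0(1)[of n] by linarith
    finally show ?thesis by (simp add: mult.commute)
  next
    case False
    then have "sgn (b - e n - s) = sgn (a + e n - s)"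
      using e0(2)[of n] by (auto simp: sgn_if)
    then show ?thesis by (simp add: w_def)
  qed
  have step2: "(\<lambda>n. \<integral>x. g x * complex_of_real (w (a + e n) (b - e n) (S x)) \<partial>N)
      \<longlonglongrightarrow> (\<integral>x. g x * complex_of_real (pi * (sqrt (1 + (S x)\<^sup>2) * indicator {a<..<b} (S x))) \<partial>N)"
    if N: "finite_measure N" "sets N = sets p" for N
  proof (rule integral_dominated_convergence)
    have [measurable]: "S \<in> borel_measurable N" "g \<in> borel_measurable N"
      using S g(1) N(2) by (auto cong: measurable_cong_sets)
    interpret finite_measure N by fact
    show "(\<lambda>x. g x * complex_of_real (pi * (sqrt (1 + (S x)\<^sup>2) * indicator {a<..<b} (S x)))) \<in> borel_measurable N"
      by measurable
    show "(\<lambda>x. g x * complex_of_real (w (a + e n) (b - e n) (S x))) \<in> borel_measurable N" for n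
      by measurable
    show "integrable N (\<lambda>x. B * (pi * (1 + (\<bar>a\<bar> + \<bar>b\<bar>))))" by simp
    show "AE x in N. (\<lambda>n. g x * complex_of_real (w (a + e n) (b - e n) (S x)))
        \<longlonglongrightarrow> g x * complex_of_real (pi * (sqrt (1 + (S x)\<^sup>2) * indicator {a<..<b} (S x)))"
      by (intro AE_I2 tendsto_intros w_lim)
    show "AE x in N. norm (g x * complex_of_real (w (a + e n) (b - e n) (S x))) \<le>
        B * (pi * (1 + (\<bar>a\<bar> + \<bar>b\<bar>)))" for n
    proof (intro AE_I2)
      fix x
      show "norm (g x * complex_of_real (w (a + e n) (b - e n) (S x))) \<le> B * (pi * (1 + (\<bar>a\<bar> + \<bar>b\<bar>)))"
        unfolding norm_mult norm_of_real real_norm_def by (intro mult_mono g(2) w_bd B0) auto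
    qed
  qed
  have "(\<integral>x. g x * complex_of_real (pi * (sqrt (1 + (S x)\<^sup>2) * indicator {a<..<b} (S x))) \<partial>p) =
      (\<integral>x. g x * complex_of_real (pi * (sqrt (1 + (S x)\<^sup>2) * indicator {a<..<b} (S x))) \<partial>q)"
  proof (rule LIMSEQ_unique[OF step2[OF p refl]])
    show "(\<lambda>n. \<integral>x. g x * complex_of_real (w (a + e n) (b - e n) (S x)) \<partial>p)
      \<longlonglongrightarrow> (\<integral>x. g x * complex_of_real (pi * (sqrt (1 + (S x)\<^sup>2) * indicator {a<..<b} (S x))) \<partial>q)"
      using step2[OF q sets] w_eq[OF e0(2)] by (simp only:)
  qed
  moreover have "(\<integral>x. g x * complex_of_real (pi * (sqrt (1 + (S x)\<^sup>2) * indicator {a<..<b} (S x))) \<partial>N) =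
     pi * (\<integral>x. g x * complex_of_real (sqrt (1 + (S x)\<^sup>2) * indicator {a<..<b} (S x)) \<partial>N)" for N
  proof -
    have "(\<integral>x. g x * complex_of_real (pi * (sqrt (1 + (S x)\<^sup>2) * indicator {a<..<b} (S x))) \<partial>N) =
        (\<integral>x. complex_of_real pi * (g x * complex_of_real (sqrt (1 + (S x)\<^sup>2) * indicator {a<..<b} (S x))) \<partial>N)"
      by (rule Bochner_Integration.integral_cong) (simp_all add: mult_ac)
    then show ?thesis by (simp only: integral_mult_right_zero)
  qed
  ultimately show ?thesis by simp
qed

text \<open>Inversion in s with \<open>kern w t\<close> as bounded factor, then in t with the
  truncated weight in s as factor, shows that the measures with density h = sqrt (1 + s^2) sqrt (1 +
  t^2) agree on open boxes. They may be infinite but are finite on each bounded box, as uniqueness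
  from a generator demands; dividing by h > 0 returns p and q.\<close>

lemma measure_eq_if_kernel_integrals_eq:
  fixes p q :: "(real \<times> real) measure"
  assumes p: "finite_borel p" and q: "finite_borel q"
    and eq: "\<And>z w. Im z \<noteq> 0 \<Longrightarrow> Im w \<noteq> 0 \<Longrightarrow>
       (\<integral>(s, t). kern z s * kern w t \<partial>p) = (\<integral>(s, t). kern z s * kern w t \<partial>q)"
  shows "p = q"
proof -
  have fin: "finite_measure p" "finite_measure q"
    and sp [measurable_cong]: "sets p = sets borel" and sq [measurable_cong]: "sets q = sets borel"
    using p q by (auto simp: finite_borel_def)
  have sets: "sets q = sets p" using sp sq by simp
  have spaces: "space p = UNIV" "space q = UNIV"
    using sets_eq_imp_space_eq[OF sp] sets_eq_imp_space_eq[OF sq] by auto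
  have fs [measurable]: "fst \<in> borel_measurable (borel :: (real \<times> real) measure)"
    "snd \<in> borel_measurable (borel :: (real \<times> real) measure)"
    by (auto intro!: borel_measurable_continuous_onI continuous_intros)
  define W where "W a b s = sqrt (1 + s\<^sup>2) * indicator {a<..<b} s" for a b s :: real
  have [measurable]: "W a b \<in> borel_measurable borel" for a b
    unfolding W_def by measurable
  have W_bd: "\<bar>W a b s\<bar> \<le> 1 + (\<bar>a\<bar> + \<bar>b\<bar>)" for a b s
    using sqrt_one_plus_sq_le[of s] by (auto simp: W_def split: split_indicator)
  have 1: "(\<integral>x. kern w (snd x) * complex_of_real (W a b (fst x)) \<partial>p) =
      (\<integral>x. kern w (snd x) * complex_of_real (W a b (fst x)) \<partial>q)" if "Im w \<noteq> 0" "a < b" for w a b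
    unfolding W_def
  proof (rule interval_integrals_eq[OF fin sets, of fst _ "norm w * kern_const w"])
    show "(\<integral>x. kern w (snd x) * kern z (fst x) \<partial>p) = (\<integral>x. kern w (snd x) * kern z (fst x) \<partial>q)" if "Im z \<noteq> 0" for z
      using eq[OF that \<open>Im w \<noteq> 0\<close>] by (simp add: case_prod_beta' mult.commute)
  qed (use that norm_kern_le in auto)
  have 2: "(\<integral>x. complex_of_real (W a b (fst x)) * complex_of_real (W c d (snd x)) \<partial>p) =
      (\<integral>x. complex_of_real (W a b (fst x)) * complex_of_real (W c d (snd x)) \<partial>q)" if "a < b" "c < d" for a b c d
    unfolding W_def[of c d]
  proof (rule interval_integrals_eq[OF fin sets, of snd _ "1 + (\<bar>a\<bar> + \<bar>b\<bar>)"])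
    show "(\<integral>x. complex_of_real (W a b (fst x)) * kern z (snd x) \<partial>p) = (\<integral>x. complex_of_real (W a b (fst x)) * kern z (snd x) \<partial>q)"
      if "Im z \<noteq> 0" for z
      using 1[OF that \<open>a < b\<close>] by (simp add: mult.commute)
  qed (use that W_bd in auto)
  define h where "h x = sqrt (1 + (fst x)\<^sup>2) * sqrt (1 + (snd x)\<^sup>2)" for x :: "real \<times> real"
  have [measurable]: "h \<in> borel_measurable borel" unfolding h_def by measurable
  have hpos: "h x > 0" for x by (simp add: h_def add_pos_nonneg)
  have h_box: "h x * indicator (box l u) x = W (fst l) (fst u) (fst x) * W (snd l) (snd u) (snd x)" for l u x
    by (cases l; cases u; cases x) (auto simp: h_def W_def mem_box Basis_prod_def split: split_indicator)
  have em: "emeasure (density N h) (box l u) = ennreal (\<integral>x. W (fst l) (fst u) (fst x) * W (snd l) (snd u) (snd x) \<partial>N)"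
    if N: "finite_measure N" "sets N = sets borel" for N l u
  proof -
    interpret finite_measure N by fact
    note [measurable_cong] = N(2)
    have "emeasure (density N h) (box l u) = (\<integral>\<^sup>+x. ennreal (h x) * indicator (box l u) x \<partial>N)"
      by (rule emeasure_density) (auto simp: N(2))
    also have "\<dots> = (\<integral>\<^sup>+x. ennreal (W (fst l) (fst u) (fst x) * W (snd l) (snd u) (snd x)) \<partial>N)"
      by (intro nn_integral_cong) (auto simp: h_box[symmetric] split: split_indicator)
    also have "\<dots> = ennreal (\<integral>x. W (fst l) (fst u) (fst x) * W (snd l) (snd u) (snd x) \<partial>N)"
    proof (rule nn_integral_eq_integral)
      show "integrable N (\<lambda>x. W (fst l) (fst u) (fst x) * W (snd l) (snd u) (snd x))"
      proof (rule integrable_const_bound)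
        show "AE x in N. norm (W (fst l) (fst u) (fst x) * W (snd l) (snd u) (snd x)) \<le>
            (1 + (\<bar>fst l\<bar> + \<bar>fst u\<bar>)) * (1 + (\<bar>snd l\<bar> + \<bar>snd u\<bar>))"
          unfolding real_norm_def abs_mult by (intro AE_I2 mult_mono W_bd) auto
      qed measurable
    qed (auto simp: W_def)
    finally show ?thesis .
  qed
  have em_eq: "emeasure (density p h) (box l u) = emeasure (density q h) (box l u)" for l u :: "real \<times> real"
  proof (cases "fst l < fst u \<and> snd l < snd u")
    case True
    have "complex_of_real (\<integral>x. W (fst l) (fst u) (fst x) * W (snd l) (snd u) (snd x) \<partial>p) =
        complex_of_real (\<integral>x. W (fst l) (fst u) (fst x) * W (snd l) (snd u) (snd x) \<partial>q)"
      using 2[of "fst l" "fst u" "snd l" "snd u"] True by (simp flip: of_real_mult)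
    then show ?thesis
      using em[OF fin(1) sp] em[OF fin(2) sq] by simp
  next
    case False
    then have "box l u = {}"
      by (auto simp: box_eq_empty Basis_prod_def) (cases l; cases u; force simp: mem_box Basis_prod_def)+
    then show ?thesis by simp
  qed
  have "density p h = density q h"
  proof (rule measure_eqI_generator_eq)
    let ?E = "range (\<lambda>(a, b). box a b::(real \<times> real) set)"
    show "Int_stable ?E"
      by (auto simp: Int_stable_def box_Int_box)
    show "?E \<subseteq> Pow UNIV" "sets (density p h) = sigma_sets UNIV ?E" "sets (density q h) = sigma_sets UNIV ?E"
      by (simp_all add: sp sq borel_eq_box)
    let ?A = "\<lambda>n::nat. box (- (real n *\<^sub>R One)) (real n *\<^sub>R One) :: (real \<times> real) set"
    show "range ?A \<subseteq> ?E" "(\<Union>i. ?A i) = UNIV"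
      unfolding UN_box_eq_UNIV by auto
    show "emeasure (density p h) (?A i) \<noteq> \<infinity>" for i
      unfolding em[OF fin(1) sp] by simp
    show "emeasure (density p h) X = emeasure (density q h) X" if "X \<in> ?E" for X
      using that em_eq by auto
  qed
  moreover have "density (density N h) (\<lambda>x. 1 / h x) = N" if "sets N = sets borel" for N
  proof -
    note [measurable_cong] = that
    have "density (density N h) (\<lambda>x. 1 / h x) = density N (\<lambda>x. ennreal (h x) * ennreal (1 / h x))"
      by (rule density_density_eq) measurable
    also have "(\<lambda>x. ennreal (h x) * ennreal (1 / h x)) = (\<lambda>_. 1)"
      using hpos by (auto simp: fun_eq_iff ennreal_mult[symmetric] less_imp_le less_imp_neq[symmetric])
    finally show ?thesis by (simp add: density_1)
  qed
  ultimately show "p = q"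
    using sp sq by metis
qed

text \<open>Moving the negative parts to the other side turns the claim into equality of two
  positive measures: the positive part of \<rho> plus the negative part of \<rho>', and the same
  with the roles exchanged.\<close>

lemma finite_signed_measure_eq_if_kernel_integrals_eq:
  fixes \<rho> \<rho>' :: "(real \<times> real) set \<Rightarrow> real"
  assumes fsm: "finite_signed_measure \<rho>" "finite_signed_measure \<rho>'"
    and eq: "\<And>z w. Im z \<noteq> 0 \<Longrightarrow> Im w \<noteq> 0 \<Longrightarrow>
       signed_integral \<rho> (\<lambda>(s, t). kern z s * kern w t) = signed_integral \<rho>' (\<lambda>(s, t). kern z s * kern w t)"
    and A: "A \<in> sets borel"
  shows "\<rho> A = \<rho>' A"
proof -
  let ?V = upper_variation
  let ?n = "\<lambda>\<rho> A. - \<rho> A :: real"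
  note fsm' = fsm[THEN finite_signed_measure_uminus]
  have fb: "finite_borel (?V r)" if "finite_signed_measure r" for r :: "(real \<times> real) set \<Rightarrow> real"
    using finite_measure_upper_variation[OF that] by (simp add: finite_borel_def)
  obtain p where p: "finite_borel p" "\<And>A. A \<in> sets borel \<Longrightarrow> measure p A = measure (?V \<rho>) A + measure (?V (?n \<rho>')) A"
    using finite_borel_sum[OF fb[OF fsm(1)] fb[OF fsm'(2)]] by blast
  obtain q where q: "finite_borel q" "\<And>A. A \<in> sets borel \<Longrightarrow> measure q A = measure (?V \<rho>') A + measure (?V (?n \<rho>)) A"
    using finite_borel_sum[OF fb[OF fsm(2)] fb[OF fsm'(1)]] by blast
  have "p = q"
  proof (rule measure_eq_if_kernel_integrals_eq[OF p(1) q(1)])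
    fix z w assume zw: "Im z \<noteq> 0" "Im w \<noteq> 0"
    define f where "f = (\<lambda>(s, t). kern z s * kern w t)"
    have fm: "f \<in> borel_measurable borel" unfolding f_def
      by (simp add: borel_prod[symmetric])
    have fB: "norm (f x) \<le> (norm z * kern_const z) * (norm w * kern_const w)" for x
      using norm_kern_le[OF zw(1)] norm_kern_le[OF zw(2)] order_trans[OF zero_le_one kern_const_ge_1]
      by (auto simp: f_def norm_mult split: prod.split intro!: mult_mono)
    have "(\<integral>x. f x \<partial>p) = (\<integral>x. f x \<partial>?V \<rho>) + (\<integral>x. f x \<partial>?V (?n \<rho>'))"
      by (rule integral_finite_borel_sum[OF fb[OF fsm(1)] fb[OF fsm'(2)] p fm fB])
    moreover have "(\<integral>x. f x \<partial>q) = (\<integral>x. f x \<partial>?V \<rho>') + (\<integral>x. f x \<partial>?V (?n \<rho>))"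
      by (rule integral_finite_borel_sum[OF fb[OF fsm(2)] fb[OF fsm'(1)] q fm fB])
    moreover have "(\<integral>x. f x \<partial>?V \<rho>) - (\<integral>x. f x \<partial>?V (?n \<rho>)) = (\<integral>x. f x \<partial>?V \<rho>') - (\<integral>x. f x \<partial>?V (?n \<rho>'))"
      using eq[OF zw] by (simp add: signed_integral_def f_def)
    ultimately have "(\<integral>x. f x \<partial>p) = (\<integral>x. f x \<partial>q)" by (simp add: algebra_simps)
    then show "(\<integral>(s, t). kern z s * kern w t \<partial>p) = (\<integral>(s, t). kern z s * kern w t \<partial>q)"
      by (simp add: f_def)
  qed
  then show ?thesis
    using p(2)[OF A] q(2)[OF A] jordan_decomposition[OF fsm(1) A] jordan_decomposition[OF fsm(2) A] by simp
qed

subsection \<open>Differentiability of kernel integrals\<close>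

definition dkern :: "complex \<Rightarrow> real \<Rightarrow> complex" where
  "dkern z s = complex_of_real (sqrt (1 + s\<^sup>2)) / (1 - z * complex_of_real s)\<^sup>2"

lemma measurable_dkern [measurable]: "dkern z \<in> borel_measurable borel"
  unfolding dkern_def by measurable

lemma
  assumes "Im z \<noteq> 0"
  shows one_le_kern_const: "1 \<le> kern_const z * norm (1 - z * complex_of_real s)"
    and abs_le_kern_const: "\<bar>s\<bar> \<le> kern_const z * norm (1 - z * complex_of_real s)"
    and sqrt_le_kern_const: "sqrt (1 + s\<^sup>2) \<le> kern_const z * norm (1 - z * complex_of_real s)"
  using one_plus_abs_le[OF assms, of s] sqrt_one_plus_sq_le[of s] by linarith+

lemma norm_dkern_le:
  assumes "Im z \<noteq> 0"
  shows "norm (dkern z s) \<le> (kern_const z)\<^sup>2"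
proof -
  let ?u = "norm (1 - z * complex_of_real s)"
  have u: "?u > 0" using one_minus_nonzero[OF assms] by simp
  have "sqrt (1 + s\<^sup>2) \<le> kern_const z * ?u" by (rule sqrt_le_kern_const[OF assms])
  also have "\<dots> \<le> kern_const z * ?u * (kern_const z * ?u)"
    using mult_left_mono[OF one_le_kern_const[OF assms, of s], of "kern_const z * ?u"] kern_const_ge_1[of z]
    by simp
  finally show ?thesis
    using u by (simp add: dkern_def norm_divide norm_mult divide_le_eq power2_eq_square mult_ac)
qed

lemma norm_kern_diff_le:
  assumes "Im z \<noteq> 0" "Im z' \<noteq> 0"
  shows "norm (kern z' s - kern z s) \<le> norm (z' - z) * (kern_const z * kern_const z')"
proof -
  let ?u = "1 - z * complex_of_real s" and ?u' = "1 - z' * complex_of_real s"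
  have nz: "?u \<noteq> 0" "?u' \<noteq> 0" using one_minus_nonzero assms by auto
  have eq: "kern z' s - kern z s = (z' - z) * (complex_of_real (sqrt (1 + s\<^sup>2)) / (?u * ?u'))"
    using nz by (simp add: kern_def divide_simps) (simp add: algebra_simps)
  have "sqrt (1 + s\<^sup>2) * 1 \<le> (kern_const z * norm ?u) * (kern_const z' * norm ?u')"
    using sqrt_le_kern_const[OF assms(1)] one_le_kern_const[OF assms(2)] kern_const_ge_1[of z]
    by (intro mult_mono) auto
  then have "norm (complex_of_real (sqrt (1 + s\<^sup>2)) / (?u * ?u')) \<le> kern_const z * kern_const z'"
    using nz by (simp add: norm_divide norm_mult divide_le_eq mult_ac)
  then show ?thesis
    unfolding eq norm_mult by (intro mult_left_mono) auto
qed

text \<open>The remainder is exactly (z' - z)^2 s sqrt (1 + s^2) / ((1 - z s)^2 (1 - z' s)). The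
  three factors of the denominator absorb sqrt (1 + s^2), s and 1, one each.\<close>

lemma kern_taylor:
  assumes "Im z \<noteq> 0" "Im z' \<noteq> 0"
  shows "norm (kern z' s - kern z s - (z' - z) * dkern z s) \<le> (norm (z' - z))\<^sup>2 * ((kern_const z)\<^sup>2 * kern_const z')"
proof -
  let ?u = "1 - z * complex_of_real s" and ?u' = "1 - z' * complex_of_real s"
  have nz: "?u \<noteq> 0" "?u' \<noteq> 0" using one_minus_nonzero assms by auto
  have eq: "kern z' s - kern z s - (z' - z) * dkern z s =
      (z' - z)\<^sup>2 * (complex_of_real (sqrt (1 + s\<^sup>2)) * complex_of_real s / (?u * ?u * ?u'))"
    using nz by (simp add: kern_def dkern_def divide_simps power2_eq_square) (simp add: algebra_simps)
  have "sqrt (1 + s\<^sup>2) * \<bar>s\<bar> * 1 \<le> (kern_const z * norm ?u) * (kern_const z * norm ?u) * (kern_const z' * norm ?u')"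
    using sqrt_le_kern_const[OF assms(1)] one_le_kern_const[OF assms(2)] abs_le_kern_const[OF assms(1)] kern_const_ge_1[of z]
    by (intro mult_mono) auto
  then have "norm (complex_of_real (sqrt (1 + s\<^sup>2)) * complex_of_real s / (?u * ?u * ?u')) \<le> (kern_const z)\<^sup>2 * kern_const z'"
    using nz by (simp add: norm_divide norm_mult divide_le_eq mult_ac power2_eq_square)
  then show ?thesis
    unfolding eq norm_mult norm_power by (intro mult_left_mono) auto
qed

lemma kern_const_nearby:
  assumes "Im z \<noteq> 0" "norm (z' - z) \<le> \<bar>Im z\<bar> / 2"
  shows "Im z' \<noteq> 0" "kern_const z' \<le> 1 + 2 * (1 + norm z + \<bar>Im z\<bar>) / \<bar>Im z\<bar>"
proof -
  have "\<bar>Im z' - Im z\<bar> \<le> \<bar>Im z\<bar> / 2"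
    using abs_Im_le_cmod[of "z' - z"] assms(2) by simp
  then have im: "\<bar>Im z'\<bar> \<ge> \<bar>Im z\<bar> / 2" by linarith
  then show "Im z' \<noteq> 0" using assms(1) by auto
  have "norm z' \<le> norm z + \<bar>Im z\<bar>"
    using norm_triangle_sub[of z' z] assms(2) by linarith
  then have "(1 + norm z') / \<bar>Im z'\<bar> \<le> (1 + norm z + \<bar>Im z\<bar>) / (\<bar>Im z\<bar> / 2)"
    using im assms(1) by (intro frac_le) auto
  then show "kern_const z' \<le> 1 + 2 * (1 + norm z + \<bar>Im z\<bar>) / \<bar>Im z\<bar>"
    by (simp add: kern_const_def mult.commute)
qed

lemma integrable_kern:
  fixes g :: "'a \<Rightarrow> complex"
  assumes "finite_measure M" "S \<in> borel_measurable M" "g \<in> borel_measurable M"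
    and "\<And>x. norm (g x) \<le> B" "Im z \<noteq> 0"
  shows "integrable M (\<lambda>x. g x * kern z (S x))"
proof (rule finite_measure.integrable_const_bound[OF assms(1)])
  note [measurable] = assms(2,3)
  have "0 \<le> B" using assms(4) norm_ge_zero order_trans by blast
  then show "AE x in M. norm (g x * kern z (S x)) \<le> B * (norm z * kern_const z)"
    using assms(4) norm_kern_le[OF assms(5)] by (auto simp: norm_mult intro!: mult_mono)
  show "(\<lambda>x. g x * kern z (S x)) \<in> borel_measurable M" by measurable
qed

lemma norm_integral_le_const:
  fixes f :: "'a \<Rightarrow> complex"
  assumes "finite_measure M" "\<And>x. norm (f x) \<le> B" "0 \<le> B"
  shows "norm (\<integral>x. f x \<partial>M) \<le> B * measure M (space M)"
proof -
  interpret finite_measure M by fact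
  show ?thesis
  proof (cases "integrable M f")
    case True
    have "norm (\<integral>x. f x \<partial>M) \<le> (\<integral>x. norm (f x) \<partial>M)" by (rule integral_norm_bound)
    also have "\<dots> \<le> (\<integral>x. B \<partial>M)" using True assms by (intro integral_mono) auto
    finally show ?thesis by (simp add: mult.commute)
  next
    case False
    \<comment> \<open>A function that is not integrable has Bochner integral 0 by convention, so the
      bound holds here as well.\<close>
    then show ?thesis using assms(3) by (simp add: not_integrable_integral_eq)
  qed
qed

text \<open>The Taylor remainder of \<open>kern\<close> is quadratic in z' - z with a constant
  independent of x, so it can be integrated; the error of the difference quotient is then linear in
  |z' - z|.\<close>

lemma kern_integral_has_field_derivative:
  fixes g :: "'a \<Rightarrow> complex"
  assumes M: "finite_measure M" and S: "S \<in> borel_measurable M" and g: "g \<in> borel_measurable M"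
    and B: "\<And>x. norm (g x) \<le> B" and z: "Im z \<noteq> 0"
  shows "((\<lambda>z. \<integral>x. g x * kern z (S x) \<partial>M) has_field_derivative (\<integral>x. g x * dkern z (S x) \<partial>M)) (at z)"
proof -
  interpret finite_measure M by fact
  note [measurable] = S g
  have B0: "0 \<le> B" using B norm_ge_zero order_trans by blast
  define F where "F z = (\<integral>x. g x * kern z (S x) \<partial>M)" for z
  define C where "C = 1 + 2 * (1 + norm z + \<bar>Im z\<bar>) / \<bar>Im z\<bar>"
  have idk: "integrable M (\<lambda>x. g x * dkern z (S x))"
  proof (rule integrable_const_bound)
    show "AE x in M. norm (g x * dkern z (S x)) \<le> B * (kern_const z)\<^sup>2"
      using B norm_dkern_le[OF z] B0 by (auto simp: norm_mult intro!: mult_mono)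
  qed measurable
  have main: "norm (F z' - F z - (\<integral>x. g x * dkern z (S x) \<partial>M) * (z' - z)) \<le>
      (norm (z' - z))\<^sup>2 * (B * ((kern_const z)\<^sup>2 * C) * measure M (space M))"
    if near: "norm (z' - z) \<le> \<bar>Im z\<bar> / 2" for z'
  proof -
    note n = kern_const_nearby[OF z near]
    note i = integrable_kern[OF M S g B n(1)] integrable_kern[OF M S g B z]
    have "F z' - F z - (\<integral>x. g x * dkern z (S x) \<partial>M) * (z' - z) =
        (\<integral>x. g x * kern z' (S x) - g x * kern z (S x) - g x * dkern z (S x) * (z' - z) \<partial>M)"
      unfolding F_def using i idk by simp
    also have "norm \<dots> \<le> B * ((norm (z' - z))\<^sup>2 * ((kern_const z)\<^sup>2 * C)) * measure M (space M)"
    proof (rule norm_integral_le_const[OF M])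
      fix x
      have "norm (g x * kern z' (S x) - g x * kern z (S x) - g x * dkern z (S x) * (z' - z)) =
          norm (g x) * norm (kern z' (S x) - kern z (S x) - (z' - z) * dkern z (S x))"
        unfolding norm_mult[symmetric] by (simp add: algebra_simps)
      also have "\<dots> \<le> B * ((norm (z' - z))\<^sup>2 * ((kern_const z)\<^sup>2 * kern_const z'))"
        using B kern_taylor[OF z n(1)] B0 by (intro mult_mono) auto
      also have "\<dots> \<le> B * ((norm (z' - z))\<^sup>2 * ((kern_const z)\<^sup>2 * C))"
        using n(2) B0 by (intro mult_left_mono) (auto simp: C_def)
      finally show "norm (g x * kern z' (S x) - g x * kern z (S x) - g x * dkern z (S x) * (z' - z)) \<le>
          B * ((norm (z' - z))\<^sup>2 * ((kern_const z)\<^sup>2 * C))" .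
    next
      show "0 \<le> B * ((norm (z' - z))\<^sup>2 * ((kern_const z)\<^sup>2 * C))"
        using B0 z by (auto simp: C_def)
    qed
    finally show ?thesis by (simp add: mult_ac)
  qed
  have "(F has_field_derivative (\<integral>x. g x * dkern z (S x) \<partial>M)) (at z)"
    unfolding has_field_derivative_def
  proof (rule has_derivativeI_sandwich[where e = "\<bar>Im z\<bar> / 2"])
    let ?K = "B * ((kern_const z)\<^sup>2 * C) * measure M (space M)"
    show "0 < \<bar>Im z\<bar> / 2" using z by simp
    show "bounded_linear ((*) (\<integral>x. g x * dkern z (S x) \<partial>M))" by (rule bounded_linear_mult_right)
    show "((\<lambda>z'. norm (z' - z) * ?K) \<longlongrightarrow> 0) (at z)"
      by (intro tendsto_eq_intros | simp)+
    fix z' assume z': "z' \<in> UNIV" "z' \<noteq> z" "dist z' z < \<bar>Im z\<bar> / 2"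
    then have "norm (F z' - F z - (\<integral>x. g x * dkern z (S x) \<partial>M) * (z' - z)) \<le> (norm (z' - z))\<^sup>2 * ?K"
      by (intro main) (simp add: dist_norm)
    then show "norm (F z' - F z - (\<integral>x. g x * dkern z (S x) \<partial>M) * (z' - z)) / norm (z' - z) \<le> norm (z' - z) * ?K"
      using z'(2) by (simp add: divide_le_eq power2_eq_square mult_ac)
  qed
  then show ?thesis by (simp add: F_def[abs_def])
qed

lemma holomorphic_on_kern_integral:
  fixes g :: "'a \<Rightarrow> complex"
  assumes "finite_measure M" "S \<in> borel_measurable M" "g \<in> borel_measurable M" "\<And>x. norm (g x) \<le> B"
    and "\<And>z. z \<in> U \<Longrightarrow> Im z \<noteq> 0"
  shows "(\<lambda>z. \<integral>x. g x * kern z (S x) \<partial>M) holomorphic_on U"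
  unfolding holomorphic_on_def field_differentiable_def
  using kern_integral_has_field_derivative[OF assms(1-4)] assms(5)
  by (blast intro: has_field_derivative_at_within)

subsection \<open>Stolz domains\<close>

text \<open>The sign c = 1 or c = -1 selects the upper or the lower component. Each is convex, hence
  connected, as the identity theorem and Vitali's theorem require of their domain.\<close>

definition half_stolz :: "real \<Rightarrow> real \<Rightarrow> real \<Rightarrow> complex set" where
  "half_stolz c \<alpha> \<beta> = {z. 0 < c * Im z \<and> \<bar>Re z\<bar> < \<alpha> * (c * Im z) \<and> c * Im z < \<beta>}"

lemma stolz_domain_eq_halves: "stolz_domain \<alpha> \<beta> = half_stolz 1 \<alpha> \<beta> \<union> half_stolz (-1) \<alpha> \<beta>"
proof -
  have "z \<in> cnj ` stolz_angle \<alpha> \<beta> \<longleftrightarrow> cnj z \<in> stolz_angle \<alpha> \<beta>" for z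
    by (metis complex_cnj_cnj image_iff)
  then show ?thesis
    by (auto simp: stolz_domain_def half_stolz_def stolz_angle_def)
qed

lemma in_stolz_domain_iff:
  assumes "\<alpha> > 0"
  shows "z \<in> stolz_domain \<alpha> \<beta> \<longleftrightarrow> \<bar>Re z\<bar> < \<alpha> * \<bar>Im z\<bar> \<and> \<bar>Im z\<bar> < \<beta>"
proof -
  have "Im z \<noteq> 0" if "\<bar>Re z\<bar> < \<alpha> * \<bar>Im z\<bar>" using that by auto
  then show ?thesis
    by (cases "Im z" "0 :: real" rule: linorder_cases)
      (auto simp: stolz_domain_eq_halves half_stolz_def)
qed

lemma Im_nonzero_stolz_domain: "z \<in> stolz_domain \<alpha> \<beta> \<Longrightarrow> Im z \<noteq> 0"
  by (auto simp: stolz_domain_eq_halves half_stolz_def)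

lemma half_stolz_mono:
  assumes "\<alpha> \<le> \<alpha>'" "\<beta> \<le> \<beta>'"
  shows "half_stolz c \<alpha> \<beta> \<subseteq> half_stolz c \<alpha>' \<beta>'"
proof
  fix z assume z: "z \<in> half_stolz c \<alpha> \<beta>"
  then have "\<alpha> * (c * Im z) \<le> \<alpha>' * (c * Im z)"
    using assms by (intro mult_right_mono) (auto simp: half_stolz_def)
  then show "z \<in> half_stolz c \<alpha>' \<beta>'"
    using z assms(2) by (auto simp: half_stolz_def)
qed

lemma stolz_domain_mono:
  assumes "\<alpha> \<le> \<alpha>'" "\<beta> \<le> \<beta>'"
  shows "stolz_domain \<alpha> \<beta> \<subseteq> stolz_domain \<alpha>' \<beta>'"
  unfolding stolz_domain_eq_halves by (intro Un_mono half_stolz_mono assms)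

lemma open_half_stolz: "open (half_stolz c \<alpha> \<beta>)"
  unfolding half_stolz_def
  by (intro open_Collect_conj open_Collect_less continuous_intros)

lemma convex_half_stolz: "convex (half_stolz c \<alpha> \<beta>)"
proof -
  have "half_stolz c \<alpha> \<beta> = {z. 0 < c * Im z} \<inter> {z. Re z - \<alpha> * (c * Im z) < 0}
      \<inter> {z. - Re z - \<alpha> * (c * Im z) < 0} \<inter> {z. c * Im z < \<beta>}"
    by (auto simp: half_stolz_def abs_less_iff)
  also have "convex \<dots>"
  proof (intro convex_Int)
    have lin: "linear f \<Longrightarrow> convex {z. f z < (a::real)}" for f :: "complex \<Rightarrow> real" and a
      using convex_linear_vimage[of f "{..<a}"] by (simp add: vimage_def)
    have lin': "linear f \<Longrightarrow> convex {z. (a::real) < f z}" for f :: "complex \<Rightarrow> real" and a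
      using convex_linear_vimage[of f "{a<..}"] by (simp add: vimage_def)
    show "convex {z. 0 < c * Im z}" by (rule lin', rule linearI) (auto simp: algebra_simps)
    show "convex {z. Re z - \<alpha> * (c * Im z) < 0}" by (rule lin, rule linearI) (auto simp: algebra_simps)
    show "convex {z. - Re z - \<alpha> * (c * Im z) < 0}" by (rule lin, rule linearI) (auto simp: algebra_simps)
    show "convex {z. c * Im z < \<beta>}" by (rule lin, rule linearI) (auto simp: algebra_simps)
  qed
  finally show ?thesis .
qed

lemma half_stolz_nonempty:
  assumes "\<alpha> > 0" "\<beta> > 0" "c = 1 \<or> c = -1"
  shows "half_stolz c \<alpha> \<beta> \<noteq> {}"
proof -
  have "Complex 0 (c * (\<beta> / 2)) \<in> half_stolz c \<alpha> \<beta>"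
    using assms by (auto simp: half_stolz_def)
  then show ?thesis by blast
qed

text \<open>Both components of a Stolz domain accumulate at 0, so the identity theorem carries
  equalities from a small Stolz domain to a large one.\<close>

lemma stolz_domain_identity:
  assumes "f holomorphic_on stolz_domain \<alpha> \<beta>" "g holomorphic_on stolz_domain \<alpha> \<beta>"
    and pos: "\<alpha>' > 0" "\<beta>' > 0" and le: "\<alpha>' \<le> \<alpha>" "\<beta>' \<le> \<beta>"
    and eq: "\<And>z. z \<in> stolz_domain \<alpha>' \<beta>' \<Longrightarrow> f z = g z" and z: "z \<in> stolz_domain \<alpha> \<beta>"
  shows "f z = g z"
proof -
  obtain c :: real where c: "c = 1 \<or> c = -1" "z \<in> half_stolz c \<alpha> \<beta>"
    using z by (auto simp: stolz_domain_eq_halves)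
  have sub: "half_stolz c \<alpha>' \<beta>' \<subseteq> half_stolz c \<alpha> \<beta>"
    by (rule half_stolz_mono[OF le])
  have sub2: "half_stolz c a b \<subseteq> stolz_domain a b" for a b
    using c(1) by (auto simp: stolz_domain_eq_halves)
  show ?thesis
  proof (rule analytic_continuation_open[OF open_half_stolz open_half_stolz _ _ sub _ _ _ c(2)])
    show "half_stolz c \<alpha>' \<beta>' \<noteq> {}" by (rule half_stolz_nonempty[OF pos c(1)])
    show "connected (half_stolz c \<alpha> \<beta>)" by (rule convex_connected[OF convex_half_stolz])
    show "f holomorphic_on half_stolz c \<alpha> \<beta>" "g holomorphic_on half_stolz c \<alpha> \<beta>"
      using assms(1,2) sub2 holomorphic_on_subset by blast+
    show "f z = g z" if "z \<in> half_stolz c \<alpha>' \<beta>'" for z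
      using eq that sub2 by blast
  qed
qed

text \<open>The constant 3/2 is a rational stand-in for sqrt 2.\<close>

lemma norm_le_Im:
  assumes "\<bar>Re z\<bar> \<le> \<bar>Im z\<bar>"
  shows "norm z \<le> 3 / 2 * \<bar>Im z\<bar>"
proof -
  have "(Re z)\<^sup>2 \<le> (Im z)\<^sup>2" using assms by (simp add: abs_le_square_iff)
  then have "(norm z)\<^sup>2 \<le> 2 * (Im z)\<^sup>2" by (simp add: cmod_power2)
  also have "\<dots> \<le> (3 / 2 * \<bar>Im z\<bar>)\<^sup>2" by (simp add: power_mult_distrib power_divide)
  finally have "(norm z)\<^sup>2 \<le> (3 / 2 * \<bar>Im z\<bar>)\<^sup>2" .
  then show ?thesis by (rule power2_le_imp_le) simp
qed

text \<open>|a| >= 9/10 gives |Z - z| <= |z| / 9, and |z| <= 3/2 |Im z| then gives |Im Z| >= 5/9 |z|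
  and |Z| <= 10/9 |z|; the constants 2 and 3 are rounded up. It is used with a = 1 + z R z, where Z
  is the point at which \<open>psi\<close> is evaluated.\<close>

lemma wide_quotient:
  assumes "\<bar>Re z\<bar> < \<bar>Im z\<bar>" "norm (a - 1) \<le> 1 / 10"
  defines "Z \<equiv> z / a"
  shows "a \<noteq> 0" "norm (Z - z) \<le> norm z / 9" "norm Z \<le> 2 * norm z" "norm z \<le> 2 * \<bar>Im Z\<bar>"
    "norm Z \<le> 3 * \<bar>Im Z\<bar>" "Im Z \<noteq> 0"
proof -
  have na: "norm a \<ge> 9 / 10"
    using norm_triangle_ineq2[of 1 "1 - a"] assms(2) by (simp add: norm_minus_commute)
  then show a: "a \<noteq> 0" by auto
  have z: "norm z \<le> 3 / 2 * \<bar>Im z\<bar>" using assms(1) by (intro norm_le_Im) simp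
  have z0: "norm z > 0" using assms(1) by auto
  have "Z - z = z * ((1 - a) / a)" using a by (simp add: Z_def field_simps)
  then have "norm (Z - z) = norm z * (norm (a - 1) / norm a)"
    by (simp add: norm_mult norm_divide norm_minus_commute)
  also have "\<dots> \<le> norm z * ((1 / 10) / (9 / 10))"
    using na assms(2) by (intro mult_left_mono frac_le) auto
  finally show d: "norm (Z - z) \<le> norm z / 9" by simp
  show "norm Z \<le> 2 * norm z" using norm_triangle_sub[of Z z] d z0 by linarith
  have im: "\<bar>Im Z\<bar> \<ge> \<bar>Im z\<bar> - norm z / 9"
    using abs_Im_le_cmod[of "Z - z"] d by simp
  then show "norm z \<le> 2 * \<bar>Im Z\<bar>" using z by linarith
  then show "Im Z \<noteq> 0" using z0 by auto
  show "norm Z \<le> 3 * \<bar>Im Z\<bar>"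
    using norm_triangle_sub[of Z z] d im z by linarith
qed

subsection \<open>The moment transform\<close>

text \<open>The moment generating function without its constant term; the Cauchy transform at 1 / z
  is z (1 + psi m z).\<close>

definition psi :: "real measure \<Rightarrow> complex \<Rightarrow> complex" where
  "psi m z = (\<integral>x. z * complex_of_real x / (1 - z * complex_of_real x) \<partial>m)"

text \<open>Measures, on the scale \<open>1 / y\<close>, how much mass lies away from 0; it controls \<^term>\<open>psi m\<close> on cones.\<close>

definition spread :: "real measure \<Rightarrow> real \<Rightarrow> real" where
  "spread m y = (\<integral>x. min 1 (y * \<bar>x\<bar>) \<partial>m)"

lemma borel_probD:
  assumes "borel_prob m"
  shows "prob_space m" "finite_measure m" "sets m = sets borel" "space m = UNIV" "measure m (space m) = 1"
proof -
  show 1: "prob_space m" and 2: "sets m = sets borel"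
    using assms by (auto simp: borel_prob_def)
  show "finite_measure m" using 1 by (rule prob_space.finite_measure)
  show "space m = UNIV" using sets_eq_imp_space_eq[OF 2] by simp
  show "measure m (space m) = 1" using 1 by (rule prob_space.prob_space)
qed

lemma measurable_borel_prob:
  assumes "borel_prob m" "f \<in> measurable borel N"
  shows "f \<in> measurable m N"
  using assms borel_probD(3)[OF assms(1)] by (simp cong: measurable_cong_sets)

lemma integrable_spread:
  fixes m :: "real measure"
  assumes "borel_prob m" "0 \<le> y"
  shows "integrable m (\<lambda>x. min 1 (y * \<bar>x\<bar>))"
proof (rule finite_measure.integrable_const_bound[OF borel_probD(2)[OF assms(1)], of _ 1])
  show "(\<lambda>x. min 1 (y * \<bar>x\<bar>)) \<in> borel_measurable m"
    by (rule measurable_borel_prob[OF assms(1)]) measurable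
qed (use assms(2) in auto)

lemma spread_mono:
  assumes "borel_prob m" "0 \<le> y" "y \<le> y'" shows "spread m y \<le> spread m y'"
  unfolding spread_def using assms
  by (intro integral_mono integrable_spread min.mono mult_right_mono) auto

lemma spread_tendsto_0:
  assumes m: "borel_prob m"
  shows "(\<lambda>n. spread m (1 / real (Suc n))) \<longlonglongrightarrow> 0"
proof -
  have "(\<lambda>n. spread m (1 / real (Suc n))) \<longlonglongrightarrow> (\<integral>x. 0 \<partial>m)"
    unfolding spread_def
  proof (rule integral_dominated_convergence[where w = "\<lambda>_. 1"])
    show "AE x in m. (\<lambda>n. min 1 (1 / real (Suc n) * \<bar>x\<bar>)) \<longlonglongrightarrow> 0"
    proof (intro AE_I2)
      fix x :: real
      have "(\<lambda>n. min 1 (1 / real (Suc n) * \<bar>x\<bar>)) \<longlonglongrightarrow> min 1 (0 * \<bar>x\<bar>)"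
        by (intro tendsto_intros LIMSEQ_Suc lim_1_over_n)
      then show "(\<lambda>n. min 1 (1 / real (Suc n) * \<bar>x\<bar>)) \<longlonglongrightarrow> 0" by simp
    qed
  qed (use m in \<open>auto intro!: measurable_borel_prob[OF m] finite_measure.integrable_const simp: borel_probD\<close>)
  then show ?thesis by simp
qed

lemma spread_small:
  assumes "borel_prob m" "e > 0"
  obtains y where "y > 0" "spread m y < e"
proof -
  have "eventually (\<lambda>n. spread m (1 / real (Suc n)) < e) sequentially"
    using spread_tendsto_0[OF assms(1)] assms(2) by (rule order_tendstoD)
  then obtain n where "spread m (1 / real (Suc n)) < e"
    by (auto simp: eventually_sequentially)
  then show thesis by (intro that[of "1 / real (Suc n)"]) auto
qed

text \<open>Multiplying 1 - z x by the conjugate of z leaves the imaginary part -Im z, hence |Im z|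
  <= |z| |1 - z x| and |1 - z x| >= 1/3 on the cone. The integrand is then at most 3 |z x|, and also
  at most 1 / |1 - z x| + 1 <= 4.\<close>

lemma psi_integrand_bounds:
  fixes x :: real
  assumes "Im z \<noteq> 0" "norm z \<le> 3 * \<bar>Im z\<bar>"
  shows "norm (z * complex_of_real x / (1 - z * complex_of_real x)) \<le> 4 * min 1 (norm z * \<bar>x\<bar>)"
proof -
  let ?u = "1 - z * complex_of_real x"
  have nz: "?u \<noteq> 0" using one_minus_nonzero[OF assms(1)] .
  have "\<bar>Im z\<bar> \<le> norm (cnj z - complex_of_real ((norm z)\<^sup>2) * complex_of_real x)"
    using abs_Im_le_cmod[of "cnj z - complex_of_real ((norm z)\<^sup>2) * complex_of_real x"] by simp
  also have "cnj z - complex_of_real ((norm z)\<^sup>2) * complex_of_real x = cnj z * ?u"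
    by (simp add: complex_norm_square algebra_simps del: of_real_power)
  finally have "\<bar>Im z\<bar> \<le> norm z * norm ?u" by (simp add: norm_mult)
  then have "norm z \<le> norm z * (3 * norm ?u)" using assms(2) by simp
  moreover have "norm z > 0" using assms(1) by auto
  ultimately have one: "1 \<le> 3 * norm ?u"
    using mult_le_cancel_left_pos[of "norm z" 1 "3 * norm ?u"] by simp
  have "norm (z * complex_of_real x / ?u) \<le> 3 * (norm z * \<bar>x\<bar>)"
    using one mult_left_mono[OF one, of "norm z * \<bar>x\<bar>"] nz
    by (simp add: norm_mult norm_divide divide_le_eq mult_ac)
  moreover have "norm (z * complex_of_real x / ?u) \<le> 4"
  proof -
    have "z * complex_of_real x / ?u = 1 / ?u - 1" using nz by (simp add: field_simps)
    also have "norm \<dots> \<le> 1 / norm ?u + 1"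
      using norm_triangle_ineq4[of "1 / ?u" 1] by (simp add: norm_divide)
    also have "1 / norm ?u \<le> 3" using one nz by (simp add: divide_le_eq)
    finally show ?thesis by simp
  qed
  moreover have "3 * (norm z * \<bar>x\<bar>) \<le> 4 * (norm z * \<bar>x\<bar>)" by simp
  ultimately show ?thesis unfolding min_def by (auto intro: order_trans)
qed

lemma psi_kern: "z * complex_of_real x / (1 - z * complex_of_real x) = complex_of_real (x / sqrt (1 + x\<^sup>2)) * kern z x"
proof -
  have "sqrt (1 + x\<^sup>2) \<noteq> 0" by (simp add: add_nonneg_eq_0_iff)
  then show ?thesis by (simp add: kern_def)
qed

lemma abs_div_sqrt_le_1: "\<bar>x / sqrt (1 + x\<^sup>2)\<bar> \<le> 1"
proof -
  have "\<bar>x\<bar> \<le> sqrt (1 + x\<^sup>2)" by (rule real_le_rsqrt) simp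
  moreover have "sqrt (1 + x\<^sup>2) > 0" by (simp add: add_pos_nonneg)
  ultimately show ?thesis by (simp add: abs_divide)
qed

lemma integrable_psi:
  assumes "borel_prob m" "Im z \<noteq> 0"
  shows "integrable m (\<lambda>x. z * complex_of_real x / (1 - z * complex_of_real x))"
  unfolding psi_kern using assms abs_div_sqrt_le_1
  by (intro integrable_kern[where B = 1]) (auto intro!: measurable_borel_prob[OF assms(1)] simp: borel_probD simp del: of_real_divide)

lemma norm_psi_le:
  assumes "borel_prob m" "Im z \<noteq> 0" "norm z \<le> 3 * \<bar>Im z\<bar>"
  shows "norm (psi m z) \<le> 4 * spread m (norm z)"
proof -
  have "norm (psi m z) \<le> (\<integral>x. norm (z * complex_of_real x / (1 - z * complex_of_real x)) \<partial>m)"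
    unfolding psi_def by (rule integral_norm_bound)
  also have "\<dots> \<le> (\<integral>x. 4 * min 1 (norm z * \<bar>x\<bar>) \<partial>m)"
    using assms integrable_psi[OF assms(1,2)]
    by (intro integral_mono psi_integrand_bounds integrable_norm integrable_mult_right integrable_spread) auto
  finally show ?thesis by (simp add: spread_def)
qed

lemma psi_holomorphic:
  assumes "borel_prob m" "\<And>z. z \<in> U \<Longrightarrow> Im z \<noteq> 0"
  shows "psi m holomorphic_on U"
proof -
  have "(\<lambda>z. \<integral>x. complex_of_real (x / sqrt (1 + x\<^sup>2)) * kern z x \<partial>m) holomorphic_on U"
    using assms abs_div_sqrt_le_1
    by (intro holomorphic_on_kern_integral[where B = 1]) (auto intro!: measurable_borel_prob[OF assms(1)] simp: borel_probD simp del: of_real_divide)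
  then show ?thesis by (simp add: psi_def[abs_def] psi_kern)
qed

lemma cauchy_transform_psi:
  assumes "borel_prob m" "Im z \<noteq> 0"
  shows "cauchy_transform m (1 / z) = z * (1 + psi m z)"
proof -
  interpret prob_space m using assms(1) by (rule borel_probD)
  have "z \<noteq> 0" using assms(2) by auto
  have "cauchy_transform m (1 / z) = (\<integral>x. z * (1 + z * complex_of_real x / (1 - z * complex_of_real x)) \<partial>m)"
    unfolding cauchy_transform_def
  proof (intro Bochner_Integration.integral_cong refl)
    fix x
    show "1 / (1 / z - complex_of_real x) = z * (1 + z * complex_of_real x / (1 - z * complex_of_real x))"
      using one_minus_nonzero[OF assms(2), of x] \<open>z \<noteq> 0\<close> by (simp add: field_simps)
  qed
  also have "\<dots> = z * (1 + psi m z)"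
    using integrable_psi[OF assms] by (simp add: psi_def prob_space)
  finally show ?thesis .
qed

lemma Im_inverse_nonzero: "Im z \<noteq> 0 \<Longrightarrow> Im (1 / z) \<noteq> 0"
  by (auto simp: Im_divide power2_eq_square sum_squares_eq_zero_iff)

lemma cauchy_transform_holomorphic:
  assumes "borel_prob m" "\<And>z. z \<in> U \<Longrightarrow> Im z \<noteq> 0"
  shows "cauchy_transform m holomorphic_on U"
proof -
  have "(\<lambda>z. 1 / z * (1 + psi m (1 / z))) holomorphic_on U"
  proof (intro holomorphic_intros holomorphic_on_compose_gen[OF _ psi_holomorphic[OF assms(1)], unfolded o_def, of _ _ "(\<lambda>z. 1 / z) ` U"])
  qed (use assms(2) assms(2)[of 0] Im_inverse_nonzero in auto)
  then show ?thesis
  proof (rule holomorphic_transform)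
    fix z assume "z \<in> U"
    then show "1 / z * (1 + psi m (1 / z)) = cauchy_transform m z"
      using cauchy_transform_psi[OF assms(1) Im_inverse_nonzero[OF assms(2)], of z] by simp
  qed
qed

text \<open>With v(z) = z x / (1 - z x) the difference z v(z) - w v(w) factors as z - w times v(z) +
  v(w) + v(z) v(w). Each v is at most 4 min 1 (y |x|), and at most 4, which makes the constant 4 + 4
  + 16 = 24.\<close>

lemma psi_near_identity:
  assumes m: "borel_prob m" and z: "Im z \<noteq> 0" "norm z \<le> 3 * \<bar>Im z\<bar>" "norm z \<le> y"
    and w: "Im w \<noteq> 0" "norm w \<le> 3 * \<bar>Im w\<bar>" "norm w \<le> y"
  shows "norm (z * (1 + psi m z) - w * (1 + psi m w) - (z - w)) \<le> 24 * spread m y * norm (z - w)"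
proof -
  interpret prob_space m using m by (rule borel_probD)
  define v where "v z x = z * complex_of_real x / (1 - z * complex_of_real x)" for z x
  note i = integrable_psi[OF m z(1), folded v_def] integrable_psi[OF m w(1), folded v_def]
  have y: "0 \<le> y" using z(3) norm_ge_zero order_trans by blast
  have bd: "norm (v z x) \<le> 4 * min 1 (y * \<bar>x\<bar>)" "norm (v w x) \<le> 4 * min 1 (y * \<bar>x\<bar>)" for x
  proof -
    have "min 1 (norm z * \<bar>x\<bar>) \<le> min 1 (y * \<bar>x\<bar>)" "min 1 (norm w * \<bar>x\<bar>) \<le> min 1 (y * \<bar>x\<bar>)"
      by (intro min.mono mult_right_mono order_refl z w abs_ge_zero)+
    then show "norm (v z x) \<le> 4 * min 1 (y * \<bar>x\<bar>)" "norm (v w x) \<le> 4 * min 1 (y * \<bar>x\<bar>)"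
      using psi_integrand_bounds[OF z(1,2), of x] psi_integrand_bounds[OF w(1,2), of x] unfolding v_def by linarith+
  qed
  have pt: "z * v z x - w * v w x = (z - w) * (v z x + v w x + v z x * v w x)" for x
    using one_minus_nonzero[OF z(1), of x] one_minus_nonzero[OF w(1), of x]
    by (simp add: v_def divide_simps) (simp add: algebra_simps)
  have ptb: "norm (v z x + v w x + v z x * v w x) \<le> 24 * min 1 (y * \<bar>x\<bar>)" for x
  proof -
    let ?m = "min 1 (y * \<bar>x\<bar>)"
    have m01: "0 \<le> ?m" "?m \<le> 1" using y by auto
    have "norm (v z x + v w x + v z x * v w x) \<le> norm (v z x) + norm (v w x) + norm (v z x) * norm (v w x)"
      using norm_triangle_ineq[of "v z x + v w x" "v z x * v w x"] norm_triangle_ineq[of "v z x" "v w x"]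
      by (simp add: norm_mult)
    also have "\<dots> \<le> 4 * ?m + 4 * ?m + (4 * ?m) * 4"
      using bd[of x] m01 by (intro add_mono mult_mono) auto
    finally show ?thesis by simp
  qed
  have "z * (1 + psi m z) - w * (1 + psi m w) - (z - w) = z * psi m z - w * psi m w"
    by (simp add: algebra_simps)
  also have "\<dots> = (\<integral>x. z * v z x - w * v w x \<partial>m)"
  proof -
    have "psi m z = (\<integral>x. v z x \<partial>m)" "psi m w = (\<integral>x. v w x \<partial>m)" by (simp_all add: psi_def v_def)
    then show ?thesis using i by simp
  qed
  also have "\<dots> = (\<integral>x. (z - w) * (v z x + v w x + v z x * v w x) \<partial>m)" by (simp only: pt)
  finally have eq: "z * (1 + psi m z) - w * (1 + psi m w) - (z - w) = (\<integral>x. (z - w) * (v z x + v w x + v z x * v w x) \<partial>m)" .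
  have "norm (\<integral>x. (z - w) * (v z x + v w x + v z x * v w x) \<partial>m) \<le>
      (\<integral>x. norm ((z - w) * (v z x + v w x + v z x * v w x)) \<partial>m)"
    by (rule integral_norm_bound)
  also have "\<dots> \<le> (\<integral>x. norm (z - w) * (24 * min 1 (y * \<bar>x\<bar>)) \<partial>m)"
  proof (rule integral_mono)
    have "integrable m (\<lambda>x. z * v z x - w * v w x)" using i by simp
    then show "integrable m (\<lambda>x. norm ((z - w) * (v z x + v w x + v z x * v w x)))"
      unfolding pt by (rule integrable_norm)
    show "integrable m (\<lambda>x. norm (z - w) * (24 * min 1 (y * \<bar>x\<bar>)))"
      using integrable_spread[OF m y] by simp
    show "norm ((z - w) * (v z x + v w x + v z x * v w x)) \<le> norm (z - w) * (24 * min 1 (y * \<bar>x\<bar>))" for x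
      unfolding norm_mult by (intro mult_left_mono ptb) auto
  qed
  finally show ?thesis unfolding eq by (simp add: spread_def mult_ac)
qed

subsection \<open>Existence and uniqueness of the R-transform\<close>

lemma is_R_transformD:
  assumes m: "borel_prob m" and R: "is_R_transform \<alpha> \<beta> m R" and z: "z \<in> stolz_domain \<alpha> \<beta>"
  defines "Z \<equiv> 1 / (1 / z + R z)"
  shows "Im Z \<noteq> 0" "Z * (1 + psi m Z) = z" "psi m Z = z * R z" "Z = z / (1 + z * R z)"
proof -
  have z0: "z \<noteq> 0" using Im_nonzero_stolz_domain[OF z] by auto
  have nr: "1 / z + R z \<notin> \<real>" and G: "cauchy_transform m (1 / z + R z) = z"
    using R z by (auto simp: is_R_transform_def)
  have "Im (1 / z + R z) \<noteq> 0" using nr by (simp add: complex_is_Real_iff)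
  then show Z: "Im Z \<noteq> 0" unfolding Z_def by (rule Im_inverse_nonzero)
  have inv: "1 / Z = 1 / z + R z" by (simp add: Z_def)
  show 1: "Z * (1 + psi m Z) = z"
    using cauchy_transform_psi[OF m Z] G unfolding inv by simp
  have Z0: "Z \<noteq> 0" using Z by auto
  have "1 + psi m Z = z * (1 / Z)" using 1 Z0 by (simp add: field_simps)
  also have "\<dots> = 1 + z * R z" unfolding inv using z0 by (simp add: field_simps)
  finally show "psi m Z = z * R z" by simp
  show "Z = z / (1 + z * R z)" using z0 by (simp add: Z_def field_simps)
qed

lemma is_R_transform_subdomain:
  assumes R: "is_R_transform \<alpha> \<beta> m R" and le: "\<alpha>' \<le> \<alpha>" "\<beta>' \<le> \<beta>"
    and eq: "\<And>z. z \<in> stolz_domain \<alpha>' \<beta>' \<Longrightarrow> R' z = R z"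
  shows "is_R_transform \<alpha>' \<beta>' m R'"
proof -
  note sub = stolz_domain_mono[OF le]
  have "R holomorphic_on stolz_domain \<alpha>' \<beta>'"
    using R sub by (auto simp: is_R_transform_def intro: holomorphic_on_subset)
  then have "R' holomorphic_on stolz_domain \<alpha>' \<beta>'"
    by (rule holomorphic_transform) (simp add: eq)
  moreover have "((\<lambda>z. z * R z) \<longlongrightarrow> 0) (at 0 within stolz_domain \<alpha>' \<beta>')"
    using R sub by (auto simp: is_R_transform_def intro: tendsto_within_subset)
  then have "((\<lambda>z. z * R' z) \<longlongrightarrow> 0) (at 0 within stolz_domain \<alpha>' \<beta>')"
    by (rule Lim_transform_eventually) (auto simp: eventually_at_filter eq)
  ultimately show ?thesis
    using R sub eq by (auto simp: is_R_transform_def)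
qed

lemma stolz_norm_le:
  assumes "z \<in> stolz_domain 1 \<beta>"
  shows "\<bar>Re z\<bar> < \<bar>Im z\<bar>" "norm z \<le> 3 / 2 * \<beta>" "z \<noteq> 0" "Im z \<noteq> 0"
proof -
  show 1: "\<bar>Re z\<bar> < \<bar>Im z\<bar>" using assms by (simp add: in_stolz_domain_iff)
  have "norm z \<le> 3 / 2 * \<bar>Im z\<bar>" using 1 by (intro norm_le_Im) simp
  moreover have "\<bar>Im z\<bar> < \<beta>" using assms by (simp add: in_stolz_domain_iff)
  ultimately show "norm z \<le> 3 / 2 * \<beta>" by simp
  show "z \<noteq> 0" "Im z \<noteq> 0" using Im_nonzero_stolz_domain[OF assms] by auto
qed

text \<open>The map z \<mapsto> z (1 + psi m z) differs from the identity by a map of Lipschitz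
  constant 24/50 < 1/2. Besides injectivity, the quantitative form yields convergence of solutions
  in \<open>R0_limit\<close>.\<close>

lemma psi_inverse_unique:
  assumes m: "borel_prob m" and y: "spread m y \<le> 1 / 50"
    and z: "Im z \<noteq> 0" "norm z \<le> 3 * \<bar>Im z\<bar>" "norm z \<le> y"
    and w: "Im w \<noteq> 0" "norm w \<le> 3 * \<bar>Im w\<bar>" "norm w \<le> y"
  shows "norm (z - w) \<le> 2 * norm (z * (1 + psi m z) - w * (1 + psi m w))"
proof -
  let ?d = "z * (1 + psi m z) - w * (1 + psi m w)"
  have "norm (?d - (z - w)) \<le> 24 * spread m y * norm (z - w)"
    by (rule psi_near_identity[OF m z w])
  also have "\<dots> \<le> 24 * (1 / 50) * norm (z - w)"
    using y by (intro mult_right_mono mult_left_mono) auto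
  finally have "norm (?d - (z - w)) \<le> norm (z - w) / 2"
    using norm_ge_zero[of "z - w"] by linarith
  moreover have "norm (z - w) \<le> norm ?d + norm (?d - (z - w))"
    using norm_triangle_ineq4[of ?d "?d - (z - w)"] by simp
  ultimately show ?thesis by linarith
qed

text \<open>Since z R z tends to 0, near 0 the points Z and Z' belonging to the two candidates lie
  in the cone where \<open>psi_inverse_unique\<close> applies, and they solve the same equation. The
  identity theorem extends the equality to the common domain.\<close>

lemma R_transform_unique:
  assumes m: "borel_prob m" and R: "is_R_transform \<alpha> \<beta> m R" "is_R_transform \<alpha>' \<beta>' m R'"
    and pos: "\<alpha> > 0" "\<beta> > 0" "\<alpha>' > 0" "\<beta>' > 0"
    and z: "z \<in> stolz_domain (min \<alpha> \<alpha>') (min \<beta> \<beta>')"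
  shows "R z = R' z"
proof -
  obtain y where y: "y > 0" "spread m y < 1 / 50" using spread_small[OF m, of "1 / 50"] by auto
  define \<alpha>0 where "\<alpha>0 = min 1 (min \<alpha> \<alpha>')"
  have ev: "\<exists>d>0. \<forall>z\<in>stolz_domain \<alpha>0 d. norm (z * R z) \<le> 1 / 10"
    if R: "is_R_transform \<alpha> \<beta> m R" and \<alpha>: "\<alpha>0 \<le> \<alpha>" "\<beta> > 0" for \<alpha> \<beta> R
  proof -
    have "((\<lambda>z. z * R z) \<longlongrightarrow> 0) (at 0 within stolz_domain \<alpha> \<beta>)"
      using R by (simp add: is_R_transform_def)
    then have "eventually (\<lambda>z. dist (z * R z) 0 < 1 / 10) (at 0 within stolz_domain \<alpha> \<beta>)"
      by (rule tendstoD) simp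
    then obtain d where d: "d > 0" "\<And>z. z \<in> stolz_domain \<alpha> \<beta> \<Longrightarrow> z \<noteq> 0 \<Longrightarrow> dist z 0 < d \<Longrightarrow> norm (z * R z) < 1 / 10"
      unfolding eventually_at by auto
    have "norm (z * R z) \<le> 1 / 10" if z: "z \<in> stolz_domain \<alpha>0 (min \<beta> (d / 2))" for z
    proof -
      have "z \<in> stolz_domain 1 (d / 2)" "z \<in> stolz_domain \<alpha> \<beta>"
        using \<alpha> by (auto simp: \<alpha>0_def intro!: subsetD[OF stolz_domain_mono z])
      with stolz_norm_le[OF this(1)] d show ?thesis by (intro less_imp_le d(2)) auto
    qed
    then show ?thesis using d \<alpha> by (intro exI[of _ "min \<beta> (d / 2)"]) auto
  qed
  have le: "\<alpha>0 \<le> \<alpha>" "\<alpha>0 \<le> \<alpha>'" by (auto simp: \<alpha>0_def)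
  obtain d where d: "d > 0" "\<And>z. z \<in> stolz_domain \<alpha>0 d \<Longrightarrow> norm (z * R z) \<le> 1 / 10"
    using ev[OF R(1) le(1) pos(2)] by blast
  obtain d' where d': "d' > 0" "\<And>z. z \<in> stolz_domain \<alpha>0 d' \<Longrightarrow> norm (z * R' z) \<le> 1 / 10"
    using ev[OF R(2) le(2) pos(4)] by blast
  \<comment> \<open>The entry y / 4 makes |Z| <= 2 |z| <= 3/4 y, within the scale at which
    \<open>spread\<close> is small.\<close>
  define \<beta>0 where "\<beta>0 = Min {\<beta>, \<beta>', d, d', y / 4}"
  have b0: "\<beta>0 > 0" "\<beta>0 \<le> \<beta>" "\<beta>0 \<le> \<beta>'" "\<beta>0 \<le> d" "\<beta>0 \<le> d'" "\<beta>0 \<le> y / 4"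
    using pos d(1) d'(1) y(1) by (auto simp: \<beta>0_def)
  have a0: "\<alpha>0 > 0" "\<alpha>0 \<le> \<alpha>" "\<alpha>0 \<le> \<alpha>'" "\<alpha>0 \<le> 1" using pos by (auto simp: \<alpha>0_def)
  have eq: "R z = R' z" if z: "z \<in> stolz_domain \<alpha>0 \<beta>0" for z
  proof -
    have zz: "z \<in> stolz_domain 1 (y / 4)" "z \<in> stolz_domain \<alpha> \<beta>" "z \<in> stolz_domain \<alpha>' \<beta>'"
        "z \<in> stolz_domain \<alpha>0 d" "z \<in> stolz_domain \<alpha>0 d'"
      using z stolz_domain_mono a0 b0 by blast+
    note n = stolz_norm_le[OF zz(1)]
    define Z where "Z = 1 / (1 / z + R z)"
    define Z' where "Z' = 1 / (1 / z + R' z)"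
    note D = is_R_transformD[OF m R(1) zz(2), folded Z_def]
    note D' = is_R_transformD[OF m R(2) zz(3), folded Z'_def]
    have w: "norm Z \<le> 2 * norm z" "norm Z \<le> 3 * \<bar>Im Z\<bar>"
      using wide_quotient[OF n(1), of "1 + z * R z"] d(2)[OF zz(4)] D(4) by auto
    have w': "norm Z' \<le> 2 * norm z" "norm Z' \<le> 3 * \<bar>Im Z'\<bar>"
      using wide_quotient[OF n(1), of "1 + z * R' z"] d'(2)[OF zz(5)] D'(4) by auto
    have "norm (Z - Z') \<le> 2 * norm (Z * (1 + psi m Z) - Z' * (1 + psi m Z'))"
    proof (rule psi_inverse_unique[OF m _ D(1) w(2) _ D'(1) w'(2)])
      show "spread m y \<le> 1 / 50" using y(2) by simp
      show "norm Z \<le> y" "norm Z' \<le> y" using w(1) w'(1) n(2) y(1) by linarith+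
    qed
    then have "Z = Z'" using D(2) D'(2) by simp
    then have "z * R z = z * R' z" using D(3) D'(3) by metis
    then show "R z = R' z" using n by simp
  qed
  show ?thesis
  proof (rule stolz_domain_identity[OF _ _ a0(1) b0(1) _ _ eq z])
    show "R holomorphic_on stolz_domain (min \<alpha> \<alpha>') (min \<beta> \<beta>')" "R' holomorphic_on stolz_domain (min \<alpha> \<alpha>') (min \<beta> \<beta>')"
      using R stolz_domain_mono[of "min \<alpha> \<alpha>'" \<alpha> "min \<beta> \<beta>'" \<beta>] stolz_domain_mono[of "min \<alpha> \<alpha>'" \<alpha>' "min \<beta> \<beta>'" \<beta>']
      by (auto simp: is_R_transform_def intro: holomorphic_on_subset)
  qed (use a0 b0 in auto)
qed

text \<open>The equation \<open>Z * (1 + psi m Z) = z\<close> is solved by the contraction \<open>Z \<mapsto> z - Z * psi m Z\<close>.\<close>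

lemma psi_inverse_exists:
  assumes m: "borel_prob m" and y: "spread m (2 * norm z) \<le> 1 / 50" and z: "\<bar>Re z\<bar> < \<bar>Im z\<bar>"
  shows "\<exists>Z. norm (Z - z) \<le> norm z / 10 \<and> Z * (1 + psi m Z) = z"
proof -
  let ?s = "cball z (norm z / 10)"
  define T where "T Z = z - Z * psi m Z" for Z
  have zn: "norm z \<le> 3 / 2 * \<bar>Im z\<bar>" using z by (intro norm_le_Im) simp
  have z0: "norm z > 0" using z by auto
  have wide: "Im Z \<noteq> 0" "norm Z \<le> 3 * \<bar>Im Z\<bar>" "norm Z \<le> 11 / 10 * norm z" "norm Z \<le> 2 * norm z" if "Z \<in> ?s" for Z
  proof -
    have d: "norm (Z - z) \<le> norm z / 10" using that by (simp add: dist_norm norm_minus_commute)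
    have im: "\<bar>Im Z\<bar> \<ge> \<bar>Im z\<bar> - norm z / 10"
      using abs_Im_le_cmod[of "Z - z"] d by simp
    show 1: "norm Z \<le> 11 / 10 * norm z" using norm_triangle_sub[of Z z] d by linarith
    then show "norm Z \<le> 2 * norm z" using z0 by linarith
    show "norm Z \<le> 3 * \<bar>Im Z\<bar>" using 1 im zn by linarith
    have "\<bar>Im Z\<bar> > 0" using im zn z0 by linarith
    then show "Im Z \<noteq> 0" by simp
  qed
  have "\<exists>!Z\<in>?s. T Z = Z"
  proof (rule Banach_fix[of _ "1 / 2"])
    show "T ` ?s \<subseteq> ?s"
    proof
      fix W assume "W \<in> T ` ?s"
      then obtain Z where Z: "Z \<in> ?s" "W = T Z" by auto
      note w = wide[OF Z(1)]
      have "norm (psi m Z) \<le> 4 * spread m (norm Z)" by (rule norm_psi_le[OF m w(1,2)])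
      also have "spread m (norm Z) \<le> spread m (2 * norm z)"
        using w(3) z0 by (intro spread_mono[OF m] norm_ge_zero) linarith
      finally have "norm (psi m Z) \<le> 4 / 50" using y by simp
      \<comment> \<open>11/10 * 4/50 = 0.088 is below 1/10, so the ball is mapped into
        itself.\<close>
      then have "norm Z * norm (psi m Z) \<le> (11 / 10 * norm z) * (4 / 50)"
        using w(3) by (intro mult_mono) auto
      then have "norm Z * norm (psi m Z) \<le> norm z / 10" using z0 by linarith
      then show "W \<in> ?s"
        by (simp add: Z T_def dist_norm norm_mult)
    qed
    show "dist (T Z) (T W) \<le> 1 / 2 * dist Z W" if "Z \<in> ?s" "W \<in> ?s" for Z W
    proof -
      have "norm (Z * (1 + psi m Z) - W * (1 + psi m W) - (Z - W)) \<le> 24 * spread m (2 * norm z) * norm (Z - W)"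
        by (rule psi_near_identity[OF m wide(1,2,4)[OF that(1)] wide(1,2,4)[OF that(2)]])
      also have "\<dots> \<le> 24 * (1 / 50) * norm (Z - W)"
        using y by (intro mult_right_mono mult_left_mono) auto
      finally have "norm (Z * (1 + psi m Z) - W * (1 + psi m W) - (Z - W)) \<le> 1 / 2 * norm (Z - W)"
        using norm_ge_zero[of "Z - W"] by linarith
      also have "Z * (1 + psi m Z) - W * (1 + psi m W) - (Z - W) = T W - T Z"
        by (simp add: T_def algebra_simps)
      finally show ?thesis by (simp add: dist_norm norm_minus_commute)
    qed
  qed (use z0 in \<open>auto simp: complete_eq_closed\<close>)
  then obtain Z where "Z \<in> ?s" "T Z = Z" by blast
  then show ?thesis
    by (intro exI[of _ Z]) (auto simp: T_def dist_norm norm_minus_commute algebra_simps)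
qed

text \<open>The fixed point argument shows that the Stolz domain lies in the image of H on the cone
  U. There H is injective and holomorphic, so it has a holomorphic inverse g, and R is 1 / g - 1 /
  z.\<close>

lemma R_transform_exists:
  assumes m: "borel_prob m" and \<beta>: "\<beta> > 0" and small: "spread m (3 * \<beta>) \<le> 1 / 50"
  obtains R where "is_R_transform 1 \<beta> m R"
    "\<And>z. z \<in> stolz_domain 1 \<beta> \<Longrightarrow> norm (z * R z) \<le> 4 * spread m (2 * norm z)"
proof -
  \<comment> \<open>The radius 3 \<beta> leaves room for |Z| <= 11/10 |z| <= 1.65 \<beta>, and it is
    the scale at which \<open>spread\<close> is assumed small.\<close>
  define U where "U = {Z. norm Z < 3 * \<bar>Im Z\<bar> \<and> norm Z < 3 * \<beta>}"
  have U: "Im Z \<noteq> 0" "norm Z \<le> 3 * \<bar>Im Z\<bar>" "norm Z \<le> 3 * \<beta>" if "Z \<in> U" for Z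
    using that norm_ge_zero[of Z] by (auto simp: U_def)
  have opU: "open U" unfolding U_def
    by (intro open_Collect_conj open_Collect_less continuous_intros)
  define H where "H Z = Z * (1 + psi m Z)" for Z
  have holH: "H holomorphic_on U"
    unfolding H_def by (intro holomorphic_intros psi_holomorphic[OF m] U)
  have inj: "inj_on H U"
  proof (rule inj_onI)
    fix Z W assume "Z \<in> U" "W \<in> U" "H Z = H W"
    then show "Z = W"
      using psi_inverse_unique[OF m small U[of Z] U[of W]] by (simp add: H_def)
  qed
  obtain g where g: "g holomorphic_on (H ` U)" "\<And>Z. Z \<in> U \<Longrightarrow> g (H Z) = Z"
    using holomorphic_has_inverse[OF holH opU inj] by metis
  have sol: "g z \<in> U" "H (g z) = z" "z \<in> H ` U" "norm (g z - z) \<le> norm z / 10" if "z \<in> stolz_domain 1 \<beta>" for z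
  proof -
    note n = stolz_norm_le[OF that]
    have "spread m (2 * norm z) \<le> spread m (3 * \<beta>)"
      using n(2) by (intro spread_mono[OF m]) auto
    then obtain Z where Z: "norm (Z - z) \<le> norm z / 10" "H Z = z"
      using psi_inverse_exists[OF m _ n(1)] small unfolding H_def by force
    have zn: "norm z \<le> 3 / 2 * \<bar>Im z\<bar>" using n(1) by (intro norm_le_Im) simp
    have im: "\<bar>Im Z\<bar> \<ge> \<bar>Im z\<bar> - norm z / 10"
      using abs_Im_le_cmod[of "Z - z"] Z(1) by simp
    have nZ: "norm Z \<le> 11 / 10 * norm z" using norm_triangle_sub[of Z z] Z(1) by linarith
    have "norm z > 0" using n(3) by simp
    then have "norm Z < 3 * \<bar>Im Z\<bar>" "norm Z < 3 * \<beta>" using im nZ zn n(2) \<beta> by linarith+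
    then have ZU: "Z \<in> U" by (simp add: U_def)
    then show "z \<in> H ` U" using Z(2) by blast
    show "g z \<in> U" "H (g z) = z" "norm (g z - z) \<le> norm z / 10"
      using g(2)[OF ZU] Z ZU by auto
  qed
  define R where "R z = 1 / g z - 1 / z" for z
  have inv: "1 / z + R z = 1 / g z" for z by (simp add: R_def)
  have zR: "z * R z = psi m (g z)" if "z \<in> stolz_domain 1 \<beta>" for z
  proof -
    have "g z \<noteq> 0" "z \<noteq> 0" using U(1)[OF sol(1)[OF that]] stolz_norm_le[OF that] by auto
    moreover have "z = g z * (1 + psi m (g z))" using sol(2)[OF that] by (simp add: H_def)
    then have "z / g z = 1 + psi m (g z)" using \<open>g z \<noteq> 0\<close> by (metis nonzero_mult_div_cancel_left)
    ultimately show ?thesis by (simp add: R_def right_diff_distrib)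
  qed
  have bd: "norm (z * R z) \<le> 4 * spread m (2 * norm z)" if z: "z \<in> stolz_domain 1 \<beta>" for z
  proof -
    have "norm (psi m (g z)) \<le> 4 * spread m (norm (g z))"
      by (rule norm_psi_le[OF m U(1,2)[OF sol(1)[OF z]]])
    also have "spread m (norm (g z)) \<le> spread m (2 * norm z)"
    proof (rule spread_mono[OF m])
      show "norm (g z) \<le> 2 * norm z"
        using sol(4)[OF z] norm_triangle_sub[of "g z" z] norm_ge_zero[of z] by linarith
    qed simp
    finally show ?thesis using zR[OF z] by simp
  qed
  have "is_R_transform 1 \<beta> m R"
    unfolding is_R_transform_def
  proof (intro conjI ballI)
    have "g holomorphic_on stolz_domain 1 \<beta>"
      using g(1) sol(3) by (auto intro: holomorphic_on_subset)
    moreover have "g z \<noteq> 0" "z \<noteq> 0" if "z \<in> stolz_domain 1 \<beta>" for z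
      using U(1)[OF sol(1)[OF that]] stolz_norm_le[OF that] by auto
    ultimately show "R holomorphic_on stolz_domain 1 \<beta>"
      unfolding R_def by (intro holomorphic_intros) auto
    fix z assume z: "z \<in> stolz_domain 1 \<beta>"
    note imn = U(1)[OF sol(1)[OF z]]
    show "1 / z + R z \<notin> \<real>"
      unfolding inv using Im_inverse_nonzero[OF imn] by (simp add: complex_is_Real_iff)
    show "cauchy_transform m (1 / z + R z) = z"
      unfolding inv cauchy_transform_psi[OF m imn] using sol(2)[OF z] by (simp add: H_def)
  next
    show "((\<lambda>z. z * R z) \<longlongrightarrow> 0) (at 0 within stolz_domain 1 \<beta>)"
    proof (rule tendstoI)
      fix e :: real assume "e > 0"
      then obtain y where y: "y > 0" "spread m y < e / 4" using spread_small[OF m, of "e / 4"] by auto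
      have "dist (z * R z) 0 < e" if "z \<in> stolz_domain 1 \<beta>" "dist z 0 < y / 2" for z
      proof -
        have "spread m (2 * norm z) \<le> spread m y"
          using that(2) by (intro spread_mono[OF m]) auto
        then show ?thesis using bd[OF that(1)] y(2) by simp
      qed
      then show "eventually (\<lambda>z. dist (z * R z) 0 < e) (at 0 within stolz_domain 1 \<beta>)"
        unfolding eventually_at using y(1) by (intro exI[of _ "y / 2"]) auto
    qed
  qed
  then show thesis using bd by (rule that)
qed

subsection \<open>Free convolution powers\<close>

text \<open>At each factor, uniqueness identifies the R-transforms supplied by
  \<open>free_conv\<close> with multiples of one R, on a possibly smaller domain. The domain
  obtained in this way is not uniform in k; \<open>free_conv_power_common_domain\<close> repairs
  this.\<close>

lemma free_conv_power_R_transform: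
  assumes "free_conv_power m k \<nu>" "borel_prob m"
  shows "borel_prob \<nu> \<and> k > 0 \<and> (\<exists>\<alpha>>0. \<exists>\<beta>>0. \<exists>R. is_R_transform \<alpha> \<beta> m R \<and>
    is_R_transform \<alpha> \<beta> \<nu> (\<lambda>z. of_nat k * R z))"
  using assms
proof (induction rule: free_conv_power.induct)
  case power_one
  obtain y where y: "y > 0" "spread m y < 1 / 50" using spread_small[OF power_one, of "1 / 50"] by auto
  obtain R where "is_R_transform 1 (y / 3) m R"
    using R_transform_exists[OF power_one, of "y / 3"] y by auto
  with y power_one show ?case
    by (intro conjI exI[of _ "1 :: real"] exI[of _ "y / 3"] exI[of _ R]) auto
next
  case (power_Suc k \<nu> \<nu>')
  obtain \<alpha> \<beta> R where R: "\<alpha> > 0" "\<beta> > 0" "is_R_transform \<alpha> \<beta> m R"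
    "is_R_transform \<alpha> \<beta> \<nu> (\<lambda>z. of_nat k * R z)" and \<nu>: "borel_prob \<nu>"
    using power_Suc by blast
  obtain \<alpha>' \<beta>' R1 R2 where R12: "\<alpha>' > 0" "\<beta>' > 0" "is_R_transform \<alpha>' \<beta>' \<nu> R1"
    "is_R_transform \<alpha>' \<beta>' m R2" "is_R_transform \<alpha>' \<beta>' \<nu>' (\<lambda>z. R1 z + R2 z)" and \<nu>': "borel_prob \<nu>'"
    using power_Suc(2) unfolding free_conv_def by blast
  let ?a = "min \<alpha> \<alpha>'" and ?b = "min \<beta> \<beta>'"
  have eq: "of_nat (Suc k) * R z = R1 z + R2 z" if "z \<in> stolz_domain ?a ?b" for z
    using R_transform_unique[OF \<nu> R(4) R12(3) R(1,2) R12(1,2) that]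
      R_transform_unique[OF power_Suc.prems R(3) R12(4) R(1,2) R12(1,2) that]
    by (simp add: algebra_simps)
  have "is_R_transform ?a ?b m R"
    by (rule is_R_transform_subdomain[OF R(3)]) auto
  moreover have "is_R_transform ?a ?b \<nu>' (\<lambda>z. of_nat (Suc k) * R z)"
    by (rule is_R_transform_subdomain[OF R12(5)]) (auto simp: eq simp del: of_nat_Suc)
  ultimately show ?case
    using R(1,2) R12(1,2) \<nu>' by (intro conjI exI[of _ ?a] exI[of _ ?b] exI[of _ R]) auto
qed

text \<open>The functional equation propagates by analytic continuation as long as the argument of the
  Cauchy transform stays off the real axis.\<close>

lemma is_R_transform_extend:
  assumes m: "borel_prob m" and R0: "is_R_transform \<alpha>0 \<beta>0 m R0" and pos: "\<alpha>0 > 0" "\<beta>0 > 0" "\<beta> > 0"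
    and hol: "R holomorphic_on stolz_domain 1 \<beta>"
    and small: "\<And>z. z \<in> stolz_domain 1 \<beta> \<Longrightarrow> norm (z * R z) \<le> 1 / 10"
    and lim: "((\<lambda>z. z * R z) \<longlongrightarrow> 0) (at 0 within stolz_domain 1 \<beta>)"
    and eq: "\<And>z. z \<in> stolz_domain (min \<alpha>0 1) (min \<beta>0 \<beta>) \<Longrightarrow> R z = R0 z"
  shows "is_R_transform 1 \<beta> m R"
proof -
  have Im: "Im (1 / z + R z) \<noteq> 0" if z: "z \<in> stolz_domain 1 \<beta>" for z
  proof -
    note n = stolz_norm_le[OF z]
    have "Im (z / (1 + z * R z)) \<noteq> 0"
      by (rule wide_quotient(6)[OF n(1)]) (use small[OF z] in simp)
    then have "Im (1 / (z / (1 + z * R z))) \<noteq> 0" by (rule Im_inverse_nonzero)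
    also have "1 / (z / (1 + z * R z)) = 1 / z + R z" using n(3) by (simp add: field_simps)
    finally show ?thesis .
  qed
  have "cauchy_transform m (1 / z + R z) = z" if "z \<in> stolz_domain 1 \<beta>" for z
  proof (rule stolz_domain_identity[of _ 1 \<beta> "\<lambda>z. z" "min \<alpha>0 1" "min \<beta>0 \<beta>"])
    have inner: "(\<lambda>z. 1 / z + R z) holomorphic_on stolz_domain 1 \<beta>"
      using stolz_norm_le(3) by (intro holomorphic_intros hol) auto
    show "(\<lambda>z. cauchy_transform m (1 / z + R z)) holomorphic_on stolz_domain 1 \<beta>"
      by (rule holomorphic_on_compose_gen[OF inner cauchy_transform_holomorphic[OF m], unfolded o_def,
            of "(\<lambda>z. 1 / z + R z) ` stolz_domain 1 \<beta>"]) (use Im in auto)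
    fix z assume z: "z \<in> stolz_domain (min \<alpha>0 1) (min \<beta>0 \<beta>)"
    then have "z \<in> stolz_domain \<alpha>0 \<beta>0"
      using stolz_domain_mono[of "min \<alpha>0 1" \<alpha>0 "min \<beta>0 \<beta>" \<beta>0] by auto
    then show "cauchy_transform m (1 / z + R z) = z"
      using R0 eq[OF z] by (simp add: is_R_transform_def)
  qed (use pos that in auto)
  then show ?thesis
    using hol lim Im by (auto simp: is_R_transform_def complex_is_Real_iff)
qed

text \<open>The domain is governed by the spread of \<nu> alone, so it is uniform for a tight family
  of powers. The R-transform of \<nu> comes from the fixed point argument; dividing it by k keeps |z
  R z / k| <= 1/10, hence 1 / z + R z / k nonreal, and continuation identifies it as the R-transform
  of m.\<close>

lemma free_conv_power_common_domain:
  assumes m: "borel_prob m" and \<nu>: "free_conv_power m k \<nu>"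
    and \<beta>: "\<beta> > 0" and small: "spread \<nu> (3 * \<beta>) \<le> 1 / 50"
  obtains R where "is_R_transform 1 \<beta> \<nu> R" "is_R_transform 1 \<beta> m (\<lambda>z. R z / of_nat k)"
    "\<And>z. z \<in> stolz_domain 1 \<beta> \<Longrightarrow> norm (z * R z) \<le> 4 * spread \<nu> (2 * norm z)"
    "\<And>z. z \<in> stolz_domain 1 \<beta> \<Longrightarrow> norm (z * R z) \<le> 4 / 50"
proof -
  obtain \<alpha>0 \<beta>0 R0 where R0: "\<alpha>0 > 0" "\<beta>0 > 0" "is_R_transform \<alpha>0 \<beta>0 m R0"
    "is_R_transform \<alpha>0 \<beta>0 \<nu> (\<lambda>z. of_nat k * R0 z)" and n: "borel_prob \<nu>" "k > 0"
    using free_conv_power_R_transform[OF \<nu> m] by blast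
  obtain R where R: "is_R_transform 1 \<beta> \<nu> R"
    "\<And>z. z \<in> stolz_domain 1 \<beta> \<Longrightarrow> norm (z * R z) \<le> 4 * spread \<nu> (2 * norm z)"
    using R_transform_exists[OF n(1) \<beta> small] by blast
  have bd: "norm (z * R z) \<le> 4 / 50" if "z \<in> stolz_domain 1 \<beta>" for z
  proof -
    have "spread \<nu> (2 * norm z) \<le> spread \<nu> (3 * \<beta>)"
      using stolz_norm_le[OF that] by (intro spread_mono[OF n(1)]) auto
    then show ?thesis using R(2)[OF that] small by linarith
  qed
  have "is_R_transform 1 \<beta> m (\<lambda>z. R z / of_nat k)"
  proof (rule is_R_transform_extend[OF m R0(3,1,2) \<beta>])
    show "(\<lambda>z. R z / of_nat k) holomorphic_on stolz_domain 1 \<beta>"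
      using R(1) n(2) by (intro holomorphic_intros) (auto simp: is_R_transform_def)
    have "((\<lambda>z. z * R z) \<longlongrightarrow> 0) (at 0 within stolz_domain 1 \<beta>)"
      using R(1) by (simp add: is_R_transform_def)
    from tendsto_divide[OF this tendsto_const[of "of_nat k"]]
    show "((\<lambda>z. z * (R z / of_nat k)) \<longlongrightarrow> 0) (at 0 within stolz_domain 1 \<beta>)"
      using n(2) by simp
    show "norm (z * (R z / of_nat k)) \<le> 1 / 10" if "z \<in> stolz_domain 1 \<beta>" for z
    proof -
      have "norm (z * R z) / real k \<le> norm (z * R z) / 1"
        using n(2) by (intro divide_left_mono) auto
      then show ?thesis using bd[OF that] by (simp add: norm_mult norm_divide)
    qed
    fix z assume "z \<in> stolz_domain (min \<alpha>0 1) (min \<beta>0 \<beta>)"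
    then have "of_nat k * R0 z = R z"
      using R_transform_unique[OF n(1) R0(4) R(1) R0(1,2) _ \<beta>] by simp
    then show "R z / of_nat k = R0 z" using n(2) by (auto simp: field_simps)
  qed
  then show thesis using R bd that by blast
qed

text \<open>The second moment truncated at scale 1 / y. For y = 1 it is the integral of x^2 / (1 +
  x^2); for small y it also controls the mass where |x| > 1 / y.\<close>

definition trunc_var :: "real measure \<Rightarrow> real \<Rightarrow> real" where
  "trunc_var m y = (\<integral>x. (y * x)\<^sup>2 / (1 + (y * x)\<^sup>2) \<partial>m)"

lemma trunc_integrand_bounds: "0 \<le> (y * x)\<^sup>2 / (1 + (y * x)\<^sup>2)" "(y * x)\<^sup>2 / (1 + (y * x :: real)\<^sup>2) \<le> 1"
  by (auto simp: divide_le_eq add_pos_nonneg)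

lemma integrable_trunc_var:
  assumes "borel_prob m" shows "integrable m (\<lambda>x. (y * x)\<^sup>2 / (1 + (y * x :: real)\<^sup>2))"
proof (rule finite_measure.integrable_const_bound[OF borel_probD(2)[OF assms], of _ 1])
  show "(\<lambda>x. (y * x)\<^sup>2 / (1 + (y * x :: real)\<^sup>2)) \<in> borel_measurable m"
    by (rule measurable_borel_prob[OF assms]) measurable
qed (use trunc_integrand_bounds in auto)

lemma trunc_var_nonneg: "0 \<le> trunc_var m y"
  unfolding trunc_var_def using trunc_integrand_bounds by (intro Bochner_Integration.integral_nonneg) auto

lemma trunc_var_mono:
  assumes "borel_prob m" "0 \<le> y" "y \<le> y'"
  shows "trunc_var m y \<le> trunc_var m y'"
  unfolding trunc_var_def
proof (intro integral_mono integrable_trunc_var[OF assms(1)])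
  fix x :: real
  have le: "(y * x)\<^sup>2 \<le> (y' * x)\<^sup>2" using assms
    by (simp add: power_mult_distrib mult_right_mono power_mono)
  have *: "t / (1 + t) = 1 - 1 / (1 + t)" if "t \<ge> 0" for t :: real using that by (simp add: field_simps)
  have "1 / (1 + (y' * x)\<^sup>2) \<le> 1 / (1 + (y * x)\<^sup>2)"
    using le by (intro divide_left_mono) (auto intro!: mult_pos_pos add_pos_nonneg)
  then show "(y * x)\<^sup>2 / (1 + (y * x)\<^sup>2) \<le> (y' * x)\<^sup>2 / (1 + (y' * x)\<^sup>2)"
    by (simp add: *)
qed

text \<open>The imaginary part of \<open>psi m Z / Z\<close> is \<open>Im Z\<close> times the integral of \<open>s\<^sup>2 / |1 - Z s|\<^sup>2\<close>.\<close>

lemma trunc_var_le_psi: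
  assumes m: "borel_prob m" and y: "y > 0"
    and Z: "norm Z \<le> 2 * y" "y \<le> 2 * \<bar>Im Z\<bar>"
  shows "trunc_var m y \<le> 40 * norm (psi m Z)"
proof -
  interpret prob_space m using m by (rule borel_probD)
  have im: "Im Z \<noteq> 0" and Z0: "Z \<noteq> 0" using Z y by auto
  define f where "f x = x\<^sup>2 / (norm (1 - Z * complex_of_real x))\<^sup>2" for x :: real
  have i: "integrable m (\<lambda>x. Z * complex_of_real x / (1 - Z * complex_of_real x) / Z)"
    by (rule integrable_divide_zero) (rule integrable_psi[OF m im])
  have pt: "Im (Z * complex_of_real x / (1 - Z * complex_of_real x) / Z) = Im Z * f x" for x
  proof -
    define u where "u = 1 - Z * complex_of_real x"
    have u: "u \<noteq> 0" using one_minus_nonzero[OF im, of x] by (simp add: u_def)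
    have "Z * complex_of_real x / u / Z = complex_of_real x / u" using Z0 by simp
    also have "\<dots> = complex_of_real x * cnj u / (u * cnj u)" using u by simp
    also have "\<dots> = complex_of_real x * cnj u / complex_of_real ((norm u)\<^sup>2)"
      by (simp only: complex_norm_square)
    also have "Im \<dots> = x * Im (cnj u) / (norm u)\<^sup>2"
      by (simp add: Im_divide_of_real del: of_real_power)
    also have "\<dots> = Im Z * f x"
      by (simp add: f_def u_def power2_eq_square)
    finally show ?thesis by (simp add: u_def)
  qed
  have "psi m Z / Z = (\<integral>x. Z * complex_of_real x / (1 - Z * complex_of_real x) / Z \<partial>m)"
    by (simp only: psi_def integral_divide_zero)
  also have "Im \<dots> = (\<integral>x. Im Z * f x \<partial>m)"
    unfolding pt[symmetric] by (rule integral_Im[OF i, symmetric])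
  finally have eq: "Im (psi m Z / Z) = Im Z * (\<integral>x. f x \<partial>m)" by simp
  have A: "\<bar>Im Z\<bar> * \<bar>\<integral>x. f x \<partial>m\<bar> \<le> norm (psi m Z) / norm Z"
    using abs_Im_le_cmod[of "psi m Z / Z"] unfolding eq by (simp add: abs_mult norm_divide)
  have int_f: "integrable m f"
  proof -
    have "integrable m (\<lambda>x. Im (Z * complex_of_real x / (1 - Z * complex_of_real x) / Z))"
      by (rule integrable_Im[OF i])
    then show ?thesis unfolding pt using im by simp
  qed
  have "trunc_var m y \<le> (\<integral>x. y\<^sup>2 * 10 * f x \<partial>m)"
    unfolding trunc_var_def
  proof (intro integral_mono integrable_trunc_var m)
    show "integrable m (\<lambda>x. y\<^sup>2 * 10 * f x)" using int_f by simp
    fix x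
    let ?u = "1 - Z * complex_of_real x"
    have u: "norm ?u > 0" using one_minus_nonzero[OF im, of x] by simp
    have "norm ?u \<le> 1 + norm Z * \<bar>x\<bar>"
      using norm_triangle_ineq4[of 1 "Z * complex_of_real x"] by (simp add: norm_mult)
    also have "\<dots> \<le> 1 + 2 * y * \<bar>x\<bar>" using Z(1) by (intro add_left_mono mult_right_mono) auto
    finally have "(norm ?u)\<^sup>2 \<le> (1 + 2 * (y * \<bar>x\<bar>))\<^sup>2"
      by (intro power_mono) (auto simp: mult.assoc)
    also have "\<dots> \<le> 10 * (1 + (y * x)\<^sup>2)"
    proof -
      have "(1 + 2 * t)\<^sup>2 \<le> 10 * (1 + t\<^sup>2)" for t :: real
      proof -
        have "10 * (1 + t\<^sup>2) - (1 + 2 * t)\<^sup>2 = 2 * (t - 1)\<^sup>2 + 4 * t\<^sup>2 + 7"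
          by (simp add: power2_eq_square algebra_simps)
        also have "\<dots> \<ge> 0" by (intro add_nonneg_nonneg) auto
        finally show ?thesis by simp
      qed
      from this[of "y * \<bar>x\<bar>"] show ?thesis by (simp add: power_mult_distrib)
    qed
    finally have "(y * x)\<^sup>2 * (norm ?u)\<^sup>2 \<le> (y * x)\<^sup>2 * (10 * (1 + (y * x)\<^sup>2))"
      by (intro mult_left_mono) auto
    moreover have "a / b \<le> 10 * a / c" if "a * c \<le> a * (10 * b)" "b > 0" "c > 0" for a b c :: real
      using that by (simp add: field_simps)
    ultimately have "(y * x)\<^sup>2 / (1 + (y * x)\<^sup>2) \<le> 10 * (y * x)\<^sup>2 / (norm ?u)\<^sup>2"
      using u by (simp add: add_pos_nonneg)
    then show "(y * x)\<^sup>2 / (1 + (y * x)\<^sup>2) \<le> y\<^sup>2 * 10 * f x"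
      by (simp add: f_def power_mult_distrib mult_ac)
  qed
  also have "\<dots> = y\<^sup>2 * 10 * (\<integral>x. f x \<partial>m)" by simp
  \<comment> \<open>From y <= 2 |Im Z| and |Im Z| <= |Z| the square y^2 is at most 4 |Im Z| |Z|,
    which matches the product of |Im Z| and the integral of f controlled in \<open>A\<close>; with
    the factor 10 this makes 40.\<close>
  also have "\<dots> \<le> 4 * (\<bar>Im Z\<bar> * norm Z) * 10 * \<bar>\<integral>x. f x \<partial>m\<bar>"
  proof (intro mult_mono)
    have "y * y \<le> (2 * \<bar>Im Z\<bar>) * (2 * norm Z)"
      using Z y abs_Im_le_cmod[of Z] by (intro mult_mono) auto
    then show "y\<^sup>2 \<le> 4 * (\<bar>Im Z\<bar> * norm Z)" by (simp add: power2_eq_square)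
    show "0 \<le> \<integral>x. f x \<partial>m" by (intro Bochner_Integration.integral_nonneg) (simp add: f_def)
  qed auto
  also have "\<dots> = 40 * norm Z * (\<bar>Im Z\<bar> * \<bar>\<integral>x. f x \<partial>m\<bar>)" by simp
  also have "\<dots> \<le> 40 * norm Z * (norm (psi m Z) / norm Z)"
    using A by (intro mult_left_mono) auto
  also have "\<dots> = 40 * norm (psi m Z)" using Z0 by simp
  finally show ?thesis .
qed

text \<open>At z = -i y the value psi m Z is z R z / k, so multiplying by k cancels the denominator:
  the left side is at most 40 |z R z|, and |z R z| is at most 4 times the spread of \<nu> at 2
  y.\<close>

lemma free_conv_power_trunc_var:
  assumes m: "borel_prob m" and \<nu>: "free_conv_power m k \<nu>"
    and \<beta>: "\<beta> > 0" and small: "spread \<nu> (3 * \<beta>) \<le> 1 / 50" and y: "0 < y" "y < \<beta>"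
  shows "real k * trunc_var m y \<le> 160 * spread \<nu> (2 * y)"
proof -
  obtain R where R: "is_R_transform 1 \<beta> m (\<lambda>z. R z / of_nat k)"
    "\<And>z. z \<in> stolz_domain 1 \<beta> \<Longrightarrow> norm (z * R z) \<le> 4 * spread \<nu> (2 * norm z)"
    "\<And>z. z \<in> stolz_domain 1 \<beta> \<Longrightarrow> norm (z * R z) \<le> 4 / 50"
    using free_conv_power_common_domain[OF m \<nu> \<beta> small] by metis
  have k: "k > 0" using free_conv_power_R_transform[OF \<nu> m] by blast
  define z where "z = Complex 0 (- y)"
  have z: "z \<in> stolz_domain 1 \<beta>" "norm z = y" using y by (auto simp: z_def in_stolz_domain_iff cmod_def)
  define Z where "Z = 1 / (1 / z + R z / of_nat k)"
  note D = is_R_transformD[OF m R(1) z(1), folded Z_def]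
  have nk: "norm (z * (R z / of_nat k)) = norm (z * R z) / real k" by (simp add: norm_mult norm_divide)
  have "norm (z * R z) / real k \<le> norm (z * R z) / 1"
    using k by (intro divide_left_mono) auto
  then have le: "norm (z * (R z / of_nat k)) \<le> 1 / 10" using R(3)[OF z(1)] nk by simp
  have "norm Z \<le> 2 * y" "y \<le> 2 * \<bar>Im Z\<bar>"
    using wide_quotient[of z "1 + z * (R z / of_nat k)"] stolz_norm_le(1)[OF z(1)] le D(4) z(2) by auto
  then have "trunc_var m y \<le> 40 * norm (psi m Z)"
    by (rule trunc_var_le_psi[OF m y(1)])
  also have "norm (psi m Z) = norm (z * R z) / real k" using D(3) nk by simp
  finally have "real k * trunc_var m y \<le> 40 * norm (z * R z)" using k by (simp add: field_simps)
  also have "\<dots> \<le> 160 * spread \<nu> (2 * y)" using R(2)[OF z(1)] z(2) by simp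
  finally show ?thesis .
qed

subsection \<open>Convergence of holomorphic functions\<close>

lemma LIMSEQ_by_subsequences:
  fixes X :: "nat \<Rightarrow> 'a::metric_space"
  assumes "\<And>s. strict_mono (s :: nat \<Rightarrow> nat) \<Longrightarrow> \<exists>r. strict_mono (r :: nat \<Rightarrow> nat) \<and> (\<lambda>n. X (s (r n))) \<longlonglongrightarrow> L"
  shows "X \<longlonglongrightarrow> L"
proof (rule ccontr)
  assume "\<not> X \<longlonglongrightarrow> L"
  then obtain e where e: "e > 0" "\<And>N. \<exists>n\<ge>N. dist (X n) L \<ge> e"
    unfolding lim_sequentially by (auto simp: not_less)
  define A where "A = {n. dist (X n) L \<ge> e}"
  have inf: "infinite A" using e(2) by (auto simp: A_def infinite_nat_iff_unbounded_le)
  have s: "strict_mono (enumerate A)" by (rule strict_mono_enumerate[OF inf])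
  obtain r where r: "strict_mono (r :: nat \<Rightarrow> nat)" "(\<lambda>n. X (enumerate A (r n))) \<longlonglongrightarrow> L"
    using assms[OF s] by blast
  have "eventually (\<lambda>n. dist (X (enumerate A (r n))) L < e) sequentially"
    using r(2) e(1) by (rule tendstoD)
  then obtain n where "dist (X (enumerate A (r n))) L < e" by (auto simp: eventually_sequentially)
  moreover have "enumerate A (r n) \<in> A" by (rule enumerate_in_set[OF inf])
  ultimately show False by (simp add: A_def)
qed

text \<open>Montel's theorem extracts a locally convergent subsequence from every subsequence. All
  the limits agree on the open set U, hence on S by the identity theorem, so the whole sequence
  converges.\<close>

lemma vitali_convergence:
  fixes f :: "nat \<Rightarrow> complex \<Rightarrow> complex"
  assumes S: "open S" "connected S" and f: "\<And>n. f n holomorphic_on S"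
    and bdd: "\<And>K. compact K \<Longrightarrow> K \<subseteq> S \<Longrightarrow> \<exists>B. \<forall>n. \<forall>z\<in>K. norm (f n z) \<le> B"
    and U: "open U" "U \<noteq> {}" "U \<subseteq> S" and conv: "\<And>z. z \<in> U \<Longrightarrow> convergent (\<lambda>n. f n z)"
  obtains g where "g holomorphic_on S" "\<And>z. z \<in> S \<Longrightarrow> (\<lambda>n. f n z) \<longlonglongrightarrow> g z"
proof -
  have sub: "\<exists>g r. g holomorphic_on S \<and> strict_mono (r :: nat \<Rightarrow> nat) \<and> (\<forall>z\<in>S. (\<lambda>n. f (s (r n)) z) \<longlonglongrightarrow> g z)"
    for s :: "nat \<Rightarrow> nat"
  proof -
    have 1: "\<And>h. h \<in> range f \<Longrightarrow> h holomorphic_on S" using f by auto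
    have 2: "\<exists>B. \<forall>h\<in>range f. \<forall>z\<in>K. norm (h z) \<le> B" if "compact K" "K \<subseteq> S" for K
      using bdd[OF that] by auto
    have 3: "range (\<lambda>n. f (s n)) \<subseteq> range f" by auto
    show ?thesis by (rule Montel[OF S(1) 1 2 3]) blast+
  qed
  obtain g r where g: "g holomorphic_on S" "strict_mono (r :: nat \<Rightarrow> nat)" "\<And>z. z \<in> S \<Longrightarrow> (\<lambda>n. f (r n) z) \<longlonglongrightarrow> g z"
    using sub[of "\<lambda>n. n"] by blast
  have gU: "(\<lambda>n. f n z) \<longlonglongrightarrow> g z" if zU: "z \<in> U" for z
  proof -
    obtain l where l: "(\<lambda>n. f n z) \<longlonglongrightarrow> l" using conv[OF zU] by (auto simp: convergent_def)
    have "(\<lambda>n. f (r n) z) \<longlonglongrightarrow> l" using LIMSEQ_subseq_LIMSEQ[OF l g(2)] by (simp add: o_def)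
    then have "l = g z" using LIMSEQ_unique g(3) zU U(3) by blast
    with l show ?thesis by simp
  qed
  have "(\<lambda>n. f n z) \<longlonglongrightarrow> g z" if z: "z \<in> S" for z
  proof (rule LIMSEQ_by_subsequences)
    fix s :: "nat \<Rightarrow> nat" assume s: "strict_mono s"
    obtain h r' where h: "h holomorphic_on S" "strict_mono (r' :: nat \<Rightarrow> nat)" "\<And>z. z \<in> S \<Longrightarrow> (\<lambda>n. f (s (r' n)) z) \<longlonglongrightarrow> h z"
      using sub[of s] by blast
    have "h w = g w" if "w \<in> U" for w
    proof -
      have "(\<lambda>n. f (s (r' n)) w) \<longlonglongrightarrow> g w"
        using LIMSEQ_subseq_LIMSEQ[OF gU[OF that] strict_mono_o[OF s h(2)]] by (simp add: o_def)
      then show ?thesis using LIMSEQ_unique h(3) that U(3) by blast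
    qed
    then have "h z = g z"
      using analytic_continuation_open[OF U(1) S(1) U(2) S(2) U(3) h(1) g(1) _ z] by blast
    then show "\<exists>r. strict_mono (r :: nat \<Rightarrow> nat) \<and> (\<lambda>n. f (s (r n)) z) \<longlonglongrightarrow> g z"
      using h(2,3) z by metis
  qed
  then show thesis using g(1) that by blast
qed

lemma vitali_convergence_to:
  fixes f :: "nat \<Rightarrow> complex \<Rightarrow> complex"
  assumes S: "open S" "connected S" and f: "\<And>n. f n holomorphic_on S"
    and bdd: "\<And>K. compact K \<Longrightarrow> K \<subseteq> S \<Longrightarrow> \<exists>B. \<forall>n. \<forall>z\<in>K. norm (f n z) \<le> B"
    and U: "open U" "U \<noteq> {}" "U \<subseteq> S" and conv: "\<And>z. z \<in> U \<Longrightarrow> (\<lambda>n. f n z) \<longlonglongrightarrow> g z"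
    and g: "g holomorphic_on S" and z: "z \<in> S"
  shows "(\<lambda>n. f n z) \<longlonglongrightarrow> g z"
proof -
  have c: "convergent (\<lambda>n. f n z)" if "z \<in> U" for z
    using conv[OF that] by (auto simp: convergent_def)
  obtain h where h: "h holomorphic_on S" "\<And>z. z \<in> S \<Longrightarrow> (\<lambda>n. f n z) \<longlonglongrightarrow> h z"
    by (rule vitali_convergence[OF S f bdd U c]) blast+
  have "h w = g w" if "w \<in> U" for w
    using LIMSEQ_unique[OF h(2) conv[OF that]] that U(3) by blast
  then have "h z = g z"
    using analytic_continuation_open[OF U(1) S(1) U(2) S(2) U(3) h(1) g _ z] by blast
  then show ?thesis using h(2)[OF z] by simp
qed

definition half_plane :: "real \<Rightarrow> complex set" where
  "half_plane c = {z. 0 < c * Im z}"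

lemma half_plane_props:
  "open (half_plane c)" "convex (half_plane c)" "connected (half_plane c)"
  "half_stolz c \<alpha> \<beta> \<subseteq> half_plane c" "z \<in> half_plane c \<Longrightarrow> Im z \<noteq> 0"
proof -
  show "open (half_plane c)" unfolding half_plane_def by (intro open_Collect_less continuous_intros)
  have "linear (\<lambda>z. c * Im z)" by (rule linearI) (auto simp: algebra_simps)
  then show "convex (half_plane c)"
    using convex_linear_vimage[of "\<lambda>z. c * Im z" "{0<..}"] by (simp add: vimage_def half_plane_def)
  then show "connected (half_plane c)" by (rule convex_connected)
qed (auto simp: half_plane_def half_stolz_def)

lemma nonreal_half_plane:
  assumes "Im z \<noteq> 0" obtains c :: real where "c = 1 \<or> c = -1" "z \<in> half_plane c"
  using assms by (cases "Im z > 0") (force simp: half_plane_def)+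

lemma kern_const_bounded_on_compact:
  assumes "compact K" "\<And>z. z \<in> K \<Longrightarrow> Im z \<noteq> 0"
  obtains B where "B \<ge> 0" "\<And>z. z \<in> K \<Longrightarrow> kern_const z \<le> B" "\<And>z. z \<in> K \<Longrightarrow> norm z \<le> B"
proof -
  have "continuous_on K (\<lambda>z. kern_const z + norm z)"
    unfolding kern_const_def using assms(2) by (intro continuous_intros) auto
  then have "bounded ((\<lambda>z. kern_const z + norm z) ` K)"
    using assms(1) compact_continuous_image compact_imp_bounded by blast
  then obtain B where B: "\<And>z. z \<in> K \<Longrightarrow> \<bar>kern_const z + norm z\<bar> \<le> B" by (auto simp: bounded_iff)
  have "kern_const z \<le> max B 0" "norm z \<le> max B 0" if "z \<in> K" for z
    using B[OF that] kern_const_ge_1[of z] norm_ge_zero[of z] by linarith+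
  then show thesis by (intro that[of "max B 0"]) auto
qed

lemma weakly_converges_complex:
  fixes f :: "'a::topological_space \<Rightarrow> complex"
  assumes "weakly_converges M m" "continuous_on UNIV f" "\<And>x. norm (f x) \<le> B"
    and "\<And>n. finite_borel (M n)" "finite_borel m"
  shows "(\<lambda>n. \<integral>x. f x \<partial>M n) \<longlonglongrightarrow> (\<integral>x. f x \<partial>m)"
proof -
  have i: "integrable N f" if "finite_borel N" for N
  proof (rule finite_measure.integrable_const_bound[of _ _ B])
    have "sets N = sets borel" using that by (simp add: finite_borel_def)
    then show "f \<in> borel_measurable N"
      using borel_measurable_continuous_onI[OF assms(2)] by (simp cong: measurable_cong_sets)
  qed (use that assms(3) in \<open>auto simp: finite_borel_def\<close>)
  have bR: "bounded (range (\<lambda>x. Re (f x)))" "bounded (range (\<lambda>x. Im (f x)))"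
    using assms(3) order_trans[OF abs_Re_le_cmod assms(3)] order_trans[OF abs_Im_le_cmod assms(3)]
    by (auto simp: bounded_iff)
  have "(\<lambda>n. \<integral>x. Re (f x) \<partial>M n) \<longlonglongrightarrow> (\<integral>x. Re (f x) \<partial>m)" "(\<lambda>n. \<integral>x. Im (f x) \<partial>M n) \<longlonglongrightarrow> (\<integral>x. Im (f x) \<partial>m)"
    using assms(1,2) bR unfolding weakly_converges_def by (auto intro!: continuous_intros)
  then show ?thesis
    using i assms(4,5) by (simp add: tendsto_complex_iff)
qed

text \<open>The integrand (z + x) / (1 - z x) is a(x) \<open>kern z x\<close> + b(x)
  \<open>kern z x\<close> / z with the bounded factors a = 1 / sqrt (1 + x^2) and b = x / sqrt (1 +
  x^2), which reduces the claim to integrals of the kernel.\<close>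

lemma levy_holomorphic:
  assumes \<sigma>: "finite_borel \<sigma>" and U: "\<And>z. z \<in> U \<Longrightarrow> Im z \<noteq> 0"
  shows "free_levy_R \<gamma> \<sigma> holomorphic_on U"
proof -
  have fin: "finite_measure \<sigma>" and [measurable_cong]: "sets \<sigma> = sets borel" using \<sigma> by (auto simp: finite_borel_def)
  define a where "a x = complex_of_real (1 / sqrt (1 + x\<^sup>2))" for x :: real
  define b where "b x = complex_of_real (x / sqrt (1 + x\<^sup>2))" for x :: real
  have [measurable]: "a \<in> borel_measurable borel" "b \<in> borel_measurable borel"
    unfolding a_def b_def by measurable
  have s1: "1 \<le> sqrt (1 + x\<^sup>2)" for x :: real by (rule real_le_rsqrt) simp
  have a1: "norm (a x) \<le> 1" for x
  proof -
    have "1 / sqrt (1 + x\<^sup>2) \<le> 1 / 1" using s1[of x] by (intro divide_left_mono) (auto simp: add_pos_nonneg)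
    moreover have "0 \<le> 1 / sqrt (1 + x\<^sup>2)" using s1[of x] by auto
    ultimately show ?thesis unfolding a_def norm_of_real by simp
  qed
  have b1: "norm (b x) \<le> 1" for x unfolding b_def norm_of_real by (rule abs_div_sqrt_le_1)
  have pt: "(z + complex_of_real x) / (1 - z * complex_of_real x) = a x * kern z x + 1 / z * (b x * kern z x)"
    if "z \<in> U" for z x
  proof -
    have "z \<noteq> 0" using U[OF that] by auto
    moreover have "sqrt (1 + x\<^sup>2) \<noteq> 0" using s1[of x] by linarith
    then have "complex_of_real (sqrt (1 + x\<^sup>2)) \<noteq> 0" unfolding of_real_eq_0_iff .
    ultimately show ?thesis
      using one_minus_nonzero[OF U[OF that], of x] unfolding a_def b_def kern_def of_real_divide of_real_1
      by (simp add: divide_simps; simp add: algebra_simps)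
  qed
  have "(\<lambda>z. complex_of_real \<gamma> + ((\<integral>x. a x * kern z x \<partial>\<sigma>) + 1 / z * (\<integral>x. b x * kern z x \<partial>\<sigma>))) holomorphic_on U"
    using U U[of 0] a1 b1 fin by (intro holomorphic_intros holomorphic_on_kern_integral[where B = 1]) auto
  then show ?thesis
  proof (rule holomorphic_transform)
    fix z assume z: "z \<in> U"
    have "integrable \<sigma> (\<lambda>x. a x * kern z x)" "integrable \<sigma> (\<lambda>x. b x * kern z x)"
      using U[OF z] a1 b1 fin by (auto intro!: integrable_kern[where B = 1])
    then show "complex_of_real \<gamma> + ((\<integral>x. a x * kern z x \<partial>\<sigma>) + 1 / z * (\<integral>x. b x * kern z x \<partial>\<sigma>)) = free_levy_R \<gamma> \<sigma> z"
      unfolding free_levy_R_def pt[OF z] by simp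
  qed
qed

text \<open>x / (1 - z x) - x / (1 - w x) = (z - w) x^2 / ((1 - z x) (1 - w x)), and 1 + x^2 is at
  most the product of the two bounds from \<open>one_plus_abs_le\<close>. The first-order drift
  cancels in the difference, so the second-order quantity \<open>trunc_var\<close> appears and the
  bound survives multiplication by k_n.\<close>

lemma psi_ratio_lipschitz:
  assumes m: "borel_prob m" and z: "Im z \<noteq> 0" and w: "Im w \<noteq> 0"
  shows "norm (psi m z / z - psi m w / w) \<le> norm (z - w) * (kern_const z * kern_const w) * trunc_var m 1"
proof -
  have z0: "z \<noteq> 0" "w \<noteq> 0" using z w by auto
  define u where "u z x = 1 - z * complex_of_real x" for z x
  have nz: "u z x \<noteq> 0" "u w x \<noteq> 0" for x using one_minus_nonzero z w by (auto simp: u_def)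
  have iz: "integrable m (\<lambda>x. z * complex_of_real x / u z x / z)" "integrable m (\<lambda>x. w * complex_of_real x / u w x / w)"
    unfolding u_def by (auto intro!: integrable_divide_zero integrable_psi[OF m] simp only: z w)
  have "psi m z / z - psi m w / w = (\<integral>x. z * complex_of_real x / u z x / z - w * complex_of_real x / u w x / w \<partial>m)"
    unfolding Bochner_Integration.integral_diff[OF iz] by (simp only: psi_def u_def integral_divide_zero)
  also have "norm \<dots> \<le> (\<integral>x. norm (z * complex_of_real x / u z x / z - w * complex_of_real x / u w x / w) \<partial>m)"
    by (rule integral_norm_bound)
  also have "\<dots> \<le> (\<integral>x. norm (z - w) * (kern_const z * kern_const w) * ((1 * x)\<^sup>2 / (1 + (1 * x)\<^sup>2)) \<partial>m)"
  proof (rule integral_mono)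
    show "integrable m (\<lambda>x. norm (z * complex_of_real x / u z x / z - w * complex_of_real x / u w x / w))"
      by (rule integrable_norm[OF Bochner_Integration.integrable_diff[OF iz]])
    show "integrable m (\<lambda>x. norm (z - w) * (kern_const z * kern_const w) * ((1 * x)\<^sup>2 / (1 + (1 * x)\<^sup>2)))"
      by (rule integrable_mult_right) (rule integrable_trunc_var[OF m])
    fix x :: real
    have eq: "z * complex_of_real x / u z x / z - w * complex_of_real x / u w x / w =
        (z - w) * (complex_of_real (x\<^sup>2) / (u z x * u w x))"
    proof -
      have "z * complex_of_real x / u z x / z - w * complex_of_real x / u w x / w = complex_of_real x / u z x - complex_of_real x / u w x"
        using z0 by simp
      also have "\<dots> = complex_of_real x * (u w x - u z x) / (u z x * u w x)"
        using nz[of x] by (simp add: field_simps)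
      also have "u w x - u z x = (z - w) * complex_of_real x" by (simp add: u_def algebra_simps)
      finally show ?thesis by (simp add: power2_eq_square mult_ac)
    qed
    have "1 + x\<^sup>2 \<le> (1 + \<bar>x\<bar>) * (1 + \<bar>x\<bar>)" by (simp add: power2_eq_square algebra_simps)
    also have "\<dots> \<le> (kern_const z * norm (u z x)) * (kern_const w * norm (u w x))"
      using one_plus_abs_le[OF z, of x] one_plus_abs_le[OF w, of x] unfolding u_def by (intro mult_mono) auto
    finally have "x\<^sup>2 * (1 + x\<^sup>2) \<le> x\<^sup>2 * ((kern_const z * norm (u z x)) * (kern_const w * norm (u w x)))"
      by (intro mult_left_mono) auto
    then have "x\<^sup>2 / (norm (u z x) * norm (u w x)) \<le> kern_const z * kern_const w * (x\<^sup>2 / (1 + x\<^sup>2))"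
      using nz[of x] by (simp add: divide_le_eq le_divide_eq add_pos_nonneg mult_ac)
    then have "norm (z - w) * (x\<^sup>2 / (norm (u z x) * norm (u w x))) \<le> norm (z - w) * (kern_const z * kern_const w * (x\<^sup>2 / (1 + x\<^sup>2)))"
      by (intro mult_left_mono) auto
    then show "norm (z * complex_of_real x / u z x / z - w * complex_of_real x / u w x / w) \<le>
        norm (z - w) * (kern_const z * kern_const w) * ((1 * x)\<^sup>2 / (1 + (1 * x)\<^sup>2))"
      unfolding eq by (simp add: norm_mult norm_divide norm_power mult.assoc)
  qed
  also have "\<dots> = norm (z - w) * (kern_const z * kern_const w) * trunc_var m 1"
    unfolding trunc_var_def by (rule integral_mult_right_zero)
  finally show ?thesis .
qed

subsection \<open>Limits of free convolution powers\<close>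

text \<open>The one-variable half of the theorem, used once for each marginal: \<open>m n\<close>
  are the marginals and \<open>\<nu> n\<close> their free powers.\<close>

locale free_limit =
  fixes m \<nu> :: "nat \<Rightarrow> real measure" and k :: "nat \<Rightarrow> nat"
    and \<gamma> :: real and \<sigma> \<nu>lim :: "real measure"
  assumes m: "\<And>n. borel_prob (m n)"
    and k_pos: "\<And>n. k n > 0"
    and k_top: "filterlim k at_top sequentially"
    and \<sigma>: "finite_borel \<sigma>"
    and power: "\<And>n. free_conv_power (m n) (k n) (\<nu> n)"
    and levy: "free_levy_law \<gamma> \<sigma> \<nu>lim"
    and weak: "weakly_converges \<nu> \<nu>lim"
begin

lemma \<nu>: "borel_prob (\<nu> n)"
  using free_conv_power_R_transform[OF power m] by blast

lemma \<nu>lim: "borel_prob \<nu>lim"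
  using levy by (simp add: free_levy_law_def freely_infinitely_divisible_def)

text \<open>For large n weak convergence applies, because the integrand of \<open>spread\<close> is
  bounded and continuous. The finitely many remaining laws are added one at a time by taking minima
  of scales, \<open>spread\<close> being monotone in the scale.\<close>

lemma uniform_spread:
  assumes "e > 0"
  shows "\<exists>y>0. \<forall>n. spread (\<nu> n) y \<le> e"
proof -
  obtain y0 where y0: "y0 > 0" "spread \<nu>lim y0 < e" using spread_small[OF \<nu>lim assms] by auto
  have "continuous_on UNIV (\<lambda>x::real. min 1 (y0 * \<bar>x\<bar>))" by (intro continuous_intros)
  moreover have "bounded (range (\<lambda>x::real. min 1 (y0 * \<bar>x\<bar>)))"
    using y0(1) by (auto simp: bounded_iff intro!: exI[of _ 1])
  ultimately have "(\<lambda>n. spread (\<nu> n) y0) \<longlonglongrightarrow> spread \<nu>lim y0"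
    using weak unfolding weakly_converges_def spread_def by blast
  then have "eventually (\<lambda>n. spread (\<nu> n) y0 < e) sequentially"
    using y0(2) by (rule order_tendstoD)
  then obtain N where N: "\<And>n. n \<ge> N \<Longrightarrow> spread (\<nu> n) y0 < e" by (auto simp: eventually_sequentially)
  have "\<exists>y>0. \<forall>n<N. spread (\<nu> n) y \<le> e"
  proof (induction N)
    case (Suc N)
    then obtain y where y: "y > 0" "\<forall>n<N. spread (\<nu> n) y \<le> e" by blast
    obtain y' where y': "y' > 0" "spread (\<nu> N) y' < e" using spread_small[OF \<nu> assms] by auto
    have le: "spread (\<nu> n) (min y y') \<le> spread (\<nu> n) y" "spread (\<nu> n) (min y y') \<le> spread (\<nu> n) y'" for n
      using y(1) y'(1) by (auto intro!: spread_mono[OF \<nu>])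
    have "spread (\<nu> n) (min y y') \<le> e" if "n < Suc N" for n
      using le[of n] y(2) y'(2) that by (cases "n = N") (auto intro: order_trans)
    then show ?case using y(1) y'(1) by (intro exI[of _ "min y y'"]) auto
  qed (auto intro: exI[of _ 1])
  then obtain y1 where y1: "y1 > 0" "\<And>n. n < N \<Longrightarrow> spread (\<nu> n) y1 \<le> e" by blast
  have "spread (\<nu> n) (min y0 y1) \<le> e" for n
  proof -
    have "spread (\<nu> n) (min y0 y1) \<le> spread (\<nu> n) y0" "spread (\<nu> n) (min y0 y1) \<le> spread (\<nu> n) y1"
      using y0(1) y1(1) by (auto intro!: spread_mono[OF \<nu>])
    then show ?thesis using N[of n] y1(2)[of n] by (cases "n < N") auto
  qed
  then show ?thesis using y0(1) y1(1) by (intro exI[of _ "min y0 y1"]) auto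
qed

lemma common_domain_exists:
  "\<exists>\<beta>0>0. (\<forall>n. spread (\<nu> n) (3 * \<beta>0) \<le> 1 / 50) \<and> (\<exists>R. \<forall>n. is_R_transform 1 \<beta>0 (\<nu> n) (R n) \<and>
     is_R_transform 1 \<beta>0 (m n) (\<lambda>z. R n z / of_nat (k n)) \<and>
     (\<forall>z\<in>stolz_domain 1 \<beta>0. norm (z * R n z) \<le> 4 / 50))"
proof -
  obtain y where y: "y > 0" "\<And>n. spread (\<nu> n) y \<le> 1 / 50"
    using uniform_spread[of "1 / 50"] by auto
  have "\<exists>R. is_R_transform 1 (y / 3) (\<nu> n) R \<and>
     is_R_transform 1 (y / 3) (m n) (\<lambda>z. R z / of_nat (k n)) \<and>
     (\<forall>z\<in>stolz_domain 1 (y / 3). norm (z * R z) \<le> 4 / 50)" for n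
  proof -
    have "y / 3 > 0" "spread (\<nu> n) (3 * (y / 3)) \<le> 1 / 50" using y by auto
    then show ?thesis by (rule free_conv_power_common_domain[OF m power]) blast
  qed
  then have "\<exists>R. \<forall>n. is_R_transform 1 (y / 3) (\<nu> n) (R n) \<and>
     is_R_transform 1 (y / 3) (m n) (\<lambda>z. R n z / of_nat (k n)) \<and>
     (\<forall>z\<in>stolz_domain 1 (y / 3). norm (z * R n z) \<le> 4 / 50)"
    by (intro choice) blast
  then show ?thesis using y by (intro exI[of _ "y / 3"]) auto
qed

text \<open>The domain and the family of R-transforms on it are chosen once, so that all later
  statements of the locale refer to the same objects.\<close>

definition "b0 = (SOME \<beta>0. \<beta>0 > 0 \<and> (\<forall>n. spread (\<nu> n) (3 * \<beta>0) \<le> 1 / 50) \<and> (\<exists>R. \<forall>n. is_R_transform 1 \<beta>0 (\<nu> n) (R n) \<and>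
     is_R_transform 1 \<beta>0 (m n) (\<lambda>z. R n z / of_nat (k n)) \<and>
     (\<forall>z\<in>stolz_domain 1 \<beta>0. norm (z * R n z) \<le> 4 / 50)))"

definition "R0 = (SOME R. \<forall>n. is_R_transform 1 b0 (\<nu> n) (R n) \<and>
     is_R_transform 1 b0 (m n) (\<lambda>z. R n z / of_nat (k n)) \<and>
     (\<forall>z\<in>stolz_domain 1 b0. norm (z * R n z) \<le> 4 / 50))"

lemma b0: "b0 > 0" "spread (\<nu> n) (3 * b0) \<le> 1 / 50"
  and R0: "is_R_transform 1 b0 (\<nu> n) (R0 n)" "is_R_transform 1 b0 (m n) (\<lambda>z. R0 n z / of_nat (k n))"
    "z \<in> stolz_domain 1 b0 \<Longrightarrow> norm (z * R0 n z) \<le> 4 / 50"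
proof -
  have *: "b0 > 0 \<and> (\<forall>n. spread (\<nu> n) (3 * b0) \<le> 1 / 50) \<and> (\<exists>R. \<forall>n. is_R_transform 1 b0 (\<nu> n) (R n) \<and>
     is_R_transform 1 b0 (m n) (\<lambda>z. R n z / of_nat (k n)) \<and>
     (\<forall>z\<in>stolz_domain 1 b0. norm (z * R n z) \<le> 4 / 50))"
    unfolding b0_def by (rule someI_ex[OF common_domain_exists])
  then show "b0 > 0" "spread (\<nu> n) (3 * b0) \<le> 1 / 50" by auto
  have "\<forall>n. is_R_transform 1 b0 (\<nu> n) (R0 n) \<and>
     is_R_transform 1 b0 (m n) (\<lambda>z. R0 n z / of_nat (k n)) \<and>
     (\<forall>z\<in>stolz_domain 1 b0. norm (z * R0 n z) \<le> 4 / 50)"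
    using someI_ex[OF *[THEN conjunct2, THEN conjunct2]] unfolding R0_def[symmetric] .
  then show "is_R_transform 1 b0 (\<nu> n) (R0 n)" "is_R_transform 1 b0 (m n) (\<lambda>z. R0 n z / of_nat (k n))"
    "z \<in> stolz_domain 1 b0 \<Longrightarrow> norm (z * R0 n z) \<le> 4 / 50" by auto
qed

lemma uniform_trunc_var:
  assumes "e > 0"
  shows "\<exists>y>0. y \<le> 1 \<and> (\<forall>n. real (k n) * trunc_var (m n) y \<le> e)"
proof -
  obtain y where y: "y > 0" "\<And>n. spread (\<nu> n) y \<le> e / 160"
    using uniform_spread[of "e / 160"] assms by auto
  \<comment> \<open>y / 2 because the bound is in terms of \<open>spread\<close> at 2 y', and b0 / 2
    because y' has to lie strictly below b0.\<close>
  define y' where "y' = Min {y / 2, b0 / 2, 1}"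
  have y': "0 < y'" "y' \<le> 1" "y' < b0" "2 * y' \<le> y" using y(1) b0(1) by (auto simp: y'_def)
  have "real (k n) * trunc_var (m n) y' \<le> e" for n
  proof -
    have "real (k n) * trunc_var (m n) y' \<le> 160 * spread (\<nu> n) (2 * y')"
      by (rule free_conv_power_trunc_var[OF m power b0(1,2) y'(1,3)])
    also have "spread (\<nu> n) (2 * y') \<le> spread (\<nu> n) y" using y' by (intro spread_mono[OF \<nu>]) auto
    also have "spread (\<nu> n) y \<le> e / 160" by (rule y)
    finally show ?thesis by simp
  qed
  then show ?thesis using y' by blast
qed

text \<open>For y <= 1 truncation at scale 1 costs at most the factor 1 / y^2 compared with
  truncation at scale 1 / y, so one good y from \<open>uniform_trunc_var\<close> is enough.\<close>

lemma trunc_var_bounded: "\<exists>B\<ge>0. \<forall>n. real (k n) * trunc_var (m n) 1 \<le> B"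
proof -
  obtain y where y: "y > 0" "y \<le> 1" "\<And>n. real (k n) * trunc_var (m n) y \<le> 1"
    using uniform_trunc_var[of 1] by auto
  have "real (k n) * trunc_var (m n) 1 \<le> 1 / y\<^sup>2" for n
  proof -
    have "trunc_var (m n) 1 \<le> (\<integral>x. 1 / y\<^sup>2 * ((y * x)\<^sup>2 / (1 + (y * x)\<^sup>2)) \<partial>m n)"
      unfolding trunc_var_def
    proof (intro integral_mono integrable_mult_right integrable_trunc_var m)
      fix x :: real
      have "(y * x)\<^sup>2 \<le> (1 * x)\<^sup>2" using y unfolding power_mult_distrib
        by (intro mult_right_mono power_mono) auto
      then have "x\<^sup>2 / (1 + x\<^sup>2) \<le> x\<^sup>2 / (1 + (y * x)\<^sup>2)"
        by (intro divide_left_mono) (auto intro!: mult_pos_pos add_pos_nonneg)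
      then show "(1 * x)\<^sup>2 / (1 + (1 * x)\<^sup>2) \<le> 1 / y\<^sup>2 * ((y * x)\<^sup>2 / (1 + (y * x)\<^sup>2))"
        using y(1) by (simp add: power_mult_distrib)
    qed
    also have "\<dots> = 1 / y\<^sup>2 * trunc_var (m n) y" unfolding trunc_var_def by (rule integral_mult_right_zero)
    finally have "real (k n) * trunc_var (m n) 1 \<le> real (k n) * (1 / y\<^sup>2 * trunc_var (m n) y)"
      by (intro mult_left_mono) auto
    also have "\<dots> = 1 / y\<^sup>2 * (real (k n) * trunc_var (m n) y)" by simp
    also have "\<dots> \<le> 1 / y\<^sup>2 * 1" using y(3) by (intro mult_left_mono) auto
    finally show ?thesis by simp
  qed
  then show ?thesis by (intro exI[of _ "1 / y\<^sup>2"]) auto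
qed

text \<open>At a fixed z the limit point Z solves the equation for \<nu>lim, and
  \<open>psi_inverse_unique\<close> for \<open>\<nu> i\<close> bounds |Zn i - Z| by twice the
  residual of Z in the equation of \<open>\<nu> i\<close>. This residual tends to 0 by weak
  convergence at the single point Z. The angle a, b is unspecified because the Levy function is
  known as the R-transform of \<nu>lim only on some domain near 0.\<close>

lemma R0_limit: "\<exists>a b. 0 < a \<and> a \<le> 1 \<and> 0 < b \<and> b \<le> b0 \<and> (\<forall>z\<in>stolz_domain a b. (\<lambda>n. R0 n z) \<longlonglongrightarrow> free_levy_R \<gamma> \<sigma> z)"
proof -
  obtain \<alpha> \<beta> where L: "\<alpha> > 0" "\<beta> > 0" "is_R_transform \<alpha> \<beta> \<nu>lim (free_levy_R \<gamma> \<sigma>)"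
    using levy by (auto simp: free_levy_law_def)
  have "((\<lambda>z. z * free_levy_R \<gamma> \<sigma> z) \<longlongrightarrow> 0) (at 0 within stolz_domain \<alpha> \<beta>)"
    using L(3) by (simp add: is_R_transform_def)
  then have "eventually (\<lambda>z. dist (z * free_levy_R \<gamma> \<sigma> z) 0 < 1 / 10) (at 0 within stolz_domain \<alpha> \<beta>)"
    by (rule tendstoD) simp
  then obtain d where d: "d > 0" "\<And>z. z \<in> stolz_domain \<alpha> \<beta> \<Longrightarrow> z \<noteq> 0 \<Longrightarrow> dist z 0 < d \<Longrightarrow> norm (z * free_levy_R \<gamma> \<sigma> z) < 1 / 10"
    unfolding eventually_at by auto
  define a where "a = min \<alpha> 1"
  define b where "b = Min {\<beta>, b0, d / 2}"
  have ab: "0 < a" "a \<le> 1" "a \<le> \<alpha>" "0 < b" "b \<le> b0" "b \<le> \<beta>" "b \<le> d / 2"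
    using L(1,2) b0(1) d(1) by (auto simp: a_def b_def)
  have "(\<lambda>n. R0 n z) \<longlonglongrightarrow> free_levy_R \<gamma> \<sigma> z" if z: "z \<in> stolz_domain a b" for z
  proof -
    have zz: "z \<in> stolz_domain 1 b0" "z \<in> stolz_domain \<alpha> \<beta>" "z \<in> stolz_domain 1 (d / 2)"
      using ab by (auto intro!: subsetD[OF stolz_domain_mono z])
    note n = stolz_norm_le[OF zz(1)]
    have zd: "norm z < d" using stolz_norm_le(2)[OF zz(3)] d(1) by simp
    let ?L = "free_levy_R \<gamma> \<sigma> z"
    define Z where "Z = 1 / (1 / z + ?L)"
    define Zn where "Zn n = 1 / (1 / z + R0 n z)" for n
    note D = is_R_transformD[OF \<nu>lim L(3) zz(2), folded Z_def]
    note Dn = is_R_transformD[OF \<nu> R0(1) zz(1), folded Zn_def]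
    have "norm (z * ?L) \<le> 1 / 10" using d(2)[OF zz(2) n(3)] zd by simp
    then have w: "norm Z \<le> 2 * norm z" "norm Z \<le> 3 * \<bar>Im Z\<bar>"
      using wide_quotient[OF n(1), of "1 + z * ?L"] D(4) by auto
    have wn: "norm (Zn i) \<le> 2 * norm z" "norm (Zn i) \<le> 3 * \<bar>Im (Zn i)\<bar>" for i
      using wide_quotient[OF n(1), of "1 + z * R0 i z"] R0(3)[OF zz(1), of i] Dn(4) by auto
    have le: "norm (Zn i - Z) \<le> 2 * norm (z - Z * (1 + psi (\<nu> i) Z))" for i
    proof -
      have "norm (Zn i - Z) \<le> 2 * norm (Zn i * (1 + psi (\<nu> i) (Zn i)) - Z * (1 + psi (\<nu> i) Z))"
      proof (rule psi_inverse_unique[OF \<nu> b0(2) Dn(1) wn(2) _ D(1) w(2)])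
        show "norm (Zn i) \<le> 3 * b0" "norm Z \<le> 3 * b0" using wn(1)[of i] w(1) n(2) by linarith+
      qed
      then show ?thesis using Dn(2) by simp
    qed
    have "(\<lambda>i. psi (\<nu> i) Z) \<longlonglongrightarrow> psi \<nu>lim Z"
      unfolding psi_def
    proof (rule weakly_converges_complex[OF weak])
      show "continuous_on UNIV (\<lambda>x. Z * complex_of_real x / (1 - Z * complex_of_real x))"
        using one_minus_nonzero[OF D(1)] by (intro continuous_intros) auto
      show "norm (Z * complex_of_real x / (1 - Z * complex_of_real x)) \<le> 4" for x
        using psi_integrand_bounds[OF D(1) w(2), of x] by simp
      show "finite_borel (\<nu> n)" "finite_borel \<nu>lim" for n
        using borel_probD(2,3)[OF \<nu>] borel_probD(2,3)[OF \<nu>lim] by (auto simp: finite_borel_def)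
    qed
    then have "(\<lambda>i. 2 * norm (z - Z * (1 + psi (\<nu> i) Z))) \<longlonglongrightarrow> 2 * norm (z - Z * (1 + psi \<nu>lim Z))"
      by (intro tendsto_intros)
    then have "(\<lambda>i. 2 * norm (z - Z * (1 + psi (\<nu> i) Z))) \<longlonglongrightarrow> 0" using D(2) by simp
    then have "(\<lambda>i. Zn i - Z) \<longlonglongrightarrow> 0"
      by (rule Lim_null_comparison[rotated]) (use le in \<open>auto intro: always_eventually\<close>)
    then have "Zn \<longlonglongrightarrow> Z" by (rule LIM_zero_cancel)
    moreover have "Z \<noteq> 0" using D(1) by auto
    ultimately have "(\<lambda>i. 1 / Zn i - 1 / z) \<longlonglongrightarrow> 1 / Z - 1 / z" by (intro tendsto_intros)
    then show ?thesis by (simp add: Zn_def Z_def)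
  qed
  then show ?thesis using ab by blast
qed

lemma inverse_k_tendsto: "(\<lambda>n. 1 / real (k n)) \<longlonglongrightarrow> 0"
  using k_top by (intro tendsto_divide_0[OF tendsto_const] filterlim_at_top_imp_at_infinity
      filterlim_compose[OF filterlim_real_sequentially])

section \<open>The rescaled moment transform off the real axis\<close>

definition "Z0 n z = 1 / (1 / z + R0 n z / of_nat (k n))"

lemma Z0_props:
  assumes z: "z \<in> stolz_domain 1 b0"
  shows "Im (Z0 n z) \<noteq> 0" "psi (m n) (Z0 n z) = z * (R0 n z / of_nat (k n))"
    "norm (Z0 n z) \<le> 2 * norm z" "norm z \<le> 2 * \<bar>Im (Z0 n z)\<bar>" "norm (Z0 n z - z) \<le> norm z / 9"
    "(\<lambda>n. Z0 n z) \<longlonglongrightarrow> z"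
proof -
  note n = stolz_norm_le[OF z]
  note D = is_R_transformD[OF m R0(2) z, folded Z0_def]
  show "Im (Z0 n z) \<noteq> 0" "psi (m n) (Z0 n z) = z * (R0 n z / of_nat (k n))" by (rule D)+
  have nk: "norm (z * (R0 n z / of_nat (k n))) \<le> 4 / 50 * (1 / real (k n))" for n
  proof -
    have "norm (z * R0 n z) * (1 / real (k n)) \<le> 4 / 50 * (1 / real (k n))"
      using R0(3)[OF z] by (intro mult_right_mono) auto
    then show ?thesis by (simp add: norm_mult norm_divide)
  qed
  have "1 / real (k n) \<le> 1" using k_pos[of n] by simp
  then have "norm ((1 + z * (R0 n z / of_nat (k n))) - 1) \<le> 1 / 10" using nk[of n] by simp
  note w = wide_quotient[OF n(1) this, folded D(4)]
  show "norm (Z0 n z) \<le> 2 * norm z" "norm z \<le> 2 * \<bar>Im (Z0 n z)\<bar>" "norm (Z0 n z - z) \<le> norm z / 9"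
    using w by auto
  have "(\<lambda>n. 4 / 50 * (1 / real (k n))) \<longlonglongrightarrow> 4 / 50 * 0"
    by (intro tendsto_intros inverse_k_tendsto)
  then have "(\<lambda>n. 4 / 50 * (1 / real (k n))) \<longlonglongrightarrow> 0" by simp
  then have "(\<lambda>n. z * (R0 n z / of_nat (k n))) \<longlonglongrightarrow> 0"
    by (rule Lim_null_comparison[rotated]) (use nk in \<open>auto intro!: always_eventually\<close>)
  then have "(\<lambda>n. z / (1 + z * (R0 n z / of_nat (k n)))) \<longlonglongrightarrow> z / (1 + 0)"
    by (intro tendsto_intros) auto
  then show "(\<lambda>n. Z0 n z) \<longlonglongrightarrow> z" by (simp add: D(4))
qed

text \<open>k_n times the integral of x / (1 - z x). It stands in for the R-transform of the free
  power at all nonreal z: at \<open>Z0 n w\<close> it equals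
  \<open>w * R0 n w / Z0 n w\<close>.\<close>

definition "r n z = of_nat (k n) * (psi (m n) z / z)"

lemma r_lipschitz:
  obtains B where "B \<ge> 0" "\<And>n z w. Im z \<noteq> 0 \<Longrightarrow> Im w \<noteq> 0 \<Longrightarrow>
    norm (r n z - r n w) \<le> norm (z - w) * (kern_const z * kern_const w) * B"
proof -
  obtain B where B: "B \<ge> 0" "\<And>n. real (k n) * trunc_var (m n) 1 \<le> B" using trunc_var_bounded by auto
  have "norm (r n z - r n w) \<le> norm (z - w) * (kern_const z * kern_const w) * B" if "Im z \<noteq> 0" "Im w \<noteq> 0" for n z w
  proof -
    have "norm (r n z - r n w) = real (k n) * norm (psi (m n) z / z - psi (m n) w / w)"
      unfolding r_def right_diff_distrib[symmetric] norm_mult by simp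
    also have "\<dots> \<le> real (k n) * (norm (z - w) * (kern_const z * kern_const w) * trunc_var (m n) 1)"
      by (intro mult_left_mono psi_ratio_lipschitz m that) auto
    also have "\<dots> = norm (z - w) * (kern_const z * kern_const w) * (real (k n) * trunc_var (m n) 1)"
      by simp
    also have "\<dots> \<le> norm (z - w) * (kern_const z * kern_const w) * B"
      using B(2) kern_const_ge_1[of z] kern_const_ge_1[of w] by (intro mult_left_mono) auto
    finally show ?thesis .
  qed
  then show thesis using B(1) that by blast
qed

lemma r_diff_tendsto:
  assumes "Z \<longlonglongrightarrow> z" "Im z \<noteq> 0" "\<And>n. Im (Z n) \<noteq> 0"
  shows "(\<lambda>n. r n (Z n) - r n z) \<longlonglongrightarrow> 0"
proof -
  obtain B where B: "B \<ge> 0" "\<And>n z w. Im z \<noteq> 0 \<Longrightarrow> Im w \<noteq> 0 \<Longrightarrow>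
    norm (r n z - r n w) \<le> norm (z - w) * (kern_const z * kern_const w) * B" using r_lipschitz by blast
  have "(\<lambda>n. norm (Z n - z) * (kern_const (Z n) * kern_const z) * B) \<longlonglongrightarrow> norm (z - z) * (kern_const z * kern_const z) * B"
    unfolding kern_const_def by (intro tendsto_intros assms(1)) (use assms(2) in auto)
  then have "(\<lambda>n. norm (Z n - z) * (kern_const (Z n) * kern_const z) * B) \<longlonglongrightarrow> 0" by simp
  then show ?thesis
    by (rule Lim_null_comparison[rotated]) (use B(2) assms in \<open>auto intro!: always_eventually\<close>)
qed

text \<open>On a small Stolz domain the values at \<open>Z0 n w\<close> converge by
  \<open>R0_limit\<close>, and the Lipschitz bound moves them from \<open>Z0 n w\<close> to w;
  Vitali's theorem carries the limit to the half-plane. Local boundedness comes from the Lipschitz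
  bound too, started at a point where \<open>r\<close> is bounded.\<close>

lemma r_limit:
  assumes z: "Im z \<noteq> 0"
  shows "(\<lambda>n. r n z) \<longlonglongrightarrow> free_levy_R \<gamma> \<sigma> z"
proof -
  obtain a b where ab: "0 < a" "a \<le> 1" "0 < b" "b \<le> b0"
    and lim: "\<And>z. z \<in> stolz_domain a b \<Longrightarrow> (\<lambda>n. R0 n z) \<longlonglongrightarrow> free_levy_R \<gamma> \<sigma> z"
    using R0_limit by blast
  obtain c :: real where c: "c = 1 \<or> c = -1" "z \<in> half_plane c" using nonreal_half_plane[OF z] by blast
  obtain B where B: "B \<ge> 0" "\<And>n z w. Im z \<noteq> 0 \<Longrightarrow> Im w \<noteq> 0 \<Longrightarrow>
    norm (r n z - r n w) \<le> norm (z - w) * (kern_const z * kern_const w) * B" using r_lipschitz by blast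
  have sub: "half_stolz c a b \<subseteq> stolz_domain a b" using c(1) by (auto simp: stolz_domain_eq_halves)
  have sub1: "stolz_domain a b \<subseteq> stolz_domain 1 b0" using ab by (intro stolz_domain_mono) auto
  have rZ: "r n (Z0 n w) = w * R0 n w / Z0 n w" if "w \<in> stolz_domain 1 b0" for n w
    using Z0_props(2)[OF that, of n] k_pos[of n] by (simp add: r_def)
  show ?thesis
  proof (rule vitali_convergence_to[of "half_plane c" r "half_stolz c a b"])
    show "r n holomorphic_on half_plane c" for n
      unfolding r_def using half_plane_props(5) half_plane_props(5)[of 0 c]
      by (intro holomorphic_intros psi_holomorphic[OF m]) auto
    show "free_levy_R \<gamma> \<sigma> holomorphic_on half_plane c"
      using half_plane_props(5) by (intro levy_holomorphic[OF \<sigma>]) auto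
    show "(\<lambda>n. r n w) \<longlonglongrightarrow> free_levy_R \<gamma> \<sigma> w" if w: "w \<in> half_stolz c a b" for w
    proof -
      have ws: "w \<in> stolz_domain a b" "w \<in> stolz_domain 1 b0" using w sub sub1 by auto
      have w0: "Im w \<noteq> 0" "w \<noteq> 0" using stolz_norm_le[OF ws(2)] by auto
      note Zp = Z0_props[OF ws(2)]
      have "(\<lambda>n. w * R0 n w / Z0 n w) \<longlonglongrightarrow> w * free_levy_R \<gamma> \<sigma> w / w"
        by (intro tendsto_intros lim[OF ws(1)] Zp(6) w0)
      then have "(\<lambda>n. r n (Z0 n w)) \<longlonglongrightarrow> free_levy_R \<gamma> \<sigma> w" using w0 by (simp add: rZ[OF ws(2)])
      from tendsto_diff[OF this r_diff_tendsto[OF Zp(6) w0(1) Zp(1)]]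
      show ?thesis by simp
    qed
    fix K assume K: "compact K" "K \<subseteq> half_plane c"
    then obtain C where C: "C \<ge> 0" "\<And>z. z \<in> K \<Longrightarrow> kern_const z \<le> C" "\<And>z. z \<in> K \<Longrightarrow> norm z \<le> C"
      using kern_const_bounded_on_compact[of K] half_plane_props(5) by (metis subsetD)
    \<comment> \<open>This base point may lie in the other half-plane: the Lipschitz bound of
      \<open>r\<close> compares points across the real axis as well.\<close>
    obtain w where w: "w \<in> stolz_domain 1 b0"
      using half_stolz_nonempty[of 1 b0 1] b0(1) by (auto simp: stolz_domain_eq_halves)
    have w0: "norm w > 0" using stolz_norm_le[OF w] by auto
    note Zp = Z0_props[OF w]
    define C0 where "C0 = 1 + (1 + 2 * norm w) / (norm w / 2)"
    have kZ: "kern_const (Z0 n w) \<le> C0" for n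
      unfolding kern_const_def C0_def using Zp(3,4)[of n] w0 by (intro add_left_mono frac_le) auto
    have C0: "0 \<le> C0" using w0 by (simp add: C0_def)
    have rb: "norm (r n (Z0 n w)) \<le> 4 / 50 / (norm w / 2)" for n
      unfolding rZ[OF w] norm_divide using R0(3)[OF w, of n] Zp(3,4)[of n] abs_Im_le_cmod[of "Z0 n w"] w0
      by (intro frac_le) auto
    have "norm (r n z) \<le> 4 / 50 / (norm w / 2) + (C + 2 * norm w) * (C * C0) * B" if "z \<in> K" for n z
    proof -
      have "norm (r n z - r n (Z0 n w)) \<le> norm (z - Z0 n w) * (kern_const z * kern_const (Z0 n w)) * B"
        using that K(2) half_plane_props(5) Zp(1) by (intro B(2)) auto
      also have "\<dots> \<le> (C + 2 * norm w) * (C * C0) * B"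
        using C(2,3)[OF that] Zp(3)[of n] kZ[of n] kern_const_ge_1[of z] kern_const_ge_1[of "Z0 n w"] C(1) C0 B(1) w0
          norm_triangle_ineq4[of z "Z0 n w"]
        by (intro mult_mono) (auto intro: mult_nonneg_nonneg)
      finally show ?thesis using rb[of n] norm_triangle_sub[of "r n z" "r n (Z0 n w)"] by linarith
    qed
    then show "\<exists>B. \<forall>n. \<forall>z\<in>K. norm (r n z) \<le> B" by blast
  qed (use c half_plane_props half_stolz_nonempty[OF ab(1,3) c(1)] open_half_stolz in auto)
qed

end

context free_limit
begin

text \<open>On a large Stolz domain only an R-transform defined by continuation is available; the
  inverse functions avoid the real axis, hence form a normal family.\<close>

lemma R_transform_limit:
  assumes pos: "\<alpha> > 0" "\<beta> > 0" and R: "\<And>n. is_R_transform \<alpha> \<beta> (m n) (R n)"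
    and z: "z \<in> stolz_domain \<alpha> \<beta>"
  shows "(\<lambda>n. 1 / (1 / z + R n z)) \<longlonglongrightarrow> z"
    and "(\<lambda>n. of_nat (k n) * R n z) \<longlonglongrightarrow> free_levy_R \<gamma> \<sigma> z"
proof -
  define Z where "Z n z = 1 / (1 / z + R n z)" for n z
  define a where "a = min 1 \<alpha>"
  define b where "b = min b0 \<beta>"
  have ab: "0 < a" "a \<le> 1" "a \<le> \<alpha>" "0 < b" "b \<le> b0" "b \<le> \<beta>" using pos b0(1) by (auto simp: a_def b_def)
  obtain c :: real where c: "c = 1 \<or> c = -1" "z \<in> half_stolz c \<alpha> \<beta>"
    using z by (auto simp: stolz_domain_eq_halves)
  have cc: "c * c = 1" using c(1) by auto
  have sub: "half_stolz c \<alpha>' \<beta>' \<subseteq> stolz_domain \<alpha>' \<beta>'" for \<alpha>' \<beta>'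
    using c(1) by (auto simp: stolz_domain_eq_halves)
  note D = is_R_transformD[OF m R, folded Z_def]
  have small: "Z n w = Z0 n w" "w \<in> stolz_domain 1 b0" if "w \<in> half_stolz c a b" for n w
  proof -
    have w: "w \<in> stolz_domain (min 1 \<alpha>) (min b0 \<beta>)" using that sub by (auto simp: a_def b_def)
    show "Z n w = Z0 n w"
      using R_transform_unique[OF m[of n] R0(2) R _ b0(1) pos w] by (simp add: Z_def Z0_def)
    show "w \<in> stolz_domain 1 b0" using w stolz_domain_mono[of "min 1 \<alpha>" 1 "min b0 \<beta>" b0] by auto
  qed
  have holZ: "Z n holomorphic_on half_stolz c \<alpha> \<beta>" for n
  proof -
    have "R n holomorphic_on half_stolz c \<alpha> \<beta>"
      using R[of n] sub by (auto simp: is_R_transform_def intro: holomorphic_on_subset)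
    moreover have "w \<noteq> 0" "1 / w + R n w \<noteq> 0" if "w \<in> half_stolz c \<alpha> \<beta>" for w
      using that sub Im_nonzero_stolz_domain[of w \<alpha> \<beta>] R[of n] Reals_0
      by (force simp: is_R_transform_def)+
    ultimately show ?thesis unfolding Z_def by (intro holomorphic_intros) auto
  qed
  \<comment> \<open>Im (Z n w) is continuous on a connected component, vanishes nowhere by the
    definition of the R-transform, and has the sign of c at a point of the small domain, where Z n =
    Z0 n is close to the identity.\<close>
  have sign: "c * Im (Z n w) > 0" if w: "w \<in> half_stolz c \<alpha> \<beta>" for n w
  proof (rule ccontr)
    assume neg: "\<not> c * Im (Z n w) > 0"
    obtain v where v: "v \<in> half_stolz c a b" using half_stolz_nonempty[OF ab(1,4) c(1)] by blast
    note vs = small[OF v]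
    have vn: "norm v \<le> 3 / 2 * \<bar>Im v\<bar>" using stolz_norm_le[OF vs(2)] by (intro norm_le_Im) simp
    have "\<bar>Im (Z0 n v) - Im v\<bar> \<le> norm v / 9"
      using Z0_props(5)[OF vs(2), of n] abs_Im_le_cmod[of "Z0 n v - v"] by simp
    moreover have "c * Im v > 0" using v by (simp add: half_stolz_def)
    ultimately have pv: "c * Im (Z n v) > 0" using vn c(1) unfolding vs(1) by (elim disjE; simp; linarith)
    have "v \<in> half_stolz c \<alpha> \<beta>" using v half_stolz_mono[OF ab(3,6)] by auto
    moreover have "connected ((\<lambda>w. c * Im (Z n w)) ` half_stolz c \<alpha> \<beta>)"
      by (intro connected_continuous_image convex_connected convex_half_stolz continuous_intros
          holomorphic_on_imp_continuous_on holZ)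
    ultimately have "{c * Im (Z n w)..c * Im (Z n v)} \<subseteq> (\<lambda>w. c * Im (Z n w)) ` half_stolz c \<alpha> \<beta>"
      using w by (intro connected_contains_Icc) auto
    moreover have "0 \<in> {c * Im (Z n w)..c * Im (Z n v)}" using neg pv by auto
    ultimately obtain u where "u \<in> half_stolz c \<alpha> \<beta>" "c * Im (Z n u) = 0" by auto
    then show False using D(1)[of u n] sub c(1) by auto
  qed
  \<comment> \<open>The Cayley transform of the half-plane with sign c; it sends Z n into the closed
    unit disc, which bounds the family uniformly on the whole component.\<close>
  define C where "C n w = (Z n w - c * \<i>) / (Z n w + c * \<i>)" for n w
  have den: "w + c * \<i> \<noteq> 0" "norm ((w - c * \<i>) / (w + c * \<i>)) \<le> 1" if "c * Im w > 0" for w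
  proof -
    have "c * Im (w + c * \<i>) = c * Im w + 1" using cc by (simp add: algebra_simps)
    then have "Im (w + c * \<i>) \<noteq> 0" using that by (metis add_pos_pos mult_zero_right order_less_irrefl zero_less_one)
    then show nz: "w + c * \<i> \<noteq> 0" by (rule contrapos_nn) (simp only: zero_complex.sel)
    have "(norm (w - c * \<i>))\<^sup>2 \<le> (norm (w + c * \<i>))\<^sup>2"
      using that by (simp add: cmod_power2) (simp add: power2_eq_square algebra_simps)
    then have "norm (w - c * \<i>) \<le> norm (w + c * \<i>)" by (rule power2_le_imp_le) simp
    then show "norm ((w - c * \<i>) / (w + c * \<i>)) \<le> 1" using nz by (simp add: norm_divide divide_le_eq)
  qed
  have zc: "c * Im z > 0" using c(2) by (simp add: half_stolz_def)
  have "(\<lambda>n. C n z) \<longlonglongrightarrow> (z - c * \<i>) / (z + c * \<i>)"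
  proof (rule vitali_convergence_to[of "half_stolz c \<alpha> \<beta>" C "half_stolz c a b"])
    show "C n holomorphic_on half_stolz c \<alpha> \<beta>" for n
      unfolding C_def using den(1)[OF sign] by (intro holomorphic_intros holZ) auto
    show "(\<lambda>z. (z - c * \<i>) / (z + c * \<i>)) holomorphic_on half_stolz c \<alpha> \<beta>"
      using den(1) by (intro holomorphic_intros) (auto simp: half_stolz_def)
    show "\<exists>B. \<forall>n. \<forall>z\<in>K. norm (C n z) \<le> B" if "K \<subseteq> half_stolz c \<alpha> \<beta>" for K
      unfolding C_def using den(2)[OF sign] that by (intro exI[of _ 1]) auto
    show "(\<lambda>n. C n w) \<longlonglongrightarrow> (w - c * \<i>) / (w + c * \<i>)" if w: "w \<in> half_stolz c a b" for w
    proof -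
      have "c * Im w > 0" using w by (simp add: half_stolz_def)
      then show ?thesis
        unfolding C_def small(1)[OF w] using small(2)[OF w] by (intro tendsto_intros Z0_props(6) den(1))
    qed
  qed (use half_stolz_nonempty[OF ab(1,4) c(1)] half_stolz_mono[OF ab(3,6)] c(2) in
      \<open>auto simp: open_half_stolz convex_connected convex_half_stolz\<close>)
  moreover have cayley_inv: "c * \<i> * (1 + (w - c * \<i>) / (w + c * \<i>)) / (1 - (w - c * \<i>) / (w + c * \<i>)) = w"
      "1 - (w - c * \<i>) / (w + c * \<i>) \<noteq> 0" if "c * Im w > 0" for w
  proof -
    have "c \<noteq> 0" using c(1) by auto
    have 1: "1 - (w - c * \<i>) / (w + c * \<i>) = 2 * (c * \<i>) / (w + c * \<i>)"
      "1 + (w - c * \<i>) / (w + c * \<i>) = 2 * w / (w + c * \<i>)"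
      using den(1)[OF that] by (simp_all add: field_simps)
    then show "1 - (w - c * \<i>) / (w + c * \<i>) \<noteq> 0" using den(1)[OF that] \<open>c \<noteq> 0\<close> by simp
    show "c * \<i> * (1 + (w - c * \<i>) / (w + c * \<i>)) / (1 - (w - c * \<i>) / (w + c * \<i>)) = w"
      unfolding 1 using den(1)[OF that] \<open>c \<noteq> 0\<close> by simp
  qed
  ultimately have "(\<lambda>n. c * \<i> * (1 + C n z) / (1 - C n z)) \<longlonglongrightarrow>
      c * \<i> * (1 + (z - c * \<i>) / (z + c * \<i>)) / (1 - (z - c * \<i>) / (z + c * \<i>))"
    by (intro tendsto_intros cayley_inv(2)[OF zc])
  then have lim: "(\<lambda>n. Z n z) \<longlonglongrightarrow> z"
    unfolding C_def cayley_inv(1)[OF zc] cayley_inv(1)[OF sign[OF c(2)]] .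
  then show "(\<lambda>n. 1 / (1 / z + R n z)) \<longlonglongrightarrow> z" by (simp add: Z_def)
  have imz: "Im z \<noteq> 0" "z \<noteq> 0" using Im_nonzero_stolz_domain[OF z] by auto
  have "(\<lambda>n. (r n (Z n z) - r n z) + r n z) \<longlonglongrightarrow> 0 + free_levy_R \<gamma> \<sigma> z"
    by (intro tendsto_intros r_diff_tendsto lim r_limit imz D(1)[OF z])
  \<comment> \<open>Since psi at Z n z equals z R n z, the factor Z n z / z turns
    \<open>r n (Z n z)\<close> into k_n R n z.\<close>
  then have "(\<lambda>n. Z n z / z * r n (Z n z)) \<longlonglongrightarrow> z / z * free_levy_R \<gamma> \<sigma> z"
    using imz by (intro tendsto_intros lim) auto
  moreover have "Z n z / z * r n (Z n z) = of_nat (k n) * R n z" for n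
  proof -
    have "Z n z \<noteq> 0" using D(1)[OF z, of n] by auto
    then show ?thesis using imz D(3)[OF z, of n] by (simp add: r_def)
  qed
  ultimately show "(\<lambda>n. of_nat (k n) * R n z) \<longlonglongrightarrow> free_levy_R \<gamma> \<sigma> z" using imz by simp
qed

end

subsection \<open>Weighted sequences of measures in the plane\<close>

lemma integral_density_weight:
  fixes f :: "'a \<Rightarrow> 'b::{banach, second_countable_topology}"
  assumes "a \<in> borel_measurable M" "f \<in> borel_measurable M" "\<And>x. 0 \<le> a x"
  shows "(\<integral>x. f x \<partial>density M (\<lambda>x. ennreal (a x))) = (\<integral>x. a x *\<^sub>R f x \<partial>M)"
  using assms by (intro integral_density) auto

lemma finite_borel_density:
  assumes "sets M = sets borel" "integrable M a" "\<And>x. 0 \<le> a x"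
  shows "finite_borel (density M (\<lambda>x. ennreal (a x)))"
    and "A \<in> sets borel \<Longrightarrow> measure (density M (\<lambda>x. ennreal (a x))) A = (\<integral>x. a x * indicator A x \<partial>M)"
proof -
  have [measurable]: "a \<in> borel_measurable M" using assms(2) by simp
  have em: "emeasure (density M (\<lambda>x. ennreal (a x))) A = ennreal (\<integral>x. a x * indicator A x \<partial>M)"
    if A: "A \<in> sets borel" for A
  proof -
    have "A \<in> sets M" using A assms(1) by simp
    then have "integrable M (\<lambda>x. a x * indicator A x)" using assms(2) by (simp add: integrable_real_mult_indicator)
    moreover have "emeasure (density M (\<lambda>x. ennreal (a x))) A = (\<integral>\<^sup>+x. ennreal (a x * indicator A x) \<partial>M)"
      using \<open>A \<in> sets M\<close> by (subst emeasure_density) (auto intro!: nn_integral_cong split: split_indicator)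
    ultimately show ?thesis
      using assms(3) by (simp add: nn_integral_eq_integral)
  qed
  have "finite_measure (density M (\<lambda>x. ennreal (a x)))"
  proof
    have "space M \<in> sets borel" using assms(1) sets.top[of M] by simp
    then show "emeasure (density M (\<lambda>x. ennreal (a x))) (space (density M (\<lambda>x. ennreal (a x)))) \<noteq> \<infinity>"
      using em[of "space M"] by simp
  qed
  then show "finite_borel (density M (\<lambda>x. ennreal (a x)))"
    using assms(1) by (simp add: finite_borel_def)
  show "measure (density M (\<lambda>x. ennreal (a x))) A = (\<integral>x. a x * indicator A x \<partial>M)" if "A \<in> sets borel"
    using em[OF that] assms(3) by (simp add: measure_def integral_nonneg_AE)
qed

text \<open>All weights are at least 1, so the masses c n lie in [1, C]. Normalising is therefore
  harmless, and a further subsequence makes the masses converge to some l; the limit measure is l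
  times the weak limit of the normalised measures.\<close>

lemma weighted_subsequence:
  fixes \<mu> :: "nat \<Rightarrow> (real \<times> real) measure" and a :: "nat \<Rightarrow> real \<times> real \<Rightarrow> real"
  assumes \<mu>: "\<And>n. borel_prob (\<mu> n)" and a: "\<And>n. integrable (\<mu> n) (a n)" "\<And>n x. 1 \<le> a n x"
    and C: "\<And>n. (\<integral>x. a n x \<partial>\<mu> n) \<le> C"
    and tight: "\<And>e. e > 0 \<Longrightarrow> \<exists>T. \<forall>n. (\<integral>x. a n x * indicator (- ({-T..T} \<times> {-T..T})) x \<partial>\<mu> n) \<le> e"
  obtains r p where "strict_mono (r :: nat \<Rightarrow> nat)" "finite_borel p"
    "\<And>f :: real \<times> real \<Rightarrow> real. continuous_on UNIV f \<Longrightarrow> bounded (range f) \<Longrightarrow>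
      (\<lambda>n. \<integral>x. a (r n) x * f x \<partial>\<mu> (r n)) \<longlonglongrightarrow> (\<integral>x. f x \<partial>p)"
proof -
  define c where "c n = (\<integral>x. a n x \<partial>\<mu> n)" for n
  have sets: "sets (\<mu> n) = sets borel" and prob: "prob_space (\<mu> n)" for n using \<mu> by (auto simp: borel_prob_def)
  have c1: "1 \<le> c n" for n
  proof -
    interpret prob_space "\<mu> n" by (rule prob)
    have "(\<integral>x. 1 \<partial>\<mu> n) \<le> (\<integral>x. a n x \<partial>\<mu> n)" using a by (intro integral_mono) auto
    then show ?thesis by (simp add: c_def prob_space)
  qed
  have pos: "0 \<le> a n x / c n" for n x using a(2)[of n x] c1[of n] by (intro divide_nonneg_nonneg) auto
  define N where "N n = density (\<mu> n) (\<lambda>x. ennreal (a n x / c n))" for n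
  have int: "integrable (\<mu> n) (\<lambda>x. a n x / c n)" for n using a(1) by simp
  note fb = finite_borel_density[OF sets int pos, folded N_def]
  have N: "borel_prob (N n)" for n
  proof -
    have "space (\<mu> n) = UNIV" using sets_eq_imp_space_eq[OF sets[of n]] by simp
    then have "measure (N n) UNIV = 1" using c1[of n] fb(2)[of UNIV n] by (simp add: c_def)
    moreover have "space (N n) = UNIV" using \<open>space (\<mu> n) = UNIV\<close> by (simp add: N_def)
    moreover have "finite_measure (N n)" using fb(1) by (simp add: finite_borel_def)
    ultimately have "prob_space (N n)"
      by (intro prob_spaceI) (simp add: finite_measure.emeasure_eq_measure)
    then show ?thesis using fb(1)[of n] by (simp add: borel_prob_def finite_borel_def)
  qed
  have "\<exists>T. \<forall>n. measure (N n) (- ({-T..T} \<times> {-T..T})) \<le> e" if e: "e > 0" for e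
  proof -
    obtain T where T: "\<And>n. (\<integral>x. a n x * indicator (- ({-T..T} \<times> {-T..T})) x \<partial>\<mu> n) \<le> e"
      using tight[OF e] by auto
    have "measure (N n) (- ({-T..T} \<times> {-T..T})) \<le> e" for n
    proof -
      have b: "- ({-T..T} \<times> {-T..T}) \<in> sets (borel :: (real \<times> real) measure)"
        by (intro borel_comp borel_closed closed_Times) auto
      have "measure (N n) (- ({-T..T} \<times> {-T..T})) = (\<integral>x. a n x * indicator (- ({-T..T} \<times> {-T..T})) x \<partial>\<mu> n) / c n"
        unfolding fb(2)[OF b] by simp
      also have "\<dots> \<le> (\<integral>x. a n x * indicator (- ({-T..T} \<times> {-T..T})) x \<partial>\<mu> n) / 1"
        using c1[of n] a(2)[of n] order_trans[OF zero_le_one a(2)]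
        by (intro divide_left_mono Bochner_Integration.integral_nonneg mult_nonneg_nonneg) auto
      finally show ?thesis using T[of n] by simp
    qed
    then show ?thesis by blast
  qed
  then obtain r1 M where r1: "strict_mono (r1 :: nat \<Rightarrow> nat)" "borel_prob M" "weakly_converges (N \<circ> r1) M"
    by (rule tight_plane_subsequence[OF N]) blast
  have "\<forall>n. c (r1 n) \<in> {1..C}" using c1 C by (auto simp: c_def)
  then obtain l r2 where r2: "strict_mono (r2 :: nat \<Rightarrow> nat)" "((\<lambda>n. c (r1 n)) \<circ> r2) \<longlonglongrightarrow> l" "l \<in> {1..C}"
    using compact_Icc[of 1 C] unfolding compact_def by (metis (no_types, lifting))
  have l: "0 \<le> l" using r2(3) by simp
  have Ms: "sets M = sets borel" "prob_space M" using r1(2) by (auto simp: borel_prob_def)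
  interpret M: prob_space M by (rule Ms)
  have iM: "integrable M (\<lambda>x. l)" by simp
  note fbM = finite_borel_density[OF Ms(1) iM l]
  show thesis
  proof (rule that[of "r1 \<circ> r2", OF strict_mono_o[OF r1(1) r2(1)] fbM(1)])
    fix f :: "real \<times> real \<Rightarrow> real" assume f: "continuous_on UNIV f" "bounded (range f)"
    have fm: "f \<in> borel_measurable borel" using f(1) by (rule borel_measurable_continuous_onI)
    have "(\<lambda>n. \<integral>x. f x \<partial>N (r1 n)) \<longlonglongrightarrow> (\<integral>x. f x \<partial>M)"
      using r1(3) f by (simp add: weakly_converges_def)
    from LIMSEQ_subseq_LIMSEQ[OF this r2(1)]
    have "(\<lambda>n. \<integral>x. f x \<partial>N (r1 (r2 n))) \<longlonglongrightarrow> (\<integral>x. f x \<partial>M)" by (simp add: o_def)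
    from tendsto_mult[OF r2(2) this]
    have "(\<lambda>n. c (r1 (r2 n)) * (\<integral>x. f x \<partial>N (r1 (r2 n)))) \<longlonglongrightarrow> l * (\<integral>x. f x \<partial>M)" by (simp add: o_def)
    moreover have "c n * (\<integral>x. f x \<partial>N n) = (\<integral>x. a n x * f x \<partial>\<mu> n)" for n
    proof -
      have "f \<in> borel_measurable (\<mu> n)" using fm sets by (simp cong: measurable_cong_sets)
      then have "(\<integral>x. f x \<partial>N n) = (\<integral>x. (a n x / c n) *\<^sub>R f x \<partial>\<mu> n)"
        unfolding N_def by (rule integral_density_weight[OF borel_measurable_integrable[OF int] _ pos])
      also have "\<dots> = (\<integral>x. a n x * f x \<partial>\<mu> n) / c n" by simp
      finally show ?thesis using c1[of n] by simp
    qed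
    moreover have "(\<integral>x. f x \<partial>density M (\<lambda>x. ennreal l)) = l * (\<integral>x. f x \<partial>M)"
      using l fm Ms by (subst integral_density_weight) (auto cong: measurable_cong_sets)
    ultimately show "(\<lambda>n. \<integral>x. a ((r1 \<circ> r2) n) x * f x \<partial>\<mu> ((r1 \<circ> r2) n)) \<longlonglongrightarrow> (\<integral>x. f x \<partial>density M (\<lambda>x. ennreal l))"
      by simp
  qed
qed

subsection \<open>Signed integrals\<close>

text \<open>g is split as (|g| + g) - |g|, a difference of nonnegative integrable densities, and
  \<open>signed_integral_diff\<close> evaluates the integral through this splitting.\<close>

lemma signed_density_decomposition:
  fixes \<mu> :: "'a::topological_space measure" and g :: "'a \<Rightarrow> real"
  assumes \<mu>: "borel_prob \<mu>" and g: "integrable \<mu> g"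
  shows "finite_signed_measure (signed_density \<mu> g)"
    and "f \<in> borel_measurable borel \<Longrightarrow> (\<And>x. \<bar>f x\<bar> \<le> B) \<Longrightarrow> signed_integral (signed_density \<mu> g) f = (\<integral>x. g x * f x \<partial>\<mu>)"
proof -
  have sets: "sets \<mu> = sets borel" using \<mu> by (simp add: borel_prob_def)
  define p where "p = density \<mu> (\<lambda>x. ennreal (\<bar>g x\<bar> + g x))"
  define q where "q = density \<mu> (\<lambda>x. ennreal \<bar>g x\<bar>)"
  have ip: "integrable \<mu> (\<lambda>x. \<bar>g x\<bar> + g x)" and iq: "integrable \<mu> (\<lambda>x. \<bar>g x\<bar>)" using g by auto
  have pos: "0 \<le> \<bar>g x\<bar> + g x" "0 \<le> \<bar>g x\<bar>" for x by auto
  note p = finite_borel_density[OF sets ip pos(1), folded p_def]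
  note q = finite_borel_density[OF sets iq pos(2), folded q_def]
  have eq: "signed_density \<mu> g A = measure p A - measure q A" if A: "A \<in> sets borel" for A
  proof -
    have As: "A \<in> sets \<mu>" using A sets by simp
    have "(\<integral>x. (\<bar>g x\<bar> + g x) * indicator A x \<partial>\<mu>) - (\<integral>x. \<bar>g x\<bar> * indicator A x \<partial>\<mu>) =
        (\<integral>x. (\<bar>g x\<bar> + g x) * indicator A x - \<bar>g x\<bar> * indicator A x \<partial>\<mu>)"
      using integrable_real_mult_indicator[OF As ip] integrable_real_mult_indicator[OF As iq]
      by (intro Bochner_Integration.integral_diff[symmetric]) auto
    also have "\<dots> = signed_density \<mu> g A"
      unfolding signed_density_def set_lebesgue_integral_def
      by (intro Bochner_Integration.integral_cong) (auto split: split_indicator)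
    finally show ?thesis using p(2)[OF A] q(2)[OF A] by simp
  qed
  have "finite_signed_measure (\<lambda>A. measure p A - measure q A)"
    by (rule finite_signed_measure_diff[OF p(1) q(1)])
  then show fsm: "finite_signed_measure (signed_density \<mu> g)"
    unfolding finite_signed_measure_def
  proof (intro conjI allI impI; elim conjE)
    show "signed_density \<mu> g {} = 0" by (simp add: eq)
    fix A :: "nat \<Rightarrow> 'a set"
    assume A: "range A \<subseteq> sets borel" "disjoint_family A"
      and H: "\<forall>A. range A \<subseteq> sets borel \<longrightarrow> disjoint_family A \<longrightarrow>
        (\<lambda>i. measure p (A i) - measure q (A i)) sums (measure p (\<Union> (range A)) - measure q (\<Union> (range A)))"
    have "A i \<in> sets borel" "\<Union> (range A) \<in> sets borel" for i using A(1) by auto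
    then show "(\<lambda>i. signed_density \<mu> g (A i)) sums signed_density \<mu> g (\<Union> (range A))"
      using H A by (simp add: eq)
  qed
  assume f: "f \<in> borel_measurable borel" "\<And>x. \<bar>f x\<bar> \<le> B"
  have fm: "f \<in> borel_measurable \<mu>" using f(1) sets by (simp cong: measurable_cong_sets)
  have gm: "g \<in> borel_measurable \<mu>" using g by simp
  have i: "integrable \<mu> (\<lambda>x. h x * f x)" if "integrable \<mu> h" for h
  proof (rule Bochner_Integration.integrable_bound[of _ "\<lambda>x. B * h x"])
    show "integrable \<mu> (\<lambda>x. B * h x)" using that by simp
    show "(\<lambda>x. h x * f x) \<in> borel_measurable \<mu>" using that fm by simp
    have "B \<ge> 0" using f(2) abs_ge_zero order_trans by blast
    then show "AE x in \<mu>. norm (h x * f x) \<le> norm (B * h x)"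
      using f(2) by (auto simp: abs_mult mult.commute intro!: mult_right_mono)
  qed
  have "signed_integral (signed_density \<mu> g) f = (\<integral>x. f x \<partial>p) - (\<integral>x. f x \<partial>q)"
    by (rule signed_integral_diff[OF p(1) q(1) eq fsm f])
  also have "(\<integral>x. f x \<partial>p) = (\<integral>x. (\<bar>g x\<bar> + g x) *\<^sub>R f x \<partial>\<mu>)"
    unfolding p_def using gm fm by (intro integral_density_weight) auto
  also have "(\<integral>x. f x \<partial>q) = (\<integral>x. \<bar>g x\<bar> *\<^sub>R f x \<partial>\<mu>)"
    unfolding q_def using gm fm by (intro integral_density_weight) auto
  also have "(\<integral>x. (\<bar>g x\<bar> + g x) *\<^sub>R f x \<partial>\<mu>) - (\<integral>x. \<bar>g x\<bar> *\<^sub>R f x \<partial>\<mu>) =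
      (\<integral>x. (\<bar>g x\<bar> + g x) * f x - \<bar>g x\<bar> * f x \<partial>\<mu>)"
    using i[OF ip] i[OF iq] by (simp add: Bochner_Integration.integral_diff)
  also have "\<dots> = (\<integral>x. g x * f x \<partial>\<mu>)" by (simp add: algebra_simps)
  finally show "signed_integral (signed_density \<mu> g) f = (\<integral>x. g x * f x \<partial>\<mu>)" .
qed

lemma signed_integral_Re_Im:
  fixes f :: "'a::topological_space \<Rightarrow> complex"
  assumes fsm: "finite_signed_measure \<rho>" and f: "f \<in> borel_measurable borel" "\<And>x. norm (f x) \<le> B"
  shows "Re (signed_integral \<rho> f) = signed_integral \<rho> (\<lambda>x. Re (f x))"
    and "Im (signed_integral \<rho> f) = signed_integral \<rho> (\<lambda>x. Im (f x))"
proof -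
  have i: "integrable (upper_variation r) f" if "finite_signed_measure r" for r
  proof (rule finite_measure.integrable_const_bound[OF finite_measure_upper_variation[OF that], of _ B])
    show "f \<in> borel_measurable (upper_variation r)" using f(1) by (simp cong: measurable_cong_sets)
  qed (use f(2) in auto)
  show "Re (signed_integral \<rho> f) = signed_integral \<rho> (\<lambda>x. Re (f x))"
    "Im (signed_integral \<rho> f) = signed_integral \<rho> (\<lambda>x. Im (f x))"
    using i[OF fsm] i[OF finite_signed_measure_uminus[OF fsm]] by (simp_all add: signed_integral_def)
qed

subsection \<open>The kernel in two variables\<close>

definition kern2 :: "complex \<Rightarrow> complex \<Rightarrow> real \<times> real \<Rightarrow> complex" where
  "kern2 z w = (\<lambda>(s, t). kern z s * kern w t)"

lemma measurable_kern2 [measurable]: "kern2 z w \<in> borel_measurable borel"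
  unfolding kern2_def by (simp add: borel_prod[symmetric])

lemma norm_kern2_le:
  assumes "Im z \<noteq> 0" "Im w \<noteq> 0"
  shows "norm (kern2 z w x) \<le> (norm z * kern_const z) * (norm w * kern_const w)"
  using norm_kern_le[OF assms(1)] norm_kern_le[OF assms(2)] kern_const_ge_1[of z]
  by (auto simp: kern2_def norm_mult split: prod.split intro!: mult_mono)

lemma continuous_on_kern2:
  assumes "Im z \<noteq> 0" "Im w \<noteq> 0" shows "continuous_on UNIV (kern2 z w)"
  unfolding kern2_def kern_def case_prod_beta'
  using one_minus_nonzero[OF assms(1)] one_minus_nonzero[OF assms(2)]
  by (intro continuous_intros) auto

lemma norm_kern2_diff_le:
  assumes "Im z \<noteq> 0" "Im w \<noteq> 0" "Im z' \<noteq> 0" "Im w' \<noteq> 0"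
  shows "norm (kern2 z' w' x - kern2 z w x) \<le>
    norm (z' - z) * (kern_const z * kern_const z') * (norm w' * kern_const w') +
    norm (w' - w) * (kern_const w * kern_const w') * (norm z * kern_const z)"
proof -
  obtain s t where x: "x = (s, t)" by (cases x)
  have "kern2 z' w' x - kern2 z w x = (kern z' s - kern z s) * kern w' t + (kern w' t - kern w t) * kern z s"
    by (simp add: x kern2_def algebra_simps)
  also have "norm \<dots> \<le> norm (kern z' s - kern z s) * norm (kern w' t) + norm (kern w' t - kern w t) * norm (kern z s)"
    by (metis norm_triangle_ineq norm_mult)
  also have "\<dots> \<le> norm (z' - z) * (kern_const z * kern_const z') * (norm w' * kern_const w') +
    norm (w' - w) * (kern_const w * kern_const w') * (norm z * kern_const z)"
    using norm_kern_diff_le[OF assms(1,3)] norm_kern_diff_le[OF assms(2,4)] norm_kern_le[OF assms(4)] norm_kern_le[OF assms(1)]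
      kern_const_ge_1[of z] kern_const_ge_1[of z'] kern_const_ge_1[of w] kern_const_ge_1[of w']
    by (intro add_mono mult_mono) auto
  finally show ?thesis .
qed

text \<open>The increment of the product of kernels minus its linear part splits into a Taylor
  remainder in z, a mixed term and a Taylor remainder in w. Each is at most a constant times the
  squared norm of the increment, uniformly in (s, t), so the estimate integrates.\<close>

lemma kern2_integral_has_derivative:
  assumes M: "finite_borel M" and z: "Im z \<noteq> 0" and w: "Im w \<noteq> 0"
  shows "\<exists>a b. ((\<lambda>(z, w). \<integral>x. kern2 z w x \<partial>M) has_derivative (\<lambda>(u, v). a * u + b * v)) (at (z, w))"
proof -
  have fin: "finite_measure M" and sM [measurable_cong]: "sets M = sets borel" using M by (auto simp: finite_borel_def)
  interpret finite_measure M by (rule fin)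
  have fs [measurable]: "fst \<in> borel_measurable (borel :: (real \<times> real) measure)"
    "snd \<in> borel_measurable (borel :: (real \<times> real) measure)"
    by (auto intro!: borel_measurable_continuous_onI continuous_intros)
  define A where "A x = dkern z (fst x) * kern w (snd x)" for x
  define B where "B x = kern z (fst x) * dkern w (snd x)" for x
  have [measurable]: "A \<in> borel_measurable borel" "B \<in> borel_measurable borel" unfolding A_def B_def by measurable
  define kz where "kz = norm z * kern_const z"
  define kw where "kw = norm w * kern_const w"
  define C1 where "C1 = 1 + 2 * (1 + norm z + \<bar>Im z\<bar>) / \<bar>Im z\<bar>"
  define C2 where "C2 = 1 + 2 * (1 + norm w + \<bar>Im w\<bar>) / \<bar>Im w\<bar>"
  have C: "0 \<le> C1" "0 \<le> C2" by (auto simp: C1_def C2_def)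
  have k0: "0 \<le> kz" "0 \<le> kw" using kern_const_ge_1[of z] kern_const_ge_1[of w] by (auto simp: kz_def kw_def)
  have iA: "integrable M A"
    by (rule integrable_const_bound[of _ "(kern_const z)\<^sup>2 * kw"])
      (use norm_dkern_le[OF z] norm_kern_le[OF w] in \<open>auto simp: A_def kw_def norm_mult intro!: mult_mono\<close>)
  have iB: "integrable M B"
    by (rule integrable_const_bound[of _ "kz * (kern_const w)\<^sup>2"])
      (use norm_dkern_le[OF w] norm_kern_le[OF z] k0 in \<open>auto simp: B_def kz_def norm_mult intro!: mult_mono\<close>)
  have ik: "integrable M (kern2 u v)" if "Im u \<noteq> 0" "Im v \<noteq> 0" for u v
    by (rule integrable_const_bound[of _ "(norm u * kern_const u) * (norm v * kern_const v)"])
      (use norm_kern2_le[OF that] in auto)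
  define K where "K = ((kern_const z)\<^sup>2 * C1 * ((norm w + \<bar>Im w\<bar>) * C2) + (kern_const z)\<^sup>2 * (kern_const w * C2) + kz * ((kern_const w)\<^sup>2 * C2)) * measure M (space M)"
  let ?d = "min (\<bar>Im z\<bar> / 2) (\<bar>Im w\<bar> / 2)"
  have main: "norm ((\<integral>x. kern2 z' w' x \<partial>M) - (\<integral>x. kern2 z w x \<partial>M) - ((\<integral>x. A x \<partial>M) * (z' - z) + (\<integral>x. B x \<partial>M) * (w' - w))) \<le>
      (norm ((z', w') - (z, w)))\<^sup>2 * K" if near: "norm ((z', w') - (z, w)) \<le> ?d" for z' w'
  proof -
    let ?r = "norm ((z', w') - (z, w))"
    have dz: "norm (z' - z) \<le> ?r" and dw: "norm (w' - w) \<le> ?r"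
      using norm_fst_le[of "z' - z" "w' - w"] norm_snd_le[of "w' - w" "z' - z"] by auto
    have nz: "Im z' \<noteq> 0" "kern_const z' \<le> C1" using kern_const_nearby[OF z, of z'] dz near by (auto simp: C1_def)
    have nw: "Im w' \<noteq> 0" "kern_const w' \<le> C2" using kern_const_nearby[OF w, of w'] dw near by (auto simp: C2_def)
    have nw': "norm w' \<le> norm w + \<bar>Im w\<bar>" using norm_triangle_sub[of w' w] dw near by auto
    have kw': "norm (kern w' t) \<le> (norm w + \<bar>Im w\<bar>) * C2" for t
      using norm_kern_le[OF nw(1), of t] mult_mono[OF nw' nw(2)] kern_const_ge_1[of w'] by auto
    have pt: "norm (kern2 z' w' x - kern2 z w x - (A x * (z' - z) + B x * (w' - w))) \<le>
        ?r\<^sup>2 * ((kern_const z)\<^sup>2 * C1 * ((norm w + \<bar>Im w\<bar>) * C2) + (kern_const z)\<^sup>2 * (kern_const w * C2) + kz * ((kern_const w)\<^sup>2 * C2))" for x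
    proof -
      obtain s t where x: "x = (s, t)" by (cases x)
      have "kern2 z' w' x - kern2 z w x - (A x * (z' - z) + B x * (w' - w)) =
         (kern z' s - kern z s - (z' - z) * dkern z s) * kern w' t +
         (z' - z) * dkern z s * (kern w' t - kern w t) + kern z s * (kern w' t - kern w t - (w' - w) * dkern w t)"
        by (simp add: x kern2_def A_def B_def algebra_simps)
      also have "norm \<dots> \<le> norm (kern z' s - kern z s - (z' - z) * dkern z s) * norm (kern w' t) +
         norm (z' - z) * norm (dkern z s) * norm (kern w' t - kern w t) + norm (kern z s) * norm (kern w' t - kern w t - (w' - w) * dkern w t)"
        unfolding norm_mult[symmetric] by (intro norm_triangle_le add_right_mono) (auto intro: norm_triangle_ineq)
      also have "\<dots> \<le> (?r\<^sup>2 * ((kern_const z)\<^sup>2 * C1)) * ((norm w + \<bar>Im w\<bar>) * C2) +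
         ?r * (kern_const z)\<^sup>2 * (?r * (kern_const w * C2)) + kz * (?r\<^sup>2 * ((kern_const w)\<^sup>2 * C2))"
      proof (intro add_mono mult_mono kw' dz norm_dkern_le z)
        have "norm (kern z' s - kern z s - (z' - z) * dkern z s) \<le> (norm (z' - z))\<^sup>2 * ((kern_const z)\<^sup>2 * kern_const z')"
          by (rule kern_taylor[OF z nz(1)])
        also have "\<dots> \<le> ?r\<^sup>2 * ((kern_const z)\<^sup>2 * C1)"
          using dz nz(2) kern_const_ge_1[of z'] by (intro mult_mono power_mono mult_left_mono) auto
        finally show "norm (kern z' s - kern z s - (z' - z) * dkern z s) \<le> ?r\<^sup>2 * ((kern_const z)\<^sup>2 * C1)" .
        have "norm (kern w' t - kern w t - (w' - w) * dkern w t) \<le> (norm (w' - w))\<^sup>2 * ((kern_const w)\<^sup>2 * kern_const w')"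
          by (rule kern_taylor[OF w nw(1)])
        also have "\<dots> \<le> ?r\<^sup>2 * ((kern_const w)\<^sup>2 * C2)"
          using dw nw(2) kern_const_ge_1[of w'] by (intro mult_mono power_mono mult_left_mono) auto
        finally show "norm (kern w' t - kern w t - (w' - w) * dkern w t) \<le> ?r\<^sup>2 * ((kern_const w)\<^sup>2 * C2)" .
        have "norm (kern w' t - kern w t) \<le> norm (w' - w) * (kern_const w * kern_const w')"
          by (rule norm_kern_diff_le[OF w nw(1)])
        also have "\<dots> \<le> ?r * (kern_const w * C2)"
          using dw nw(2) kern_const_ge_1[of w'] kern_const_ge_1[of w] by (intro mult_mono mult_left_mono) auto
        finally show "norm (kern w' t - kern w t) \<le> ?r * (kern_const w * C2)" .
        show "norm (kern z s) \<le> kz" unfolding kz_def by (rule norm_kern_le[OF z])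
      qed (use C k0 in auto)
      also have "\<dots> = ?r\<^sup>2 * ((kern_const z)\<^sup>2 * C1 * ((norm w + \<bar>Im w\<bar>) * C2) + (kern_const z)\<^sup>2 * (kern_const w * C2) + kz * ((kern_const w)\<^sup>2 * C2))"
        by (simp add: power2_eq_square algebra_simps)
      finally show ?thesis .
    qed
    have "(\<integral>x. kern2 z' w' x \<partial>M) - (\<integral>x. kern2 z w x \<partial>M) - ((\<integral>x. A x \<partial>M) * (z' - z) + (\<integral>x. B x \<partial>M) * (w' - w)) =
        (\<integral>x. kern2 z' w' x - kern2 z w x - (A x * (z' - z) + B x * (w' - w)) \<partial>M)"
      using ik[OF nz(1) nw(1)] ik[OF z w] iA iB by simp
    also have "norm \<dots> \<le> ?r\<^sup>2 * ((kern_const z)\<^sup>2 * C1 * ((norm w + \<bar>Im w\<bar>) * C2) + (kern_const z)\<^sup>2 * (kern_const w * C2) + kz * ((kern_const w)\<^sup>2 * C2)) * measure M (space M)"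
      using C k0 kern_const_ge_1[of w] by (intro norm_integral_le_const[OF fin pt]) auto
    finally show ?thesis by (simp add: K_def mult.assoc)
  qed
  have "((\<lambda>(z, w). \<integral>x. kern2 z w x \<partial>M) has_derivative (\<lambda>(u, v). (\<integral>x. A x \<partial>M) * u + (\<integral>x. B x \<partial>M) * v)) (at (z, w))"
  proof (rule has_derivativeI_sandwich[where e = ?d])
    show "0 < ?d" using z w by simp
    show "bounded_linear (\<lambda>(u, v). (\<integral>x. A x \<partial>M) * u + (\<integral>x. B x \<partial>M) * v)"
      unfolding case_prod_beta'
      by (intro bounded_linear_add bounded_linear_compose[OF bounded_linear_mult_right] bounded_linear_fst bounded_linear_snd)
    show "((\<lambda>y. norm (y - (z, w)) * K) \<longlongrightarrow> 0) (at (z, w))"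
      by (intro tendsto_eq_intros | simp)+
    fix y assume y: "y \<in> UNIV" "y \<noteq> (z, w)" "dist y (z, w) < ?d"
    obtain z' w' where y': "y = (z', w')" by (cases y)
    have "norm ((z', w') - (z, w)) \<le> ?d" using y(3) by (simp add: y' dist_norm)
    from main[OF this] y(2)
    show "norm ((case y of (z, w) \<Rightarrow> \<integral>x. kern2 z w x \<partial>M) - (case (z, w) of (z, w) \<Rightarrow> \<integral>x. kern2 z w x \<partial>M) -
        (case y - (z, w) of (u, v) \<Rightarrow> (\<integral>x. A x \<partial>M) * u + (\<integral>x. B x \<partial>M) * v)) / norm (y - (z, w)) \<le> norm (y - (z, w)) * K"
      unfolding y' by (simp add: divide_le_eq power2_eq_square mult_ac)
  qed
  then show ?thesis by blast
qed

subsection \<open>The bi-free limit theorem\<close>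

locale bifree_limit =
  fixes \<mu> :: "nat \<Rightarrow> (real \<times> real) measure" and k :: "nat \<Rightarrow> nat"
    and \<nu>1 \<nu>2 :: "nat \<Rightarrow> real measure" and \<gamma>1 \<gamma>2 :: real
    and \<sigma>1 \<sigma>2 \<nu>1_lim \<nu>2_lim :: "real measure"
  assumes \<mu>: "\<And>n. borel_prob (\<mu> n)"
    and l1: "free_limit (\<lambda>n. marginal1 (\<mu> n)) \<nu>1 k \<gamma>1 \<sigma>1 \<nu>1_lim"
    and l2: "free_limit (\<lambda>n. marginal2 (\<mu> n)) \<nu>2 k \<gamma>2 \<sigma>2 \<nu>2_lim"
begin

sublocale l1: free_limit "\<lambda>n. marginal1 (\<mu> n)" \<nu>1 k \<gamma>1 \<sigma>1 \<nu>1_lim by (rule l1)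
sublocale l2: free_limit "\<lambda>n. marginal2 (\<mu> n)" \<nu>2 k \<gamma>2 \<sigma>2 \<nu>2_lim by (rule l2)

lemma sets_\<mu> [measurable_cong]: "sets (\<mu> n) = sets borel"
  using \<mu> by (simp add: borel_prob_def)

lemma space_\<mu> [simp]: "space (\<mu> n) = UNIV"
  using sets_eq_imp_space_eq[OF sets_\<mu>] by simp

lemma prob_\<mu>: "prob_space (\<mu> n)" and fin_\<mu>: "finite_measure (\<mu> n)"
  using \<mu> by (auto simp: borel_prob_def prob_space.finite_measure)

lemma fst_snd_measurable [measurable]:
  "fst \<in> borel_measurable (borel :: (real \<times> real) measure)"
  "snd \<in> borel_measurable (borel :: (real \<times> real) measure)"
  by (auto intro!: borel_measurable_continuous_onI continuous_intros)

lemma integral_marginal1: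
  fixes f :: "real \<Rightarrow> 'b::{banach, second_countable_topology}"
  assumes "f \<in> borel_measurable borel"
  shows "(\<integral>s. f s \<partial>marginal1 (\<mu> n)) = (\<integral>x. f (fst x) \<partial>\<mu> n)"
    and "integrable (marginal1 (\<mu> n)) f \<longleftrightarrow> integrable (\<mu> n) (\<lambda>x. f (fst x))"
  unfolding marginal1_def using assms
  by (auto intro!: integral_distr integrable_distr_eq)

lemma integral_marginal2:
  fixes f :: "real \<Rightarrow> 'b::{banach, second_countable_topology}"
  assumes "f \<in> borel_measurable borel"
  shows "(\<integral>s. f s \<partial>marginal2 (\<mu> n)) = (\<integral>x. f (snd x) \<partial>\<mu> n)"
    and "integrable (marginal2 (\<mu> n)) f \<longleftrightarrow> integrable (\<mu> n) (\<lambda>x. f (snd x))"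
  unfolding marginal2_def using assms
  by (auto intro!: integral_distr integrable_distr_eq)

section \<open>Mass and tightness of the signed densities\<close>

definition tau :: "real \<Rightarrow> real \<Rightarrow> real" where "tau y s = (y * s)\<^sup>2 / (1 + (y * s)\<^sup>2)"

lemma measurable_tau [measurable]: "tau y \<in> borel_measurable borel"
  unfolding tau_def by measurable

lemma tau_bounds: "0 \<le> tau y s" "tau y s \<le> 1"
  using trunc_integrand_bounds[of y s] by (auto simp: tau_def)

lemma integral_tau:
  "(\<integral>x. tau y (fst x) \<partial>\<mu> n) = trunc_var (marginal1 (\<mu> n)) y"
  "(\<integral>x. tau y (snd x) \<partial>\<mu> n) = trunc_var (marginal2 (\<mu> n)) y"
  "integrable (\<mu> n) (\<lambda>x. tau y (fst x))" "integrable (\<mu> n) (\<lambda>x. tau y (snd x))"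
proof -
  show "(\<integral>x. tau y (fst x) \<partial>\<mu> n) = trunc_var (marginal1 (\<mu> n)) y"
    "(\<integral>x. tau y (snd x) \<partial>\<mu> n) = trunc_var (marginal2 (\<mu> n)) y"
    using integral_marginal1(1)[OF measurable_tau, of n y] integral_marginal2(1)[OF measurable_tau, of n y]
    by (simp_all add: trunc_var_def tau_def)
  show "integrable (\<mu> n) (\<lambda>x. tau y (fst x))" "integrable (\<mu> n) (\<lambda>x. tau y (snd x))"
    by (rule finite_measure.integrable_const_bound[OF fin_\<mu>, of _ 1]; use tau_bounds in auto)+
qed

text \<open>The density of \<rho>_n with respect to \<mu>_n.\<close>

definition dens :: "nat \<Rightarrow> real \<times> real \<Rightarrow> real" where
  "dens n = (\<lambda>(s, t). real (k n) * (s * t / (sqrt (1 + s\<^sup>2) * sqrt (1 + t\<^sup>2))))"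

lemma measurable_dens [measurable]: "dens n \<in> borel_measurable borel"
  unfolding dens_def by (simp add: borel_prod[symmetric])

lemma abs_div_sqrt_sq: "\<bar>s / sqrt (1 + s\<^sup>2)\<bar>\<^sup>2 = tau 1 s"
  by (simp add: tau_def power_divide add_nonneg_nonneg)

lemma abs_dens: "\<bar>dens n x\<bar> = real (k n) * (\<bar>fst x / sqrt (1 + (fst x)\<^sup>2)\<bar> * \<bar>snd x / sqrt (1 + (snd x)\<^sup>2)\<bar>)"
  by (cases x) (simp add: dens_def abs_mult abs_divide)

lemma abs_dens_le_k: "\<bar>dens n x\<bar> \<le> real (k n)"
  unfolding abs_dens
  using mult_mono[OF abs_div_sqrt_le_1[of "fst x"] abs_div_sqrt_le_1[of "snd x"]]
  by (intro mult_left_le) auto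

lemma young: "a * b \<le> l * a\<^sup>2 / 2 + b\<^sup>2 / (2 * l)" if "l > 0" for a b l :: real
proof -
  have "0 \<le> (l * a - b)\<^sup>2 / (2 * l)" using that by simp
  also have "\<dots> = l * a\<^sup>2 / 2 + b\<^sup>2 / (2 * l) - a * b"
    using that by (simp add: field_simps power2_eq_square)
  finally show ?thesis by simp
qed

lemma abs_dens_le: "\<bar>dens n x\<bar> \<le> real (k n) * (tau 1 (fst x) + tau 1 (snd x))"
proof -
  have "\<bar>fst x / sqrt (1 + (fst x)\<^sup>2)\<bar> * \<bar>snd x / sqrt (1 + (snd x)\<^sup>2)\<bar> \<le> tau 1 (fst x) / 2 + tau 1 (snd x) / 2"
    using young[of 1 "\<bar>fst x / sqrt (1 + (fst x)\<^sup>2)\<bar>" "\<bar>snd x / sqrt (1 + (snd x)\<^sup>2)\<bar>"]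
    unfolding abs_div_sqrt_sq by simp
  also have "\<dots> \<le> tau 1 (fst x) + tau 1 (snd x)" using tau_bounds(1)[of 1] by (intro add_mono) auto
  finally show ?thesis unfolding abs_dens by (intro mult_left_mono) auto
qed

lemma integrable_dens: "integrable (\<mu> n) (dens n)"
  by (rule finite_measure.integrable_const_bound[OF fin_\<mu>, of _ "real (k n)"]) (use abs_dens_le_k in auto)

text \<open>|dens| is a product of a function of s and a function of t; Young's inequality bounds it
  by truncated squares, whose integrals are \<open>trunc_var\<close> of the marginals.\<close>

lemma dens_mass_bounded: "\<exists>B\<ge>0. \<forall>n. (\<integral>x. \<bar>dens n x\<bar> \<partial>\<mu> n) \<le> B"
proof -
  obtain B1 where B1: "B1 \<ge> 0" "\<And>n. real (k n) * trunc_var (marginal1 (\<mu> n)) 1 \<le> B1"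
    using l1.trunc_var_bounded by auto
  obtain B2 where B2: "B2 \<ge> 0" "\<And>n. real (k n) * trunc_var (marginal2 (\<mu> n)) 1 \<le> B2"
    using l2.trunc_var_bounded by auto
  have "(\<integral>x. \<bar>dens n x\<bar> \<partial>\<mu> n) \<le> B1 + B2" for n
  proof -
    have "(\<integral>x. \<bar>dens n x\<bar> \<partial>\<mu> n) \<le> (\<integral>x. real (k n) * (tau 1 (fst x) + tau 1 (snd x)) \<partial>\<mu> n)"
      by (intro integral_mono integrable_abs integrable_dens abs_dens_le)
        (intro integrable_mult_right Bochner_Integration.integrable_add integral_tau)
    also have "\<dots> = real (k n) * trunc_var (marginal1 (\<mu> n)) 1 + real (k n) * trunc_var (marginal2 (\<mu> n)) 1"
      using integral_tau[of n 1] by (simp add: algebra_simps)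
    also have "\<dots> \<le> B1 + B2" using B1(2)[of n] B2(2)[of n] by simp
    finally show ?thesis .
  qed
  then show ?thesis using B1(1) B2(1) by (intro exI[of _ "B1 + B2"]) auto
qed

text \<open>A point outside the square has a coordinate beyond T, say s. Young's inequality with
  weight l bounds |dens| by l times the tail function of s plus 1 / l times the truncated square of
  t. The second term is made small by l, and only then the first by the scale y. The weight 1 + 2
  |dens| dominates both weights of \<open>dens_subsequence\<close>.\<close>

lemma dens_tight:
  assumes e: "e > 0"
  shows "\<exists>T. \<forall>n. (\<integral>x. (1 + 2 * \<bar>dens n x\<bar>) * indicator (- ({-T..T} \<times> {-T..T})) x \<partial>\<mu> n) \<le> e"
proof -
  obtain B1 where B1: "B1 \<ge> 0" "\<And>n. real (k n) * trunc_var (marginal1 (\<mu> n)) 1 \<le> B1"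
    using l1.trunc_var_bounded by auto
  obtain B2 where B2: "B2 \<ge> 0" "\<And>n. real (k n) * trunc_var (marginal2 (\<mu> n)) 1 \<le> B2"
    using l2.trunc_var_bounded by auto
  \<comment> \<open>Makes (B1 + B2) / l, the total of the 1 / l terms, at most e / 2; the added 1
    keeps l positive when B1 = B2 = 0.\<close>
  define l where "l = 2 * (B1 + B2) / e + 1"
  have l: "l > 0" "(B1 + B2) / l \<le> e / 2"
  proof -
    show l0: "l > 0" using B1(1) B2(1) e by (auto simp: l_def intro: add_nonneg_pos)
    have "2 * (B1 + B2) \<le> l * e" using e by (simp add: l_def field_simps)
    then show "(B1 + B2) / l \<le> e / 2" using l0 by (simp add: field_simps)
  qed
  \<comment> \<open>Solves (2 + 2 l) (e' + e') = e / 2, the budget left for the tails at scale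
    y.\<close>
  define e' where "e' = e / (8 * (1 + l))"
  have e': "e' > 0" "(2 + 2 * l) * (e' + e') \<le> e / 2"
  proof -
    show "e' > 0" using e l(1) by (simp add: e'_def)
    have 1: "(1 + l) * e' = e / 8" using l(1) by (simp add: e'_def field_simps)
    have 2: "(2 + 2 * l) * (e' + e') = 4 * ((1 + l) * e')" by (simp add: algebra_simps)
    show "(2 + 2 * l) * (e' + e') \<le> e / 2" unfolding 2 1 by simp
  qed
  obtain y1 where y1: "y1 > 0" "\<And>n. real (k n) * trunc_var (marginal1 (\<mu> n)) y1 \<le> e'"
    using l1.uniform_trunc_var[OF e'(1)] by auto
  obtain y2 where y2: "y2 > 0" "\<And>n. real (k n) * trunc_var (marginal2 (\<mu> n)) y2 \<le> e'"
    using l2.uniform_trunc_var[OF e'(1)] by auto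
  define y where "y = min y1 y2"
  have y: "y > 0" using y1 y2 by (simp add: y_def)
  have tv1: "real (k n) * trunc_var (marginal1 (\<mu> n)) y \<le> e'" for n
    using y1 y2 trunc_var_mono[OF l1.m, of y y1 n] y y1(2)[of n]
    by (intro order_trans[OF mult_left_mono y1(2)]) (auto simp: y_def)
  have tv2: "real (k n) * trunc_var (marginal2 (\<mu> n)) y \<le> e'" for n
    using y1 y2 trunc_var_mono[OF l2.m, of y y2 n] y y2(2)[of n]
    by (intro order_trans[OF mult_left_mono y2(2)]) (auto simp: y_def)
  define T where "T = 1 / y"
  have big: "1 \<le> 2 * tau y s" if "\<bar>s\<bar> > T" for s
  proof -
    have "1 \<le> \<bar>y * s\<bar>" using that y by (simp add: T_def abs_mult field_simps)
    then have "1 \<le> \<bar>y * s\<bar>\<^sup>2" by (rule one_le_power)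
    then have "1 + (y * s)\<^sup>2 \<le> 2 * (y * s)\<^sup>2" by simp
    then show ?thesis by (simp add: tau_def le_divide_eq add_pos_nonneg)
  qed
  have c1: "\<bar>s / sqrt (1 + s\<^sup>2)\<bar>\<^sup>2 \<le> 2 * tau y s" if "\<bar>s\<bar> > T" for s
    using big[OF that] abs_div_sqrt_le_1[of s] power_le_one[of "\<bar>s / sqrt (1 + s\<^sup>2)\<bar>" 2] by simp
  \<comment> \<open>A majorant in which every summand depends on one coordinate, so that its
    integral involves only the marginals.\<close>
  define H where "H n x = 2 * tau y (fst x) + 2 * tau y (snd x) +
      2 * (real (k n) * (l * tau y (fst x) + tau 1 (snd x) / (2 * l))) + 2 * (real (k n) * (l * tau y (snd x) + tau 1 (fst x) / (2 * l)))" for n x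
  have pt: "(1 + 2 * \<bar>dens n x\<bar>) * indicator (- ({-T..T} \<times> {-T..T})) x \<le> H n x" for n x
  proof (cases "\<bar>fst x\<bar> > T \<or> \<bar>snd x\<bar> > T")
    case False
    then have "x \<in> {-T..T} \<times> {-T..T}" by (cases x) auto
    moreover have "0 \<le> H n x"
      unfolding H_def using l(1) by (intro add_nonneg_nonneg mult_nonneg_nonneg divide_nonneg_nonneg tau_bounds) auto
    ultimately show ?thesis by simp
  next
    case True
    have nn: "0 \<le> real (k n) * (l * tau y (fst x) + tau 1 (snd x) / (2 * l))"
      "0 \<le> real (k n) * (l * tau y (snd x) + tau 1 (fst x) / (2 * l))"
      using l(1) by (intro add_nonneg_nonneg mult_nonneg_nonneg divide_nonneg_nonneg tau_bounds; simp)+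
    have "1 + 2 * \<bar>dens n x\<bar> \<le> H n x"
    proof (cases "\<bar>fst x\<bar> > T")
      case t: True
      have "\<bar>fst x / sqrt (1 + (fst x)\<^sup>2)\<bar> * \<bar>snd x / sqrt (1 + (snd x)\<^sup>2)\<bar> \<le>
         l * \<bar>fst x / sqrt (1 + (fst x)\<^sup>2)\<bar>\<^sup>2 / 2 + tau 1 (snd x) / (2 * l)"
        using young[OF l(1), of "\<bar>fst x / sqrt (1 + (fst x)\<^sup>2)\<bar>" "\<bar>snd x / sqrt (1 + (snd x)\<^sup>2)\<bar>"]
        unfolding abs_div_sqrt_sq[of "snd x"] .
      also have "\<dots> \<le> l * (2 * tau y (fst x)) / 2 + tau 1 (snd x) / (2 * l)"
        using c1[OF t] l(1) by (intro add_right_mono divide_right_mono mult_left_mono) auto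
      finally have "\<bar>dens n x\<bar> \<le> real (k n) * (l * tau y (fst x) + tau 1 (snd x) / (2 * l))"
        unfolding abs_dens by (intro mult_left_mono) auto
      then show ?thesis using big[OF t] nn tau_bounds(1)[of y "snd x"] unfolding H_def by linarith
    next
      case False
      then have t: "\<bar>snd x\<bar> > T" using True by simp
      have "\<bar>snd x / sqrt (1 + (snd x)\<^sup>2)\<bar> * \<bar>fst x / sqrt (1 + (fst x)\<^sup>2)\<bar> \<le>
         l * \<bar>snd x / sqrt (1 + (snd x)\<^sup>2)\<bar>\<^sup>2 / 2 + tau 1 (fst x) / (2 * l)"
        using young[OF l(1), of "\<bar>snd x / sqrt (1 + (snd x)\<^sup>2)\<bar>" "\<bar>fst x / sqrt (1 + (fst x)\<^sup>2)\<bar>"]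
        unfolding abs_div_sqrt_sq[of "fst x"] .
      also have "\<dots> \<le> l * (2 * tau y (snd x)) / 2 + tau 1 (fst x) / (2 * l)"
        using c1[OF t] l(1) by (intro add_right_mono divide_right_mono mult_left_mono) auto
      finally have "\<bar>dens n x\<bar> \<le> real (k n) * (l * tau y (snd x) + tau 1 (fst x) / (2 * l))"
        unfolding abs_dens mult.commute[of "\<bar>fst x / sqrt (1 + (fst x)\<^sup>2)\<bar>"] by (intro mult_left_mono) auto
      then show ?thesis using big[OF t] nn tau_bounds(1)[of y "fst x"] unfolding H_def by linarith
    qed
    moreover have "x \<notin> {-T..T} \<times> {-T..T}" using True by (cases x) auto
    ultimately show ?thesis by simp
  qed
  have "(\<integral>x. (1 + 2 * \<bar>dens n x\<bar>) * indicator (- ({-T..T} \<times> {-T..T})) x \<partial>\<mu> n) \<le> e" for n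
  proof -
    let ?k = "real (k n)" and ?v1 = "trunc_var (marginal1 (\<mu> n))" and ?v2 = "trunc_var (marginal2 (\<mu> n))"
    have iH: "integrable (\<mu> n) (H n)"
      unfolding H_def by (intro Bochner_Integration.integrable_add integrable_mult_right integral_tau integrable_divide)
    have box: "- ({-T..T} \<times> {-T..T}) \<in> sets (\<mu> n)"
      unfolding sets_\<mu> by (intro borel_comp borel_closed closed_Times) auto
    have "integrable (\<mu> n) (\<lambda>x. 1 + 2 * \<bar>dens n x\<bar>)"
      using integrable_dens[of n] finite_measure.integrable_const[OF fin_\<mu>, of n "1 :: real"] by auto
    then have "(\<integral>x. (1 + 2 * \<bar>dens n x\<bar>) * indicator (- ({-T..T} \<times> {-T..T})) x \<partial>\<mu> n) \<le> (\<integral>x. H n x \<partial>\<mu> n)"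
      by (intro integral_mono integrable_real_mult_indicator box iH pt)
    also have "\<dots> = 2 * ?v1 y + 2 * ?v2 y + 2 * (?k * (l * ?v1 y + ?v2 1 / (2 * l))) + 2 * (?k * (l * ?v2 y + ?v1 1 / (2 * l)))"
      unfolding H_def by (simp add: integral_tau Bochner_Integration.integral_add)
    also have "\<dots> \<le> 2 * (?k * ?v1 y) + 2 * (?k * ?v2 y) + 2 * (?k * (l * ?v1 y + ?v2 1 / (2 * l))) + 2 * (?k * (l * ?v2 y + ?v1 1 / (2 * l)))"
    proof -
      have "1 \<le> ?k" using l1.k_pos[of n] by simp
      then have "1 * ?v1 y \<le> ?k * ?v1 y" "1 * ?v2 y \<le> ?k * ?v2 y"
        by (intro mult_right_mono trunc_var_nonneg; simp)+
      then show ?thesis by simp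
    qed
    also have "\<dots> = (2 + 2 * l) * (?k * ?v1 y + ?k * ?v2 y) + (?k * ?v1 1 + ?k * ?v2 1) / l"
      using l(1) by (simp add: field_simps)
    also have "\<dots> \<le> (2 + 2 * l) * (e' + e') + (B1 + B2) / l"
      using tv1[of n] tv2[of n] B1(2)[of n] B2(2)[of n] l(1)
      by (intro add_mono mult_left_mono divide_right_mono) auto
    also have "\<dots> \<le> e" using e'(2) l(2) by linarith
    finally show ?thesis .
  qed
  then show ?thesis by blast
qed

text \<open>The weights 1 + |dens| + dens and 1 + |dens| differ by dens and are at least 1, as
  \<open>weighted_subsequence\<close> asks; the second extraction is made along the first. The
  limits p and q share the mass contributed by the summand 1, so p - q is a splitting but not a
  Jordan decomposition.\<close>

lemma dens_subsequence:
  assumes "strict_mono (s :: nat \<Rightarrow> nat)"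
  obtains r p q where "strict_mono (r :: nat \<Rightarrow> nat)" "finite_borel p" "finite_borel q"
    "\<And>f :: real \<times> real \<Rightarrow> real. continuous_on UNIV f \<Longrightarrow> bounded (range f) \<Longrightarrow>
      (\<lambda>n. \<integral>x. dens (s (r n)) x * f x \<partial>\<mu> (s (r n))) \<longlonglongrightarrow> (\<integral>x. f x \<partial>p) - (\<integral>x. f x \<partial>q)"
proof -
  obtain B where B: "B \<ge> 0" "\<And>n. (\<integral>x. \<bar>dens n x\<bar> \<partial>\<mu> n) \<le> B" using dens_mass_bounded by auto
  define a where "a n x = 1 + \<bar>dens n x\<bar> + dens n x" for n x
  define b where "b n x = 1 + \<bar>dens n x\<bar>" for n x
  have i1: "integrable (\<mu> n) (\<lambda>x. 1 :: real)" for n using finite_measure.integrable_const[OF fin_\<mu>] .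
  have ia: "integrable (\<mu> n) (a n)" and ib: "integrable (\<mu> n) (b n)" and ic: "integrable (\<mu> n) (\<lambda>x. 1 + 2 * \<bar>dens n x\<bar>)" for n
    unfolding a_def b_def using integrable_dens[of n] i1[of n] by auto
  have m1: "(\<integral>x. 1 \<partial>\<mu> n) = (1::real)" for n using prob_space.prob_space[OF prob_\<mu>] by simp
  have ge1: "1 \<le> a n x" "1 \<le> b n x" for n x by (auto simp: a_def b_def)
  have le: "a n x \<le> 1 + 2 * \<bar>dens n x\<bar>" "b n x \<le> 1 + 2 * \<bar>dens n x\<bar>" for n x by (auto simp: a_def b_def)
  have "(\<integral>x. 1 + 2 * \<bar>dens n x\<bar> \<partial>\<mu> n) = 1 + 2 * (\<integral>x. \<bar>dens n x\<bar> \<partial>\<mu> n)" for n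
    using integrable_dens[of n] i1[of n] m1[of n] by simp
  then have C: "(\<integral>x. a n x \<partial>\<mu> n) \<le> 1 + 2 * B" "(\<integral>x. b n x \<partial>\<mu> n) \<le> 1 + 2 * B" for n
    using integral_mono[OF ia ic le(1), of n] integral_mono[OF ib ic le(2), of n] B(2)[of n] by simp_all
  have tight: "\<exists>T. \<forall>n. (\<integral>x. w n x * indicator (- ({-T..T} \<times> {-T..T})) x \<partial>\<mu> n) \<le> e"
    if "e > 0" and w: "\<And>n. integrable (\<mu> n) (w n)" "\<And>n x. w n x \<le> 1 + 2 * \<bar>dens n x\<bar>" for e w
  proof -
    obtain T where T: "\<And>n. (\<integral>x. (1 + 2 * \<bar>dens n x\<bar>) * indicator (- ({-T..T} \<times> {-T..T})) x \<partial>\<mu> n) \<le> e"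
      using dens_tight[OF \<open>e > 0\<close>] by auto
    have "(\<integral>x. w n x * indicator (- ({-T..T} \<times> {-T..T})) x \<partial>\<mu> n) \<le> e" for n
    proof (rule order_trans[OF integral_mono T])
      have box: "- ({-T..T} \<times> {-T..T}) \<in> sets (\<mu> n)"
        unfolding sets_\<mu> by (intro borel_comp borel_closed closed_Times) auto
      show "integrable (\<mu> n) (\<lambda>x. w n x * indicator (- ({-T..T} \<times> {-T..T})) x)"
        "integrable (\<mu> n) (\<lambda>x. (1 + 2 * \<bar>dens n x\<bar>) * indicator (- ({-T..T} \<times> {-T..T})) x)"
        by (intro integrable_real_mult_indicator box w(1) ic)+
      show "w n x * indicator (- ({-T..T} \<times> {-T..T})) x \<le> (1 + 2 * \<bar>dens n x\<bar>) * indicator (- ({-T..T} \<times> {-T..T})) x" for x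
        using w(2) by (intro mult_right_mono) auto
    qed
    then show ?thesis by blast
  qed
  have tight_a: "\<exists>T. \<forall>n. (\<integral>x. a (s n) x * indicator (- ({-T..T} \<times> {-T..T})) x \<partial>\<mu> (s n)) \<le> e" if "e > 0" for e
    using tight[OF that ia le(1)] by blast
  obtain r1 p where r1: "strict_mono (r1 :: nat \<Rightarrow> nat)" "finite_borel p"
    and p: "\<And>f :: real \<times> real \<Rightarrow> real. continuous_on UNIV f \<Longrightarrow> bounded (range f) \<Longrightarrow>
      (\<lambda>n. \<integral>x. a (s (r1 n)) x * f x \<partial>\<mu> (s (r1 n))) \<longlonglongrightarrow> (\<integral>x. f x \<partial>p)"
    by (rule weighted_subsequence[OF \<mu> ia ge1(1) C(1) tight_a]) blast+
  have tight_b: "\<exists>T. \<forall>n. (\<integral>x. b (s (r1 n)) x * indicator (- ({-T..T} \<times> {-T..T})) x \<partial>\<mu> (s (r1 n))) \<le> e" if "e > 0" for e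
    using tight[OF that ib le(2)] by blast
  obtain r2 q where r2: "strict_mono (r2 :: nat \<Rightarrow> nat)" "finite_borel q"
    and q: "\<And>f :: real \<times> real \<Rightarrow> real. continuous_on UNIV f \<Longrightarrow> bounded (range f) \<Longrightarrow>
      (\<lambda>n. \<integral>x. b (s (r1 (r2 n))) x * f x \<partial>\<mu> (s (r1 (r2 n)))) \<longlonglongrightarrow> (\<integral>x. f x \<partial>q)"
    by (rule weighted_subsequence[OF \<mu> ib ge1(2) C(2) tight_b]) blast+
  show thesis
  proof (rule that[OF strict_mono_o[OF r1(1) r2(1)] r1(2) r2(2)])
    fix f :: "real \<times> real \<Rightarrow> real" assume f: "continuous_on UNIV f" "bounded (range f)"
    have fm: "f \<in> borel_measurable borel" using f(1) by (rule borel_measurable_continuous_onI)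
    obtain C where C: "\<And>x. \<bar>f x\<bar> \<le> C" using f(2) by (auto simp: bounded_iff)
    have i: "integrable (\<mu> n) (\<lambda>x. h x * f x)" if "integrable (\<mu> n) h" for h n
    proof (rule Bochner_Integration.integrable_bound[of _ "\<lambda>x. C * h x"])
      show "integrable (\<mu> n) (\<lambda>x. C * h x)" using that by simp
      have "f \<in> borel_measurable (\<mu> n)" using fm by (simp cong: measurable_cong_sets add: sets_\<mu>)
      then show "(\<lambda>x. h x * f x) \<in> borel_measurable (\<mu> n)" using that by simp
      have "C \<ge> 0" using C abs_ge_zero order_trans by blast
      then show "AE x in \<mu> n. norm (h x * f x) \<le> norm (C * h x)"
        using C by (auto simp: abs_mult mult.commute intro!: mult_right_mono)
    qed
    have "(\<integral>x. a n x * f x \<partial>\<mu> n) - (\<integral>x. b n x * f x \<partial>\<mu> n) = (\<integral>x. a n x * f x - b n x * f x \<partial>\<mu> n)" for n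
      by (intro Bochner_Integration.integral_diff[symmetric] i ia ib)
    also have "(\<integral>x. a n x * f x - b n x * f x \<partial>\<mu> n) = (\<integral>x. dens n x * f x \<partial>\<mu> n)" for n
      by (intro Bochner_Integration.integral_cong refl) (simp add: a_def b_def algebra_simps)
    finally have eq: "(\<integral>x. a n x * f x \<partial>\<mu> n) - (\<integral>x. b n x * f x \<partial>\<mu> n) = (\<integral>x. dens n x * f x \<partial>\<mu> n)" for n .
    have "(\<lambda>n. (\<integral>x. a (s (r1 (r2 n))) x * f x \<partial>\<mu> (s (r1 (r2 n)))) - (\<integral>x. b (s (r1 (r2 n))) x * f x \<partial>\<mu> (s (r1 (r2 n)))))
        \<longlonglongrightarrow> (\<integral>x. f x \<partial>p) - (\<integral>x. f x \<partial>q)"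
      using LIMSEQ_subseq_LIMSEQ[OF p[OF f] r2(1)] q[OF f] by (intro tendsto_diff) (simp_all add: o_def)
    then show "(\<lambda>n. \<integral>x. dens (s ((r1 \<circ> r2) n)) x * f x \<partial>\<mu> (s ((r1 \<circ> r2) n))) \<longlonglongrightarrow> (\<integral>x. f x \<partial>p) - (\<integral>x. f x \<partial>q)"
      by (simp add: eq)
  qed
qed

end

lemma nonreal_pairs_iff: "(z, w) \<in> nonreal_pairs \<longleftrightarrow> Im z \<noteq> 0 \<and> Im w \<noteq> 0"
  by (simp add: nonreal_pairs_def complex_is_Real_iff)

lemma product_domain_iff: "(z, w) \<in> product_domain \<alpha> \<beta> \<longleftrightarrow> z \<in> stolz_domain \<alpha> \<beta> \<and> w \<in> stolz_domain \<alpha> \<beta>"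
  by (simp add: product_domain_def)

lemma min_sq_le: "(min 1 (\<bar>a\<bar>))\<^sup>2 \<le> 2 * (a\<^sup>2 / (1 + a\<^sup>2))" for a :: real
proof (cases "\<bar>a\<bar> \<le> 1")
  case True
  then have "a\<^sup>2 \<le> 1" by (simp add: abs_square_le_1)
  then have "a\<^sup>2 * (1 + a\<^sup>2) \<le> a\<^sup>2 * 2" by (intro mult_left_mono) auto
  then show ?thesis using True by (simp add: min_def le_divide_eq add_pos_nonneg)
next
  case False
  then have "1 \<le> \<bar>a\<bar>\<^sup>2" by (intro one_le_power) simp
  then show ?thesis using False by (simp add: min_def le_divide_eq add_pos_nonneg)
qed

section \<open>Integrals of the kernel against the signed densities\<close>

context bifree_limit
begin

text \<open>The sequence in statement (2), written as the integral of the bounded kernel against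
  \<rho>_n.\<close>

definition Dn :: "nat \<Rightarrow> complex \<Rightarrow> complex \<Rightarrow> complex" where
  "Dn n z w = (\<integral>x. complex_of_real (dens n x) * kern2 z w x \<partial>\<mu> n)"

lemma dens_kern2:
  "complex_of_real (dens n (s, t)) * kern2 z w (s, t) =
    of_nat (k n) * (z * complex_of_real s / (1 - z * complex_of_real s) * (w * complex_of_real t / (1 - w * complex_of_real t)))"
proof -
  have "complex_of_real (dens n (s, t)) = of_nat (k n) * (complex_of_real (s / sqrt (1 + s\<^sup>2)) * complex_of_real (t / sqrt (1 + t\<^sup>2)))"
    by (simp add: dens_def)
  then show ?thesis unfolding psi_kern kern2_def by simp
qed

lemma Dn_eq:
  "of_nat (k n) * (\<integral>(s, t). z * w * complex_of_real s * complex_of_real t /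
      ((1 - z * complex_of_real s) * (1 - w * complex_of_real t)) \<partial>\<mu> n) = Dn n z w"
proof -
  have "Dn n z w = (\<integral>x. of_nat (k n) * (case x of (s, t) \<Rightarrow> z * w * complex_of_real s * complex_of_real t /
      ((1 - z * complex_of_real s) * (1 - w * complex_of_real t))) \<partial>\<mu> n)"
    unfolding Dn_def
  proof (intro Bochner_Integration.integral_cong refl)
    fix x :: "real \<times> real"
    obtain s t where x: "x = (s, t)" by (cases x)
    show "complex_of_real (dens n x) * kern2 z w x = of_nat (k n) * (case x of (s, t) \<Rightarrow> z * w * complex_of_real s * complex_of_real t /
      ((1 - z * complex_of_real s) * (1 - w * complex_of_real t)))"
      unfolding x dens_kern2 by (simp add: mult_ac)
  qed
  then show ?thesis by (simp only: integral_mult_right_zero)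
qed

lemma D_limit_iff: "D_limit \<mu> k D \<longleftrightarrow> (\<forall>z w. Im z \<noteq> 0 \<longrightarrow> Im w \<noteq> 0 \<longrightarrow> (\<lambda>n. Dn n z w) \<longlonglongrightarrow> D z w)"
  unfolding D_limit_def Dn_eq by (auto simp: nonreal_pairs_iff)

lemma integrable_dens_mult:
  fixes F :: "real \<times> real \<Rightarrow> complex"
  assumes "F \<in> borel_measurable borel" "\<And>x. norm (F x) \<le> M"
  shows "integrable (\<mu> n) (\<lambda>x. complex_of_real (dens n x) * F x)"
proof (rule finite_measure.integrable_const_bound[OF fin_\<mu>, of _ "real (k n) * M"])
  note [measurable] = assms(1)
  show "(\<lambda>x. complex_of_real (dens n x) * F x) \<in> borel_measurable (\<mu> n)" by measurable
  show "AE x in \<mu> n. norm (complex_of_real (dens n x) * F x) \<le> real (k n) * M"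
    unfolding norm_mult norm_of_real by (intro AE_I2 mult_mono abs_dens_le_k assms(2)) auto
qed

lemma dens_integral_bound:
  "\<exists>B\<ge>0. \<forall>n F M. F \<in> borel_measurable borel \<longrightarrow> (\<forall>x. norm (F x) \<le> M) \<longrightarrow>
     norm (\<integral>x. complex_of_real (dens n x) * F x \<partial>\<mu> n) \<le> B * M"
proof -
  obtain B where B: "B \<ge> 0" "\<And>n. (\<integral>x. \<bar>dens n x\<bar> \<partial>\<mu> n) \<le> B" using dens_mass_bounded by auto
  have "norm (\<integral>x. complex_of_real (dens n x) * F x \<partial>\<mu> n) \<le> B * M"
    if F: "F \<in> borel_measurable borel" "\<And>x. norm (F x) \<le> M" for n F M
  proof -
    have M0: "0 \<le> M" using F(2) norm_ge_zero order_trans by blast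
    have "norm (\<integral>x. complex_of_real (dens n x) * F x \<partial>\<mu> n) \<le> (\<integral>x. norm (complex_of_real (dens n x) * F x) \<partial>\<mu> n)"
      by (rule integral_norm_bound)
    also have "\<dots> \<le> (\<integral>x. \<bar>dens n x\<bar> * M \<partial>\<mu> n)"
    proof (rule integral_mono)
      show "integrable (\<mu> n) (\<lambda>x. norm (complex_of_real (dens n x) * F x))"
        by (rule integrable_norm[OF integrable_dens_mult[OF F]])
      show "integrable (\<mu> n) (\<lambda>x. \<bar>dens n x\<bar> * M)" using integrable_dens by auto
      show "norm (complex_of_real (dens n x) * F x) \<le> \<bar>dens n x\<bar> * M" for x
        unfolding norm_mult norm_of_real by (intro mult_left_mono F(2)) auto
    qed
    also have "\<dots> = (\<integral>x. \<bar>dens n x\<bar> \<partial>\<mu> n) * M" by simp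
    also have "\<dots> \<le> B * M" using B(2) M0 by (intro mult_right_mono) auto
    finally show ?thesis .
  qed
  then show ?thesis using B(1) by blast
qed

lemma Dn_bound:
  obtains B where "B \<ge> 0" "\<And>n z w. Im z \<noteq> 0 \<Longrightarrow> Im w \<noteq> 0 \<Longrightarrow>
    norm (Dn n z w) \<le> B * ((norm z * kern_const z) * (norm w * kern_const w))"
proof -
  obtain B where B: "B \<ge> 0" "\<And>n F M. F \<in> borel_measurable borel \<Longrightarrow> (\<And>x. norm (F x) \<le> M) \<Longrightarrow>
     norm (\<integral>x. complex_of_real (dens n x) * F x \<partial>\<mu> n) \<le> B * M"
    using dens_integral_bound by blast
  show thesis
  proof (rule that[OF B(1)])
    show "norm (Dn n z w) \<le> B * ((norm z * kern_const z) * (norm w * kern_const w))"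
      if "Im z \<noteq> 0" "Im w \<noteq> 0" for n z w
      unfolding Dn_def by (intro B(2) measurable_kern2 norm_kern2_le that)
  qed
qed

text \<open>\<open>norm_kern2_diff_le\<close> bounds the change of the kernel uniformly in (s, t),
  and the total variation of \<rho>_n is bounded, so the difference vanishes in the limit although
  the measure changes with n.\<close>

lemma Dn_diff_tendsto:
  assumes lim: "Z \<longlonglongrightarrow> z" "W \<longlonglongrightarrow> w" and im: "Im z \<noteq> 0" "Im w \<noteq> 0" "\<And>n. Im (Z n) \<noteq> 0" "\<And>n. Im (W n) \<noteq> 0"
  shows "(\<lambda>n. Dn n (Z n) (W n) - Dn n z w) \<longlonglongrightarrow> 0"
proof -
  obtain B where B: "B \<ge> 0" "\<And>n F M. F \<in> borel_measurable borel \<Longrightarrow> (\<And>x. norm (F x) \<le> M) \<Longrightarrow>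
     norm (\<integral>x. complex_of_real (dens n x) * F x \<partial>\<mu> n) \<le> B * M"
    using dens_integral_bound by blast
  define X where "X z' w' = norm (z' - z) * (kern_const z * kern_const z') * (norm w' * kern_const w') +
    norm (w' - w) * (kern_const w * kern_const w') * (norm z * kern_const z)" for z' w'
  have le: "norm (Dn n (Z n) (W n) - Dn n z w) \<le> B * X (Z n) (W n)" for n
  proof -
    have "Dn n (Z n) (W n) - Dn n z w = (\<integral>x. complex_of_real (dens n x) * (kern2 (Z n) (W n) x - kern2 z w x) \<partial>\<mu> n)"
      unfolding Dn_def right_diff_distrib
      by (intro Bochner_Integration.integral_diff[symmetric] integrable_dens_mult[OF measurable_kern2 norm_kern2_le] im)
    also have "norm \<dots> \<le> B * X (Z n) (W n)"
      unfolding X_def by (intro B(2) norm_kern2_diff_le im) measurable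
    finally show ?thesis .
  qed
  have "(\<lambda>n. B * X (Z n) (W n)) \<longlonglongrightarrow> B * X z w"
    unfolding X_def kern_const_def by (intro tendsto_intros lim) (use im in auto)
  then have "(\<lambda>n. B * X (Z n) (W n)) \<longlonglongrightarrow> 0" by (simp add: X_def)
  then show ?thesis
    by (rule Lim_null_comparison[rotated]) (use le in \<open>auto intro: always_eventually\<close>)
qed

lemma signed_integral_dens:
  assumes "f \<in> borel_measurable borel" "\<And>x. \<bar>f x\<bar> \<le> B"
  shows "signed_integral (signed_density (\<mu> n) (\<lambda>(s, t). real (k n) * (s * t / (sqrt (1 + s\<^sup>2) * sqrt (1 + t\<^sup>2))))) f =
    (\<integral>x. dens n x * f x \<partial>\<mu> n)"
  using signed_density_decomposition(2)[OF \<mu> integrable_dens assms] unfolding dens_def .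

lemma rho_limit_iff:
  "rho_limit \<mu> k \<rho> \<longleftrightarrow> finite_signed_measure \<rho> \<and>
    (\<forall>f. continuous_on UNIV f \<longrightarrow> bounded (range f) \<longrightarrow> (\<lambda>n. \<integral>x. dens n x * f x \<partial>\<mu> n) \<longlonglongrightarrow> signed_integral \<rho> f)"
proof -
  have "signed_integral (signed_density (\<mu> n) (\<lambda>(s, t). real (k n) * (s * t / (sqrt (1 + s\<^sup>2) * sqrt (1 + t\<^sup>2))))) f =
    (\<integral>x. dens n x * f x \<partial>\<mu> n)" if f: "continuous_on UNIV f" "bounded (range f)" for f n
  proof -
    obtain B where "\<And>x. \<bar>f x\<bar> \<le> B" using f(2) by (auto simp: bounded_iff)
    then show ?thesis
      by (rule signed_integral_dens[OF borel_measurable_continuous_onI[OF f(1)]])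
  qed
  then show ?thesis unfolding rho_limit_def weak_conv_signed_def by auto
qed

lemma kern2_Re_Im:
  assumes "Im z \<noteq> 0" "Im w \<noteq> 0"
  shows "continuous_on UNIV (\<lambda>x. Re (kern2 z w x))" "bounded (range (\<lambda>x. Re (kern2 z w x)))"
    "continuous_on UNIV (\<lambda>x. Im (kern2 z w x))" "bounded (range (\<lambda>x. Im (kern2 z w x)))"
    "Re (Dn n z w) = (\<integral>x. dens n x * Re (kern2 z w x) \<partial>\<mu> n)" "Im (Dn n z w) = (\<integral>x. dens n x * Im (kern2 z w x) \<partial>\<mu> n)"
proof -
  show "continuous_on UNIV (\<lambda>x. Re (kern2 z w x))" "continuous_on UNIV (\<lambda>x. Im (kern2 z w x))"
    by (intro continuous_intros continuous_on_kern2 assms)+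
  show "bounded (range (\<lambda>x. Re (kern2 z w x)))" "bounded (range (\<lambda>x. Im (kern2 z w x)))"
    using order_trans[OF abs_Re_le_cmod norm_kern2_le[OF assms]] order_trans[OF abs_Im_le_cmod norm_kern2_le[OF assms]]
    by (auto simp: bounded_iff)
  note i = integrable_dens_mult[OF measurable_kern2 norm_kern2_le[OF assms], of n]
  show "Re (Dn n z w) = (\<integral>x. dens n x * Re (kern2 z w x) \<partial>\<mu> n)" "Im (Dn n z w) = (\<integral>x. dens n x * Im (kern2 z w x) \<partial>\<mu> n)"
    unfolding Dn_def using integral_Re[OF i] integral_Im[OF i] by simp_all
qed

lemma rho_limit_imp_Dn:
  assumes "rho_limit \<mu> k \<rho>" "Im z \<noteq> 0" "Im w \<noteq> 0"
  shows "(\<lambda>n. Dn n z w) \<longlonglongrightarrow> signed_integral \<rho> (kern2 z w)"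
proof -
  have fsm: "finite_signed_measure \<rho>" using assms(1) by (simp add: rho_limit_iff)
  note K = kern2_Re_Im[OF assms(2,3)]
  note RI = signed_integral_Re_Im[OF fsm measurable_kern2 norm_kern2_le[OF assms(2,3)]]
  show ?thesis
    using assms(1) K unfolding rho_limit_iff tendsto_complex_iff RI by simp
qed

lemma D_representation_iff:
  "D_representation D \<rho> \<longleftrightarrow> (\<forall>z w. Im z \<noteq> 0 \<longrightarrow> Im w \<noteq> 0 \<longrightarrow> D z w = signed_integral \<rho> (kern2 z w))"
proof -
  have "(\<lambda>(s, t). z * w * complex_of_real (sqrt (1 + s\<^sup>2)) * complex_of_real (sqrt (1 + t\<^sup>2)) /
            ((1 - z * complex_of_real s) * (1 - w * complex_of_real t))) = kern2 z w" for z w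
    by (auto simp: kern2_def kern_def fun_eq_iff)
  note eq = this
  show ?thesis
    unfolding D_representation_def eq Ball_def split_paired_All nonreal_pairs_iff by auto
qed

lemma Dn_convergent_imp_rho_limit:
  assumes D: "\<And>z w. Im z \<noteq> 0 \<Longrightarrow> Im w \<noteq> 0 \<Longrightarrow> (\<lambda>n. Dn n z w) \<longlonglongrightarrow> D z w"
  shows "\<exists>\<rho>. rho_limit \<mu> k \<rho>"
proof -
  \<comment> \<open>Whatever subsequence produced p - q, its kernel integrals are D, because the
    whole sequence \<open>Dn\<close> converges to D.\<close>
  have sub: "signed_integral \<rho> (kern2 z w) = D z w \<and> finite_signed_measure \<rho>"
    if r: "strict_mono r" and pq: "finite_borel p" "finite_borel q" and im: "Im z \<noteq> 0" "Im w \<noteq> 0"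
      and lim: "\<And>f :: real \<times> real \<Rightarrow> real. continuous_on UNIV f \<Longrightarrow> bounded (range f) \<Longrightarrow>
        (\<lambda>n. \<integral>x. dens (r n) x * f x \<partial>\<mu> (r n)) \<longlonglongrightarrow> (\<integral>x. f x \<partial>p) - (\<integral>x. f x \<partial>q)"
      and \<rho>: "\<rho> = (\<lambda>A. measure p A - measure q A)"
    for r :: "nat \<Rightarrow> nat" and p q z w \<rho>
  proof -
    have fsm: "finite_signed_measure \<rho>" unfolding \<rho> by (rule finite_signed_measure_diff[OF pq])
    note K = kern2_Re_Im[OF im]
    note RI = signed_integral_Re_Im[OF fsm measurable_kern2 norm_kern2_le[OF im]]
    have si: "signed_integral \<rho> f = (\<integral>x. f x \<partial>p) - (\<integral>x. f x \<partial>q)" if f: "continuous_on UNIV f" "bounded (range f)" for f :: "real \<times> real \<Rightarrow> real"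
    proof -
      obtain B where "\<And>x. \<bar>f x\<bar> \<le> B" using f(2) by (auto simp: bounded_iff)
      then show ?thesis
        using signed_integral_diff[OF pq _ fsm borel_measurable_continuous_onI[OF f(1)]] unfolding \<rho> by blast
    qed
    have "(\<lambda>n. Dn (r n) z w) \<longlonglongrightarrow> signed_integral \<rho> (kern2 z w)"
      unfolding tendsto_complex_iff RI K(5,6) si[OF K(1,2)] si[OF K(3,4)]
      using lim[OF K(1,2)] lim[OF K(3,4)] by blast
    moreover have "(\<lambda>n. Dn (r n) z w) \<longlonglongrightarrow> D z w"
      using LIMSEQ_subseq_LIMSEQ[OF D[OF im] r] by (simp add: o_def)
    ultimately show ?thesis using LIMSEQ_unique fsm by blast
  qed
  obtain r p q where r: "strict_mono (r :: nat \<Rightarrow> nat)" and pq: "finite_borel p" "finite_borel q"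
    and lim: "\<And>f :: real \<times> real \<Rightarrow> real. continuous_on UNIV f \<Longrightarrow> bounded (range f) \<Longrightarrow>
      (\<lambda>n. \<integral>x. dens (r n) x * f x \<partial>\<mu> (r n)) \<longlonglongrightarrow> (\<integral>x. f x \<partial>p) - (\<integral>x. f x \<partial>q)"
    by (rule dens_subsequence[OF strict_mono_id[unfolded id_def]]) blast
  define \<rho> where "\<rho> A = measure p A - measure q A" for A
  have \<rho>eq: "\<rho> = (\<lambda>A. measure p A - measure q A)" by (simp add: \<rho>_def fun_eq_iff)
  have fsm: "finite_signed_measure \<rho>" unfolding \<rho>eq by (rule finite_signed_measure_diff[OF pq])
  have "(\<lambda>n. \<integral>x. dens n x * f x \<partial>\<mu> n) \<longlonglongrightarrow> signed_integral \<rho> f"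
    if f: "continuous_on UNIV f" "bounded (range f)" for f
  proof (rule LIMSEQ_by_subsequences)
    fix s :: "nat \<Rightarrow> nat" assume s: "strict_mono s"
    obtain r' p' q' where r': "strict_mono (r' :: nat \<Rightarrow> nat)" and pq': "finite_borel p'" "finite_borel q'"
      and lim': "\<And>f :: real \<times> real \<Rightarrow> real. continuous_on UNIV f \<Longrightarrow> bounded (range f) \<Longrightarrow>
        (\<lambda>n. \<integral>x. dens (s (r' n)) x * f x \<partial>\<mu> (s (r' n))) \<longlonglongrightarrow> (\<integral>x. f x \<partial>p') - (\<integral>x. f x \<partial>q')"
      by (rule dens_subsequence[OF s]) blast
    define \<rho>' where "\<rho>' A = measure p' A - measure q' A" for A
    have \<rho>'eq: "\<rho>' = (\<lambda>A. measure p' A - measure q' A)" by (simp add: \<rho>'_def fun_eq_iff)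
    have fsm': "finite_signed_measure \<rho>'" unfolding \<rho>'eq by (rule finite_signed_measure_diff[OF pq'])
    have "strict_mono (\<lambda>n. s (r' n))" using strict_mono_o[OF s r'] by (simp add: o_def)
    note sub' = sub[OF this pq' _ _ lim' \<rho>'eq] and sub0 = sub[OF r pq _ _ lim \<rho>eq]
    have same: "\<rho> A = \<rho>' A" if "A \<in> sets borel" for A
      by (rule finite_signed_measure_eq_if_kernel_integrals_eq[OF fsm fsm' _ that])
        (use sub' sub0 in \<open>simp add: kern2_def\<close>)
    obtain B where B: "\<And>x. \<bar>f x\<bar> \<le> B" using f(2) by (auto simp: bounded_iff)
    \<comment> \<open>\<rho> agrees with p' - q' on Borel sets, so its signed integral may be
      computed with p' and q'.\<close>
    have "signed_integral \<rho> f = (\<integral>x. f x \<partial>p') - (\<integral>x. f x \<partial>q')"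
      by (rule signed_integral_diff[OF pq' _ fsm borel_measurable_continuous_onI[OF f(1)] B])
        (simp add: same \<rho>'_def)
    then show "\<exists>r. strict_mono (r :: nat \<Rightarrow> nat) \<and> (\<lambda>n. \<integral>x. dens (s (r n)) x * f x \<partial>\<mu> (s (r n))) \<longlonglongrightarrow> signed_integral \<rho> f"
      using r' lim'[OF f] by auto
  qed
  then show ?thesis using fsm by (auto simp: rho_limit_iff)
qed

lemma Dn_holomorphic:
  assumes "Im w \<noteq> 0" "\<And>z. z \<in> U \<Longrightarrow> Im z \<noteq> 0"
  shows "(\<lambda>z. Dn n z w) holomorphic_on U" "(\<lambda>z. Dn n w z) holomorphic_on U"
proof -
  have B: "norm (complex_of_real (dens n x) * kern w (snd x)) \<le> real (k n) * (norm w * kern_const w)"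
    "norm (complex_of_real (dens n x) * kern w (fst x)) \<le> real (k n) * (norm w * kern_const w)" for x
    unfolding norm_mult norm_of_real by (intro mult_mono abs_dens_le_k norm_kern_le assms(1); simp)+
  have "(\<lambda>z. \<integral>x. complex_of_real (dens n x) * kern w (snd x) * kern z (fst x) \<partial>\<mu> n) holomorphic_on U"
    by (rule holomorphic_on_kern_integral[OF fin_\<mu> _ _ B(1) assms(2)]) measurable
  then show "(\<lambda>z. Dn n z w) holomorphic_on U"
    by (simp add: Dn_def kern2_def case_prod_beta' mult_ac)
  have "(\<lambda>z. \<integral>x. complex_of_real (dens n x) * kern w (fst x) * kern z (snd x) \<partial>\<mu> n) holomorphic_on U"
    by (rule holomorphic_on_kern_integral[OF fin_\<mu> _ _ B(2) assms(2)]) measurable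
  then show "(\<lambda>z. Dn n w z) holomorphic_on U"
    by (simp add: Dn_def kern2_def case_prod_beta' mult_ac)
qed

text \<open>Applied to \<open>Dn\<close> in one variable, with A depending on the other. The growth
  bound is locally bounded off the real axis, as Vitali's theorem requires.\<close>

lemma half_plane_convergence:
  fixes f :: "nat \<Rightarrow> complex \<Rightarrow> complex"
  assumes pos: "\<alpha> > 0" "\<beta> > 0" and hol: "\<And>n c. f n holomorphic_on half_plane c"
    and bd: "\<And>n z. Im z \<noteq> 0 \<Longrightarrow> norm (f n z) \<le> A * (norm z * kern_const z)" and A: "A \<ge> 0"
    and conv: "\<And>z. z \<in> stolz_domain \<alpha> \<beta> \<Longrightarrow> convergent (\<lambda>n. f n z)" and z: "Im z \<noteq> 0"
  shows "convergent (\<lambda>n. f n z)"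
proof -
  obtain c :: real where c: "c = 1 \<or> c = -1" "z \<in> half_plane c" using nonreal_half_plane[OF z] by blast
  have sub: "half_stolz c \<alpha> \<beta> \<subseteq> stolz_domain \<alpha> \<beta>" using c(1) by (auto simp: stolz_domain_eq_halves)
  have bdd: "\<exists>B. \<forall>n. \<forall>z\<in>K. norm (f n z) \<le> B" if K: "compact K" "K \<subseteq> half_plane c" for K
  proof -
    have im: "Im z \<noteq> 0" if "z \<in> K" for z using that K(2) half_plane_props(5) by blast
    obtain C where C: "C \<ge> 0" "\<And>z. z \<in> K \<Longrightarrow> kern_const z \<le> C" "\<And>z. z \<in> K \<Longrightarrow> norm z \<le> C"
      by (rule kern_const_bounded_on_compact[OF K(1) im]) blast+
    have "norm (f n z) \<le> A * (C * C)" if "z \<in> K" for n z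
    proof -
      have "norm z * kern_const z \<le> C * C"
        using C(2,3)[OF that] C(1) kern_const_ge_1[of z] by (intro mult_mono) auto
      then have "A * (norm z * kern_const z) \<le> A * (C * C)" using A by (intro mult_left_mono) auto
      then show ?thesis using bd[OF im[OF that], of n] by linarith
    qed
    then show ?thesis by blast
  qed
  have cU: "convergent (\<lambda>n. f n z)" if "z \<in> half_stolz c \<alpha> \<beta>" for z using that sub conv by blast
  obtain g where "\<And>z. z \<in> half_plane c \<Longrightarrow> (\<lambda>n. f n z) \<longlonglongrightarrow> g z"
    by (rule vitali_convergence[OF half_plane_props(1,3) hol bdd open_half_stolz
          half_stolz_nonempty[OF pos c(1)] half_plane_props(4) cU]) blast+
  then show ?thesis using c(2) by (auto simp: convergent_def)
qed

text \<open>One variable at a time: w stays in the Stolz domain while z moves through a half-plane;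
  then z is any nonreal number and w moves.\<close>

lemma Dn_convergent_extend:
  assumes pos: "\<alpha> > 0" "\<beta> > 0"
    and conv: "\<And>z w. z \<in> stolz_domain \<alpha> \<beta> \<Longrightarrow> w \<in> stolz_domain \<alpha> \<beta> \<Longrightarrow> convergent (\<lambda>n. Dn n z w)"
    and im: "Im z \<noteq> 0" "Im w \<noteq> 0"
  shows "convergent (\<lambda>n. Dn n z w)"
proof -
  obtain B where B: "B \<ge> 0" "\<And>n z w. Im z \<noteq> 0 \<Longrightarrow> Im w \<noteq> 0 \<Longrightarrow>
    norm (Dn n z w) \<le> B * ((norm z * kern_const z) * (norm w * kern_const w))" by (rule Dn_bound) blast
  have A: "0 \<le> B * (norm v * kern_const v)" for v using B(1) kern_const_ge_1[of v] by simp
  have step: "convergent (\<lambda>n. Dn n z w)" if w: "w \<in> stolz_domain \<alpha> \<beta>" for w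
  proof (rule half_plane_convergence[OF pos _ _ A[of w] _ im(1)])
    note imw = Im_nonzero_stolz_domain[OF w]
    show "(\<lambda>z. Dn n z w) holomorphic_on half_plane c" for n c
      by (rule Dn_holomorphic(1)[OF imw half_plane_props(5)])
    show "norm (Dn n z w) \<le> B * (norm w * kern_const w) * (norm z * kern_const z)" if "Im z \<noteq> 0" for n z
      using B(2)[OF that imw, of n] by (simp add: mult_ac)
    show "convergent (\<lambda>n. Dn n z w)" if "z \<in> stolz_domain \<alpha> \<beta>" for z by (rule conv[OF that w])
  qed
  show ?thesis
  proof (rule half_plane_convergence[OF pos _ _ A[of z] step im(2)])
    show "(\<lambda>w. Dn n z w) holomorphic_on half_plane c" for n c
      by (rule Dn_holomorphic(2)[OF im(1) half_plane_props(5)])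
    show "norm (Dn n z w) \<le> B * (norm z * kern_const z) * (norm w * kern_const w)" if "Im w \<noteq> 0" for n w
      using B(2)[OF im(1) that, of n] by (simp add: mult_ac)
  qed
qed

end

lemma Bseq_if_diff_tendsto_0:
  fixes X Y :: "nat \<Rightarrow> 'a::real_normed_vector"
  assumes "(\<lambda>n. X n - Y n) \<longlonglongrightarrow> 0" "Bseq Y"
  shows "Bseq X"
proof -
  have "Bseq (\<lambda>n. X n - Y n)" using assms(1) by (intro convergent_imp_Bseq) (auto simp: convergent_def)
  then obtain K1 where K1: "\<And>n. norm (X n - Y n) \<le> K1" by (auto simp: Bseq_def)
  obtain K2 where K2: "\<And>n. norm (Y n) \<le> K2" using assms(2) by (auto simp: Bseq_def)
  have "norm (X n) \<le> K1 + K2" for n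
    using norm_triangle_sub[of "X n" "Y n"] K1[of n] K2[of n] by linarith
  then show ?thesis by (rule BseqI')
qed

lemma Bseq_mult_tendsto_0:
  fixes X Y :: "nat \<Rightarrow> 'a::real_normed_algebra"
  assumes "Bseq X" "Y \<longlonglongrightarrow> 0"
  shows "(\<lambda>n. X n * Y n) \<longlonglongrightarrow> 0"
proof -
  obtain K where K: "\<And>n. norm (X n) \<le> K" using assms(1) by (auto simp: Bseq_def)
  have "(\<lambda>n. K * norm (Y n)) \<longlonglongrightarrow> K * norm (0 :: 'a)" by (intro tendsto_intros assms(2))
  then have lim: "(\<lambda>n. K * norm (Y n)) \<longlonglongrightarrow> 0" by simp
  have "norm (X n * Y n) \<le> K * norm (Y n)" for n
    by (rule order_trans[OF norm_mult_ineq mult_right_mono[OF K norm_ge_zero]])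
  then show ?thesis by (intro Lim_null_comparison[OF _ lim] always_eventually) blast
qed

section \<open>Asymptotics of the bi-free R-transform\<close>

context bifree_limit
begin

lemma psi_marginals:
  "psi (marginal1 (\<mu> n)) z = (\<integral>x. z * complex_of_real (fst x) / (1 - z * complex_of_real (fst x)) \<partial>\<mu> n)"
  "psi (marginal2 (\<mu> n)) z = (\<integral>x. z * complex_of_real (snd x) / (1 - z * complex_of_real (snd x)) \<partial>\<mu> n)"
  "Im z \<noteq> 0 \<Longrightarrow> integrable (\<mu> n) (\<lambda>x. z * complex_of_real (fst x) / (1 - z * complex_of_real (fst x)))"
  "Im z \<noteq> 0 \<Longrightarrow> integrable (\<mu> n) (\<lambda>x. z * complex_of_real (snd x) / (1 - z * complex_of_real (snd x)))"
proof -
  have m: "(\<lambda>s. z * complex_of_real s / (1 - z * complex_of_real s)) \<in> borel_measurable borel" by measurable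
  show "psi (marginal1 (\<mu> n)) z = (\<integral>x. z * complex_of_real (fst x) / (1 - z * complex_of_real (fst x)) \<partial>\<mu> n)"
    "psi (marginal2 (\<mu> n)) z = (\<integral>x. z * complex_of_real (snd x) / (1 - z * complex_of_real (snd x)) \<partial>\<mu> n)"
    unfolding psi_def integral_marginal1(1)[OF m] integral_marginal2(1)[OF m] by (rule refl)+
  assume "Im z \<noteq> 0"
  then show "integrable (\<mu> n) (\<lambda>x. z * complex_of_real (fst x) / (1 - z * complex_of_real (fst x)))"
    "integrable (\<mu> n) (\<lambda>x. z * complex_of_real (snd x) / (1 - z * complex_of_real (snd x)))"
    using integrable_psi[OF l1.m] integrable_psi[OF l2.m] integral_marginal1(2)[OF m] integral_marginal2(2)[OF m] by blast+
qed

lemma Dn_product: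
  "Dn n z w = of_nat (k n) * (\<integral>x. z * complex_of_real (fst x) / (1 - z * complex_of_real (fst x)) *
     (w * complex_of_real (snd x) / (1 - w * complex_of_real (snd x))) \<partial>\<mu> n)"
proof -
  have "Dn n z w = (\<integral>x. of_nat (k n) * (z * complex_of_real (fst x) / (1 - z * complex_of_real (fst x)) *
     (w * complex_of_real (snd x) / (1 - w * complex_of_real (snd x)))) \<partial>\<mu> n)"
    unfolding Dn_def
  proof (intro Bochner_Integration.integral_cong refl)
    fix x :: "real \<times> real"
    show "complex_of_real (dens n x) * kern2 z w x = of_nat (k n) * (z * complex_of_real (fst x) / (1 - z * complex_of_real (fst x)) *
     (w * complex_of_real (snd x) / (1 - w * complex_of_real (snd x))))"
      using dens_kern2[of n "fst x" "snd x" z w] by simp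
  qed
  then show ?thesis by (simp only: integral_mult_right_zero)
qed

text \<open>Expanding \<open>(1 + u) (1 + v)\<close> with \<open>u = Z s / (1 - Z s)\<close> and \<open>v = W t / (1 - W t)\<close>.\<close>

lemma cauchy_transform2_expansion:
  assumes Z: "Im Z \<noteq> 0" and W: "Im W \<noteq> 0"
  shows "cauchy_transform2 (\<mu> n) (1 / Z) (1 / W) =
    Z * W * (1 + psi (marginal1 (\<mu> n)) Z + psi (marginal2 (\<mu> n)) W + Dn n Z W / of_nat (k n))"
proof -
  interpret P: prob_space "\<mu> n" by (rule prob_\<mu>)
  define u where "u x = Z * complex_of_real (fst x) / (1 - Z * complex_of_real (fst x))" for x :: "real \<times> real"
  define v where "v x = W * complex_of_real (snd x) / (1 - W * complex_of_real (snd x))" for x :: "real \<times> real"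
  have k: "of_nat (k n) \<noteq> (0 :: complex)" using l1.k_pos[of n] by simp
  have iu: "integrable (\<mu> n) u" and iv: "integrable (\<mu> n) v"
    unfolding u_def v_def using psi_marginals(3)[OF Z] psi_marginals(4)[OF W] by auto
  have iuv: "integrable (\<mu> n) (\<lambda>x. u x * v x)"
  proof -
    have "integrable (\<mu> n) (\<lambda>x. complex_of_real (dens n x) * kern2 Z W x / of_nat (k n))"
      by (rule integrable_divide_zero) (rule integrable_dens_mult[OF measurable_kern2 norm_kern2_le[OF Z W]])
    moreover have "complex_of_real (dens n x) * kern2 Z W x / of_nat (k n) = u x * v x" for x
      using dens_kern2[of n "fst x" "snd x" Z W] k by (simp add: u_def v_def)
    ultimately show ?thesis by simp
  qed
  have "cauchy_transform2 (\<mu> n) (1 / Z) (1 / W) = (\<integral>x. Z * W * (1 + u x + v x + u x * v x) \<partial>\<mu> n)"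
    unfolding cauchy_transform2_def
  proof (intro Bochner_Integration.integral_cong refl)
    fix x :: "real \<times> real"
    obtain s t where x: "x = (s, t)" by (cases x)
    have nz: "1 - Z * complex_of_real s \<noteq> 0" "1 - W * complex_of_real t \<noteq> 0" "Z \<noteq> 0" "W \<noteq> 0"
      using one_minus_nonzero Z W by auto
    have 1: "1 + u x + v x + u x * v x = (1 + u x) * (1 + v x)" by (simp add: algebra_simps)
    have 2: "1 + u x = 1 / (1 - Z * complex_of_real s)" "1 + v x = 1 / (1 - W * complex_of_real t)"
      using nz by (simp_all add: u_def v_def x field_simps)
    have 3: "1 / Z - complex_of_real s = (1 - Z * complex_of_real s) / Z" "1 / W - complex_of_real t = (1 - W * complex_of_real t) / W"
      using nz by (simp_all add: field_simps)
    show "(case x of (s, t) \<Rightarrow> 1 / ((1 / Z - complex_of_real s) * (1 / W - complex_of_real t))) = Z * W * (1 + u x + v x + u x * v x)"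
      unfolding 1 unfolding 2 unfolding x prod.case 3 using nz by simp
  qed
  also have "\<dots> = Z * W * (1 + (\<integral>x. u x \<partial>\<mu> n) + (\<integral>x. v x \<partial>\<mu> n) + (\<integral>x. u x * v x \<partial>\<mu> n))"
    using iu iv iuv P.prob_space by simp
  also have "(\<integral>x. u x \<partial>\<mu> n) = psi (marginal1 (\<mu> n)) Z" by (simp add: psi_marginals(1) u_def)
  also have "(\<integral>x. v x \<partial>\<mu> n) = psi (marginal2 (\<mu> n)) W" by (simp add: psi_marginals(2) v_def)
  also have "(\<integral>x. u x * v x \<partial>\<mu> n) = Dn n Z W / of_nat (k n)"
    unfolding Dn_product u_def v_def using k by simp
  finally show ?thesis .
qed

lemma bifree_h_formula:
  assumes pos: "\<alpha> > 0" "\<beta> > 0"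
    and R1: "is_R_transform \<alpha> \<beta> (marginal1 (\<mu> n)) (R_transform \<alpha> \<beta> (marginal1 (\<mu> n)))"
    and R2: "is_R_transform \<alpha> \<beta> (marginal2 (\<mu> n)) (R_transform \<alpha> \<beta> (marginal2 (\<mu> n)))"
    and z: "z \<in> stolz_domain \<alpha> \<beta>" and w: "w \<in> stolz_domain \<alpha> \<beta>"
  defines "a \<equiv> 1 + z * R_transform \<alpha> \<beta> (marginal1 (\<mu> n)) z"
    and "b \<equiv> 1 + w * R_transform \<alpha> \<beta> (marginal2 (\<mu> n)) w"
  shows "bifree_h \<alpha> \<beta> (\<mu> n) z w = (a + b - 1 + Dn n (z / a) (w / b) / of_nat (k n)) / (a * b)"
    and "a \<noteq> 0" "b \<noteq> 0" "Im (z / a) \<noteq> 0" "Im (w / b) \<noteq> 0"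
proof -
  define Z where "Z = 1 / (1 / z + R_transform \<alpha> \<beta> (marginal1 (\<mu> n)) z)"
  define W where "W = 1 / (1 / w + R_transform \<alpha> \<beta> (marginal2 (\<mu> n)) w)"
  note DZ = is_R_transformD[OF l1.m R1 z, folded Z_def a_def]
  note DW = is_R_transformD[OF l2.m R2 w, folded W_def b_def]
  have z0: "z \<noteq> 0" "w \<noteq> 0" using Im_nonzero_stolz_domain z w by force+
  show "Im (z / a) \<noteq> 0" "Im (w / b) \<noteq> 0" using DZ(1,4) DW(1,4) by auto
  then show nz: "a \<noteq> 0" "b \<noteq> 0" by auto
  have inv: "1 / z + R_transform \<alpha> \<beta> (marginal1 (\<mu> n)) z = 1 / Z" "1 / w + R_transform \<alpha> \<beta> (marginal2 (\<mu> n)) w = 1 / W"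
    by (simp_all add: Z_def W_def)
  have "bifree_h \<alpha> \<beta> (\<mu> n) z w = Z * W * (1 + (a - 1) + (b - 1) + Dn n Z W / of_nat (k n)) / (z * w)"
    unfolding bifree_h_def inv cauchy_transform2_expansion[OF DZ(1) DW(1)] DZ(3) DW(3)
    by (simp add: a_def b_def)
  also have "\<dots> = (a + b - 1 + Dn n (z / a) (w / b) / of_nat (k n)) / (a * b)"
    using z0 nz unfolding DZ(4) DW(4) by (simp add: field_simps)
  finally show "bifree_h \<alpha> \<beta> (\<mu> n) z w = (a + b - 1 + Dn n (z / a) (w / b) / of_nat (k n)) / (a * b)" .
qed

lemma R_transform_some: "\<exists>R. is_R_transform \<alpha> \<beta> m R \<Longrightarrow> is_R_transform \<alpha> \<beta> m (R_transform \<alpha> \<beta> m)"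
proof -
  assume "\<exists>R. is_R_transform \<alpha> \<beta> m R"
  from someI_ex[OF this] show ?thesis unfolding R_transform_def .
qed

text \<open>With Y = X - k (a - 1) (b - 1), multiplying 1 - 1 / h by k gives Y / E. As k (a - 1)
  converges and b - 1 tends to 0, Y differs from \<open>Dn n z w\<close> by a null sequence, and E
  tends to 1. Boundedness of Y then makes Y / E - \<open>Dn n z w\<close> a null sequence, although
  neither term is known to converge at this stage.\<close>

lemma bifree_R_asymptotics:
  assumes pos: "\<alpha> > 0" "\<beta> > 0" and def: "\<And>n. bifree_R_defined \<alpha> \<beta> (\<mu> n)"
    and z: "z \<in> stolz_domain \<alpha> \<beta>" and w: "w \<in> stolz_domain \<alpha> \<beta>"
  shows "(\<lambda>n. of_nat (k n) * bifree_R \<alpha> \<beta> (\<mu> n) z w - Dn n z w) \<longlonglongrightarrow>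
    z * free_levy_R \<gamma>1 \<sigma>1 z + w * free_levy_R \<gamma>2 \<sigma>2 w"
proof -
  have R1: "is_R_transform \<alpha> \<beta> (marginal1 (\<mu> n)) (R_transform \<alpha> \<beta> (marginal1 (\<mu> n)))"
    and R2: "is_R_transform \<alpha> \<beta> (marginal2 (\<mu> n)) (R_transform \<alpha> \<beta> (marginal2 (\<mu> n)))" for n
    using def[of n] by (auto simp: bifree_R_defined_def intro!: R_transform_some)
  define \<kappa> where "\<kappa> n = (of_nat (k n) :: complex)" for n
  define a where "a n = 1 + z * R_transform \<alpha> \<beta> (marginal1 (\<mu> n)) z" for n
  define b where "b n = 1 + w * R_transform \<alpha> \<beta> (marginal2 (\<mu> n)) w" for n
  define X where "X n = Dn n (z / a n) (w / b n)" for n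
  define E where "E n = a n + b n - 1 + X n / \<kappa> n" for n
  have imz: "Im z \<noteq> 0" "Im w \<noteq> 0" using Im_nonzero_stolz_domain z w by auto
  have \<kappa>0: "\<kappa> n \<noteq> 0" for n using l1.k_pos[of n] by (simp add: \<kappa>_def)
  note h = bifree_h_formula[OF pos R1 R2 z w, folded a_def b_def, folded X_def, folded \<kappa>_def, folded E_def]
  have za: "z / a n = 1 / (1 / z + R_transform \<alpha> \<beta> (marginal1 (\<mu> n)) z)"
    "w / b n = 1 / (1 / w + R_transform \<alpha> \<beta> (marginal2 (\<mu> n)) w)" for n
    using is_R_transformD(4)[OF l1.m R1 z, of n] is_R_transformD(4)[OF l2.m R2 w, of n]
    by (simp_all add: a_def b_def)
  have limZ: "(\<lambda>n. z / a n) \<longlonglongrightarrow> z" "(\<lambda>n. w / b n) \<longlonglongrightarrow> w"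
    unfolding za by (rule l1.R_transform_limit(1)[OF pos R1 z] l2.R_transform_limit(1)[OF pos R2 w])+
  have lev: "(\<lambda>n. \<kappa> n * (a n - 1)) \<longlonglongrightarrow> z * free_levy_R \<gamma>1 \<sigma>1 z" "(\<lambda>n. \<kappa> n * (b n - 1)) \<longlonglongrightarrow> w * free_levy_R \<gamma>2 \<sigma>2 w"
    using tendsto_mult_left[OF l1.R_transform_limit(2)[OF pos R1 z], of z]
      tendsto_mult_left[OF l2.R_transform_limit(2)[OF pos R2 w], of w]
    by (simp_all add: a_def b_def \<kappa>_def mult.left_commute)
  have ik: "(\<lambda>n. 1 / \<kappa> n) \<longlonglongrightarrow> 0"
    using tendsto_of_real[OF l1.inverse_k_tendsto, where 'a = complex] by (simp add: \<kappa>_def)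
  have ab1: "(\<lambda>n. a n - 1) \<longlonglongrightarrow> 0" "(\<lambda>n. b n - 1) \<longlonglongrightarrow> 0"
    using tendsto_mult[OF ik lev(1)] tendsto_mult[OF ik lev(2)] \<kappa>0 by simp_all
  obtain B where B: "B \<ge> 0" "\<And>n z w. Im z \<noteq> 0 \<Longrightarrow> Im w \<noteq> 0 \<Longrightarrow>
    norm (Dn n z w) \<le> B * ((norm z * kern_const z) * (norm w * kern_const w))" by (rule Dn_bound) blast
  have XD: "(\<lambda>n. X n - Dn n z w) \<longlonglongrightarrow> 0"
    unfolding X_def by (rule Dn_diff_tendsto[OF limZ imz h(4,5)])
  have bD: "Bseq (\<lambda>n. Dn n z w)"
    using B(2)[OF imz] by (intro BseqI') auto
  have bX: "Bseq X" by (rule Bseq_if_diff_tendsto_0[OF XD bD])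
  have Xk: "(\<lambda>n. X n / \<kappa> n) \<longlonglongrightarrow> 0"
    using Bseq_mult_tendsto_0[OF bX ik] by simp
  have E1: "E \<longlonglongrightarrow> 1"
    using tendsto_add[OF tendsto_add[OF tendsto_add[OF ab1] tendsto_const[of 1]] Xk] by (simp add: E_def[abs_def] algebra_simps)
  \<comment> \<open>h = E / (a b), so the absence of zeros of h gives E n \<noteq> 0.\<close>
  have E0: "E n \<noteq> 0" for n
    using def[of n] h(1)[of n] z w by (auto simp: bifree_R_defined_def product_domain_def)
  define Y where "Y n = X n - \<kappa> n * (a n - 1) * (b n - 1)" for n
  have YD: "(\<lambda>n. Y n - Dn n z w) \<longlonglongrightarrow> 0"
    using tendsto_diff[OF XD tendsto_mult[OF lev(1) ab1(2)]] by (simp add: Y_def[abs_def] algebra_simps)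
  have bY: "Bseq Y" by (rule Bseq_if_diff_tendsto_0[OF YD bD])
  have key: "\<kappa> n * bifree_R \<alpha> \<beta> (\<mu> n) z w - Dn n z w =
      \<kappa> n * (a n - 1) + \<kappa> n * (b n - 1) + (Y n * (1 / E n - 1) + (Y n - Dn n z w))" for n
  proof -
    have "1 - 1 / bifree_h \<alpha> \<beta> (\<mu> n) z w = 1 - a n * b n / E n"
      unfolding h(1) using h(2,3) by simp
    also have "\<dots> = (E n - a n * b n) / E n" using E0[of n] by (simp add: field_simps)
    also have "E n - a n * b n = Y n / \<kappa> n"
      using \<kappa>0[of n] by (simp add: E_def Y_def field_simps)
    finally have f1: "\<kappa> n * (1 - 1 / bifree_h \<alpha> \<beta> (\<mu> n) z w) = Y n / E n" using \<kappa>0[of n] by simp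
    have f2: "\<kappa> n * bifree_R \<alpha> \<beta> (\<mu> n) z w = \<kappa> n * (a n - 1) + \<kappa> n * (b n - 1) + \<kappa> n * (1 - 1 / bifree_h \<alpha> \<beta> (\<mu> n) z w)"
      by (simp add: bifree_R_def a_def b_def algebra_simps)
    show ?thesis unfolding f2 f1 by (simp add: algebra_simps)
  qed
  have "(\<lambda>n. 1 / E n - 1) \<longlonglongrightarrow> 1 / 1 - 1" by (intro tendsto_intros E1) auto
  then have "(\<lambda>n. 1 / E n - 1) \<longlonglongrightarrow> 0" by simp
  from Bseq_mult_tendsto_0[OF bY this]
  have "(\<lambda>n. Y n * (1 / E n - 1)) \<longlonglongrightarrow> 0" .
  from tendsto_add[OF tendsto_add[OF lev] tendsto_add[OF this YD]]
  show ?thesis by (simp add: key \<kappa>_def[symmetric])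
qed

text \<open>h is a nonzero multiple of 1 + (a - 1) + (b - 1) + Dn / k. The first two corrections are
  at most 1/10 each on the cone. The last is at most 16/200 + 16/200 = 4/25 by Young's inequality
  and the truncated second moments of the marginals at the scales |Z| and |W|, uniformly in
  n.\<close>

lemma bifree_R_defined_exists: "\<exists>\<beta>>0. \<forall>n. bifree_R_defined 1 \<beta> (\<mu> n)"
proof -
  obtain y1 where y1: "y1 > 0" "\<And>n. real (k n) * trunc_var (marginal1 (\<mu> n)) y1 \<le> 1 / 200"
    using l1.uniform_trunc_var[of "1 / 200"] by auto
  obtain y2 where y2: "y2 > 0" "\<And>n. real (k n) * trunc_var (marginal2 (\<mu> n)) y2 \<le> 1 / 200"
    using l2.uniform_trunc_var[of "1 / 200"] by auto
  \<comment> \<open>The thirds appear because |Z| <= 2 |z| <= 3 \<beta>, and likewise for W.\<close>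
  define \<beta> where "\<beta> = Min {l1.b0, l2.b0, y1 / 3, y2 / 3}"
  have \<beta>: "\<beta> > 0" "\<beta> \<le> l1.b0" "\<beta> \<le> l2.b0" "3 * \<beta> \<le> y1" "3 * \<beta> \<le> y2"
    using l1.b0(1) l2.b0(1) y1(1) y2(1) by (auto simp: \<beta>_def)
  have "bifree_R_defined 1 \<beta> (\<mu> n)" for n
  proof -
    have ex1: "is_R_transform 1 \<beta> (marginal1 (\<mu> n)) (\<lambda>z. l1.R0 n z / of_nat (k n))"
      by (rule is_R_transform_subdomain[OF l1.R0(2)]) (use \<beta> in auto)
    have ex2: "is_R_transform 1 \<beta> (marginal2 (\<mu> n)) (\<lambda>z. l2.R0 n z / of_nat (k n))"
      by (rule is_R_transform_subdomain[OF l2.R0(2)]) (use \<beta> in auto)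
    let ?R1 = "R_transform 1 \<beta> (marginal1 (\<mu> n))" and ?R2 = "R_transform 1 \<beta> (marginal2 (\<mu> n))"
    have R1: "is_R_transform 1 \<beta> (marginal1 (\<mu> n)) ?R1" and R2: "is_R_transform 1 \<beta> (marginal2 (\<mu> n)) ?R2"
      using ex1 ex2 by (auto intro!: R_transform_some)
    have k1: "1 \<le> real (k n)" using l1.k_pos[of n] by simp
    have div: "norm (z * (r / of_nat (k n))) \<le> 1 / 10" if "norm (z * r) \<le> 4 / 50" for z r :: complex
    proof -
      have "norm (z * r) / real (k n) \<le> norm (z * r) / 1" using k1 by (intro divide_left_mono) auto
      then show ?thesis using that by (simp add: norm_mult norm_divide)
    qed
    have sub: "stolz_domain 1 \<beta> \<subseteq> stolz_domain 1 l1.b0" "stolz_domain 1 \<beta> \<subseteq> stolz_domain 1 l2.b0"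
      using \<beta> stolz_domain_mono[of 1 1 \<beta> l1.b0] stolz_domain_mono[of 1 1 \<beta> l2.b0] by simp_all
    have s1: "norm (z * ?R1 z) \<le> 1 / 10" if z: "z \<in> stolz_domain 1 \<beta>" for z
      using R_transform_unique[OF l1.m R1 ex1 _ \<beta>(1) _ \<beta>(1), of z] z l1.R0(3)[of z n] sub div by auto
    have s2: "norm (z * ?R2 z) \<le> 1 / 10" if z: "z \<in> stolz_domain 1 \<beta>" for z
      using R_transform_unique[OF l2.m R2 ex2 _ \<beta>(1) _ \<beta>(1), of z] z l2.R0(3)[of z n] sub div by auto
    have "bifree_h 1 \<beta> (\<mu> n) z w \<noteq> 0" if z: "z \<in> stolz_domain 1 \<beta>" and w: "w \<in> stolz_domain 1 \<beta>" for z w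
    proof -
      define a where "a = 1 + z * ?R1 z"
      define b where "b = 1 + w * ?R2 w"
      define Z where "Z = z / a"
      define W where "W = w / b"
      note h = bifree_h_formula[OF zero_less_one \<beta>(1) R1 R2 z w, folded a_def b_def, folded Z_def W_def]
      have a1: "norm (a - 1) \<le> 1 / 10" "norm (b - 1) \<le> 1 / 10" using s1[OF z] s2[OF w] by (simp_all add: a_def b_def)
      note qZ = wide_quotient[OF stolz_norm_le(1)[OF z] a1(1), folded Z_def]
      note qW = wide_quotient[OF stolz_norm_le(1)[OF w] a1(2), folded W_def]
      have nZ: "norm Z \<le> y1" "norm W \<le> y2"
        using qZ(3) qW(3) stolz_norm_le(2)[OF z] stolz_norm_le(2)[OF w] \<beta> by linarith+
      define u where "u x = Z * complex_of_real (fst x) / (1 - Z * complex_of_real (fst x))" for x :: "real \<times> real"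
      define v where "v x = W * complex_of_real (snd x) / (1 - W * complex_of_real (snd x))" for x :: "real \<times> real"
      have pt: "norm (u x * v x) \<le> 16 * tau (norm Z) (fst x) + 16 * tau (norm W) (snd x)" for x
      proof -
        let ?m = "min 1 (norm Z * \<bar>fst x\<bar>)" and ?m' = "min 1 (norm W * \<bar>snd x\<bar>)"
        have "norm (u x * v x) \<le> (4 * ?m) * (4 * ?m')"
          unfolding norm_mult u_def v_def using psi_integrand_bounds[OF qZ(6,5)] psi_integrand_bounds[OF qW(6,5)]
          by (intro mult_mono) auto
        also have "\<dots> = 16 * (?m * ?m')" by simp
        also have "?m * ?m' \<le> ?m\<^sup>2 / 2 + ?m'\<^sup>2 / 2" using young[of 1 ?m ?m'] by simp
        also have "?m\<^sup>2 \<le> 2 * tau (norm Z) (fst x)"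
          using min_sq_le[of "norm Z * fst x"] by (simp add: abs_mult tau_def)
        also have "?m'\<^sup>2 \<le> 2 * tau (norm W) (snd x)"
          using min_sq_le[of "norm W * snd x"] by (simp add: abs_mult tau_def)
        finally show ?thesis by simp
      qed
      have "norm (Dn n Z W / of_nat (k n)) = norm (\<integral>x. u x * v x \<partial>\<mu> n)"
        using k1 unfolding Dn_product u_def v_def by (simp add: norm_mult norm_divide)
      also have "\<dots> \<le> (\<integral>x. norm (u x * v x) \<partial>\<mu> n)" by (rule integral_norm_bound)
      also have "\<dots> \<le> (\<integral>x. 16 * tau (norm Z) (fst x) + 16 * tau (norm W) (snd x) \<partial>\<mu> n)"
      proof (rule integral_mono')
        show "integrable (\<mu> n) (\<lambda>x. 16 * tau (norm Z) (fst x) + 16 * tau (norm W) (snd x))"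
          by (intro Bochner_Integration.integrable_add integrable_mult_right integral_tau)
        show "norm (u x * v x) \<le> 16 * tau (norm Z) (fst x) + 16 * tau (norm W) (snd x)" for x by (rule pt)
        show "0 \<le> 16 * tau (norm Z) (fst x) + 16 * tau (norm W) (snd x)" for x
          by (rule order_trans[OF norm_ge_zero pt])
      qed
      also have "\<dots> = 16 * trunc_var (marginal1 (\<mu> n)) (norm Z) + 16 * trunc_var (marginal2 (\<mu> n)) (norm W)"
        by (simp add: integral_tau)
      also have "\<dots> \<le> 16 * (1 / 200) + 16 * (1 / 200)"
      proof -
        have "trunc_var (marginal1 (\<mu> n)) (norm Z) \<le> trunc_var (marginal1 (\<mu> n)) y1"
          "trunc_var (marginal2 (\<mu> n)) (norm W) \<le> trunc_var (marginal2 (\<mu> n)) y2"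
          using nZ by (auto intro!: trunc_var_mono l1.m l2.m)
        moreover have "1 * trunc_var (marginal1 (\<mu> n)) y1 \<le> real (k n) * trunc_var (marginal1 (\<mu> n)) y1"
          "1 * trunc_var (marginal2 (\<mu> n)) y2 \<le> real (k n) * trunc_var (marginal2 (\<mu> n)) y2"
          using k1 by (intro mult_right_mono trunc_var_nonneg; simp)+
        ultimately show ?thesis using y1(2)[of n] y2(2)[of n] by linarith
      qed
      finally have d: "norm (Dn n Z W / of_nat (k n)) \<le> 4 / 25" by simp
      have "a + b - 1 + Dn n Z W / of_nat (k n) \<noteq> 0"
      proof
        assume "a + b - 1 + Dn n Z W / of_nat (k n) = 0"
        then have "1 = - ((a - 1) + (b - 1) + Dn n Z W / of_nat (k n))" by (simp add: algebra_simps)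
        then have "1 = norm ((a - 1) + (b - 1) + Dn n Z W / of_nat (k n))" by (metis norm_minus_cancel norm_one)
        also have "\<dots> \<le> norm (a - 1) + norm (b - 1) + norm (Dn n Z W / of_nat (k n))"
          by (intro norm_triangle_le add_right_mono norm_triangle_ineq)
        finally show False using a1 d by simp
      qed
      then show ?thesis unfolding h(1) using h(2,3) by simp
    qed
    then show ?thesis
      using ex1 ex2 by (auto simp: bifree_R_defined_def product_domain_def)
  qed
  then show ?thesis using \<beta>(1) by blast
qed

section \<open>Equivalence of the three statements and the limit formula\<close>

lemma R_limit_imp_Dn:
  assumes pos: "\<alpha> > 0" "\<beta> > 0" and R: "R_limit \<mu> k \<alpha> \<beta> R" and z: "z \<in> stolz_domain \<alpha> \<beta>" and w: "w \<in> stolz_domain \<alpha> \<beta>"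
  shows "(\<lambda>n. Dn n z w) \<longlonglongrightarrow> R z w - (z * free_levy_R \<gamma>1 \<sigma>1 z + w * free_levy_R \<gamma>2 \<sigma>2 w)"
proof -
  have "(\<lambda>n. of_nat (k n) * bifree_R \<alpha> \<beta> (\<mu> n) z w) \<longlonglongrightarrow> R z w" and def: "\<And>n. bifree_R_defined \<alpha> \<beta> (\<mu> n)"
    using R z w by (auto simp: R_limit_def product_domain_def)
  from tendsto_diff[OF this(1) bifree_R_asymptotics[OF pos def z w]] show ?thesis by simp
qed

text \<open>Forward, the asymptotics convert the limit on the given product domain into one of
  \<open>Dn\<close>, which then spreads to all nonreal pairs. Backward, a product domain has to be
  exhibited: aperture 1 and a \<beta> on which every \<open>\<mu> n\<close> has a bi-free
  R-transform.\<close>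

lemma R_limit_iff_D_limit: "(\<exists>\<alpha>>0. \<exists>\<beta>>0. \<exists>R. R_limit \<mu> k \<alpha> \<beta> R) \<longleftrightarrow> (\<exists>D. D_limit \<mu> k D)"
proof
  assume "\<exists>\<alpha>>0. \<exists>\<beta>>0. \<exists>R. R_limit \<mu> k \<alpha> \<beta> R"
  then obtain \<alpha> \<beta> R where R: "\<alpha> > 0" "\<beta> > 0" "R_limit \<mu> k \<alpha> \<beta> R" by blast
  have "convergent (\<lambda>n. Dn n z w)" if "Im z \<noteq> 0" "Im w \<noteq> 0" for z w
    by (rule Dn_convergent_extend[OF R(1,2) _ that]) (use R_limit_imp_Dn[OF R] in \<open>auto simp: convergent_def\<close>)
  then have "\<exists>D. \<forall>z w. Im z \<noteq> 0 \<longrightarrow> Im w \<noteq> 0 \<longrightarrow> (\<lambda>n. Dn n z w) \<longlonglongrightarrow> D z w"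
    by (intro exI[of _ "\<lambda>z w. lim (\<lambda>n. Dn n z w)"]) (auto simp: convergent_LIMSEQ_iff)
  then show "\<exists>D. D_limit \<mu> k D" by (simp add: D_limit_iff)
next
  assume "\<exists>D. D_limit \<mu> k D"
  then obtain D where D: "\<And>z w. Im z \<noteq> 0 \<Longrightarrow> Im w \<noteq> 0 \<Longrightarrow> (\<lambda>n. Dn n z w) \<longlonglongrightarrow> D z w" by (auto simp: D_limit_iff)
  obtain \<beta> where \<beta>: "\<beta> > 0" "\<And>n. bifree_R_defined 1 \<beta> (\<mu> n)" using bifree_R_defined_exists by blast
  have "R_limit \<mu> k 1 \<beta> (\<lambda>z w. z * free_levy_R \<gamma>1 \<sigma>1 z + w * free_levy_R \<gamma>2 \<sigma>2 w + D z w)"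
    unfolding R_limit_def product_domain_def
  proof (intro conjI allI ballI \<beta>(2); clarify)
    fix z w assume zw: "z \<in> stolz_domain 1 \<beta>" "w \<in> stolz_domain 1 \<beta>"
    have "(\<lambda>n. Dn n z w) \<longlonglongrightarrow> D z w" using D Im_nonzero_stolz_domain zw by blast
    from tendsto_add[OF bifree_R_asymptotics[OF zero_less_one \<beta> zw] this]
    show "(\<lambda>n. of_nat (k n) * bifree_R 1 \<beta> (\<mu> n) z w) \<longlonglongrightarrow> z * free_levy_R \<gamma>1 \<sigma>1 z + w * free_levy_R \<gamma>2 \<sigma>2 w + D z w"
      by simp
  qed
  then show "\<exists>\<alpha>>0. \<exists>\<beta>>0. \<exists>R. R_limit \<mu> k \<alpha> \<beta> R" using \<beta>(1) zero_less_one by blast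
qed

lemma D_limit_iff_rho_limit: "(\<exists>D. D_limit \<mu> k D) \<longleftrightarrow> (\<exists>\<rho>. rho_limit \<mu> k \<rho>)"
proof
  assume "\<exists>D. D_limit \<mu> k D"
  then obtain D where "D_limit \<mu> k D" by blast
  then show "\<exists>\<rho>. rho_limit \<mu> k \<rho>"
    unfolding D_limit_iff by (intro Dn_convergent_imp_rho_limit[of D]) blast
next
  assume "\<exists>\<rho>. rho_limit \<mu> k \<rho>"
  then obtain \<rho> where \<rho>: "rho_limit \<mu> k \<rho>" by blast
  have "D_limit \<mu> k (\<lambda>z w. signed_integral \<rho> (kern2 z w))"
    unfolding D_limit_iff using rho_limit_imp_Dn[OF \<rho>] by blast
  then show "\<exists>D. D_limit \<mu> k D" by blast
qed

lemma levy_term_has_derivative: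
  assumes \<sigma>: "finite_borel \<sigma>" and z: "Im z \<noteq> 0"
  obtains c where "((\<lambda>z. z * free_levy_R \<gamma> \<sigma> z) has_field_derivative c) (at z)"
proof -
  have "open (- \<real> :: complex set)" by (simp add: closed_complex_Reals open_Compl)
  moreover have "(\<lambda>z. z * free_levy_R \<gamma> \<sigma> z) holomorphic_on (- \<real>)"
    by (intro holomorphic_intros levy_holomorphic[OF \<sigma>]) (simp add: complex_is_Real_iff)
  moreover have "z \<in> - \<real>" using z by (simp add: complex_is_Real_iff)
  ultimately have "\<exists>c. ((\<lambda>z. z * free_levy_R \<gamma> \<sigma> z) has_field_derivative c) (at z)"
    using holomorphic_on_open[of "- \<real>" "\<lambda>z. z * free_levy_R \<gamma> \<sigma> z"] by blast
  then show thesis using that by blast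
qed

text \<open>The signed integral is split into its Jordan parts, each differentiable by
  \<open>kern2_integral_has_derivative\<close>; each Levy term is a holomorphic function of one
  coordinate.\<close>

lemma limit_formula_holomorphic:
  assumes fsm: "finite_signed_measure \<rho>"
  shows "holomorphic2_on (\<lambda>z w. z * free_levy_R \<gamma>1 \<sigma>1 z + w * free_levy_R \<gamma>2 \<sigma>2 w + signed_integral \<rho> (kern2 z w)) nonreal_pairs"
  unfolding holomorphic2_on_def
proof
  fix p :: "complex \<times> complex" assume "p \<in> nonreal_pairs"
  then obtain z w where p: "p = (z, w)" "Im z \<noteq> 0" "Im w \<noteq> 0" by (cases p) (auto simp: nonreal_pairs_iff)
  have fb: "finite_borel (upper_variation r)" if "finite_signed_measure r" for r :: "(real \<times> real) set \<Rightarrow> real"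
    using finite_measure_upper_variation[OF that] by (simp add: finite_borel_def)
  obtain a1 b1 where 1: "((\<lambda>(z, w). \<integral>x. kern2 z w x \<partial>upper_variation \<rho>) has_derivative (\<lambda>(u, v). a1 * u + b1 * v)) (at (z, w))"
    using kern2_integral_has_derivative[OF fb[OF fsm] p(2,3)] by blast
  obtain a2 b2 where 2: "((\<lambda>(z, w). \<integral>x. kern2 z w x \<partial>upper_variation (\<lambda>A. - \<rho> A)) has_derivative (\<lambda>(u, v). a2 * u + b2 * v)) (at (z, w))"
    using kern2_integral_has_derivative[OF fb[OF finite_signed_measure_uminus[OF fsm]] p(2,3)] by blast
  obtain c1 where c1: "((\<lambda>z. z * free_levy_R \<gamma>1 \<sigma>1 z) has_field_derivative c1) (at z)"
    by (rule levy_term_has_derivative[OF l1.\<sigma> p(2)])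
  obtain c2 where c2: "((\<lambda>z. z * free_levy_R \<gamma>2 \<sigma>2 z) has_field_derivative c2) (at w)"
    by (rule levy_term_has_derivative[OF l2.\<sigma> p(3)])
  have 3: "((\<lambda>x. fst x * free_levy_R \<gamma>1 \<sigma>1 (fst x)) has_derivative (\<lambda>h. c1 * fst h)) (at (z, w))"
    by (rule has_derivative_compose[where f = fst and f' = fst and g = "\<lambda>z. z * free_levy_R \<gamma>1 \<sigma>1 z",
          OF has_derivative_fst[OF has_derivative_ident]]) (use c1 in \<open>simp add: has_field_derivative_def\<close>)
  have 4: "((\<lambda>x. snd x * free_levy_R \<gamma>2 \<sigma>2 (snd x)) has_derivative (\<lambda>h. c2 * snd h)) (at (z, w))"
    by (rule has_derivative_compose[where f = snd and f' = snd and g = "\<lambda>z. z * free_levy_R \<gamma>2 \<sigma>2 z",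
          OF has_derivative_snd[OF has_derivative_ident]]) (use c2 in \<open>simp add: has_field_derivative_def\<close>)
  have "((\<lambda>x. fst x * free_levy_R \<gamma>1 \<sigma>1 (fst x) + snd x * free_levy_R \<gamma>2 \<sigma>2 (snd x) +
      ((case x of (z, w) \<Rightarrow> \<integral>x. kern2 z w x \<partial>upper_variation \<rho>) - (case x of (z, w) \<Rightarrow> \<integral>x. kern2 z w x \<partial>upper_variation (\<lambda>A. - \<rho> A))))
    has_derivative (\<lambda>h. c1 * fst h + c2 * snd h + ((case h of (u, v) \<Rightarrow> a1 * u + b1 * v) - (case h of (u, v) \<Rightarrow> a2 * u + b2 * v)))) (at (z, w))"
    by (intro has_derivative_add has_derivative_diff 1 2 3 4)
  also have "(\<lambda>h. c1 * fst h + c2 * snd h + ((case h of (u, v) \<Rightarrow> a1 * u + b1 * v) - (case h of (u, v) \<Rightarrow> a2 * u + b2 * v))) =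
      (\<lambda>(u, v). (c1 + a1 - a2) * u + (c2 + b1 - b2) * v)"
    by (auto simp: fun_eq_iff algebra_simps)
  finally show "\<exists>a b. ((\<lambda>(z, w). z * free_levy_R \<gamma>1 \<sigma>1 z + w * free_levy_R \<gamma>2 \<sigma>2 w + signed_integral \<rho> (kern2 z w)) has_derivative
      (\<lambda>(u, v). a * u + b * v)) (at p)"
    unfolding signed_integral_def case_prod_beta' p(1) by blast
qed

end

theorem theorem3p2:
  fixes \<mu> :: "nat \<Rightarrow> (real \<times> real) measure"
    and k :: "nat \<Rightarrow> nat"
    and \<nu>1 \<nu>2 :: "nat \<Rightarrow> real measure"
    and \<gamma>1 \<gamma>2 :: real
    and \<sigma>1 \<sigma>2 :: "real measure"
    and \<nu>1_lim \<nu>2_lim :: "real measure"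
  assumes "\<And>n. borel_prob (\<mu> n)"
    and "\<And>n. k n > 0"
    and "filterlim k at_top sequentially"
    and "finite_borel \<sigma>1"
    and "finite_borel \<sigma>2"
    and "\<And>n. free_conv_power (marginal1 (\<mu> n)) (k n) (\<nu>1 n)"
    and "\<And>n. free_conv_power (marginal2 (\<mu> n)) (k n) (\<nu>2 n)"
    and "free_levy_law \<gamma>1 \<sigma>1 \<nu>1_lim"
    and "free_levy_law \<gamma>2 \<sigma>2 \<nu>2_lim"
    and "weakly_converges \<nu>1 \<nu>1_lim"
    and "weakly_converges \<nu>2 \<nu>2_lim"
  shows "((\<exists>\<alpha>>0. \<exists>\<beta>>0. \<exists>R. R_limit \<mu> k \<alpha> \<beta> R) \<longleftrightarrow> (\<exists>D. D_limit \<mu> k D)) \<and>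
    ((\<exists>D. D_limit \<mu> k D) \<longleftrightarrow> (\<exists>\<rho>. rho_limit \<mu> k \<rho>)) \<and>
    (\<forall>\<alpha> \<beta> R D \<rho>. \<alpha> > 0 \<and> \<beta> > 0 \<and> R_limit \<mu> k \<alpha> \<beta> R \<and> D_limit \<mu> k D \<and> rho_limit \<mu> k \<rho> \<longrightarrow>
        D_representation D \<rho> \<and>
        (\<forall>\<rho>'. finite_signed_measure \<rho>' \<and> D_representation D \<rho>' \<longrightarrow>
           (\<forall>A\<in>sets borel. \<rho>' A = \<rho> A)) \<and>
        (\<forall>(z, w)\<in>product_domain \<alpha> \<beta>.
           R z w = z * free_levy_R \<gamma>1 \<sigma>1 z + w * free_levy_R \<gamma>2 \<sigma>2 w + D z w) \<and>
        (\<exists>E. holomorphic2_on E nonreal_pairs \<and>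
           (\<forall>(z, w)\<in>product_domain \<alpha> \<beta>. E z w = R z w)))"
proof -
  have "borel_prob (marginal1 (\<mu> n))" "borel_prob (marginal2 (\<mu> n))" for n
  proof -
    have p: "prob_space (\<mu> n)" and s: "sets (\<mu> n) = sets borel" using assms(1)[of n] by (auto simp: borel_prob_def)
    have "fst \<in> borel_measurable (\<mu> n)" "snd \<in> borel_measurable (\<mu> n)"
      using s by (auto simp: cong: measurable_cong_sets intro!: borel_measurable_continuous_onI continuous_intros)
    then show "borel_prob (marginal1 (\<mu> n))" "borel_prob (marginal2 (\<mu> n))"
      using p by (auto simp: borel_prob_def marginal1_def marginal2_def intro!: prob_space.prob_space_distr)
  qed
  then interpret bifree_limit \<mu> k \<nu>1 \<nu>2 \<gamma>1 \<gamma>2 \<sigma>1 \<sigma>2 \<nu>1_lim \<nu>2_lim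
    using assms by unfold_locales auto
  show ?thesis
  proof (intro conjI allI impI; (elim conjE)?)
    show "(\<exists>\<alpha>>0. \<exists>\<beta>>0. \<exists>R. R_limit \<mu> k \<alpha> \<beta> R) \<longleftrightarrow> (\<exists>D. D_limit \<mu> k D)" by (rule R_limit_iff_D_limit)
    show "(\<exists>D. D_limit \<mu> k D) \<longleftrightarrow> (\<exists>\<rho>. rho_limit \<mu> k \<rho>)" by (rule D_limit_iff_rho_limit)
    fix \<alpha> \<beta> :: real and R D :: "complex \<Rightarrow> complex \<Rightarrow> complex" and \<rho> :: "(real \<times> real) set \<Rightarrow> real"
    assume pos: "\<alpha> > 0" "\<beta> > 0" and R: "R_limit \<mu> k \<alpha> \<beta> R" and D: "D_limit \<mu> k D" and \<rho>: "rho_limit \<mu> k \<rho>"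
    have fsm: "finite_signed_measure \<rho>" using \<rho> by (simp add: rho_limit_iff)
    have D\<rho>: "D z w = signed_integral \<rho> (kern2 z w)" if "Im z \<noteq> 0" "Im w \<noteq> 0" for z w
      using D rho_limit_imp_Dn[OF \<rho> that] that LIMSEQ_unique unfolding D_limit_iff by blast
    then show "D_representation D \<rho>" by (simp add: D_representation_iff)
    show "\<forall>A\<in>sets borel. \<rho>' A = \<rho> A" if \<rho>': "finite_signed_measure \<rho>'" "D_representation D \<rho>'" for \<rho>'
    proof
      fix A :: "(real \<times> real) set" assume "A \<in> sets borel"
      then show "\<rho>' A = \<rho> A"
      proof (rule finite_signed_measure_eq_if_kernel_integrals_eq[OF \<rho>'(1) fsm, rotated])
        fix z w :: complex assume "Im z \<noteq> 0" "Im w \<noteq> 0"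
        then have "signed_integral \<rho>' (kern2 z w) = signed_integral \<rho> (kern2 z w)"
          using D\<rho> \<rho>'(2) by (simp add: D_representation_iff)
        then show "signed_integral \<rho>' (\<lambda>(s, t). kern z s * kern w t) = signed_integral \<rho> (\<lambda>(s, t). kern z s * kern w t)"
          by (simp add: kern2_def)
      qed
    qed
    have RD: "R z w = z * free_levy_R \<gamma>1 \<sigma>1 z + w * free_levy_R \<gamma>2 \<sigma>2 w + D z w"
      if "z \<in> stolz_domain \<alpha> \<beta>" "w \<in> stolz_domain \<alpha> \<beta>" for z w
    proof -
      have "(\<lambda>n. Dn n z w) \<longlonglongrightarrow> D z w" using D Im_nonzero_stolz_domain that by (auto simp: D_limit_iff)
      from LIMSEQ_unique[OF this R_limit_imp_Dn[OF pos R that]] show ?thesis by simp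
    qed
    then show "\<forall>(z, w)\<in>product_domain \<alpha> \<beta>. R z w = z * free_levy_R \<gamma>1 \<sigma>1 z + w * free_levy_R \<gamma>2 \<sigma>2 w + D z w"
      by (auto simp: product_domain_iff)
    show "\<exists>E. holomorphic2_on E nonreal_pairs \<and> (\<forall>(z, w)\<in>product_domain \<alpha> \<beta>. E z w = R z w)"
    proof (intro exI conjI)
      \<comment> \<open>The extension is built from \<rho>; it agrees with R on the product domain
        because points of Stolz domains are nonreal.\<close>
      show "holomorphic2_on (\<lambda>z w. z * free_levy_R \<gamma>1 \<sigma>1 z + w * free_levy_R \<gamma>2 \<sigma>2 w + signed_integral \<rho> (kern2 z w)) nonreal_pairs"
        by (rule limit_formula_holomorphic[OF fsm])
      show "\<forall>(z, w)\<in>product_domain \<alpha> \<beta>. z * free_levy_R \<gamma>1 \<sigma>1 z + w * free_levy_R \<gamma>2 \<sigma>2 w + signed_integral \<rho> (kern2 z w) = R z w"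
        using RD D\<rho> Im_nonzero_stolz_domain by (auto simp: product_domain_iff)
    qed
  qed
qed

end
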